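(* Let $(X,Y)$ be a pair of complex manifolds such that $X$ is a closed submanifold of $Y$, and let $\bar j$ be the injection of $X$ into its first formal neighbourhood $\overline X$ in $Y$. (1) Assume that $N^*_{X/Y}$ carries a global holomorphic connection. Then for any retractions $\sigma$ and $\sigma'$ of $\bar j$, $\mathcal P_\sigma$ (resp. $\mathcal Q_\sigma$) is naturally isomorphic to $\mathcal P_{\sigma'}$ (resp. $\mathcal Q_{\sigma'}$), and this isomorphism commutes with the quasi-isomorphisms $\mathcal P_\sigma\to\mathcal O_X$ and $\mathcal P_{\sigma'}\to\mathcal O_X$ (resp. $\omega_{X/Y}^{\otimes-1}\to\mathcal Q_\sigma$ and $\omega_{X/Y}^{\otimes-1}\to\mathcal Q_{\sigma'}$). (2) Let $\sigma$ and $\sigma'$ be two retractions of $\bar j$ such that the element $\sigma'-\sigma$ of $\mathrm{Hom}_{\mathcal O_X}(\Omega^1_X,N^*_{X/Y})$ is an isomorphism. Then $\mathcal P_\sigma$ (resp. $\mathcal Q_\sigma$) is naturally isomorphic to $\mathcal P_{\sigma'}$ (resp. $\mathcal Q_{\sigma'}$), and this isomorphism commutes with the quasi-isomorphisms $\mathcal P_\sigma\to\mathcal O_X$ and $\mathcal P_{\sigma'}\to\mathcal O_X$ (resp. $\omega_{X/Y}^{\otimes-1}\to\mathcal Q_\sigma$ and $\omega_{X/Y}^{\otimes-1}\to\mathcal Q_{\sigma'}$).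
   Context: All isomorphisms are isomorphisms of complexes of $\mathcal O_{\overline X}$-modules. Let $\mathcal J\subset\mathcal O_Y$ be the ideal sheaf of $X$, $r$ the codimension of $X$ in $Y$, $N^*=N^*_{X/Y}=\mathcal J/\mathcal J^2$, $N$ its dual, $\overline X=(X,\mathcal O_Y/\mathcal J^2)$, $\bar j:X\to\overline X$ the injection. A retraction of $\bar j$ is a holomorphic map $\sigma:\overline X\to X$ with $\sigma\circ\bar j=\mathrm{id}$, equivalently a $\mathbb C_X$-algebra section $\sigma^*:\mathcal O_X\to\mathcal O_{\overline X}$ of $\mathcal O_{\overline X}\to\mathcal O_X$. Retractions form an affine space over $\mathrm{Der}_{\mathbb C_X}(\mathcal O_X,N^* )\simeq\mathrm{Hom}_{\mathcal O_X}(\Omega^1_X,N^* )$; $\sigma'-\sigma$ is the difference of the sections. Put $\omega_{X/Y}=\det N[-r]$, so $\omega_{X/Y}^{\otimes-1}=\det N^*[r]$. Let $\mathcal B=N^*\oplus\mathcal O_X$ with product $(i,a)(i',a')=(ia'+ai',aa')$, identified with $\mathcal O_{\overline X}$ by $(i,a)\mapsto i+\sigma^*(a)$. For $p\ge0$, $\Lambda^{p+1}_\sigma\mathcal O_{\overline X}=\Lambda^{p+1}N^*\oplus\Lambda^pN^*$ is the $\mathcal O_{\overline X}$-module with action $(i,a)*(\underline i,\underline j)=(a\underline i+i\wedge\underline j,a\underline j)$; it is $\Lambda^{p+1}_{\mathcal O_X}\mathcal B$ via $(\underline i,\underline j)\mapsto\underline i+(0,1)\wedge\underline j$. Let $d_q:\Lambda^q_\sigma\mathcal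 O_{\overline X}\to\Lambda^{q-1}_\sigma\mathcal O_{\overline X}$, $(\underline i,\underline j)\mapsto(\underline j,0)$ for $q\ge2$, and $d_1:\mathcal O_{\overline X}\to\mathcal O_X$ the projection. The AK complex $\mathcal P_\sigma$ has $\Lambda^{p+1}_\sigma\mathcal O_{\overline X}$ in degree $-p$ for $0\le p\le r$, with differential $p\,d_{p+1}$ from degree $-p$ to $-(p-1)$; the quasi-isomorphism $\mathcal P_\sigma\to\mathcal O_X$ is given by the projection $\mathcal O_{\overline X}\to\mathcal O_X$ in degree $0$. The dual AK complex $\mathcal Q_\sigma$ (isomorphic to $\mathcal Hom_{\mathcal O_X}(\mathcal P_\sigma,\det N^*[r])$ with differential multiplied by $(-1)^r$) has $\mathcal O_X$ in degree $0$ and $\Lambda^q_\sigma\mathcal O_{\overline X}$ in degree $-q$ for $1\le q\le r$, with differential $-(r-q+1)d_q$ from degree $-q$ to $-(q-1)$; the quasi-isomorphism $\det N^*[r]\to\mathcal Q_\sigma$ is the inclusion $\omega\mapsto(\omega,0)$ of $\det N^*$ in $\Lambda^r_\sigma\mathcal O_{\overline X}$. *)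

theory Defs
  imports
    "HOL-Analysis.Analysis"
    "HOL-Algebra.Module"
    "HOL-Algebra.QuotRing"
    "HOL-Algebra.Ideal_Product"
begin

section \<open>Complex manifolds and closed submanifolds\<close>

text \<open>
  A chart \<open>(U, \<phi>, S)\<close> maps the open set \<open>U\<close> homeomorphically onto a relatively open subset of
  the coordinate subspace \<open>cplane S\<close> of \<open>complex ^ 'n\<close>, a copy of the complex affine space of
  dimension \<open>card S\<close>.  This lets one type \<open>'n\<close> serve for manifolds of every dimension from 0 to
  \<open>CARD('n)\<close>, and in particular for a manifold and its submanifolds.
\<close>

type_synonym ('y, 'n) chart = "'y set \<times> ('y \<Rightarrow> complex ^ 'n) \<times> 'n set"

record ('y, 'n) cmfd =
  mtop :: "'y topology"
  atlas :: "('y, 'n) chart set"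

definition cplane :: "'n::finite set \<Rightarrow> (complex ^ 'n) set" where
  "cplane S = {z. \<forall>i. i \<notin> S \<longrightarrow> z $ i = 0}"

text \<open>
  Holomorphy of a function of several variables: real differentiability with a complex-linear
  differential.  It is applied to relatively open subsets \<open>W\<close> of some \<open>cplane S\<close>, whence the
  derivative within \<open>W\<close>.
\<close>

definition holo_on :: "(complex ^ 'n::finite) set \<Rightarrow> (complex ^ 'n \<Rightarrow> complex) \<Rightarrow> bool" where
  "holo_on W f \<longleftrightarrow>
     (\<forall>z\<in>W. \<exists>D. (f has_derivative D) (at z within W) \<and> (\<forall>c v. D (c *s v) = c * D v))"

definition is_chart :: "'y topology \<Rightarrow> ('y, 'n::finite) chart \<Rightarrow> bool" where
  "is_chart T = (\<lambda>(U, \<phi>, S).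
     openin T U \<and> openin (top_of_set (cplane S)) (\<phi> ` U) \<and>
     homeomorphic_map (subtopology T U) (top_of_set (\<phi> ` U)) \<phi>)"

definition holo_transition :: "('y, 'n::finite) chart \<Rightarrow> ('y, 'n) chart \<Rightarrow> bool" where
  "holo_transition = (\<lambda>(U, \<phi>, S) (U', \<phi>', S').
     \<forall>i. holo_on (\<phi> ` (U \<inter> U')) (\<lambda>z. \<phi>' (inv_into U \<phi> z) $ i))"

definition compatible :: "('y, 'n::finite) chart \<Rightarrow> ('y, 'n) chart \<Rightarrow> bool" where
  "compatible c c' \<longleftrightarrow> holo_transition c c' \<and> holo_transition c' c"

definition complex_manifold :: "('y, 'n::finite) cmfd \<Rightarrow> bool" where
  "complex_manifold M \<longleftrightarrow>
     Hausdorff_space (mtop M) \<and> second_countable (mtop M) \<and>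
     (\<Union>(U, \<phi>, S)\<in>atlas M. U) = topspace (mtop M) \<and>
     (\<forall>c\<in>atlas M. is_chart (mtop M) c) \<and>
     (\<forall>c\<in>atlas M. \<forall>c'\<in>atlas M. compatible c c')"

definition max_atlas :: "('y, 'n::finite) cmfd \<Rightarrow> ('y, 'n) chart set" where
  "max_atlas M = {c. is_chart (mtop M) c \<and> (\<forall>c'\<in>atlas M. compatible c c')}"

text \<open>\<open>holfun M V f\<close>: \<open>V\<close> is open in \<open>M\<close> and \<open>f\<close> is holomorphic on \<open>V\<close> (values outside \<open>V\<close> are
  irrelevant).\<close>

definition holfun :: "('y, 'n::finite) cmfd \<Rightarrow> 'y set \<Rightarrow> ('y \<Rightarrow> complex) \<Rightarrow> bool" where
  "holfun M V f \<longleftrightarrow> openin (mtop M) V \<and>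
     (\<forall>(U, \<phi>, S)\<in>atlas M. holo_on (\<phi> ` (U \<inter> V)) (\<lambda>z. f (inv_into U \<phi> z)))"

text \<open>\<open>(U, \<phi>, S)\<close> is adapted to \<open>X\<close> when \<open>X \<inter> U\<close> is the zero set of the coordinates in \<open>K\<close>.\<close>

definition adapted_chart :: "('y, 'n::finite) cmfd \<Rightarrow> 'y set \<Rightarrow> ('y, 'n) chart \<Rightarrow> 'n set \<Rightarrow> bool" where
  "adapted_chart Y X = (\<lambda>(U, \<phi>, S) K.
     (U, \<phi>, S) \<in> max_atlas Y \<and> K \<subseteq> S \<and> \<phi> ` (U \<inter> X) = \<phi> ` U \<inter> cplane (S - K))"

definition closed_submanifold :: "('y, 'n::finite) cmfd \<Rightarrow> 'y set \<Rightarrow> nat \<Rightarrow> bool" where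
  "closed_submanifold Y X r \<longleftrightarrow> closedin (mtop Y) X \<and>
     (\<forall>x\<in>X. \<exists>U \<phi> S K. adapted_chart Y X (U, \<phi>, S) K \<and> x \<in> U \<and> card K = r)"

definition submfd :: "('y, 'n::finite) cmfd \<Rightarrow> 'y set \<Rightarrow> ('y, 'n) cmfd" where
  "submfd Y X = \<lparr> mtop = subtopology (mtop Y) X,
     atlas = {(U \<inter> X, \<phi>, S - K) | U \<phi> S K. adapted_chart Y X (U, \<phi>, S) K} \<rparr>"


section \<open>Sheaves as etale spaces\<close>

text \<open>
  A sheaf on a space is given by its stalks and its sections, a section over \<open>U\<close> being a function
  assigning to each point of \<open>U\<close> an element of the stalk there.  \<open>is_sec F U s\<close> only concerns the
  values of \<open>s\<close> on \<open>U\<close>.  A stalk is a ring or a module over the stalk of a sheaf of rings.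
\<close>

record ('x, 's, 'v) sheaf =
  stalk :: "'x \<Rightarrow> 's"
  is_sec :: "'x set \<Rightarrow> ('x \<Rightarrow> 'v) \<Rightarrow> bool"

definition sheaf_map ::
  "'x topology \<Rightarrow> ('x, 's, 'v) sheaf \<Rightarrow> ('x, 't, 'w) sheaf \<Rightarrow> ('x \<Rightarrow> 'v \<Rightarrow> 'w) \<Rightarrow> bool" where
  "sheaf_map T F G h \<longleftrightarrow>
     (\<forall>U s. openin T U \<longrightarrow> is_sec F U s \<longrightarrow> is_sec G U (\<lambda>x. h x (s x)))"

definition mod_hom :: "'r ring \<Rightarrow> ('r, 'm) module \<Rightarrow> ('r, 'k) module \<Rightarrow> ('m \<Rightarrow> 'k) set" where
  "mod_hom R M N = {h. h \<in> carrier M \<rightarrow> carrier N \<and>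
     (\<forall>u\<in>carrier M. \<forall>v\<in>carrier M. h (u \<oplus>\<^bsub>M\<^esub> v) = h u \<oplus>\<^bsub>N\<^esub> h v) \<and>
     (\<forall>a\<in>carrier R. \<forall>u\<in>carrier M. h (a \<odot>\<^bsub>M\<^esub> u) = a \<odot>\<^bsub>N\<^esub> h u)}"

definition sheaf_hom ::
  "'x topology \<Rightarrow> ('x, 'r ring, 'r) sheaf \<Rightarrow> ('x, ('r, 'm) module, 'm) sheaf \<Rightarrow>
   ('x, ('r, 'k) module, 'k) sheaf \<Rightarrow> ('x \<Rightarrow> 'm \<Rightarrow> 'k) \<Rightarrow> bool" where
  "sheaf_hom T R F G h \<longleftrightarrow> sheaf_map T F G h \<and>
     (\<forall>x\<in>topspace T. h x \<in> mod_hom (stalk R x) (stalk F x) (stalk G x))"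

definition sheaf_iso ::
  "'x topology \<Rightarrow> ('x, 'r ring, 'r) sheaf \<Rightarrow> ('x, ('r, 'm) module, 'm) sheaf \<Rightarrow>
   ('x, ('r, 'k) module, 'k) sheaf \<Rightarrow> ('x \<Rightarrow> 'm \<Rightarrow> 'k) \<Rightarrow> bool" where
  "sheaf_iso T R F G h \<longleftrightarrow> sheaf_hom T R F G h \<and>
     (\<exists>k. sheaf_hom T R G F k \<and>
       (\<forall>x\<in>topspace T. (\<forall>u\<in>carrier (stalk F x). k x (h x u) = u) \<and>
                       (\<forall>v\<in>carrier (stalk G x). h x (k x v) = v)))"

text \<open>The germ at \<open>x\<close> of a function defined near \<open>x\<close>.\<close>

definition germ :: "'x topology \<Rightarrow> 'x \<Rightarrow> ('x \<Rightarrow> 'v) \<Rightarrow> ('x \<Rightarrow> 'v) set" where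
  "germ T x f = {g. \<exists>V. openin T V \<and> x \<in> V \<and> (\<forall>y\<in>V. g y = f y)}"


section \<open>Tensor products and exterior powers\<close>

definition free_module :: "'r ring \<Rightarrow> 'b set \<Rightarrow> ('r, 'b \<Rightarrow> 'r) module" where
  "free_module R B = \<lparr>
     carrier = {f. (\<forall>b. f b \<in> carrier R) \<and>
                   finite {b. f b \<noteq> \<zero>\<^bsub>R\<^esub>} \<and> {b. f b \<noteq> \<zero>\<^bsub>R\<^esub>} \<subseteq> B},
     mult = undefined, one = undefined,
     zero = (\<lambda>_. \<zero>\<^bsub>R\<^esub>), add = (\<lambda>f g b. f b \<oplus>\<^bsub>R\<^esub> g b),
     smult = (\<lambda>a f b. a \<otimes>\<^bsub>R\<^esub> f b) \<rparr>"

definition gen :: "'r ring \<Rightarrow> 'b \<Rightarrow> 'b \<Rightarrow> 'r" where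
  "gen R b = (\<lambda>b'. if b' = b then \<one>\<^bsub>R\<^esub> else \<zero>\<^bsub>R\<^esub>)"

definition submod_span :: "'r ring \<Rightarrow> ('r, 'm) module \<Rightarrow> 'm set \<Rightarrow> 'm set" where
  "submod_span R M S = \<Inter>{H. submodule H R M \<and> S \<subseteq> H}"

definition quot_module :: "('r, 'm) module \<Rightarrow> 'm set \<Rightarrow> ('r, 'm set) module" where
  "quot_module M H = \<lparr>
     carrier = a_rcosets\<^bsub>M\<^esub> H,
     mult = undefined, one = undefined,
     zero = H, add = set_add M,
     smult = (\<lambda>a C. \<Union>c\<in>C. H +>\<^bsub>M\<^esub> (a \<odot>\<^bsub>M\<^esub> c)) \<rparr>"

definition tensor_rel ::
  "'r ring \<Rightarrow> ('r, 'm) module \<Rightarrow> ('r, 'k) module \<Rightarrow> ('m \<times> 'k \<Rightarrow> 'r) set" where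
  "tensor_rel R M N = (let F = free_module R (carrier M \<times> carrier N) in
     submod_span R F
      ({gen R (u \<oplus>\<^bsub>M\<^esub> u', v) \<ominus>\<^bsub>F\<^esub> (gen R (u, v) \<oplus>\<^bsub>F\<^esub> gen R (u', v)) | u u' v.
          u \<in> carrier M \<and> u' \<in> carrier M \<and> v \<in> carrier N} \<union>
       {gen R (u, v \<oplus>\<^bsub>N\<^esub> v') \<ominus>\<^bsub>F\<^esub> (gen R (u, v) \<oplus>\<^bsub>F\<^esub> gen R (u, v')) | u v v'.
          u \<in> carrier M \<and> v \<in> carrier N \<and> v' \<in> carrier N} \<union>
       {gen R (a \<odot>\<^bsub>M\<^esub> u, v) \<ominus>\<^bsub>F\<^esub> (a \<odot>\<^bsub>F\<^esub> gen R (u, v)) | a u v.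
          a \<in> carrier R \<and> u \<in> carrier M \<and> v \<in> carrier N} \<union>
       {gen R (u, a \<odot>\<^bsub>N\<^esub> v) \<ominus>\<^bsub>F\<^esub> (a \<odot>\<^bsub>F\<^esub> gen R (u, v)) | a u v.
          a \<in> carrier R \<and> u \<in> carrier M \<and> v \<in> carrier N}))"

definition tensor ::
  "'r ring \<Rightarrow> ('r, 'm) module \<Rightarrow> ('r, 'k) module \<Rightarrow> ('r, ('m \<times> 'k \<Rightarrow> 'r) set) module" where
  "tensor R M N = quot_module (free_module R (carrier M \<times> carrier N)) (tensor_rel R M N)"

definition pure_tensor ::
  "'r ring \<Rightarrow> ('r, 'm) module \<Rightarrow> ('r, 'k) module \<Rightarrow> 'm \<Rightarrow> 'k \<Rightarrow> ('m \<times> 'k \<Rightarrow> 'r) set" where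
  "pure_tensor R M N u v =
     tensor_rel R M N +>\<^bsub>free_module R (carrier M \<times> carrier N)\<^esub> gen R (u, v)"

text \<open>
  The \<open>p\<close>-th exterior power is the free module on the lists of \<open>p\<close> elements of \<open>M\<close>, modulo
  multilinearity and the vanishing of lists with a repetition.  For \<open>p = 0\<close> it is the free
  module on the empty list, that is \<open>R\<close> itself.
\<close>

definition lists_of :: "('r, 'm) module \<Rightarrow> nat \<Rightarrow> 'm list set" where
  "lists_of M p = {us. length us = p \<and> set us \<subseteq> carrier M}"

definition ext_rel :: "'r ring \<Rightarrow> ('r, 'm) module \<Rightarrow> nat \<Rightarrow> ('m list \<Rightarrow> 'r) set" where
  "ext_rel R M p = (let F = free_module R (lists_of M p) in
     submod_span R F
      ({gen R (us @ (u \<oplus>\<^bsub>M\<^esub> v) # vs) \<ominus>\<^bsub>F\<^esub>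
          (gen R (us @ u # vs) \<oplus>\<^bsub>F\<^esub> gen R (us @ v # vs)) | us u v vs.
          us @ u # vs \<in> lists_of M p \<and> v \<in> carrier M} \<union>
       {gen R (us @ (a \<odot>\<^bsub>M\<^esub> u) # vs) \<ominus>\<^bsub>F\<^esub> (a \<odot>\<^bsub>F\<^esub> gen R (us @ u # vs)) | us a u vs.
          us @ u # vs \<in> lists_of M p \<and> a \<in> carrier R} \<union>
       {gen R us | us. us \<in> lists_of M p \<and> \<not> distinct us}))"

definition ext_power :: "'r ring \<Rightarrow> ('r, 'm) module \<Rightarrow> nat \<Rightarrow> ('r, ('m list \<Rightarrow> 'r) set) module" where
  "ext_power R M p = quot_module (free_module R (lists_of M p)) (ext_rel R M p)"

definition wedge_list :: "'r ring \<Rightarrow> ('r, 'm) module \<Rightarrow> 'm list \<Rightarrow> ('m list \<Rightarrow> 'r) set" where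
  "wedge_list R M us =
     ext_rel R M (length us) +>\<^bsub>free_module R (lists_of M (length us))\<^esub> gen R us"

text \<open>
  Left multiplication by \<open>u\<close> from the \<open>p\<close>-th to the \<open>(p + 1)\<close>-st exterior power, induced by
  \<open>us \<mapsto> u # us\<close> on generators.
\<close>

definition wedge_left ::
  "'r ring \<Rightarrow> ('r, 'm) module \<Rightarrow> nat \<Rightarrow> 'm \<Rightarrow> ('m list \<Rightarrow> 'r) set \<Rightarrow> ('m list \<Rightarrow> 'r) set" where
  "wedge_left R M p u C =
     (\<Union>c\<in>C. ext_rel R M (Suc p) +>\<^bsub>free_module R (lists_of M (Suc p))\<^esub>
        (\<lambda>l. case l of [] \<Rightarrow> \<zero>\<^bsub>R\<^esub> | v # us \<Rightarrow> if v = u then c us else \<zero>\<^bsub>R\<^esub>))"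

definition tensor_sheaf ::
  "'x topology \<Rightarrow> ('x, 'r ring, 'r) sheaf \<Rightarrow> ('x, ('r, 'm) module, 'm) sheaf \<Rightarrow>
   ('x, ('r, 'k) module, 'k) sheaf \<Rightarrow>
   ('x, ('r, ('m \<times> 'k \<Rightarrow> 'r) set) module, ('m \<times> 'k \<Rightarrow> 'r) set) sheaf" where
  "tensor_sheaf T R F G = \<lparr>
     stalk = (\<lambda>x. tensor (stalk R x) (stalk F x) (stalk G x)),
     is_sec = (\<lambda>U s. \<forall>x\<in>U. \<exists>V. openin T V \<and> x \<in> V \<and> V \<subseteq> U \<and>
       (\<exists>(m::nat) f g. (\<forall>k<m. is_sec F V (f k) \<and> is_sec G V (g k)) \<and>
          (\<forall>y\<in>V. s y =
             finsum (tensor (stalk R y) (stalk F y) (stalk G y))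
               (\<lambda>k. pure_tensor (stalk R y) (stalk F y) (stalk G y) (f k y) (g k y)) {..<m}))) \<rparr>"

definition ext_sheaf ::
  "'x topology \<Rightarrow> ('x, 'r ring, 'r) sheaf \<Rightarrow> ('x, ('r, 'm) module, 'm) sheaf \<Rightarrow> nat \<Rightarrow>
   ('x, ('r, ('m list \<Rightarrow> 'r) set) module, ('m list \<Rightarrow> 'r) set) sheaf" where
  "ext_sheaf T R F p = \<lparr>
     stalk = (\<lambda>x. ext_power (stalk R x) (stalk F x) p),
     is_sec = (\<lambda>U s. \<forall>x\<in>U. \<exists>V. openin T V \<and> x \<in> V \<and> V \<subseteq> U \<and>
       (\<exists>(m::nat) a f. (\<forall>k<m. is_sec R V (a k) \<and> (\<forall>i<p. is_sec F V (f k i))) \<and>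
          (\<forall>y\<in>V. s y =
             finsum (ext_power (stalk R y) (stalk F y) p)
               (\<lambda>k. a k y \<odot>\<^bsub>ext_power (stalk R y) (stalk F y) p\<^esub>
                 wedge_list (stalk R y) (stalk F y) (map (\<lambda>i. f k i y) [0..<p])) {..<m}))) \<rparr>"


section \<open>Holomorphic functions and differential forms\<close>

type_synonym 'y fgerm = "('y \<Rightarrow> complex) set"

definition hol_germs :: "('y, 'n::finite) cmfd \<Rightarrow> 'y \<Rightarrow> 'y fgerm ring" where
  "hol_germs M x = \<lparr>
     carrier = {germ (mtop M) x f | f V. x \<in> V \<and> holfun M V f},
     mult = (\<lambda>A B. \<Union>f\<in>A. \<Union>g\<in>B. germ (mtop M) x (\<lambda>y. f y * g y)),
     one = germ (mtop M) x (\<lambda>_. 1),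
     zero = germ (mtop M) x (\<lambda>_. 0),
     add = (\<lambda>A B. \<Union>f\<in>A. \<Union>g\<in>B. germ (mtop M) x (\<lambda>y. f y + g y)) \<rparr>"

definition hol_sheaf :: "('y, 'n::finite) cmfd \<Rightarrow> ('y, 'y fgerm ring, 'y fgerm) sheaf" where
  "hol_sheaf M = \<lparr>
     stalk = hol_germs M,
     is_sec = (\<lambda>U s. \<forall>x\<in>U. \<exists>V f. x \<in> V \<and> V \<subseteq> U \<and> holfun M V f \<and>
       (\<forall>y\<in>V. s y = germ (mtop M) y f)) \<rparr>"

text \<open>
  A covector at \<open>y\<close> is represented by the family of its coordinate expressions in the charts of
  the atlas around \<open>y\<close>; \<open>cdiff M f y\<close> is the differential of \<open>f\<close> at \<open>y\<close>.  A holomorphic 1-form is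
  locally a finite sum of terms \<open>a df\<close> with \<open>a\<close> and \<open>f\<close> holomorphic.
\<close>

type_synonym ('y, 'n) covector = "('y, 'n) chart \<Rightarrow> complex ^ 'n"

definition cdiff :: "('y, 'n::finite) cmfd \<Rightarrow> ('y \<Rightarrow> complex) \<Rightarrow> 'y \<Rightarrow> ('y, 'n) covector" where
  "cdiff M f y = (\<lambda>(U, \<phi>, S).
     if (U, \<phi>, S) \<in> atlas M \<and> y \<in> U
     then (\<chi> i. if i \<in> S then deriv (\<lambda>t. f (inv_into U \<phi> (\<phi> y + t *s axis i 1))) 0 else 0)
     else 0)"

definition loc_form :: "('y, 'n::finite) cmfd \<Rightarrow> 'y set \<Rightarrow> ('y \<Rightarrow> ('y, 'n) covector) \<Rightarrow> bool" where
  "loc_form M V w \<longleftrightarrow> openin (mtop M) V \<and>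
     (\<exists>(m::nat) a f. (\<forall>k<m. holfun M V (a k) \<and> holfun M V (f k)) \<and>
        (\<forall>y\<in>V. w y = (\<lambda>c. \<Sum>k<m. a k y *s cdiff M (f k) y c)))"

type_synonym ('y, 'n) wgerm = "('y \<Rightarrow> ('y, 'n) covector) set"

definition form_germs ::
  "('y, 'n::finite) cmfd \<Rightarrow> 'y \<Rightarrow> ('y fgerm, ('y, 'n) wgerm) module" where
  "form_germs M x = \<lparr>
     carrier = {germ (mtop M) x w | w V. x \<in> V \<and> loc_form M V w},
     mult = undefined, one = undefined,
     zero = germ (mtop M) x (\<lambda>_ _. 0),
     add = (\<lambda>A B. \<Union>v\<in>A. \<Union>w\<in>B. germ (mtop M) x (\<lambda>y c. v y c + w y c)),
     smult = (\<lambda>A B. \<Union>f\<in>A. \<Union>w\<in>B. germ (mtop M) x (\<lambda>y c. f y *s w y c)) \<rparr>"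

definition form_sheaf ::
  "('y, 'n::finite) cmfd \<Rightarrow> ('y, ('y fgerm, ('y, 'n) wgerm) module, ('y, 'n) wgerm) sheaf" where
  "form_sheaf M = \<lparr>
     stalk = form_germs M,
     is_sec = (\<lambda>U s. \<forall>x\<in>U. \<exists>V w. x \<in> V \<and> V \<subseteq> U \<and> loc_form M V w \<and>
       (\<forall>y\<in>V. s y = germ (mtop M) y w)) \<rparr>"

definition dgerm :: "('y, 'n::finite) cmfd \<Rightarrow> 'y \<Rightarrow> 'y fgerm \<Rightarrow> ('y, 'n) wgerm" where
  "dgerm M x A = (\<Union>f\<in>A. germ (mtop M) x (cdiff M f))"


section \<open>The first formal neighbourhood and the conormal sheaf\<close>

abbreviation OX :: "('y, 'n::finite) cmfd \<Rightarrow> 'y set \<Rightarrow> ('y, 'y fgerm ring, 'y fgerm) sheaf" where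
  "OX Y X \<equiv> hol_sheaf (submfd Y X)"

abbreviation OmegaX :: "('y, 'n::finite) cmfd \<Rightarrow> 'y set \<Rightarrow>
    ('y, ('y fgerm, ('y, 'n) wgerm) module, ('y, 'n) wgerm) sheaf" where
  "OmegaX Y X \<equiv> form_sheaf (submfd Y X)"

definition ideal_stalk :: "('y, 'n::finite) cmfd \<Rightarrow> 'y set \<Rightarrow> 'y \<Rightarrow> 'y fgerm set" where
  "ideal_stalk Y X x =
     {germ (mtop Y) x f | f V. x \<in> V \<and> holfun Y V f \<and> (\<forall>y\<in>V \<inter> X. f y = 0)}"

definition ideal_sq :: "('y, 'n::finite) cmfd \<Rightarrow> 'y set \<Rightarrow> 'y \<Rightarrow> 'y fgerm set" where
  "ideal_sq Y X x = ideal_prod (hol_germs Y x) (ideal_stalk Y X x) (ideal_stalk Y X x)"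

definition obar_class :: "('y, 'n::finite) cmfd \<Rightarrow> 'y set \<Rightarrow> 'y \<Rightarrow> ('y \<Rightarrow> complex) \<Rightarrow> 'y fgerm set" where
  "obar_class Y X x f = ideal_sq Y X x +>\<^bsub>hol_germs Y x\<^esub> germ (mtop Y) x f"

definition OXbar :: "('y, 'n::finite) cmfd \<Rightarrow> 'y set \<Rightarrow>
    ('y, 'y fgerm set ring, 'y fgerm set) sheaf" where
  "OXbar Y X = \<lparr>
     stalk = (\<lambda>x. hol_germs Y x Quot ideal_sq Y X x),
     is_sec = (\<lambda>U s. \<forall>x\<in>U. \<exists>V f. x \<in> V \<and> V \<inter> X \<subseteq> U \<and> holfun Y V f \<and>
       (\<forall>y\<in>V \<inter> X. s y = obar_class Y X y f)) \<rparr>"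

text \<open>The projection from \<open>OXbar\<close> to \<open>OX\<close>: restriction of functions to \<open>X\<close>.\<close>

definition res_stalk :: "('y, 'n::finite) cmfd \<Rightarrow> 'y set \<Rightarrow> 'y \<Rightarrow> 'y fgerm set \<Rightarrow> 'y fgerm" where
  "res_stalk Y X x C = (\<Union>A\<in>C. \<Union>f\<in>A. germ (mtop (submfd Y X)) x f)"

text \<open>
  The conormal sheaf, a subsheaf of \<open>OXbar\<close>.  A germ \<open>a\<close> of \<open>OX\<close> acts on it as any lift of \<open>a\<close>
  to \<open>OXbar\<close>; the choice of the lift does not matter.
\<close>

definition conormal :: "('y, 'n::finite) cmfd \<Rightarrow> 'y set \<Rightarrow>
    ('y, ('y fgerm, 'y fgerm set) module, 'y fgerm set) sheaf" where
  "conormal Y X = \<lparr>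
     stalk = (\<lambda>x. let Rb = stalk (OXbar Y X) x in \<lparr>
       carrier = {ideal_sq Y X x +>\<^bsub>hol_germs Y x\<^esub> A | A. A \<in> ideal_stalk Y X x},
       mult = undefined, one = undefined,
       zero = \<zero>\<^bsub>Rb\<^esub>, add = add Rb,
       smult = (\<lambda>a u. (SOME b. b \<in> carrier Rb \<and> res_stalk Y X x b = a) \<otimes>\<^bsub>Rb\<^esub> u) \<rparr>),
     is_sec = (\<lambda>U s. \<forall>x\<in>U. \<exists>V f. x \<in> V \<and> V \<inter> X \<subseteq> U \<and> holfun Y V f \<and> (\<forall>y\<in>V \<inter> X. f y = 0) \<and>
       (\<forall>y\<in>V \<inter> X. s y = obar_class Y X y f)) \<rparr>"

text \<open>A retraction, given by its pullback: a section of \<open>OXbar \<rightarrow> OX\<close> as sheaves of complex algebras.\<close>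

definition retraction_pullback :: "('y, 'n::finite) cmfd \<Rightarrow> 'y set \<Rightarrow> ('y \<Rightarrow> 'y fgerm \<Rightarrow> 'y fgerm set) \<Rightarrow> bool" where
  "retraction_pullback Y X \<sigma> \<longleftrightarrow>
     sheaf_map (mtop (submfd Y X)) (OX Y X) (OXbar Y X) \<sigma> \<and>
     (\<forall>x\<in>X. \<sigma> x \<in> ring_hom (stalk (OX Y X) x) (stalk (OXbar Y X) x) \<and>
        (\<forall>c. \<sigma> x (germ (mtop (submfd Y X)) x (\<lambda>_. c)) = obar_class Y X x (\<lambda>_. c)) \<and>
        (\<forall>a\<in>carrier (stalk (OX Y X) x). res_stalk Y X x (\<sigma> x a) = a))"

text \<open>
  \<open>h\<close> is the element \<open>\<sigma>' - \<sigma>\<close> of the group of \<open>OX\<close>-linear morphisms from the sheaf of 1-forms to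
  the conormal sheaf: the one whose composition with \<open>d\<close> is the derivation \<open>\<sigma>' - \<sigma>\<close>.
\<close>

definition retraction_diff :: "('y, 'n::finite) cmfd \<Rightarrow> 'y set \<Rightarrow>
    ('y \<Rightarrow> 'y fgerm \<Rightarrow> 'y fgerm set) \<Rightarrow> ('y \<Rightarrow> 'y fgerm \<Rightarrow> 'y fgerm set) \<Rightarrow>
    ('y \<Rightarrow> ('y, 'n) wgerm \<Rightarrow> 'y fgerm set) \<Rightarrow> bool" where
  "retraction_diff Y X \<sigma> \<sigma>' h \<longleftrightarrow>
     sheaf_hom (mtop (submfd Y X)) (OX Y X) (OmegaX Y X) (conormal Y X) h \<and>
     (\<forall>x\<in>X. \<forall>a\<in>carrier (stalk (OX Y X) x).
        h x (dgerm (submfd Y X) x a) = \<sigma>' x a \<ominus>\<^bsub>stalk (OXbar Y X) x\<^esub> \<sigma> x a)"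

text \<open>
  A holomorphic connection.  Complex linearity follows from additivity and the Leibniz rule for
  constants.
\<close>

definition conormal_connection :: "('y, 'n::finite) cmfd \<Rightarrow> 'y set \<Rightarrow>
    ('y \<Rightarrow> 'y fgerm set \<Rightarrow> (('y, 'n) wgerm \<times> 'y fgerm set \<Rightarrow> 'y fgerm) set) \<Rightarrow> bool" where
  "conormal_connection Y X D \<longleftrightarrow>
     (let T = mtop (submfd Y X);
          E = tensor_sheaf T (OX Y X) (OmegaX Y X) (conormal Y X) in
      sheaf_map T (conormal Y X) E D \<and>
      (\<forall>x\<in>X. let R = stalk (OX Y X) x; W = stalk (OmegaX Y X) x;
                 N = stalk (conormal Y X) x; Ex = stalk E x in
         D x \<in> carrier N \<rightarrow> carrier Ex \<and>
         (\<forall>u\<in>carrier N. \<forall>v\<in>carrier N. D x (u \<oplus>\<^bsub>N\<^esub> v) = D x u \<oplus>\<^bsub>Ex\<^esub> D x v) \<and>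
         (\<forall>a\<in>carrier R. \<forall>u\<in>carrier N. D x (a \<odot>\<^bsub>N\<^esub> u) =
            pure_tensor R W N (dgerm (submfd Y X) x a) u \<oplus>\<^bsub>Ex\<^esub> (a \<odot>\<^bsub>Ex\<^esub> D x u))))"


section \<open>The AK complexes\<close>

type_synonym 'y ext = "('y fgerm set list \<Rightarrow> 'y fgerm) set"

abbreviation extN :: "('y, 'n::finite) cmfd \<Rightarrow> 'y set \<Rightarrow> nat \<Rightarrow>
    ('y, ('y fgerm, 'y ext) module, 'y ext) sheaf" where
  "extN Y X p \<equiv> ext_sheaf (mtop (submfd Y X)) (OX Y X) (conormal Y X) p"

text \<open>
  \<open>AK Y X \<sigma> q\<close> is, for \<open>q \<ge> 1\<close>, the sum of the \<open>q\<close>-th and the \<open>(q - 1)\<close>-st exterior powers of the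
  conormal sheaf; a germ \<open>b\<close> of \<open>OXbar\<close> acts through its decomposition \<open>b = i + \<sigma> a\<close>.  For \<open>q = 0\<close>
  it is \<open>OX\<close>, written as the 0-th exterior power with a zero second summand, on which \<open>OXbar\<close>
  acts through the projection to \<open>OX\<close>.  In this way all the terms of the complexes have one type.
\<close>

definition AK_stalk :: "('y, 'n::finite) cmfd \<Rightarrow> 'y set \<Rightarrow>
    ('y \<Rightarrow> 'y fgerm \<Rightarrow> 'y fgerm set) \<Rightarrow> nat \<Rightarrow> 'y \<Rightarrow> ('y fgerm set, 'y ext \<times> 'y ext) module" where
  "AK_stalk Y X \<sigma> q x =
    (let Rb = stalk (OXbar Y X) x; L = stalk (extN Y X q) x; L' = stalk (extN Y X (q - 1)) x in \<lparr>
      carrier = carrier L \<times> (if q = 0 then {\<zero>\<^bsub>L'\<^esub>} else carrier L'),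
      mult = undefined, one = undefined,
      zero = (\<zero>\<^bsub>L\<^esub>, \<zero>\<^bsub>L'\<^esub>),
      add = (\<lambda>(I, J) (I', J'). (I \<oplus>\<^bsub>L\<^esub> I', J \<oplus>\<^bsub>L'\<^esub> J')),
      smult = (\<lambda>b (I, J). let a = res_stalk Y X x b; i = b \<ominus>\<^bsub>Rb\<^esub> \<sigma> x a in
        if q = 0 then (a \<odot>\<^bsub>L\<^esub> I, J)
        else ((a \<odot>\<^bsub>L\<^esub> I) \<oplus>\<^bsub>L\<^esub> wedge_left (stalk (OX Y X) x) (stalk (conormal Y X) x) (q - 1) i J,
              a \<odot>\<^bsub>L'\<^esub> J)) \<rparr>)"

definition AK :: "('y, 'n::finite) cmfd \<Rightarrow> 'y set \<Rightarrow>
    ('y \<Rightarrow> 'y fgerm \<Rightarrow> 'y fgerm set) \<Rightarrow> nat \<Rightarrow>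
    ('y, ('y fgerm set, 'y ext \<times> 'y ext) module, 'y ext \<times> 'y ext) sheaf" where
  "AK Y X \<sigma> q = \<lparr>
     stalk = AK_stalk Y X \<sigma> q,
     is_sec = (\<lambda>U s. is_sec (extN Y X q) U (\<lambda>x. fst (s x)) \<and>
       (if q = 0 then \<forall>x\<in>U. snd (s x) = \<zero>\<^bsub>stalk (extN Y X 0) x\<^esub>
        else is_sec (extN Y X (q - 1)) U (\<lambda>x. snd (s x)))) \<rparr>"

text \<open>
  \<open>AK_d Y X q\<close> maps \<open>AK Y X \<sigma> q\<close> to \<open>AK Y X \<sigma> (q - 1)\<close>, for \<open>q \<ge> 1\<close>.  For \<open>q = 1\<close> it is the
  projection from \<open>OXbar\<close> to \<open>OX\<close>.
\<close>

definition AK_d :: "('y, 'n::finite) cmfd \<Rightarrow> 'y set \<Rightarrow> nat \<Rightarrow> 'y \<Rightarrow> 'y ext \<times> 'y ext \<Rightarrow> 'y ext \<times> 'y ext" where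
  "AK_d Y X q x = (\<lambda>(I, J). (J, \<zero>\<^bsub>stalk (extN Y X (q - 2)) x\<^esub>))"

text \<open>
  A complex of modules concentrated in degrees \<open>-r, \<dots>, 0\<close>: \<open>obj C p\<close> is the term of degree \<open>-p\<close>,
  and \<open>bd C p\<close> goes from degree \<open>-p\<close> to degree \<open>-(p - 1)\<close>.  Only indices \<open>p \<le> r\<close> are meaningful.
\<close>

record ('x, 'r, 'm) mcomplex =
  obj :: "nat \<Rightarrow> ('x, ('r, 'm) module, 'm) sheaf"
  bd :: "nat \<Rightarrow> 'x \<Rightarrow> 'm \<Rightarrow> 'm"

definition complex_iso ::
  "'x topology \<Rightarrow> ('x, 'r ring, 'r) sheaf \<Rightarrow> nat \<Rightarrow> ('x, 'r, 'm) mcomplex \<Rightarrow> ('x, 'r, 'm) mcomplex \<Rightarrow>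
   (nat \<Rightarrow> 'x \<Rightarrow> 'm \<Rightarrow> 'm) \<Rightarrow> bool" where
  "complex_iso T R r C C' h \<longleftrightarrow>
     (\<forall>p\<le>r. sheaf_iso T R (obj C p) (obj C' p) (h p)) \<and>
     (\<forall>p\<in>{1..r}. \<forall>x\<in>topspace T. \<forall>u\<in>carrier (stalk (obj C p) x).
        h (p - 1) x (bd C p x u) = bd C' p x (h p x u))"

definition AKcomplex :: "('y, 'n::finite) cmfd \<Rightarrow> 'y set \<Rightarrow> ('y \<Rightarrow> 'y fgerm \<Rightarrow> 'y fgerm set) \<Rightarrow>
    ('y, 'y fgerm set, 'y ext \<times> 'y ext) mcomplex" where
  "AKcomplex Y X \<sigma> = \<lparr>
     obj = (\<lambda>p. AK Y X \<sigma> (p + 1)),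
     bd = (\<lambda>p x u. add_pow (stalk (AK Y X \<sigma> p) x) p (AK_d Y X (p + 1) x u)) \<rparr>"

definition dualAKcomplex :: "('y, 'n::finite) cmfd \<Rightarrow> 'y set \<Rightarrow> nat \<Rightarrow>
    ('y \<Rightarrow> 'y fgerm \<Rightarrow> 'y fgerm set) \<Rightarrow> ('y, 'y fgerm set, 'y ext \<times> 'y ext) mcomplex" where
  "dualAKcomplex Y X r \<sigma> = \<lparr>
     obj = (\<lambda>q. AK Y X \<sigma> q),
     bd = (\<lambda>q x u. add_pow (stalk (AK Y X \<sigma> (q - 1)) x) (- (int r - int q + 1)) (AK_d Y X q x u)) \<rparr>"

definition AK_augmentation :: "('y, 'n::finite) cmfd \<Rightarrow> 'y set \<Rightarrow> 'y \<Rightarrow> 'y ext \<times> 'y ext \<Rightarrow> 'y ext \<times> 'y ext" where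
  "AK_augmentation Y X = AK_d Y X 1"

text \<open>
  The inclusion of the \<open>r\<close>-th exterior power of the conormal sheaf, placed in degree \<open>-r\<close>, into
  the dual AK complex.
\<close>

definition dualAK_coaugmentation :: "('y, 'n::finite) cmfd \<Rightarrow> 'y set \<Rightarrow> nat \<Rightarrow> 'y \<Rightarrow> 'y ext \<Rightarrow> 'y ext \<times> 'y ext" where
  "dualAK_coaugmentation Y X r x I = (I, \<zero>\<^bsub>stalk (extN Y X (r - 1)) x\<^esub>)"

definition AK_isomorphic :: "('y, 'n::finite) cmfd \<Rightarrow> 'y set \<Rightarrow> nat \<Rightarrow>
    ('y \<Rightarrow> 'y fgerm \<Rightarrow> 'y fgerm set) \<Rightarrow> ('y \<Rightarrow> 'y fgerm \<Rightarrow> 'y fgerm set) \<Rightarrow> bool" where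
  "AK_isomorphic Y X r \<sigma> \<sigma>' \<longleftrightarrow>
     (\<exists>h. complex_iso (mtop (submfd Y X)) (OXbar Y X) r (AKcomplex Y X \<sigma>) (AKcomplex Y X \<sigma>') h \<and>
        (\<forall>x\<in>X. \<forall>u\<in>carrier (stalk (AK Y X \<sigma> 1) x).
           AK_augmentation Y X x (h 0 x u) = AK_augmentation Y X x u))"

definition dualAK_isomorphic :: "('y, 'n::finite) cmfd \<Rightarrow> 'y set \<Rightarrow> nat \<Rightarrow>
    ('y \<Rightarrow> 'y fgerm \<Rightarrow> 'y fgerm set) \<Rightarrow> ('y \<Rightarrow> 'y fgerm \<Rightarrow> 'y fgerm set) \<Rightarrow> bool" where
  "dualAK_isomorphic Y X r \<sigma> \<sigma>' \<longleftrightarrow>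
     (\<exists>h. complex_iso (mtop (submfd Y X)) (OXbar Y X) r
            (dualAKcomplex Y X r \<sigma>) (dualAKcomplex Y X r \<sigma>') h \<and>
        (\<forall>x\<in>X. \<forall>I\<in>carrier (stalk (extN Y X r) x).
           h r x (dualAK_coaugmentation Y X r x I) = dualAK_coaugmentation Y X r x I))"

end

(*
  Let \<delta> = \<sigma>' - \<sigma> : O_X -> N*.  An isomorphism of the AK complexes has the form (I, J) |-> (I - D J, J), where
  D : \<Lambda>^p N* -> \<Lambda>^(p+1) N* is additive with D (a J) = a D J + \<delta> a \<and> J; such maps commute with the differentials
  for trivial reasons.  They exist in all degrees as soon as there is such an E = D for p = 1, since then
  D (u \<and> J) = E u \<and> J - u \<and> D J defines the rest.

  Let h be the linear map \<Omega>_X -> N* with h (df) = \<delta> f; in local coordinates z_i of X it sends a form with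
  components w_i to the sum of the w_i \<delta> z_i, because \<delta> f is the sum of the (d_i f) \<delta> z_i.  This last formula is
  not formal, as the stalks of O_X have many derivations: it is checked by taking normal derivatives of lifts to Y
  at every point near the given one, which determine a section of N* by Hadamard's lemma.

  In case (1), E is the connection followed by the map w \<otimes> u |-> h w \<and> u.  In case (2), E is the composition of
  h^(-1), the exterior derivative \<Omega>^1 -> \<Omega>^2 and \<Lambda>^2 h.
*)
theory Submission
  imports
    Defs
    "HOL-Complex_Analysis.Cauchy_Integral_Formula"
begin

section \<open>Free modules, quotients and exterior powers\<close>

text \<open>What \<open>E\<close> has to satisfy beyond additivity is the rule E (a u) = a E u +
  \<delta> a \<and> u. The connection provides it because h turns the term da \<otimes> u of its
  Leibniz rule into \<delta> a \<and> u; the exterior derivative provides it because, for u = h w,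
  the second power of h turns da \<and> w into \<delta> a \<and> u. Neither D nor E is linear, so
  universal properties do not produce them directly, and the recursion for D has to be seen to
  vanish on lists with a repetition. It does so because E u has even degree and therefore commutes
  with left multiplications. All maps on stalks are chosen point by point. They form maps of sheaves
  since additivity and the Leibniz rules force their values on the expressions a u_1 \<and> ...
  \<and> u_p and a df, of which sections are local sums. For this reason 2-forms are not introduced:
  \<theta>, which stands for d followed by \<Lambda>^2 h, is determined by its rules on germs of
  1-forms and sends a df to \<delta> a \<and> \<delta> f. Its existence rests on the symmetry of
  second derivatives, and as holomorphy is defined by bare differentiability, this symmetry comes
  from Cauchy's integral formula.\<close>

lemma mod_homD:
  assumes "h \<in> mod_hom R M N"
  shows mod_hom_closed: "u \<in> carrier M \<Longrightarrow> h u \<in> carrier N"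
    and mod_hom_add: "u \<in> carrier M \<Longrightarrow> v \<in> carrier M \<Longrightarrow> h (u \<oplus>\<^bsub>M\<^esub> v) = h u \<oplus>\<^bsub>N\<^esub> h v"
    and mod_hom_smult: "a \<in> carrier R \<Longrightarrow> u \<in> carrier M \<Longrightarrow> h (a \<odot>\<^bsub>M\<^esub> u) = a \<odot>\<^bsub>N\<^esub> h u"
  using assms by (auto simp: mod_hom_def)

lemma mod_hom_zero:
  assumes "module R M" "module R N" "h \<in> mod_hom R M N"
  shows "h \<zero>\<^bsub>M\<^esub> = \<zero>\<^bsub>N\<^esub>"
proof -
  interpret M: module R M by fact
  interpret N: module R N by fact
  have "h (\<zero>\<^bsub>R\<^esub> \<odot>\<^bsub>M\<^esub> \<zero>\<^bsub>M\<^esub>) = \<zero>\<^bsub>R\<^esub> \<odot>\<^bsub>N\<^esub> h \<zero>\<^bsub>M\<^esub>"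
    by (rule mod_hom_smult[OF assms(3)]) auto
  then show ?thesis using mod_hom_closed[OF assms(3) M.M.zero_closed] by simp
qed

lemma mod_hom_finsum:
  assumes "module R M" "module R N" "h \<in> mod_hom R M N" "finite A" "f \<in> A \<rightarrow> carrier M"
  shows "h (finsum M f A) = finsum N (\<lambda>i. h (f i)) A"
  using assms(4,5)
proof (induction A rule: finite_induct)
  case empty
  then show ?case
    using assms mod_hom_zero[OF assms(1-3)] by (simp add: module_def abelian_group_def abelian_monoid.finsum_empty)
next
  case (insert x F)
  interpret M: module R M by fact
  interpret N: module R N by fact
  show ?case using insert mod_hom_closed[OF assms(3)] mod_hom_add[OF assms(3)]
    by (auto simp: M.M.finsum_insert N.M.finsum_insert Pi_def M.M.finsum_closed)
qed

lemma mod_hom_uminus: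
  assumes "module R M" "module R N" "h \<in> mod_hom R M N" "u \<in> carrier M"
  shows "h (\<ominus>\<^bsub>M\<^esub> u) = \<ominus>\<^bsub>N\<^esub> h u"
proof -
  interpret M: module R M by fact
  interpret N: module R N by fact
  have "h (\<ominus>\<^bsub>M\<^esub> u) \<oplus>\<^bsub>N\<^esub> h u = \<zero>\<^bsub>N\<^esub>"
    using mod_hom_add[OF assms(3), of "\<ominus>\<^bsub>M\<^esub> u" u] assms(4) mod_hom_zero[OF assms(1-3)]
    by (simp add: M.M.l_neg)
  then show ?thesis using assms mod_hom_closed[OF assms(3)]
    by (metis M.M.a_inv_closed N.M.minus_equality)
qed

lemma (in abelian_group) eq_if_minus_zero:
  "a \<in> carrier G \<Longrightarrow> b \<in> carrier G \<Longrightarrow> a \<ominus> b = \<zero> \<Longrightarrow> a = b"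
  by (metis a_inv_closed a_minus_def minus_equality minus_minus)

section \<open>Free modules and linear extension\<close>

lemma free_module_carrier:
  "f \<in> carrier (free_module R B) \<longleftrightarrow>
     (\<forall>b. f b \<in> carrier R) \<and> finite {b. f b \<noteq> \<zero>\<^bsub>R\<^esub>} \<and> {b. f b \<noteq> \<zero>\<^bsub>R\<^esub>} \<subseteq> B"
  by (simp add: free_module_def)

lemma free_module_simps:
  "\<zero>\<^bsub>free_module R B\<^esub> = (\<lambda>_. \<zero>\<^bsub>R\<^esub>)"
  "f \<oplus>\<^bsub>free_module R B\<^esub> g = (\<lambda>b. f b \<oplus>\<^bsub>R\<^esub> g b)"
  "a \<odot>\<^bsub>free_module R B\<^esub> f = (\<lambda>b. a \<otimes>\<^bsub>R\<^esub> f b)"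
  by (simp_all add: free_module_def)

lemma free_module_module:
  assumes "cring R"
  shows "module R (free_module R B)"
proof -
  interpret cring R by fact
  let ?F = "free_module R B"
  have supp: "f \<in> carrier ?F"
    if "\<And>b. f b \<in> carrier R" "{b. f b \<noteq> \<zero>\<^bsub>R\<^esub>} \<subseteq> S" "finite S" "S \<subseteq> B" for f S
    using that finite_subset by (auto simp: free_module_carrier)
  show ?thesis
  proof (rule moduleI)
    show "abelian_group ?F"
    proof (rule abelian_groupI)
      fix f g assume f: "f \<in> carrier ?F" and g: "g \<in> carrier ?F"
      show "f \<oplus>\<^bsub>?F\<^esub> g \<in> carrier ?F"
        using f g by (intro supp[where S = "{b. f b \<noteq> \<zero>\<^bsub>R\<^esub>} \<union> {b. g b \<noteq> \<zero>\<^bsub>R\<^esub>}"])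
          (auto simp: free_module_simps free_module_carrier)
      show "f \<oplus>\<^bsub>?F\<^esub> g = g \<oplus>\<^bsub>?F\<^esub> f"
        using f g by (auto simp: free_module_simps free_module_carrier a_comm)
      fix h assume h: "h \<in> carrier ?F"
      show "f \<oplus>\<^bsub>?F\<^esub> g \<oplus>\<^bsub>?F\<^esub> h = f \<oplus>\<^bsub>?F\<^esub> (g \<oplus>\<^bsub>?F\<^esub> h)"
        using f g h by (auto simp: free_module_simps free_module_carrier a_assoc)
    next
      fix f assume f: "f \<in> carrier ?F"
      show "\<exists>g\<in>carrier ?F. g \<oplus>\<^bsub>?F\<^esub> f = \<zero>\<^bsub>?F\<^esub>"
        using f by (intro bexI[of _ "\<lambda>b. \<ominus>\<^bsub>R\<^esub> f b"] supp[where S = "{b. f b \<noteq> \<zero>\<^bsub>R\<^esub>}"])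
          (auto simp: free_module_simps free_module_carrier l_neg)
      show "\<zero>\<^bsub>?F\<^esub> \<oplus>\<^bsub>?F\<^esub> f = f"
        using f by (auto simp: free_module_simps free_module_carrier)
    qed (auto simp: free_module_simps free_module_carrier)
  next
    fix a and f :: "_ \<Rightarrow> _" assume "a \<in> carrier R" "f \<in> carrier ?F"
    then show "a \<odot>\<^bsub>?F\<^esub> f \<in> carrier ?F"
      by (intro supp[where S = "{b. f b \<noteq> \<zero>\<^bsub>R\<^esub>}"]) (auto simp: free_module_simps free_module_carrier)
  qed (auto simp: free_module_simps free_module_carrier l_distr r_distr m_assoc assms)
qed

lemma gen_closed: "cring R \<Longrightarrow> b \<in> B \<Longrightarrow> gen R b \<in> carrier (free_module R B)"
  by (auto simp: gen_def free_module_carrier cring_def ring.ring_simprules monoid.one_closed ring_def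
      intro: finite_subset[of _ "{b}"])

definition lin_ext :: "'r ring \<Rightarrow> ('r, 'm) module \<Rightarrow> ('b \<Rightarrow> 'm) \<Rightarrow> ('b \<Rightarrow> 'r) \<Rightarrow> 'm" where
  "lin_ext R P \<theta> c = finsum P (\<lambda>b. c b \<odot>\<^bsub>P\<^esub> \<theta> b) {b. c b \<noteq> \<zero>\<^bsub>R\<^esub>}"

text \<open>Terms outside the support vanish. The freedom in the index set makes the sums belonging
  to two functions with different supports comparable in \<open>lin_ext_hom\<close>.\<close>

lemma lin_ext_superset:
  assumes "module R P" "c \<in> carrier (free_module R B)" "\<theta> \<in> B \<rightarrow> carrier P"
    "finite S" "{b. c b \<noteq> \<zero>\<^bsub>R\<^esub>} \<subseteq> S" "S \<subseteq> B"
  shows "lin_ext R P \<theta> c = finsum P (\<lambda>b. c b \<odot>\<^bsub>P\<^esub> \<theta> b) S"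
proof -
  interpret P: module R P by fact
  show ?thesis unfolding lin_ext_def
    by (rule P.M.add.finprod_mono_neutral_cong_left)
      (use assms in \<open>auto simp: free_module_carrier Pi_def subset_eq\<close>)
qed

lemma lin_ext_hom:
  assumes "module R P" "\<theta> \<in> B \<rightarrow> carrier P"
  shows "lin_ext R P \<theta> \<in> mod_hom R (free_module R B) P"
proof -
  interpret P: module R P by fact
  interpret F: module R "free_module R B" by (rule free_module_module) (rule P.R.is_cring)
  let ?F = "free_module R B"
  have cl: "(\<lambda>b. f b \<odot>\<^bsub>P\<^esub> \<theta> b) \<in> S \<rightarrow> carrier P" if "f \<in> carrier ?F" "S \<subseteq> B" for f S
    using that assms by (auto simp: free_module_carrier Pi_def subset_eq)
  show ?thesis unfolding mod_hom_def
  proof (safe)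
    fix f assume f: "f \<in> carrier ?F"
    show "lin_ext R P \<theta> f \<in> carrier P"
      unfolding lin_ext_def
      by (rule P.M.finsum_closed, rule cl) (use f in \<open>auto simp: free_module_carrier\<close>)
    let ?Sf = "{b. f b \<noteq> \<zero>\<^bsub>R\<^esub>}"
    have Sf: "finite ?Sf" "?Sf \<subseteq> B" using f by (auto simp: free_module_carrier)
    { fix g assume g: "g \<in> carrier ?F"
      let ?S = "{b. f b \<noteq> \<zero>\<^bsub>R\<^esub>} \<union> {b. g b \<noteq> \<zero>\<^bsub>R\<^esub>}"
      have S: "finite ?S" "?S \<subseteq> B" using f g by (auto simp: free_module_carrier)
      have e1: "lin_ext R P \<theta> f = finsum P (\<lambda>b. f b \<odot>\<^bsub>P\<^esub> \<theta> b) ?S"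
        by (rule lin_ext_superset[OF assms(1) f assms(2)]) (use S in auto)
      have e2: "lin_ext R P \<theta> g = finsum P (\<lambda>b. g b \<odot>\<^bsub>P\<^esub> \<theta> b) ?S"
        by (rule lin_ext_superset[OF assms(1) g assms(2)]) (use S in auto)
      have "lin_ext R P \<theta> (f \<oplus>\<^bsub>?F\<^esub> g) = finsum P (\<lambda>b. (f \<oplus>\<^bsub>?F\<^esub> g) b \<odot>\<^bsub>P\<^esub> \<theta> b) ?S"
        by (rule lin_ext_superset[OF assms(1) _ assms(2)])
          (use S F.M.a_closed[OF f g] f g in \<open>auto simp: free_module_simps(2) free_module_carrier\<close>)
      also have "\<dots> = finsum P (\<lambda>b. f b \<odot>\<^bsub>P\<^esub> \<theta> b \<oplus>\<^bsub>P\<^esub> g b \<odot>\<^bsub>P\<^esub> \<theta> b) ?S"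
        using f g assms(2) S
        by (intro P.M.finsum_cong' refl)
          (auto simp: free_module_simps(2) free_module_carrier P.smult_l_distr Pi_def subset_eq)
      also have "\<dots> = lin_ext R P \<theta> f \<oplus>\<^bsub>P\<^esub> lin_ext R P \<theta> g"
        unfolding e1 e2 by (rule P.M.finsum_addf[OF cl[OF f] cl[OF g]]) (use S in auto)
      finally show "lin_ext R P \<theta> (f \<oplus>\<^bsub>?F\<^esub> g) = lin_ext R P \<theta> f \<oplus>\<^bsub>P\<^esub> lin_ext R P \<theta> g" .
    }
    { fix a assume a: "a \<in> carrier R"
      have "lin_ext R P \<theta> (a \<odot>\<^bsub>?F\<^esub> f) = finsum P (\<lambda>b. (a \<odot>\<^bsub>?F\<^esub> f) b \<odot>\<^bsub>P\<^esub> \<theta> b) ?Sf"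
        by (rule lin_ext_superset[OF assms(1) _ assms(2)])
          (use Sf F.smult_closed[OF a f] f a in \<open>auto simp: free_module_simps(3) free_module_carrier\<close>)
      also have "\<dots> = finsum P (\<lambda>b. a \<odot>\<^bsub>P\<^esub> (f b \<odot>\<^bsub>P\<^esub> \<theta> b)) ?Sf"
        using f a assms(2) Sf
        by (intro P.M.finsum_cong' refl)
          (auto simp: free_module_simps(3) free_module_carrier P.smult_assoc1 Pi_def subset_eq)
      also have "\<dots> = a \<odot>\<^bsub>P\<^esub> lin_ext R P \<theta> f"
        unfolding lin_ext_def by (rule P.finsum_smult_ldistr[symmetric]) (use Sf a cl[OF f] in auto)
      finally show "lin_ext R P \<theta> (a \<odot>\<^bsub>?F\<^esub> f) = a \<odot>\<^bsub>P\<^esub> lin_ext R P \<theta> f" .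
    }
  qed
qed

lemma lin_ext_gen:
  assumes "module R P" "\<theta> \<in> B \<rightarrow> carrier P" "b \<in> B"
  shows "lin_ext R P \<theta> (gen R b) = \<theta> b"
proof -
  interpret P: module R P by fact
  have "lin_ext R P \<theta> (gen R b) = finsum P (\<lambda>b'. gen R b b' \<odot>\<^bsub>P\<^esub> \<theta> b') {b}"
    by (rule lin_ext_superset[OF assms(1) gen_closed[OF P.R.is_cring assms(3)] assms(2)])
      (use assms in \<open>auto simp: gen_def\<close>)
  also have "\<dots> = \<theta> b" using assms
    by (simp add: P.M.finsum_insert Pi_def gen_def)
  finally show ?thesis .
qed

text \<open>Induction on a finite set that contains the support: setting one coordinate to zero
  splits off a multiple of one generator. As the set may be larger than the support, the coefficient
  split off may be zero.\<close>

lemma free_module_induct: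
  assumes "cring R" "c \<in> carrier (free_module R B)"
    and zero: "Q \<zero>\<^bsub>free_module R B\<^esub>"
    and step: "\<And>a b c. a \<in> carrier R \<Longrightarrow> b \<in> B \<Longrightarrow> c \<in> carrier (free_module R B) \<Longrightarrow> Q c \<Longrightarrow>
       Q (a \<odot>\<^bsub>free_module R B\<^esub> gen R b \<oplus>\<^bsub>free_module R B\<^esub> c)"
  shows "Q c"
proof -
  interpret cring R by fact
  have "Q c" if "finite S" "S \<subseteq> B" "{b. c b \<noteq> \<zero>\<^bsub>R\<^esub>} \<subseteq> S" "c \<in> carrier (free_module R B)" for S c
    using that
  proof (induction S arbitrary: c rule: finite_induct)
    case empty
    then have "c = \<zero>\<^bsub>free_module R B\<^esub>" by (auto simp: free_module_simps)
    then show ?case using zero by simp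
  next
    case (insert b S)
    define c' where "c' = c(b := \<zero>\<^bsub>R\<^esub>)"
    have c': "c' \<in> carrier (free_module R B)"
      using insert.prems c'_def by (auto simp: free_module_carrier intro: finite_subset[of _ "{b. c b \<noteq> \<zero>\<^bsub>R\<^esub>}"])
    have "{b. c' b \<noteq> \<zero>\<^bsub>R\<^esub>} \<subseteq> S" using insert.prems by (auto simp: c'_def)
    then have Q: "Q c'" using insert.prems c' by (intro insert.IH) auto
    have e: "c = c b \<odot>\<^bsub>free_module R B\<^esub> gen R b \<oplus>\<^bsub>free_module R B\<^esub> c'"
      using insert.prems c'_def by (auto simp: free_module_simps gen_def free_module_carrier fun_eq_iff)
    have b: "c b \<in> carrier R" "b \<in> B" using insert.prems c'_def by (auto simp: free_module_carrier)
    show ?case by (subst e, rule step[OF b c' Q])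
  qed
  from this[of "{b. c b \<noteq> \<zero>\<^bsub>R\<^esub>}"] show ?thesis using assms(2) by (auto simp: free_module_carrier)
qed

section \<open>Spans, kernels and quotient modules\<close>

text \<open>The carrier itself is one of the submodules intersected, which keeps the span inside
  it.\<close>

lemma submod_span_submodule:
  assumes "module R M" "S \<subseteq> carrier M"
  shows "submodule (submod_span R M S) R M"
proof -
  interpret module R M by fact
  have car: "submodule (carrier M) R M" by (rule carrier_is_submodule)
  have z: "\<zero>\<^bsub>M\<^esub> \<in> H" if "submodule H R M" for H
    using subgroup.one_closed[OF submodule.axioms(1)[OF that]] by simp
  show ?thesis unfolding submod_span_def
  proof (rule submoduleI, goal_cases)
    case 1 show ?case using car assms(2) by (intro Inf_lower) simp
  next
    case 2 show ?case using z by simp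
  next
    case (3 a) then show ?case using submoduleE(3) by simp
  next
    case (4 a b) then show ?case using submoduleE(5) by simp
  next
    case (5 a b) then show ?case using submoduleE(4) by simp
  qed
qed

lemma submod_span_least: "submodule H R M \<Longrightarrow> S \<subseteq> H \<Longrightarrow> submod_span R M S \<subseteq> H"
  unfolding submod_span_def by (rule Inter_lower) simp

lemma submod_span_superset: "S \<subseteq> submod_span R M S"
  unfolding submod_span_def by (rule Inter_greatest) simp

text \<open>Together with \<open>submod_span_least\<close> this reduces the vanishing of a linear
  map on a module of relations to its vanishing on the generating relations.\<close>

lemma kernel_submodule:
  assumes "module R M" "module R P" "L \<in> mod_hom R M P"
  shows "submodule {c \<in> carrier M. L c = \<zero>\<^bsub>P\<^esub>} R M"
proof -
  interpret M: module R M by fact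
  interpret P: module R P by fact
  show ?thesis
    using mod_hom_zero[OF assms] mod_hom_uminus[OF assms]
    by (intro M.submoduleI) (auto simp: mod_hom_add[OF assms(3)] mod_hom_smult[OF assms(3)])
qed

context
  fixes R :: "'r ring" and M :: "('r, 'm) module" and H
  assumes M: "module R M" and H: "submodule H R M"
begin

interpretation M: module R M by (rule M)

lemma submodule_abelian_subgroup: "abelian_subgroup H M"
  by (rule abelian_subgroupI3)
    (auto intro!: additive_subgroup.intro submodule.axioms(1)[OF H] M.M.abelian_group_axioms)

interpretation H: abelian_subgroup H M by (rule submodule_abelian_subgroup)

lemma quot_carrier: "carrier (quot_module M H) = (\<lambda>c. H +>\<^bsub>M\<^esub> c) ` carrier M"
  by (auto simp: quot_module_def A_RCOSETS_def' a_r_coset_def')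

lemma quot_eq_iff:
  assumes "c \<in> carrier M" "d \<in> carrier M"
  shows "H +>\<^bsub>M\<^esub> c = H +>\<^bsub>M\<^esub> d \<longleftrightarrow> c \<ominus>\<^bsub>M\<^esub> d \<in> H"
proof -
  have "c \<ominus>\<^bsub>M\<^esub> d \<in> H \<longleftrightarrow> c \<in> H +>\<^bsub>M\<^esub> d"
    using H.a_rcos_module[OF assms(2,1)] by (simp add: a_minus_def)
  also have "\<dots> \<longleftrightarrow> H +>\<^bsub>M\<^esub> c = H +>\<^bsub>M\<^esub> d"
    using H.a_rcos_self[OF assms(1)] H.a_repr_independence'[OF _ assms(2), of c] by auto
  finally show ?thesis ..
qed

lemma quot_add:
  "c \<in> carrier M \<Longrightarrow> d \<in> carrier M \<Longrightarrow>
   (H +>\<^bsub>M\<^esub> c) \<oplus>\<^bsub>quot_module M H\<^esub> (H +>\<^bsub>M\<^esub> d) = H +>\<^bsub>M\<^esub> (c \<oplus>\<^bsub>M\<^esub> d)"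
  by (simp add: quot_module_def H.a_rcos_sum)

lemma quot_zero: "\<zero>\<^bsub>quot_module M H\<^esub> = H +>\<^bsub>M\<^esub> \<zero>\<^bsub>M\<^esub>"
  by (simp add: quot_module_def H.a_subset)

lemma coset_rep: "c \<in> carrier M \<Longrightarrow> d \<in> H +>\<^bsub>M\<^esub> c \<Longrightarrow> d \<in> carrier M \<and> H +>\<^bsub>M\<^esub> d = H +>\<^bsub>M\<^esub> c"
  using H.a_elemrcos_carrier H.a_repr_independence' by blast

text \<open>The scalar multiple of a coset is defined as a union over all its elements. These differ
  by members of \<open>H\<close>, which absorbs scalars, so every set in the union is the same
  coset.\<close>

lemma quot_smult:
  assumes "a \<in> carrier R" "c \<in> carrier M"
  shows "a \<odot>\<^bsub>quot_module M H\<^esub> (H +>\<^bsub>M\<^esub> c) = H +>\<^bsub>M\<^esub> (a \<odot>\<^bsub>M\<^esub> c)"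
proof -
  have *: "H +>\<^bsub>M\<^esub> (a \<odot>\<^bsub>M\<^esub> d) = H +>\<^bsub>M\<^esub> (a \<odot>\<^bsub>M\<^esub> c)" if "d \<in> H +>\<^bsub>M\<^esub> c" for d
  proof -
    note d = coset_rep[OF assms(2) that, THEN conjunct1] coset_rep[OF assms(2) that, THEN conjunct2]
    have "d \<ominus>\<^bsub>M\<^esub> c \<in> H" by (rule iffD1[OF quot_eq_iff[OF d(1) assms(2)] d(2)])
    then have m: "a \<odot>\<^bsub>M\<^esub> (d \<ominus>\<^bsub>M\<^esub> c) \<in> H" using submodule.smult_closed[OF H] assms by simp
    have e: "a \<odot>\<^bsub>M\<^esub> (d \<ominus>\<^bsub>M\<^esub> c) = a \<odot>\<^bsub>M\<^esub> d \<ominus>\<^bsub>M\<^esub> a \<odot>\<^bsub>M\<^esub> c"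
      using d(1) assms by (simp add: a_minus_def M.smult_r_distr M.smult_r_minus)
    show ?thesis by (rule iffD2[OF quot_eq_iff]) (use m e d(1) assms in auto)
  qed
  have "(\<Union>d\<in>H +>\<^bsub>M\<^esub> c. H +>\<^bsub>M\<^esub> (a \<odot>\<^bsub>M\<^esub> d)) = H +>\<^bsub>M\<^esub> (a \<odot>\<^bsub>M\<^esub> c)"
    by (rule UN_constant_eq[OF H.a_rcos_self[OF assms(2)]]) (intro ballI *)
  then show ?thesis by (simp add: quot_module_def)
qed

lemma quot_module_module: "module R (quot_module M H)"
proof (rule moduleI)
  show "cring R" by (rule M.R.is_cring)
  show "abelian_group (quot_module M H)"
  proof (rule abelian_groupI)
    fix C assume "C \<in> carrier (quot_module M H)"
    then obtain c where c: "c \<in> carrier M" "C = H +>\<^bsub>M\<^esub> c" by (auto simp: quot_carrier)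
    show "\<exists>D\<in>carrier (quot_module M H). D \<oplus>\<^bsub>quot_module M H\<^esub> C = \<zero>\<^bsub>quot_module M H\<^esub>"
      using c by (intro bexI[of _ "H +>\<^bsub>M\<^esub> (\<ominus>\<^bsub>M\<^esub> c)"]) (auto simp: quot_carrier quot_add quot_zero M.M.l_neg)
  qed (auto simp: quot_carrier quot_add quot_zero M.M.a_ac simp del: M.M.a_coset_add_zero)
qed (auto simp: quot_carrier quot_add quot_smult M.smult_l_distr M.smult_r_distr M.smult_assoc1)

lemma quot_proj_hom: "(\<lambda>c. H +>\<^bsub>M\<^esub> c) \<in> mod_hom R M (quot_module M H)"
  by (auto simp: mod_hom_def quot_carrier quot_add quot_smult)

text \<open>The map evaluates \<open>L\<close> at an arbitrary element of the coset; another element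
  differs from it by a member of \<open>H\<close>, where \<open>L\<close> is zero.\<close>

lemma quot_lift:
  assumes P: "module R P" and L: "L \<in> mod_hom R M P" and 0: "\<And>c. c \<in> H \<Longrightarrow> L c = \<zero>\<^bsub>P\<^esub>"
  obtains g where "g \<in> mod_hom R (quot_module M H) P" "\<And>c. c \<in> carrier M \<Longrightarrow> g (H +>\<^bsub>M\<^esub> c) = L c"
proof
  interpret P: module R P by fact
  define g where "g = (\<lambda>C. L (SOME c. c \<in> C))"
  have g: "g (H +>\<^bsub>M\<^esub> c) = L c" if "c \<in> carrier M" for c
  proof -
    define d where "d = (SOME d. d \<in> H +>\<^bsub>M\<^esub> c)"
    have "d \<in> H +>\<^bsub>M\<^esub> c" unfolding d_def using H.a_rcos_self[OF that] by (rule someI)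
    note d = coset_rep[OF that this, THEN conjunct1] coset_rep[OF that this, THEN conjunct2]
    have "d \<ominus>\<^bsub>M\<^esub> c \<in> H" by (rule iffD1[OF quot_eq_iff[OF d(1) that] d(2)])
    then have "L (d \<ominus>\<^bsub>M\<^esub> c) = \<zero>\<^bsub>P\<^esub>" by (rule 0)
    moreover have "L (d \<ominus>\<^bsub>M\<^esub> c) = L d \<ominus>\<^bsub>P\<^esub> L c"
      using d(1) that by (simp add: a_minus_def mod_hom_add[OF L] mod_hom_uminus[OF M P L])
    ultimately show ?thesis unfolding g_def d_def[symmetric]
      using mod_hom_closed[OF L] that d(1) P.M.eq_if_minus_zero[of "L d" "L c"] by simp
  qed
  then show "\<And>c. c \<in> carrier M \<Longrightarrow> g (H +>\<^bsub>M\<^esub> c) = L c" .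
  show "g \<in> mod_hom R (quot_module M H) P"
    by (auto simp: mod_hom_def quot_carrier quot_add quot_smult g mod_hom_closed[OF L] mod_hom_add[OF L]
        mod_hom_smult[OF L])
qed

end

lemma mod_hom_minus:
  assumes "module R M" "module R N" "h \<in> mod_hom R M N" "u \<in> carrier M" "v \<in> carrier M"
  shows "h (u \<ominus>\<^bsub>M\<^esub> v) = h u \<ominus>\<^bsub>N\<^esub> h v"
proof -
  interpret M: module R M by fact
  show ?thesis using assms
    by (simp add: a_minus_def mod_hom_add[OF assms(3)] mod_hom_uminus[OF assms(1-3)])
qed

section \<open>Exterior powers and their universal property\<close>

text \<open>The conditions mirror the three families of generators of \<open>ext_rel\<close>, so
  these are the maps that factor through the exterior power. Change of sign under exchange is not
  among them; it is derived by polarisation.\<close>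

definition alternating :: "'r ring \<Rightarrow> ('r, 'm) module \<Rightarrow> ('r, 'k) module \<Rightarrow> nat \<Rightarrow> ('m list \<Rightarrow> 'k) \<Rightarrow> bool" where
  "alternating R M P p \<theta> \<longleftrightarrow> \<theta> \<in> lists_of M p \<rightarrow> carrier P \<and>
     (\<forall>us u v vs. us @ u # vs \<in> lists_of M p \<longrightarrow> v \<in> carrier M \<longrightarrow>
        \<theta> (us @ (u \<oplus>\<^bsub>M\<^esub> v) # vs) = \<theta> (us @ u # vs) \<oplus>\<^bsub>P\<^esub> \<theta> (us @ v # vs)) \<and>
     (\<forall>us a u vs. us @ u # vs \<in> lists_of M p \<longrightarrow> a \<in> carrier R \<longrightarrow>
        \<theta> (us @ (a \<odot>\<^bsub>M\<^esub> u) # vs) = a \<odot>\<^bsub>P\<^esub> \<theta> (us @ u # vs)) \<and>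
     (\<forall>us\<in>lists_of M p. \<not> distinct us \<longrightarrow> \<theta> us = \<zero>\<^bsub>P\<^esub>)"

lemma lists_of_slot:
  "us @ u # vs \<in> lists_of M p \<Longrightarrow> v \<in> carrier M \<Longrightarrow> us @ v # vs \<in> lists_of M p"
  by (auto simp: lists_of_def)

lemma lists_of_slotD: "us @ u # vs \<in> lists_of M p \<Longrightarrow> u \<in> carrier M"
  by (auto simp: lists_of_def)

lemma lists_of_Cons: "u # us \<in> lists_of M (Suc p) \<longleftrightarrow> u \<in> carrier M \<and> us \<in> lists_of M p"
  by (auto simp: lists_of_def)

context
  fixes R :: "'r ring" and M :: "('r, 'm) module"
  assumes M: "module R M"
begin

interpretation M: module R M by (rule M)

lemma lists_of_add:
  "us @ u # vs \<in> lists_of M p \<Longrightarrow> v \<in> carrier M \<Longrightarrow> us @ (u \<oplus>\<^bsub>M\<^esub> v) # vs \<in> lists_of M p"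
  using lists_of_slot[of us u vs M p "u \<oplus>\<^bsub>M\<^esub> v"] lists_of_slotD[of us u vs M p] by simp

lemma lists_of_smult:
  "us @ u # vs \<in> lists_of M p \<Longrightarrow> a \<in> carrier R \<Longrightarrow> us @ (a \<odot>\<^bsub>M\<^esub> u) # vs \<in> lists_of M p"
  using lists_of_slot[of us u vs M p "a \<odot>\<^bsub>M\<^esub> u"] lists_of_slotD[of us u vs M p] by simp

lemmas lists_of_lin = lists_of_slot lists_of_add lists_of_smult

text \<open>Serves to replace \<theta> by the values of its linear extension on generators. Every
  list that occurs in the conditions has to be seen to lie in \<open>lists_of\<close>, where the two
  maps agree.\<close>

lemma alternating_cong:
  assumes "alternating R M P p \<theta>" and eq: "\<And>us. us \<in> lists_of M p \<Longrightarrow> \<theta> us = \<eta> us"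
  shows "alternating R M P p \<eta>"
  unfolding alternating_def
proof (intro conjI allI impI ballI, goal_cases)
  case 1
  have "\<theta> \<in> lists_of M p \<rightarrow> carrier P" using assms(1) unfolding alternating_def by (rule conjunct1)
  then show ?case by (simp add: Pi_iff eq)
next
  case (2 us u v vs)
  note l = 2(1) lists_of_slot[OF 2] lists_of_add[OF 2]
  have "\<theta> (us @ (u \<oplus>\<^bsub>M\<^esub> v) # vs) = \<theta> (us @ u # vs) \<oplus>\<^bsub>P\<^esub> \<theta> (us @ v # vs)"
    using assms(1) 2 unfolding alternating_def by blast
  then show ?case unfolding l[THEN eq] .
next
  case (3 us a u vs)
  note l = 3(1) lists_of_smult[OF 3]
  have "\<theta> (us @ (a \<odot>\<^bsub>M\<^esub> u) # vs) = a \<odot>\<^bsub>P\<^esub> \<theta> (us @ u # vs)"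
    using assms(1) 3 unfolding alternating_def by blast
  then show ?case unfolding l[THEN eq] .
next
  case (4 us)
  have "\<theta> us = \<zero>\<^bsub>P\<^esub>" using assms(1) 4 unfolding alternating_def by blast
  then show ?case unfolding 4(1)[THEN eq] .
qed

lemma free_lists_module: "module R (free_module R (lists_of M p))"
  by (rule free_module_module) (rule M.R.is_cring)

lemma ext_rel_submodule: "submodule (ext_rel R M p) R (free_module R (lists_of M p))"
proof -
  interpret F: module R "free_module R (lists_of M p)" by (rule free_lists_module)
  note g = gen_closed[OF M.R.is_cring]
  show ?thesis unfolding ext_rel_def Let_def
    by (rule submod_span_submodule[OF free_lists_module])
      (auto intro!: F.M.minus_closed F.M.a_closed F.smult_closed g elim: lists_of_lin)
qed

text \<open>The kernel of \<open>L\<close> is a submodule, so only the generators of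
  \<open>ext_rel\<close> have to be checked, and on each of them the vanishing is one of the
  conditions in \<open>alternating\<close>.\<close>

lemma ext_rel_kill:
  assumes P: "module R P" and L: "L \<in> mod_hom R (free_module R (lists_of M p)) P"
    and alt: "alternating R M P p (\<lambda>us. L (gen R us))" and c: "c \<in> ext_rel R M p"
  shows "L c = \<zero>\<^bsub>P\<^esub>"
proof -
  let ?F = "free_module R (lists_of M p)"
  interpret F: module R ?F by (rule free_lists_module)
  interpret P: module R P by (rule P)
  note g = gen_closed[OF M.R.is_cring]
  have pz: "x \<ominus>\<^bsub>P\<^esub> x = \<zero>\<^bsub>P\<^esub>" if "x \<in> carrier P" for x
    using that by (simp add: a_minus_def P.M.r_neg)
  have cl: "L (gen R us) \<in> carrier P" if "us \<in> lists_of M p" for us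
    by (rule mod_hom_closed[OF L g[OF that]])
  note LL = mod_hom_minus[OF free_lists_module P L] mod_hom_add[OF L] mod_hom_smult[OF L]
  have "ext_rel R M p \<subseteq> {c \<in> carrier ?F. L c = \<zero>\<^bsub>P\<^esub>}"
    unfolding ext_rel_def Let_def
  proof (rule submod_span_least[OF kernel_submodule[OF free_lists_module P L]], safe, goal_cases)
    case (1 x us u v vs)
    then show ?case
      by (auto intro!: F.M.minus_closed F.M.a_closed g elim: lists_of_lin)
  next
    case (2 x us u v vs)
    have l: "us @ v # vs \<in> lists_of M p" "us @ (u \<oplus>\<^bsub>M\<^esub> v) # vs \<in> lists_of M p"
      using 2 by (auto elim: lists_of_lin)
    have "L (gen R (us @ (u \<oplus>\<^bsub>M\<^esub> v) # vs)) = L (gen R (us @ u # vs)) \<oplus>\<^bsub>P\<^esub> L (gen R (us @ v # vs))"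
      using alt 2 unfolding alternating_def by blast
    then show ?case using 2 l by (simp add: LL g pz cl)
  next
    case (3 x us a u vs)
    then show ?case
      by (auto intro!: F.M.minus_closed F.smult_closed g elim: lists_of_lin)
  next
    case (4 x us a u vs)
    have l: "us @ (a \<odot>\<^bsub>M\<^esub> u) # vs \<in> lists_of M p"
      using 4 by (auto elim: lists_of_lin)
    have "L (gen R (us @ (a \<odot>\<^bsub>M\<^esub> u) # vs)) = a \<odot>\<^bsub>P\<^esub> L (gen R (us @ u # vs))"
      using alt 4 unfolding alternating_def by blast
    then show ?case using 4 l by (simp add: LL g pz cl)
  next
    case (5 x us)
    then show ?case by (simp add: g)
  next
    case (6 x us)
    then show ?case using alt unfolding alternating_def by blast
  qed
  then show ?thesis using c by blast
qed

lemma ext_power_module: "module R (ext_power R M p)"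
  unfolding ext_power_def by (rule quot_module_module[OF free_lists_module ext_rel_submodule])

lemma ext_proj_hom: "(\<lambda>c. ext_rel R M p +>\<^bsub>free_module R (lists_of M p)\<^esub> c)
    \<in> mod_hom R (free_module R (lists_of M p)) (ext_power R M p)"
  unfolding ext_power_def by (rule quot_proj_hom[OF free_lists_module ext_rel_submodule])

lemma ext_proj_zero: 
  "c \<in> ext_rel R M p \<Longrightarrow> ext_rel R M p +>\<^bsub>free_module R (lists_of M p)\<^esub> c = \<zero>\<^bsub>ext_power R M p\<^esub>"
proof -
  assume c: "c \<in> ext_rel R M p"
  interpret F: module R "free_module R (lists_of M p)" by (rule free_lists_module)
  have c': "c \<in> carrier (free_module R (lists_of M p))"
    using F.submoduleE(1)[OF ext_rel_submodule] c by (rule subsetD)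
  have "c \<ominus>\<^bsub>free_module R (lists_of M p)\<^esub> \<zero>\<^bsub>free_module R (lists_of M p)\<^esub> = c"
    using c' by (simp add: a_minus_def)
  then show ?thesis unfolding ext_power_def quot_zero[OF free_lists_module ext_rel_submodule]
    by (intro iffD2[OF quot_eq_iff[OF free_lists_module ext_rel_submodule]] c' F.M.zero_closed) (simp add: c)
qed

lemma wedge_list_eq:
  "us \<in> lists_of M p \<Longrightarrow> wedge_list R M us = ext_rel R M p +>\<^bsub>free_module R (lists_of M p)\<^esub> gen R us"
  by (simp add: wedge_list_def lists_of_def)

lemma wedge_list_closed: "us \<in> lists_of M p \<Longrightarrow> wedge_list R M us \<in> carrier (ext_power R M p)"
  unfolding wedge_list_eq
  by (rule mod_hom_closed[OF ext_proj_hom]) (rule gen_closed[OF M.R.is_cring])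

lemma wedge_list_alternating: "alternating R M (ext_power R M p) p (wedge_list R M)"
proof -
  let ?F = "free_module R (lists_of M p)" and ?H = "ext_rel R M p"
  interpret F: module R ?F by (rule free_lists_module)
  interpret E: module R "ext_power R M p" by (rule ext_power_module)
  note g = gen_closed[OF M.R.is_cring]
  note LL = mod_hom_minus[OF free_lists_module ext_power_module ext_proj_hom] mod_hom_add[OF ext_proj_hom] mod_hom_smult[OF ext_proj_hom]
  note cl = mod_hom_closed[OF ext_proj_hom]
  note sup = submod_span_superset[of _ R ?F, THEN subsetD]
  show ?thesis unfolding alternating_def
  proof (intro conjI allI impI ballI, goal_cases)
    case 1 then show ?case by (rule Pi_I) (rule wedge_list_closed)
  next
    case (2 us u v vs)
    have l: "us @ v # vs \<in> lists_of M p" "us @ (u \<oplus>\<^bsub>M\<^esub> v) # vs \<in> lists_of M p"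
      using 2 by (auto elim: lists_of_lin)
    have "gen R (us @ (u \<oplus>\<^bsub>M\<^esub> v) # vs) \<ominus>\<^bsub>?F\<^esub> (gen R (us @ u # vs) \<oplus>\<^bsub>?F\<^esub> gen R (us @ v # vs)) \<in> ?H"
      unfolding ext_rel_def Let_def by (rule sup) (use 2 in blast)
    note z = ext_proj_zero[OF this]
    show ?case
      by (rule E.M.eq_if_minus_zero) (use 2 l z in \<open>simp_all add: LL g cl wedge_list_eq\<close>)
  next
    case (3 us a u vs)
    have l: "us @ (a \<odot>\<^bsub>M\<^esub> u) # vs \<in> lists_of M p" using 3 by (auto elim: lists_of_lin)
    have "gen R (us @ (a \<odot>\<^bsub>M\<^esub> u) # vs) \<ominus>\<^bsub>?F\<^esub> (a \<odot>\<^bsub>?F\<^esub> gen R (us @ u # vs)) \<in> ?H"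
      unfolding ext_rel_def Let_def by (rule sup) (use 3 in blast)
    note z = ext_proj_zero[OF this]
    show ?case
      by (rule E.M.eq_if_minus_zero) (use 3 l z in \<open>simp_all add: LL g cl wedge_list_eq\<close>)
  next
    case (4 us)
    have "gen R us \<in> ?H" unfolding ext_rel_def Let_def by (rule sup) (use 4 in blast)
    from ext_proj_zero[OF this] show ?case using 4 by (simp add: wedge_list_eq)
  qed
qed

text \<open>Transported from the free module along the projection, which turns the generators into
  wedge products.\<close>

lemma ext_power_induct [consumes 1, case_names zero add]:
  assumes "C \<in> carrier (ext_power R M p)" and "Q \<zero>\<^bsub>ext_power R M p\<^esub>"
    and step: "\<And>a us C. a \<in> carrier R \<Longrightarrow> us \<in> lists_of M p \<Longrightarrow> C \<in> carrier (ext_power R M p) \<Longrightarrow> Q C \<Longrightarrow>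
       Q (a \<odot>\<^bsub>ext_power R M p\<^esub> wedge_list R M us \<oplus>\<^bsub>ext_power R M p\<^esub> C)"
  shows "Q C"
proof -
  let ?F = "free_module R (lists_of M p)" and ?H = "ext_rel R M p"
  interpret F: module R ?F by (rule free_lists_module)
  note g = gen_closed[OF M.R.is_cring]
  from assms(1) obtain c where c: "c \<in> carrier ?F" "C = ?H +>\<^bsub>?F\<^esub> c"
    unfolding ext_power_def quot_carrier[OF free_lists_module ext_rel_submodule] by (rule imageE)
  have "Q (?H +>\<^bsub>?F\<^esub> c)"
  proof (rule free_module_induct[OF M.R.is_cring c(1)], goal_cases)
    case 1
    show ?case using assms(2) mod_hom_zero[OF free_lists_module ext_power_module ext_proj_hom] by simp
  next
    case (2 a us d)
    have "?H +>\<^bsub>?F\<^esub> (a \<odot>\<^bsub>?F\<^esub> gen R us \<oplus>\<^bsub>?F\<^esub> d) =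
        a \<odot>\<^bsub>ext_power R M p\<^esub> wedge_list R M us \<oplus>\<^bsub>ext_power R M p\<^esub> (?H +>\<^bsub>?F\<^esub> d)"
      using 2 by (simp add: mod_hom_add[OF ext_proj_hom] mod_hom_smult[OF ext_proj_hom] g wedge_list_eq)
    then show ?case using step 2 mod_hom_closed[OF ext_proj_hom] by simp
  qed
  then show ?thesis using c(2) by simp
qed

text \<open>Uniqueness in the universal property: the wedge products generate the exterior
  power.\<close>

lemma ext_power_hom_eqI:
  assumes P: "module R P" and g: "g \<in> mod_hom R (ext_power R M p) P" and h: "h \<in> mod_hom R (ext_power R M p) P"
    and eq: "\<And>us. us \<in> lists_of M p \<Longrightarrow> g (wedge_list R M us) = h (wedge_list R M us)"
    and C: "C \<in> carrier (ext_power R M p)"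
  shows "g C = h C"
proof -
  interpret E: module R "ext_power R M p" by (rule ext_power_module)
  show ?thesis using C
  proof (induction rule: ext_power_induct)
    case zero
    then show ?case by (simp add: mod_hom_zero[OF ext_power_module P g] mod_hom_zero[OF ext_power_module P h])
  next
    case (add a us C)
    then show ?case
      by (simp add: mod_hom_add[OF g] mod_hom_add[OF h] mod_hom_smult[OF g] mod_hom_smult[OF h] wedge_list_closed eq)
  qed
qed

text \<open>Existence in the universal property: the linear extension of \<theta> to the free module
  kills the relations by \<open>ext_rel_kill\<close> and descends to the quotient.\<close>

lemma ext_power_lift:
  assumes P: "module R P" and \<theta>: "alternating R M P p \<theta>"
  obtains g where "g \<in> mod_hom R (ext_power R M p) P"
    "\<And>us. us \<in> lists_of M p \<Longrightarrow> g (wedge_list R M us) = \<theta> us"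
proof -
  let ?F = "free_module R (lists_of M p)"
  let ?L = "lin_ext R P \<theta>"
  have \<theta>c: "\<theta> \<in> lists_of M p \<rightarrow> carrier P" using \<theta> unfolding alternating_def by (rule conjunct1)
  have L: "?L \<in> mod_hom R ?F P" by (rule lin_ext_hom[OF P \<theta>c])
  have Lg: "?L (gen R us) = \<theta> us" if "us \<in> lists_of M p" for us by (rule lin_ext_gen[OF P \<theta>c that])
  show ?thesis
  proof (rule quot_lift[OF free_lists_module ext_rel_submodule P L ext_rel_kill[OF P L alternating_cong[OF \<theta> Lg[symmetric]]]])
    fix g assume g: "g \<in> mod_hom R (quot_module ?F (ext_rel R M p)) P"
      "\<And>c. c \<in> carrier ?F \<Longrightarrow> g (ext_rel R M p +>\<^bsub>?F\<^esub> c) = ?L c"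
    show thesis
      by (rule that[OF g(1)[folded ext_power_def]])
        (simp add: wedge_list_eq g(2) gen_closed[OF M.R.is_cring] Lg)
  qed
qed

end

section \<open>Left multiplication by an element of the module\<close>

text \<open>The function inside \<open>wedge_left\<close>, considered by itself: on free modules it
  is the linear map that carries the generator of \<open>us\<close> to that of
  \<open>u # us\<close>.\<close>

definition cons_ext :: "'r ring \<Rightarrow> 'm \<Rightarrow> ('m list \<Rightarrow> 'r) \<Rightarrow> 'm list \<Rightarrow> 'r" where
  "cons_ext R u c = (\<lambda>l. case l of [] \<Rightarrow> \<zero>\<^bsub>R\<^esub> | v # us \<Rightarrow> if v = u then c us else \<zero>\<^bsub>R\<^esub>)"

lemma alternatingD:
  assumes "alternating R M P p \<theta>"
  shows "us \<in> lists_of M p \<Longrightarrow> \<theta> us \<in> carrier P"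
    and "us @ u # vs \<in> lists_of M p \<Longrightarrow> v \<in> carrier M \<Longrightarrow>
       \<theta> (us @ (u \<oplus>\<^bsub>M\<^esub> v) # vs) = \<theta> (us @ u # vs) \<oplus>\<^bsub>P\<^esub> \<theta> (us @ v # vs)"
    and "us @ u # vs \<in> lists_of M p \<Longrightarrow> a \<in> carrier R \<Longrightarrow>
       \<theta> (us @ (a \<odot>\<^bsub>M\<^esub> u) # vs) = a \<odot>\<^bsub>P\<^esub> \<theta> (us @ u # vs)"
    and "us \<in> lists_of M p \<Longrightarrow> \<not> distinct us \<Longrightarrow> \<theta> us = \<zero>\<^bsub>P\<^esub>"
  using assms unfolding alternating_def by blast+

lemma alternatingI:
  assumes "\<And>us. us \<in> lists_of M p \<Longrightarrow> \<theta> us \<in> carrier P"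
    and "\<And>us u vs v. us @ u # vs \<in> lists_of M p \<Longrightarrow> v \<in> carrier M \<Longrightarrow>
       \<theta> (us @ (u \<oplus>\<^bsub>M\<^esub> v) # vs) = \<theta> (us @ u # vs) \<oplus>\<^bsub>P\<^esub> \<theta> (us @ v # vs)"
    and "\<And>us u vs a. us @ u # vs \<in> lists_of M p \<Longrightarrow> a \<in> carrier R \<Longrightarrow>
       \<theta> (us @ (a \<odot>\<^bsub>M\<^esub> u) # vs) = a \<odot>\<^bsub>P\<^esub> \<theta> (us @ u # vs)"
    and "\<And>us. us \<in> lists_of M p \<Longrightarrow> \<not> distinct us \<Longrightarrow> \<theta> us = \<zero>\<^bsub>P\<^esub>"
  shows "alternating R M P p \<theta>"
  using assms unfolding alternating_def by blast

lemma mod_homI: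
  assumes "\<And>u. u \<in> carrier M \<Longrightarrow> h u \<in> carrier N"
    and "\<And>u v. u \<in> carrier M \<Longrightarrow> v \<in> carrier M \<Longrightarrow> h (u \<oplus>\<^bsub>M\<^esub> v) = h u \<oplus>\<^bsub>N\<^esub> h v"
    and "\<And>a u. a \<in> carrier R \<Longrightarrow> u \<in> carrier M \<Longrightarrow> h (a \<odot>\<^bsub>M\<^esub> u) = a \<odot>\<^bsub>N\<^esub> h u"
  shows "h \<in> mod_hom R M N"
  using assms by (simp add: mod_hom_def)

lemma mod_hom_comp:
  assumes g: "g \<in> mod_hom R M N" and h: "h \<in> mod_hom R N P"
  shows "(\<lambda>u. h (g u)) \<in> mod_hom R M P"
  by (rule mod_homI)
    (simp_all add: mod_hom_closed[OF g] mod_hom_closed[OF h] mod_hom_add[OF g] mod_hom_add[OF h]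
      mod_hom_smult[OF g] mod_hom_smult[OF h])

context
  fixes R :: "'r ring" and M :: "('r, 'm) module"
  assumes M: "module R M"
begin

interpretation M: module R M by (rule M)

lemmas ext_induct = ext_power_induct[OF M, consumes 1, case_names zero add]

lemma cons_ext_hom:
  assumes u: "u \<in> carrier M"
  shows "cons_ext R u \<in> mod_hom R (free_module R (lists_of M p)) (free_module R (lists_of M (Suc p)))"
proof -
  have supp: "{l. cons_ext R u c l \<noteq> \<zero>\<^bsub>R\<^esub>} = (#) u ` {l. c l \<noteq> \<zero>\<^bsub>R\<^esub>}" for c
  proof (rule Set.set_eqI)
    fix l show "l \<in> {l. cons_ext R u c l \<noteq> \<zero>\<^bsub>R\<^esub>} \<longleftrightarrow> l \<in> (#) u ` {l. c l \<noteq> \<zero>\<^bsub>R\<^esub>}"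
      by (cases l) (auto simp: cons_ext_def)
  qed
  have cl: "cons_ext R u c \<in> carrier (free_module R (lists_of M (Suc p)))"
    if "c \<in> carrier (free_module R (lists_of M p))" for c
    using that u unfolding free_module_carrier supp
    by (auto simp: cons_ext_def lists_of_Cons split: list.splits)
  show ?thesis
    by (rule mod_homI) (rule cl, assumption,
      auto simp: free_module_simps cons_ext_def fun_eq_iff split: list.splits)
qed

lemma cons_ext_gen: "cons_ext R u (gen R us) = gen R (u # us)"
  by (auto simp: cons_ext_def gen_def fun_eq_iff split: list.splits)

lemma wedge_list_Cons_alternating:
  assumes u: "u \<in> carrier M"
  shows "alternating R M (ext_power R M (Suc p)) p (\<lambda>us. wedge_list R M (u # us))"
proof (rule alternatingI, goal_cases)
  case (1 us)
  then show ?case by (intro alternatingD(1)[OF wedge_list_alternating[OF M]]) (simp add: lists_of_Cons u)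
next
  case (2 us w vs v)
  then show ?case using alternatingD(2)[OF wedge_list_alternating[OF M], of "u # us" w vs "Suc p" v]
    by (simp add: lists_of_Cons u)
next
  case (3 us w vs a)
  then show ?case using alternatingD(3)[OF wedge_list_alternating[OF M], of "u # us" w vs "Suc p" a]
    by (simp add: lists_of_Cons u)
next
  case (4 us)
  then show ?case using alternatingD(4)[OF wedge_list_alternating[OF M], of "u # us" "Suc p"]
    by (simp add: lists_of_Cons u)
qed

text \<open>\<open>wedge_left\<close> is a union over the elements of a coset. Prefixing
  \<open>u\<close> is alternating in the remaining entries, so relations in degree \<open>p\<close>
  go to relations in degree \<open>p + 1\<close>, and the union consists of a single coset.\<close>

lemma wedge_left_coset:
  assumes u: "u \<in> carrier M" and c: "c \<in> carrier (free_module R (lists_of M p))"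
  shows "wedge_left R M p u (ext_rel R M p +>\<^bsub>free_module R (lists_of M p)\<^esub> c) =
    ext_rel R M (Suc p) +>\<^bsub>free_module R (lists_of M (Suc p))\<^esub> cons_ext R u c"
proof -
  let ?F = "free_module R (lists_of M p)" and ?H = "ext_rel R M p"
  let ?P = "\<lambda>c. ext_rel R M (Suc p) +>\<^bsub>free_module R (lists_of M (Suc p))\<^esub> cons_ext R u c"
  interpret F: module R ?F by (rule free_lists_module[OF M])
  interpret E: module R "ext_power R M (Suc p)" by (rule ext_power_module[OF M])
  interpret H: abelian_subgroup ?H ?F
    by (rule submodule_abelian_subgroup[OF free_lists_module[OF M] ext_rel_submodule[OF M]])
  have P: "?P \<in> mod_hom R ?F (ext_power R M (Suc p))"
    by (rule mod_hom_comp[OF cons_ext_hom[OF u] ext_proj_hom[OF M]])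
  have kill: "?P d = \<zero>\<^bsub>ext_power R M (Suc p)\<^esub>" if "d \<in> ?H" for d
  proof (rule ext_rel_kill[OF M ext_power_module[OF M] P _ that])
    show "alternating R M (ext_power R M (Suc p)) p (\<lambda>us. ?P (gen R us))"
      by (rule alternating_cong[OF M wedge_list_Cons_alternating[OF u]])
        (simp add: cons_ext_gen wedge_list_eq[OF M, of _ "Suc p"] lists_of_Cons u)
  qed
  have "?P d = ?P c" if d: "d \<in> ?H +>\<^bsub>?F\<^esub> c" for d
  proof -
    note d = coset_rep[OF free_lists_module[OF M] ext_rel_submodule[OF M] c d, THEN conjunct1]
      coset_rep[OF free_lists_module[OF M] ext_rel_submodule[OF M] c d, THEN conjunct2]
    have "d \<ominus>\<^bsub>?F\<^esub> c \<in> ?H"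
      by (rule iffD1[OF quot_eq_iff[OF free_lists_module[OF M] ext_rel_submodule[OF M] d(1) c] d(2)])
    then have "?P (d \<ominus>\<^bsub>?F\<^esub> c) = \<zero>\<^bsub>ext_power R M (Suc p)\<^esub>" by (rule kill)
    then have "?P d \<ominus>\<^bsub>ext_power R M (Suc p)\<^esub> ?P c = \<zero>\<^bsub>ext_power R M (Suc p)\<^esub>"
      by (simp only: mod_hom_minus[OF free_lists_module[OF M] ext_power_module[OF M] P d(1) c])
    then show ?thesis
      by (rule E.M.eq_if_minus_zero[OF mod_hom_closed[OF P d(1)] mod_hom_closed[OF P c]])
  qed
  then show ?thesis unfolding wedge_left_def cons_ext_def[symmetric]
    by (intro UN_constant_eq[OF H.a_rcos_self[OF c]] ballI)
qed

lemma wedge_left_hom: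
  assumes u: "u \<in> carrier M"
  shows "wedge_left R M p u \<in> mod_hom R (ext_power R M p) (ext_power R M (Suc p))"
proof -
  let ?F = "free_module R (lists_of M p)" and ?H = "ext_rel R M p"
  interpret F: module R ?F by (rule free_lists_module[OF M])
  note w = wedge_left_coset[OF u]
  note P = mod_hom_comp[OF cons_ext_hom[OF u] ext_proj_hom[OF M]]
  have ca: "C \<in> carrier (ext_power R M p) \<Longrightarrow> \<exists>c\<in>carrier ?F. C = ?H +>\<^bsub>?F\<^esub> c" for C
    unfolding ext_power_def quot_carrier[OF free_lists_module[OF M] ext_rel_submodule[OF M]] by blast
  show ?thesis
  proof (rule mod_homI, goal_cases)
    case (1 C)
    then obtain c where c: "c \<in> carrier ?F" "C = ?H +>\<^bsub>?F\<^esub> c" using ca by blast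
    then show ?case by (simp only: w mod_hom_closed[OF P c(1)])
  next
    case (2 C D)
    then obtain c d where c: "c \<in> carrier ?F" "C = ?H +>\<^bsub>?F\<^esub> c"
      and d: "d \<in> carrier ?F" "D = ?H +>\<^bsub>?F\<^esub> d" using ca by meson
    show ?case unfolding c(2) d(2) mod_hom_add[OF ext_proj_hom[OF M] c(1) d(1), symmetric]
      by (simp only: w[OF c(1)] w[OF d(1)] w[OF F.M.a_closed[OF c(1) d(1)]] mod_hom_add[OF P c(1) d(1)])
  next
    case (3 a C)
    then obtain c where c: "c \<in> carrier ?F" "C = ?H +>\<^bsub>?F\<^esub> c" using ca by blast
    show ?case unfolding c(2) mod_hom_smult[OF ext_proj_hom[OF M] 3(1) c(1), symmetric]
      by (simp only: w[OF c(1)] w[OF F.smult_closed[OF 3(1) c(1)]] mod_hom_smult[OF P 3(1) c(1)])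
  qed
qed

lemma wedge_left_wedge_list:
  assumes "u \<in> carrier M" "us \<in> lists_of M p"
  shows "wedge_left R M p u (wedge_list R M us) = wedge_list R M (u # us)"
  unfolding wedge_list_eq[OF M assms(2)] wedge_left_coset[OF assms(1) gen_closed[OF M.R.is_cring assms(2)]]
    cons_ext_gen
  by (rule wedge_list_eq[OF M, symmetric]) (simp add: lists_of_Cons assms)

lemma wedge_left_closed:
  "u \<in> carrier M \<Longrightarrow> C \<in> carrier (ext_power R M p) \<Longrightarrow> wedge_left R M p u C \<in> carrier (ext_power R M (Suc p))"
  by (rule mod_hom_closed[OF wedge_left_hom])

text \<open>Both sides are linear in \<open>C\<close>, so \<open>C\<close> may be taken to be a
  product, where this is additivity in the first entry of \<open>u # us\<close>.\<close>

lemma wedge_left_add: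
  assumes u: "u \<in> carrier M" and v: "v \<in> carrier M" and C: "C \<in> carrier (ext_power R M p)"
  shows "wedge_left R M p (u \<oplus>\<^bsub>M\<^esub> v) C = wedge_left R M p u C \<oplus>\<^bsub>ext_power R M (Suc p)\<^esub> wedge_left R M p v C"
proof -
  interpret E: module R "ext_power R M (Suc p)" by (rule ext_power_module[OF M])
  interpret E0: module R "ext_power R M p" by (rule ext_power_module[OF M])
  note h = wedge_left_hom[OF u, of p] wedge_left_hom[OF v, of p] wedge_left_hom[OF M.M.a_closed[OF u v], of p]
  note z = h[THEN mod_hom_zero[OF ext_power_module[OF M] ext_power_module[OF M]]]
  show ?thesis using C
  proof (induction rule: ext_induct)
    case zero
    then show ?case by (simp add: z)
  next
    case (add a us C)
    have "wedge_list R M ((u \<oplus>\<^bsub>M\<^esub> v) # us) = wedge_list R M (u # us) \<oplus>\<^bsub>ext_power R M (Suc p)\<^esub> wedge_list R M (v # us)"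
      using alternatingD(2)[OF wedge_list_alternating[OF M], of "[]" u us "Suc p" v] add u v
      by (simp add: lists_of_Cons)
    moreover have "wedge_list R M (u # us) \<in> carrier (ext_power R M (Suc p))"
      "wedge_list R M (v # us) \<in> carrier (ext_power R M (Suc p))"
      using add u v by (auto intro!: wedge_list_closed[OF M] simp: lists_of_Cons)
    ultimately show ?case using add u v
      by (simp add: h[THEN mod_hom_add] h[THEN mod_hom_smult] wedge_list_closed[OF M]
          wedge_left_wedge_list E.smult_r_distr E.M.a_ac wedge_left_closed)
  qed
qed

lemma wedge_left_smult:
  assumes u: "u \<in> carrier M" and b: "b \<in> carrier R" and C: "C \<in> carrier (ext_power R M p)"
  shows "wedge_left R M p (b \<odot>\<^bsub>M\<^esub> u) C = b \<odot>\<^bsub>ext_power R M (Suc p)\<^esub> wedge_left R M p u C"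
proof -
  interpret E: module R "ext_power R M (Suc p)" by (rule ext_power_module[OF M])
  interpret E0: module R "ext_power R M p" by (rule ext_power_module[OF M])
  note h = wedge_left_hom[OF u, of p] wedge_left_hom[OF M.smult_closed[OF b u], of p]
  note z = h[THEN mod_hom_zero[OF ext_power_module[OF M] ext_power_module[OF M]]]
  show ?thesis using C
  proof (induction rule: ext_induct)
    case zero
    then show ?case by (simp add: z b)
  next
    case (add a us C)
    have "wedge_list R M ((b \<odot>\<^bsub>M\<^esub> u) # us) = b \<odot>\<^bsub>ext_power R M (Suc p)\<^esub> wedge_list R M (u # us)"
      using alternatingD(3)[OF wedge_list_alternating[OF M], of "[]" u us "Suc p" b] add u b
      by (simp add: lists_of_Cons)
    moreover have "wedge_list R M (u # us) \<in> carrier (ext_power R M (Suc p))"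
      using add u by (auto intro!: wedge_list_closed[OF M] simp: lists_of_Cons)
    ultimately show ?case using add u b
      by (simp add: h[THEN mod_hom_add] h[THEN mod_hom_smult] wedge_list_closed[OF M]
          wedge_left_wedge_list E.smult_r_distr E.smult_assoc1[symmetric] M.R.m_comm wedge_left_closed)
  qed
qed

lemma wedge_left_self:
  assumes u: "u \<in> carrier M" and C: "C \<in> carrier (ext_power R M p)"
  shows "wedge_left R M (Suc p) u (wedge_left R M p u C) = \<zero>\<^bsub>ext_power R M (Suc (Suc p))\<^esub>"
proof -
  interpret E: module R "ext_power R M (Suc (Suc p))" by (rule ext_power_module[OF M])
  note h = wedge_left_hom[OF u]
  note z = h[THEN mod_hom_zero[OF ext_power_module[OF M] ext_power_module[OF M]]]
  interpret E1: module R "ext_power R M (Suc p)" by (rule ext_power_module[OF M])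
  interpret E0: module R "ext_power R M p" by (rule ext_power_module[OF M])
  show ?thesis using C
  proof (induction rule: ext_induct)
    case zero
    then show ?case by (simp add: z)
  next
    case (add a us C)
    have l: "u # us \<in> lists_of M (Suc p)" "u # u # us \<in> lists_of M (Suc (Suc p))"
      using add u by (auto simp: lists_of_Cons)
    have "wedge_list R M (u # u # us) = \<zero>\<^bsub>ext_power R M (Suc (Suc p))\<^esub>"
      by (rule alternatingD(4)[OF wedge_list_alternating[OF M] l(2)]) simp
    then show ?case using add u l
      by (simp add: mod_hom_add[OF h] mod_hom_smult[OF h] wedge_list_closed[OF M]
          wedge_left_wedge_list wedge_left_closed)
  qed
qed

text \<open>Polarisation: the square of u + v vanishes, and so do the squares of \<open>u\<close>
  and \<open>v\<close>, which leaves the two mixed terms.\<close>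

lemma wedge_left_anticomm:
  assumes u: "u \<in> carrier M" and v: "v \<in> carrier M" and C: "C \<in> carrier (ext_power R M p)"
  shows "wedge_left R M (Suc p) u (wedge_left R M p v C) =
    \<ominus>\<^bsub>ext_power R M (Suc (Suc p))\<^esub> wedge_left R M (Suc p) v (wedge_left R M p u C)"
proof -
  interpret E: module R "ext_power R M (Suc (Suc p))" by (rule ext_power_module[OF M])
  interpret E1: module R "ext_power R M (Suc p)" by (rule ext_power_module[OF M])
  have uv: "u \<oplus>\<^bsub>M\<^esub> v \<in> carrier M" using u v by simp
  note c = wedge_left_closed[OF u C] wedge_left_closed[OF v C]
  note c2 = wedge_left_closed[OF u c(1)] wedge_left_closed[OF u c(2)] wedge_left_closed[OF v c(1)] wedge_left_closed[OF v c(2)]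
  have "\<zero>\<^bsub>ext_power R M (Suc (Suc p))\<^esub> = wedge_left R M (Suc p) (u \<oplus>\<^bsub>M\<^esub> v) (wedge_left R M p (u \<oplus>\<^bsub>M\<^esub> v) C)"
    by (rule wedge_left_self[OF uv C, symmetric])
  also have "\<dots> = wedge_left R M (Suc p) u (wedge_left R M p v C) \<oplus>\<^bsub>ext_power R M (Suc (Suc p))\<^esub>
      wedge_left R M (Suc p) v (wedge_left R M p u C)"
    using u v C c c2
    by (simp add: wedge_left_add mod_hom_add[OF wedge_left_hom] wedge_left_self E.M.a_comm)
  finally show ?thesis using c2
    by (intro E.M.minus_equality[symmetric]) auto
qed

end

section \<open>Products with elements of degree two and antiderivations\<close>

text \<open>The product of degrees 2 and \<open>p\<close>, which is what is needed to multiply by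
  the values of \<open>E\<close>. It is described by linearity in the left factor and by its values
  on decomposable elements; such a function exists by \<open>wedge2_spec\<close>.\<close>

definition wedge2 :: "'r ring \<Rightarrow> ('r, 'm) module \<Rightarrow> nat \<Rightarrow> ('m list \<Rightarrow> 'r) set \<Rightarrow> ('m list \<Rightarrow> 'r) set
    \<Rightarrow> ('m list \<Rightarrow> 'r) set" where
  "wedge2 R M p = (SOME W. \<forall>J\<in>carrier (ext_power R M p).
     (\<lambda>e. W e J) \<in> mod_hom R (ext_power R M 2) (ext_power R M (Suc (Suc p))) \<and>
     (\<forall>g\<in>carrier M. \<forall>g'\<in>carrier M. W (wedge_list R M [g, g']) J = wedge_left R M (Suc p) g (wedge_left R M p g' J)))"

text \<open>The antiderivation with value \<open>E u\<close> in degree one, written out along a list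
  of factors. The value zero on the empty list means D 1 = 0, so that in degree 0 the resulting map
  corresponds to \<delta>.\<close>

primrec wdiff :: "'r ring \<Rightarrow> ('r, 'm) module \<Rightarrow> ('m \<Rightarrow> ('m list \<Rightarrow> 'r) set) \<Rightarrow> 'm list \<Rightarrow> ('m list \<Rightarrow> 'r) set" where
  "wdiff R M E [] = \<zero>\<^bsub>ext_power R M 1\<^esub>"
| "wdiff R M E (u # us) = wedge2 R M (length us) (E u) (wedge_list R M us)
     \<ominus>\<^bsub>ext_power R M (Suc (Suc (length us)))\<^esub> wedge_left R M (Suc (length us)) u (wdiff R M E us)"

text \<open>The last clause determines \<open>D\<close>: every element is a sum of multiples of
  wedge products, and the preceding clauses say what happens to sums and multiples. The passage from
  stalks to sections rests on this.\<close>

definition ext_derivation :: "'r ring \<Rightarrow> ('r, 'm) module \<Rightarrow> ('r \<Rightarrow> 'm) \<Rightarrow> ('m \<Rightarrow> ('m list \<Rightarrow> 'r) set) \<Rightarrow> nat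
    \<Rightarrow> (('m list \<Rightarrow> 'r) set \<Rightarrow> ('m list \<Rightarrow> 'r) set) \<Rightarrow> bool" where
  "ext_derivation R M \<delta> E p D \<longleftrightarrow>
     (\<forall>J\<in>carrier (ext_power R M p). D J \<in> carrier (ext_power R M (Suc p))) \<and>
     (\<forall>J\<in>carrier (ext_power R M p). \<forall>K\<in>carrier (ext_power R M p).
        D (J \<oplus>\<^bsub>ext_power R M p\<^esub> K) = D J \<oplus>\<^bsub>ext_power R M (Suc p)\<^esub> D K) \<and>
     (\<forall>a\<in>carrier R. \<forall>J\<in>carrier (ext_power R M p). D (a \<odot>\<^bsub>ext_power R M p\<^esub> J) =
        a \<odot>\<^bsub>ext_power R M (Suc p)\<^esub> D J \<oplus>\<^bsub>ext_power R M (Suc p)\<^esub> wedge_left R M p (\<delta> a) J) \<and>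
     (\<forall>us\<in>lists_of M p. D (wedge_list R M us) = wdiff R M E us)"

text \<open>
  The \<open>R\<close>-linear maps from the \<open>p\<close>-th exterior power to this module that lift the identity are
  the maps \<open>J \<mapsto> (J, D J)\<close> with \<open>D\<close> additive and \<open>D (a J) = a D J + \<delta> a \<and> J\<close>.  So the universal
  property of exterior powers also constructs such \<open>D\<close>, which are not linear.
\<close>

definition twisted_module :: "'r ring \<Rightarrow> ('r, 'm) module \<Rightarrow> ('r \<Rightarrow> 'm) \<Rightarrow> nat
    \<Rightarrow> ('r, ('m list \<Rightarrow> 'r) set \<times> ('m list \<Rightarrow> 'r) set) module" where
  "twisted_module R M \<delta> p = (let L = ext_power R M p; L' = ext_power R M (Suc p) in \<lparr>
     carrier = carrier L \<times> carrier L', mult = undefined, one = undefined,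
     zero = (\<zero>\<^bsub>L\<^esub>, \<zero>\<^bsub>L'\<^esub>),
     add = (\<lambda>(J, K) (J', K'). (J \<oplus>\<^bsub>L\<^esub> J', K \<oplus>\<^bsub>L'\<^esub> K')),
     smult = (\<lambda>a (J, K). (a \<odot>\<^bsub>L\<^esub> J, a \<odot>\<^bsub>L'\<^esub> K \<oplus>\<^bsub>L'\<^esub> wedge_left R M p (\<delta> a) J)) \<rparr>)"

lemma lists_of_2: "us \<in> lists_of M 2 \<longleftrightarrow> (\<exists>g\<in>carrier M. \<exists>g'\<in>carrier M. us = [g, g'])"
proof -
  have "length us = 2 \<longleftrightarrow> (\<exists>g g'. us = [g, g'])"
    by (cases us; cases "tl us"; auto)
  then show ?thesis by (auto simp: lists_of_def)
qed

context
  fixes R :: "'r ring" and M :: "('r, 'm) module"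
  assumes M: "module R M"
begin

interpretation M: module R M by (rule M)
interpretation L: module R "ext_power R M p" for p by (rule ext_power_module[OF M])

lemmas exm = ext_power_module[OF M]
lemmas wl_hom = wedge_left_hom[OF M]
lemmas wl_closed = wedge_left_closed[OF M]
lemmas ext_induct' = ext_power_induct[OF M, consumes 1, case_names zero add]

lemma wedge2_alternating:
  assumes J: "J \<in> carrier (ext_power R M p)"
  shows "alternating R M (ext_power R M (Suc (Suc p))) 2
     (\<lambda>us. wedge_left R M (Suc p) (us ! 0) (wedge_left R M p (us ! 1) J))"
proof (rule alternatingI, goal_cases)
  case (1 us)
  then show ?case by (auto simp: lists_of_2 J wl_closed)
next
  case (2 us u vs v)
  then consider g where "us = []" "vs = [g]" "g \<in> carrier M" "u \<in> carrier M"
    | g where "us = [g]" "vs = []" "g \<in> carrier M" "u \<in> carrier M"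
    by (auto simp: lists_of_2 Cons_eq_append_conv append_eq_Cons_conv)
  then show ?case using 2(2) J
    by cases (simp_all add: wedge_left_add[OF M] mod_hom_add[OF wl_hom] wl_closed)
next
  case (3 us u vs v)
  then consider g where "us = []" "vs = [g]" "g \<in> carrier M" "u \<in> carrier M"
    | g where "us = [g]" "vs = []" "g \<in> carrier M" "u \<in> carrier M"
    by (auto simp: lists_of_2 Cons_eq_append_conv append_eq_Cons_conv)
  then show ?case using 3(2) J
    by cases (simp_all add: wedge_left_smult[OF M] mod_hom_smult[OF wl_hom] wl_closed)
next
  case (4 us)
  then show ?case using J by (auto simp: lists_of_2 wedge_left_self[OF M])
qed

text \<open>For fixed \<open>J\<close> the universal property of the second exterior power gives a
  linear map in \<open>e\<close>; choosing one for every \<open>J\<close> yields a function of both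
  arguments.\<close>

lemma wedge2_spec:
  assumes J: "J \<in> carrier (ext_power R M p)"
  shows "(\<lambda>e. wedge2 R M p e J) \<in> mod_hom R (ext_power R M 2) (ext_power R M (Suc (Suc p))) \<and>
     (\<forall>g\<in>carrier M. \<forall>g'\<in>carrier M.
       wedge2 R M p (wedge_list R M [g, g']) J = wedge_left R M (Suc p) g (wedge_left R M p g' J))"
proof -
  have "\<exists>W. W \<in> mod_hom R (ext_power R M 2) (ext_power R M (Suc (Suc p))) \<and>
     (\<forall>g\<in>carrier M. \<forall>g'\<in>carrier M. W (wedge_list R M [g, g']) = wedge_left R M (Suc p) g (wedge_left R M p g' J))"
    if J: "J \<in> carrier (ext_power R M p)" for J
  proof (rule ext_power_lift[OF M exm wedge2_alternating[OF J]])
    fix W assume "W \<in> mod_hom R (ext_power R M 2) (ext_power R M (Suc (Suc p)))"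
      and "\<And>us. us \<in> lists_of M 2 \<Longrightarrow> W (wedge_list R M us) = wedge_left R M (Suc p) (us ! 0) (wedge_left R M p (us ! 1) J)"
    then show ?thesis by (intro exI[of _ W]) (simp add: lists_of_2)
  qed
  then obtain W where W: "\<forall>J\<in>carrier (ext_power R M p). W J \<in> mod_hom R (ext_power R M 2) (ext_power R M (Suc (Suc p))) \<and>
     (\<forall>g\<in>carrier M. \<forall>g'\<in>carrier M. W J (wedge_list R M [g, g']) = wedge_left R M (Suc p) g (wedge_left R M p g' J))"
    by metis
  have "\<forall>J\<in>carrier (ext_power R M p).
     (\<lambda>e. wedge2 R M p e J) \<in> mod_hom R (ext_power R M 2) (ext_power R M (Suc (Suc p))) \<and>
     (\<forall>g\<in>carrier M. \<forall>g'\<in>carrier M.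
       wedge2 R M p (wedge_list R M [g, g']) J = wedge_left R M (Suc p) g (wedge_left R M p g' J))"
    unfolding wedge2_def by (rule someI[of _ "\<lambda>e J. W J e"]) (use W in simp)
  then show ?thesis using J by (rule bspec)
qed

lemma wedge_left_zero:
  "J \<in> carrier (ext_power R M p) \<Longrightarrow> wedge_left R M p \<zero>\<^bsub>M\<^esub> J = \<zero>\<^bsub>ext_power R M (Suc p)\<^esub>"
  using wedge_left_smult[OF M, of "\<zero>\<^bsub>M\<^esub>" "\<zero>\<^bsub>R\<^esub>" J p] wl_closed[of "\<zero>\<^bsub>M\<^esub>" J p] by simp

lemmas wedge2_hom = wedge2_spec[THEN conjunct1]

lemma wedge2_closed:
  "e \<in> carrier (ext_power R M 2) \<Longrightarrow> J \<in> carrier (ext_power R M p) \<Longrightarrow>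
   wedge2 R M p e J \<in> carrier (ext_power R M (Suc (Suc p)))"
  by (rule mod_hom_closed[OF wedge2_hom])

lemma wedge2_pair:
  "g \<in> carrier M \<Longrightarrow> g' \<in> carrier M \<Longrightarrow> J \<in> carrier (ext_power R M p) \<Longrightarrow>
   wedge2 R M p (wedge_list R M [g, g']) J = wedge_left R M (Suc p) g (wedge_left R M p g' J)"
  using wedge2_spec by blast

lemma pair_closed: "g \<in> carrier M \<Longrightarrow> g' \<in> carrier M \<Longrightarrow> wedge_list R M [g, g'] \<in> carrier (ext_power R M 2)"
  by (rule wedge_list_closed[OF M]) (simp add: lists_of_2)

lemma ext2_induct [consumes 1, case_names zero add]:
  assumes "e \<in> carrier (ext_power R M 2)" "Q \<zero>\<^bsub>ext_power R M 2\<^esub>"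
    and "\<And>a g g' e. a \<in> carrier R \<Longrightarrow> g \<in> carrier M \<Longrightarrow> g' \<in> carrier M \<Longrightarrow> e \<in> carrier (ext_power R M 2) \<Longrightarrow>
      Q e \<Longrightarrow> Q (a \<odot>\<^bsub>ext_power R M 2\<^esub> wedge_list R M [g, g'] \<oplus>\<^bsub>ext_power R M 2\<^esub> e)"
  shows "Q e"
  using assms(1)
proof (induction rule: ext_induct')
  case zero
  then show ?case using assms(2) .
next
  case (add a us C)
  then obtain g g' where "g \<in> carrier M" "g' \<in> carrier M" "us = [g, g']" by (auto simp: lists_of_2)
  then show ?case using assms(3) add by blast
qed

text \<open>Linearity in \<open>e\<close> holds by construction. Linearity in \<open>J\<close> is
  checked by induction on \<open>e\<close>; on decomposable elements it is that of two left
  multiplications.\<close>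

lemma wedge2_hom_right:
  assumes "e \<in> carrier (ext_power R M 2)"
  shows "wedge2 R M p e \<in> mod_hom R (ext_power R M p) (ext_power R M (Suc (Suc p)))"
proof (rule mod_homI, goal_cases)
  case (1 J)
  then show ?case by (rule wedge2_closed[OF assms])
next
  case (2 J K)
  note h = mod_hom_zero[OF exm exm wedge2_hom]  mod_hom_add[OF wedge2_hom] mod_hom_smult[OF wedge2_hom]
  from assms show ?case
  proof (induction rule: ext2_induct)
    case zero
    show ?case using 2 by (simp add: h)
  next
    case (add a g g' e)
    then show ?case using 2
      by (simp add: h pair_closed wedge2_pair mod_hom_add[OF wl_hom] wl_closed wedge2_closed L.smult_r_distr L.M.a_ac)
  qed
next
  case (3 b J)
  note h = mod_hom_zero[OF exm exm wedge2_hom]  mod_hom_add[OF wedge2_hom] mod_hom_smult[OF wedge2_hom]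
  from assms show ?case
  proof (induction rule: ext2_induct)
    case zero
    show ?case using 3 by (simp add: h)
  next
    case (add a g g' e)
    then show ?case using 3
      by (simp add: h pair_closed wedge2_pair mod_hom_smult[OF wl_hom] wl_closed wedge2_closed L.smult_r_distr
          L.smult_assoc1[symmetric] M.R.m_comm)
  qed
qed

text \<open>An element of degree two is even: moving \<open>u\<close> past both factors of a
  decomposable \<open>e\<close> changes the sign twice.\<close>

lemma wedge2_commute:
  assumes u: "u \<in> carrier M" and e: "e \<in> carrier (ext_power R M 2)" and J: "J \<in> carrier (ext_power R M p)"
  shows "wedge_left R M (Suc (Suc p)) u (wedge2 R M p e J) = wedge2 R M (Suc p) e (wedge_left R M p u J)"
proof -
  note h = mod_hom_zero[OF exm exm wedge2_hom]  mod_hom_add[OF wedge2_hom] mod_hom_smult[OF wedge2_hom]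
    mod_hom_zero[OF exm exm wl_hom[OF u]]  mod_hom_add[OF wl_hom] mod_hom_smult[OF wl_hom]
  from e show ?thesis
  proof (induction rule: ext2_induct)
    case zero
    show ?case using u J by (simp add: h wl_closed)
  next
    case (add a g g' e)
    have 1: "wedge_left R M (Suc (Suc p)) u (wedge_left R M (Suc p) g (wedge_left R M p g' J)) =
      wedge_left R M (Suc (Suc p)) g (wedge_left R M (Suc p) g' (wedge_left R M p u J))"
      unfolding wedge_left_anticomm[OF M u \<open>g \<in> carrier M\<close> wl_closed[OF \<open>g' \<in> carrier M\<close> J]]
        wedge_left_anticomm[OF M u \<open>g' \<in> carrier M\<close> J]
      using u J add(2,3) by (simp add: mod_hom_uminus[OF exm exm wl_hom] wl_closed)
    show ?case using u J add
      by (simp add: h pair_closed wedge2_pair wl_closed wedge2_closed 1)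
  qed
qed

section \<open>Antiderivations over a derivation of the base ring\<close>

context
  fixes \<delta> :: "'r \<Rightarrow> 'm" and E :: "'m \<Rightarrow> ('m list \<Rightarrow> 'r) set"
  assumes \<delta>_closed: "\<And>a. a \<in> carrier R \<Longrightarrow> \<delta> a \<in> carrier M"
    and \<delta>_add: "\<And>a b. a \<in> carrier R \<Longrightarrow> b \<in> carrier R \<Longrightarrow> \<delta> (a \<oplus>\<^bsub>R\<^esub> b) = \<delta> a \<oplus>\<^bsub>M\<^esub> \<delta> b"
    and \<delta>_mult: "\<And>a b. a \<in> carrier R \<Longrightarrow> b \<in> carrier R \<Longrightarrow> \<delta> (a \<otimes>\<^bsub>R\<^esub> b) = a \<odot>\<^bsub>M\<^esub> \<delta> b \<oplus>\<^bsub>M\<^esub> b \<odot>\<^bsub>M\<^esub> \<delta> a"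
    and E_closed: "\<And>u. u \<in> carrier M \<Longrightarrow> E u \<in> carrier (ext_power R M 2)"
    and E_add: "\<And>u v. u \<in> carrier M \<Longrightarrow> v \<in> carrier M \<Longrightarrow> E (u \<oplus>\<^bsub>M\<^esub> v) = E u \<oplus>\<^bsub>ext_power R M 2\<^esub> E v"
    and E_smult: "\<And>a u. a \<in> carrier R \<Longrightarrow> u \<in> carrier M \<Longrightarrow>
       E (a \<odot>\<^bsub>M\<^esub> u) = a \<odot>\<^bsub>ext_power R M 2\<^esub> E u \<oplus>\<^bsub>ext_power R M 2\<^esub> wedge_list R M [\<delta> a, u]"
begin

lemma wedge_list_closed': "set us \<subseteq> carrier M \<Longrightarrow> wedge_list R M us \<in> carrier (ext_power R M (length us))"
  by (rule wedge_list_closed[OF M]) (simp add: lists_of_def)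

lemma wedge_list_Cons:
  "u \<in> carrier M \<Longrightarrow> set us \<subseteq> carrier M \<Longrightarrow> wedge_list R M (u # us) = wedge_left R M (length us) u (wedge_list R M us)"
  by (rule wedge_left_wedge_list[OF M, symmetric]) (simp_all add: lists_of_def)

lemma wdiff_closed: "set us \<subseteq> carrier M \<Longrightarrow> wdiff R M E us \<in> carrier (ext_power R M (Suc (length us)))"
proof (induction us)
  case (Cons u us)
  then show ?case
    by (simp add: wedge2_closed wl_closed E_closed wedge_list_closed' L.M.minus_closed)
qed simp

text \<open>Induction on the entries in front of the modified one. In the base case the modified
  entry is at the head, where additivity of \<open>E\<close> and of the left factor enters; in the
  step it lies in the tail, where both terms of the recursion are additive.\<close>

lemma wdiff_add:
  assumes "set us \<subseteq> carrier M" "u \<in> carrier M" "v \<in> carrier M" "set vs \<subseteq> carrier M"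
  shows "wdiff R M E (us @ (u \<oplus>\<^bsub>M\<^esub> v) # vs) =
    wdiff R M E (us @ u # vs) \<oplus>\<^bsub>ext_power R M (Suc (Suc (length us + length vs)))\<^esub> wdiff R M E (us @ v # vs)"
  using assms
proof (induction us)
  case Nil
  then show ?case using wedge_list_closed'[of vs] wdiff_closed[of vs]
    by (simp add: E_add mod_hom_add[OF wedge2_hom] E_closed wedge_left_add[OF M] wedge2_closed wl_closed
        a_minus_def L.M.minus_add L.M.a_ac)
next
  case (Cons w us)
  have l: "us @ u # vs \<in> lists_of M (Suc (length us + length vs))" using Cons by (auto simp: lists_of_def)
  have "wedge_list R M (us @ (u \<oplus>\<^bsub>M\<^esub> v) # vs) = wedge_list R M (us @ u # vs)
     \<oplus>\<^bsub>ext_power R M (Suc (length us + length vs))\<^esub> wedge_list R M (us @ v # vs)"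
    by (rule alternatingD(2)[OF wedge_list_alternating[OF M] l]) (use Cons in auto)
  then show ?case
    using Cons wedge_list_closed'[of "us @ u # vs"] wdiff_closed[of "us @ u # vs"]
      wedge_list_closed'[of "us @ v # vs"] wdiff_closed[of "us @ v # vs"]
    by (simp add: E_closed mod_hom_add[OF wedge2_hom_right] mod_hom_add[OF wl_hom] wedge2_closed wl_closed
        a_minus_def L.M.minus_add L.M.a_ac)
qed

text \<open>The term with \<delta> a arises in the base case from \<open>E_smult\<close>. In the
  step it is produced inside the tail, behind the minus sign of the recursion and behind
  \<open>w\<close>; exchanging \<open>w\<close> and \<delta> a cancels that sign.\<close>

lemma wdiff_smult:
  assumes "set us \<subseteq> carrier M" "u \<in> carrier M" "a \<in> carrier R" "set vs \<subseteq> carrier M"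
  shows "wdiff R M E (us @ (a \<odot>\<^bsub>M\<^esub> u) # vs) =
    a \<odot>\<^bsub>ext_power R M (Suc (Suc (length us + length vs)))\<^esub> wdiff R M E (us @ u # vs)
      \<oplus>\<^bsub>ext_power R M (Suc (Suc (length us + length vs)))\<^esub>
    wedge_left R M (Suc (length us + length vs)) (\<delta> a) (wedge_list R M (us @ u # vs))"
  using assms
proof (induction us)
  case Nil
  then show ?case using wedge_list_closed'[of vs] wdiff_closed[of vs]
    by (simp add: E_smult mod_hom_add[OF wedge2_hom] mod_hom_smult[OF wedge2_hom] E_closed pair_closed \<delta>_closed
        wedge2_pair wedge_left_smult[OF M] wedge2_closed wl_closed wedge_list_Cons[of u vs]
        a_minus_def L.smult_r_distr L.smult_r_minus L.M.a_ac)
next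
  case (Cons w us)
  have l: "us @ u # vs \<in> lists_of M (Suc (length us + length vs))" using Cons by (auto simp: lists_of_def)
  have 1: "wedge_list R M (us @ (a \<odot>\<^bsub>M\<^esub> u) # vs) =
     a \<odot>\<^bsub>ext_power R M (Suc (length us + length vs))\<^esub> wedge_list R M (us @ u # vs)"
    by (rule alternatingD(3)[OF wedge_list_alternating[OF M] l]) (use Cons in auto)
  let ?q = "Suc (length us + length vs)"
  have w: "wedge_list R M (us @ u # vs) \<in> carrier (ext_power R M ?q)"
    using wedge_list_closed'[of "us @ u # vs"] Cons by simp
  have 2: "wedge_left R M (Suc ?q) w (wedge_left R M ?q (\<delta> a) (wedge_list R M (us @ u # vs))) =
    \<ominus>\<^bsub>ext_power R M (Suc (Suc ?q))\<^esub> wedge_left R M (Suc ?q) (\<delta> a) (wedge_left R M ?q w (wedge_list R M (us @ u # vs)))"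
    by (rule wedge_left_anticomm[OF M _ _ w]) (use Cons \<delta>_closed in auto)
  show ?case
    using Cons w wdiff_closed[of "us @ u # vs"]
    by (simp add: 1 2 E_closed \<delta>_closed mod_hom_smult[OF wedge2_hom_right] mod_hom_add[OF wl_hom] mod_hom_smult[OF wl_hom]
        wedge2_closed wl_closed wedge_list_Cons a_minus_def L.M.minus_add L.smult_r_distr L.smult_r_minus L.M.a_ac)
qed

text \<open>If \<open>u\<close> is the head, its square kills the second term of the recursion. If
  \<open>u\<close> lies in the tail, then \<open>u\<close> times the product of the tail is zero,
  which kills the first term, and exchanging \<open>u\<close> and \<open>w\<close> reduces the
  second term to the tail. The identity lets the two terms of the recursion cancel on a list with a
  repetition.\<close>

lemma wdiff_mem:
  assumes "set us \<subseteq> carrier M" "u \<in> set us"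
  shows "wedge_left R M (Suc (length us)) u (wdiff R M E us) = wedge2 R M (length us) (E u) (wedge_list R M us)"
  using assms
proof (induction us)
  case (Cons w us)
  let ?n = "length us"
  have w: "w \<in> carrier M" and us: "set us \<subseteq> carrier M" and u: "u \<in> carrier M" using Cons by auto
  note cl = wedge_list_closed'[OF us] wdiff_closed[OF us]
  note W = wedge2_closed[OF E_closed cl(1)]
  have "wedge_left R M (Suc (length (w # us))) u (wdiff R M E (w # us)) =
    wedge2 R M (Suc ?n) (E w) (wedge_left R M ?n u (wedge_list R M us))
      \<ominus>\<^bsub>ext_power R M (Suc (Suc (Suc ?n)))\<^esub> wedge_left R M (Suc (Suc ?n)) u (wedge_left R M (Suc ?n) w (wdiff R M E us))"
    using u w cl W by (simp add: mod_hom_minus[OF exm exm wl_hom] wedge2_commute E_closed wl_closed)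
  also have "\<dots> = wedge2 R M (Suc ?n) (E u) (wedge_left R M ?n w (wedge_list R M us))"
  proof (cases "u = w")
    case True
    then show ?thesis using u w cl W wedge2_closed[OF E_closed[OF w] wl_closed[OF w cl(1)]]
      by (simp add: wedge_left_self[OF M] a_minus_def)
  next
    case False
    then have m: "u \<in> set us" using Cons by simp
    then have "wedge_list R M (u # us) = \<zero>\<^bsub>ext_power R M (Suc ?n)\<^esub>"
      by (intro alternatingD(4)[OF wedge_list_alternating[OF M]]) (use u us in \<open>auto simp: lists_of_def\<close>)
    then have z: "wedge_left R M ?n u (wedge_list R M us) = \<zero>\<^bsub>ext_power R M (Suc ?n)\<^esub>"
      using wedge_list_Cons[OF u us] by simp
    have "wedge_left R M (Suc (Suc ?n)) u (wedge_left R M (Suc ?n) w (wdiff R M E us)) =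
      \<ominus>\<^bsub>ext_power R M (Suc (Suc (Suc ?n)))\<^esub> wedge_left R M (Suc (Suc ?n)) w (wedge2 R M ?n (E u) (wedge_list R M us))"
      unfolding wedge_left_anticomm[OF M u w cl(2)] using Cons.IH[OF us m] by simp
    then show ?thesis unfolding z
      using u w cl W wedge2_closed[OF E_closed[OF u] wl_closed[OF w cl(1)]]
      by (simp add: mod_hom_zero[OF exm exm wedge2_hom_right] E_closed wedge2_commute a_minus_def L.M.minus_minus)
  qed
  also have "\<dots> = wedge2 R M (length (w # us)) (E u) (wedge_list R M (w # us))"
    by (simp add: wedge_list_Cons w us)
  finally show ?case .
qed simp

text \<open>If the tail is distinct, the head occurs in it and the two terms of the recursion are
  equal by \<open>wdiff_mem\<close>. Otherwise the repetition is in the tail, whose product and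
  whose value of \<open>wdiff\<close> both vanish.\<close>

lemma wdiff_not_distinct:
  assumes "set us \<subseteq> carrier M" "\<not> distinct us"
  shows "wdiff R M E us = \<zero>\<^bsub>ext_power R M (Suc (length us))\<^esub>"
  using assms
proof (induction us)
  case (Cons u us)
  then have u: "u \<in> carrier M" and us: "set us \<subseteq> carrier M" by auto
  note cl = wedge_list_closed'[OF us] wdiff_closed[OF us]
  show ?case
  proof (cases "distinct us")
    case True
    then have "u \<in> set us" using Cons by simp
    then show ?thesis using wdiff_mem[OF us] wedge2_closed[OF E_closed[OF u] cl(1)] by (simp add: a_minus_def L.M.r_neg)
  next
    case False
    then have "wedge_list R M us = \<zero>\<^bsub>ext_power R M (length us)\<^esub>"
      by (intro alternatingD(4)[OF wedge_list_alternating[OF M]]) (use us in \<open>auto simp: lists_of_def\<close>)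
    then show ?thesis using Cons.IH[OF us False] u
      by (simp add: mod_hom_zero[OF exm exm wl_hom] mod_hom_zero[OF exm exm wedge2_hom_right] E_closed a_minus_def)
  qed
qed simp

lemma \<delta>_one: "\<delta> \<one>\<^bsub>R\<^esub> = \<zero>\<^bsub>M\<^esub>"
  using \<delta>_mult[of "\<one>\<^bsub>R\<^esub>" "\<one>\<^bsub>R\<^esub>"] \<delta>_closed[of "\<one>\<^bsub>R\<^esub>"] by simp

text \<open>Associativity of the twisted action is the Leibniz rule of \<delta>, distributivity over
  sums of scalars is its additivity, and the unit law is \<delta> 1 = 0.\<close>

lemma twisted_module: "module R (twisted_module R M \<delta> p)"
proof (rule moduleI)
  show "cring R" by (rule M.R.is_cring)
  show "abelian_group (twisted_module R M \<delta> p)"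
  proof (rule abelian_groupI)
    fix C assume C: "C \<in> carrier (twisted_module R M \<delta> p)"
    then show "\<exists>D\<in>carrier (twisted_module R M \<delta> p). D \<oplus>\<^bsub>twisted_module R M \<delta> p\<^esub> C = \<zero>\<^bsub>twisted_module R M \<delta> p\<^esub>"
      by (intro bexI[of _ "(\<ominus>\<^bsub>ext_power R M p\<^esub> fst C, \<ominus>\<^bsub>ext_power R M (Suc p)\<^esub> snd C)"])
        (auto simp: twisted_module_def Let_def L.M.l_neg)
  qed (auto simp: twisted_module_def Let_def L.M.a_ac)
next
  fix a b and x :: "_ \<times> _" assume "a \<in> carrier R" "b \<in> carrier R" "x \<in> carrier (twisted_module R M \<delta> p)"
  then show "(a \<otimes>\<^bsub>R\<^esub> b) \<odot>\<^bsub>twisted_module R M \<delta> p\<^esub> x =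
     a \<odot>\<^bsub>twisted_module R M \<delta> p\<^esub> (b \<odot>\<^bsub>twisted_module R M \<delta> p\<^esub> x)"
    by (auto simp: twisted_module_def Let_def L.smult_assoc1 \<delta>_mult wedge_left_add[OF M] wedge_left_smult[OF M] wl_closed
        \<delta>_closed L.smult_r_distr mod_hom_smult[OF wl_hom] L.M.a_ac)
qed (auto simp: twisted_module_def Let_def \<delta>_closed wl_closed L.smult_l_distr L.smult_r_distr \<delta>_add wedge_left_add[OF M]
    mod_hom_add[OF wl_hom] L.M.a_ac \<delta>_one wedge_left_zero)

lemma wdiff_alternating: "alternating R M (twisted_module R M \<delta> p) p (\<lambda>us. (wedge_list R M us, wdiff R M E us))"
proof (rule alternatingI, goal_cases)
  case (1 us)
  then show ?case using wedge_list_closed[OF M 1] wdiff_closed[of us]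
    by (auto simp: twisted_module_def Let_def lists_of_def)
next
  case (2 us u vs v)
  then show ?case using alternatingD(2)[OF wedge_list_alternating[OF M] 2] wdiff_add[of us u v vs]
    by (auto simp: twisted_module_def Let_def lists_of_def)
next
  case (3 us u vs a)
  then show ?case using alternatingD(3)[OF wedge_list_alternating[OF M] 3] wdiff_smult[of us u a vs]
    by (auto simp: twisted_module_def Let_def lists_of_def)
next
  case (4 us)
  then show ?case using alternatingD(4)[OF wedge_list_alternating[OF M] 4] wdiff_not_distinct[of us]
    by (auto simp: twisted_module_def Let_def lists_of_def)
qed

text \<open>The universal property is applied to \<open>us\<close> paired with its value of
  \<open>wdiff\<close>. The first component of the resulting linear map is the identity, since it is
  so on products; linearity of the pair is then the rule required of the second component.\<close>

lemma ext_derivation_exists: "\<exists>D. ext_derivation R M \<delta> E p D"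
proof (rule ext_power_lift[OF M twisted_module wdiff_alternating])
  let ?T = "twisted_module R M \<delta> p"
  fix g assume g: "g \<in> mod_hom R (ext_power R M p) ?T"
    and gw: "\<And>us. us \<in> lists_of M p \<Longrightarrow> g (wedge_list R M us) = (wedge_list R M us, wdiff R M E us)"
  have fst: "fst (g J) = J" if "J \<in> carrier (ext_power R M p)" for J
  proof (rule ext_power_hom_eqI[OF M exm _ _ _ that, where g = "\<lambda>J. fst (g J)"])
    show "(\<lambda>J. fst (g J)) \<in> mod_hom R (ext_power R M p) (ext_power R M p)"
      by (rule mod_homI)
        (use mod_hom_closed[OF g] mod_hom_add[OF g] mod_hom_smult[OF g] in
          \<open>auto simp: twisted_module_def Let_def split_beta mem_Times_iff\<close>)
  qed (auto simp: gw intro: mod_homI)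
  show "\<exists>D. ext_derivation R M \<delta> E p D"
  proof (rule exI[of _ "\<lambda>J. snd (g J)"])
    show "ext_derivation R M \<delta> E p (\<lambda>J. snd (g J))"
      unfolding ext_derivation_def
      using mod_hom_closed[OF g] mod_hom_add[OF g] mod_hom_smult[OF g] gw fst
      by (auto simp: twisted_module_def Let_def split_beta mem_Times_iff)
  qed
qed

end

end

section \<open>Sections of exterior powers of a sheaf of modules\<close>

lemma (in abelian_monoid) finsum_lessThan_add:
  fixes m n :: nat
  assumes "\<And>k. k < m + n \<Longrightarrow> f k \<in> carrier G"
  shows "finsum G f {..<m + n} = finsum G f {..<m} \<oplus> finsum G (\<lambda>k. f (m + k)) {..<n}"
  using assms
proof (induction n)
  case 0
  then show ?case by (simp add: finsum_closed Pi_def)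
next
  case (Suc n)
  have c: "f \<in> {..<m + n} \<rightarrow> carrier G" "f (m + n) \<in> carrier G" "f \<in> {..<m} \<rightarrow> carrier G"
    "(\<lambda>k. f (m + k)) \<in> {..<n} \<rightarrow> carrier G" using Suc by auto
  then show ?case using Suc
    by (simp add: lessThan_Suc finsum_insert finsum_closed a_ac)
qed

lemma ext_derivationD:
  assumes "ext_derivation R M \<delta> E p D"
  shows "J \<in> carrier (ext_power R M p) \<Longrightarrow> D J \<in> carrier (ext_power R M (Suc p))"
    and "J \<in> carrier (ext_power R M p) \<Longrightarrow> K \<in> carrier (ext_power R M p) \<Longrightarrow>
        D (J \<oplus>\<^bsub>ext_power R M p\<^esub> K) = D J \<oplus>\<^bsub>ext_power R M (Suc p)\<^esub> D K"
    and "a \<in> carrier R \<Longrightarrow> J \<in> carrier (ext_power R M p) \<Longrightarrow> D (a \<odot>\<^bsub>ext_power R M p\<^esub> J) =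
        a \<odot>\<^bsub>ext_power R M (Suc p)\<^esub> D J \<oplus>\<^bsub>ext_power R M (Suc p)\<^esub> wedge_left R M p (\<delta> a) J"
    and "us \<in> lists_of M p \<Longrightarrow> D (wedge_list R M us) = wdiff R M E us"
  using assms unfolding ext_derivation_def by simp_all

lemma ext_derivation_zero:
  assumes M: "module R M" and D: "ext_derivation R M \<delta> E p D"
  shows "D \<zero>\<^bsub>ext_power R M p\<^esub> = \<zero>\<^bsub>ext_power R M (Suc p)\<^esub>"
proof -
  interpret L: module R "ext_power R M p" by (rule ext_power_module[OF M])
  interpret L': module R "ext_power R M (Suc p)" by (rule ext_power_module[OF M])
  show ?thesis
    using ext_derivationD(2)[OF D L.M.zero_closed L.M.zero_closed] ext_derivationD(1)[OF D L.M.zero_closed]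
    by (simp add: L'.M.add.r_cancel_one')
qed

text \<open>The conditions on sections are those used to calculate with local sums of a u_1 \<and>
  ... \<and> u_p: coefficients are multiplied and negated, while addition is concatenation of local
  sums.\<close>

locale module_sheaf =
  fixes T :: "'x topology" and R :: "('x, 'r ring, 'r) sheaf" and F :: "('x, ('r, 'm) module, 'm) sheaf"
  assumes stalk_module: "\<And>x. x \<in> topspace T \<Longrightarrow> module (stalk R x) (stalk F x)"
    and sec_R_closed: "\<And>U s x. openin T U \<Longrightarrow> is_sec R U s \<Longrightarrow> x \<in> U \<Longrightarrow> s x \<in> carrier (stalk R x)"
    and sec_F_closed: "\<And>U s x. openin T U \<Longrightarrow> is_sec F U s \<Longrightarrow> x \<in> U \<Longrightarrow> s x \<in> carrier (stalk F x)"
    and sec_R_restrict: "\<And>U V s. openin T U \<Longrightarrow> is_sec R U s \<Longrightarrow> openin T V \<Longrightarrow> V \<subseteq> U \<Longrightarrow> is_sec R V s"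
    and sec_F_restrict: "\<And>U V s. openin T U \<Longrightarrow> is_sec F U s \<Longrightarrow> openin T V \<Longrightarrow> V \<subseteq> U \<Longrightarrow> is_sec F V s"
    and sec_R_one: "\<And>U. openin T U \<Longrightarrow> is_sec R U (\<lambda>x. \<one>\<^bsub>stalk R x\<^esub>)"
    and sec_R_mult: "\<And>U s t. openin T U \<Longrightarrow> is_sec R U s \<Longrightarrow> is_sec R U t \<Longrightarrow> is_sec R U (\<lambda>x. s x \<otimes>\<^bsub>stalk R x\<^esub> t x)"
    and sec_R_uminus: "\<And>U s. openin T U \<Longrightarrow> is_sec R U s \<Longrightarrow> is_sec R U (\<lambda>x. \<ominus>\<^bsub>stalk R x\<^esub> s x)"
begin

abbreviation L :: "nat \<Rightarrow> 'x \<Rightarrow> ('r, ('m list \<Rightarrow> 'r) set) module" where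
  "L p x \<equiv> ext_power (stalk R x) (stalk F x) p"

abbreviation esec :: "nat \<Rightarrow> 'x set \<Rightarrow> ('x \<Rightarrow> ('m list \<Rightarrow> 'r) set) \<Rightarrow> bool" where
  "esec p U s \<equiv> is_sec (ext_sheaf T R F p) U s"

text \<open>The inner condition of \<open>ext_sheaf\<close> over one open set, with the number of
  terms, the coefficients and the factors as arguments, so that proofs can modify them.\<close>

definition simple_rep where
  "simple_rep p V s (m::nat) a f \<longleftrightarrow> (\<forall>k<m. is_sec R V (a k) \<and> (\<forall>i<p. is_sec F V (f k i))) \<and>
     (\<forall>y\<in>V. s y = finsum (L p y)
        (\<lambda>k. a k y \<odot>\<^bsub>L p y\<^esub> wedge_list (stalk R y) (stalk F y) (map (\<lambda>i. f k i y) [0..<p])) {..<m})"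

definition simple_sec where
  "simple_sec p V s \<longleftrightarrow> (\<exists>m a f. simple_rep p V s m a f)"

lemma simple_repD1: "simple_rep p V s m a f \<Longrightarrow> k < m \<Longrightarrow> is_sec R V (a k) \<and> (\<forall>i<p. is_sec F V (f k i))"
  unfolding simple_rep_def by blast

lemma simple_repD2:
  assumes "simple_rep p V s m a f" "y \<in> V"
  shows "s y = finsum (L p y)
        (\<lambda>k. a k y \<odot>\<^bsub>L p y\<^esub> wedge_list (stalk R y) (stalk F y) (map (\<lambda>i. f k i y) [0..<p])) {..<m}"
  using conjunct2[OF assms(1)[unfolded simple_rep_def]] assms(2) by (rule bspec)

lemma simple_secI:
  fixes m :: nat
  assumes "\<And>k. k < m \<Longrightarrow> is_sec R V (a k) \<and> (\<forall>i<p. is_sec F V (f k i))"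
    and "\<And>y. y \<in> V \<Longrightarrow> s y = finsum (L p y)
        (\<lambda>k. a k y \<odot>\<^bsub>L p y\<^esub> wedge_list (stalk R y) (stalk F y) (map (\<lambda>i. f k i y) [0..<p])) {..<m}"
  shows "simple_sec p V s"
  unfolding simple_sec_def simple_rep_def
  by (rule exI[of _ m], rule exI[of _ a], rule exI[of _ f], intro conjI allI impI ballI assms(2))
    (use assms(1) in simp_all)

lemma esec_iff: "esec p U s \<longleftrightarrow> (\<forall>x\<in>U. \<exists>V. openin T V \<and> x \<in> V \<and> V \<subseteq> U \<and> simple_sec p V s)"
  by (simp add: ext_sheaf_def simple_sec_def simple_rep_def)

lemma in_top: "openin T V \<Longrightarrow> y \<in> V \<Longrightarrow> y \<in> topspace T"
  using openin_subset by blast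

lemma L_module: "x \<in> topspace T \<Longrightarrow> module (stalk R x) (L p x)"
  by (rule ext_power_module[OF stalk_module])

lemma map_lists_of:
  assumes "openin T V" "y \<in> V" "\<And>i. i < p \<Longrightarrow> is_sec F V (f i)"
  shows "map (\<lambda>i. f i y) [0..<p] \<in> lists_of (stalk F y) p"
  using assms sec_F_closed by (auto simp: lists_of_def)

lemma simple_term_closed:
  assumes "openin T V" "y \<in> V" "is_sec R V a" "\<And>i. i < p \<Longrightarrow> is_sec F V (f i)"
  shows "a y \<odot>\<^bsub>L p y\<^esub> wedge_list (stalk R y) (stalk F y) (map (\<lambda>i. f i y) [0..<p]) \<in> carrier (L p y)"
proof -
  have y: "y \<in> topspace T" using in_top assms by blast
  interpret E: module "stalk R y" "L p y" by (rule L_module[OF y])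
  show ?thesis
    by (rule E.smult_closed[OF sec_R_closed[OF assms(1,3,2)] wedge_list_closed[OF stalk_module[OF y] map_lists_of[OF assms(1,2,4)]]])
qed

lemma simple_sec_closed:
  assumes "openin T V" "simple_sec p V s" "y \<in> V"
  shows "s y \<in> carrier (L p y)"
proof -
  have y: "y \<in> topspace T" using in_top assms by blast
  interpret E: module "stalk R y" "L p y" by (rule L_module[OF y])
  obtain m a f where rep1: "simple_rep p V s m a f" using assms(2) unfolding simple_sec_def by blast
  note 1 = simple_repD1[OF rep1] and 2 = simple_repD2[OF rep1]
  show ?thesis unfolding 2[OF assms(3)]
    by (rule E.M.finsum_closed, rule Pi_I, rule simple_term_closed[OF assms(1,3)]) (use 1 in simp_all)
qed

lemma simple_sec_restrict:
  assumes "openin T V" "simple_sec p V s" "openin T W" "W \<subseteq> V"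
  shows "simple_sec p W s"
proof -
  obtain m a f where rep1: "simple_rep p V s m a f" using assms(2) unfolding simple_sec_def by blast
  note 1 = simple_repD1[OF rep1] and 2 = simple_repD2[OF rep1]
  show ?thesis
  proof (rule simple_secI)
    fix y assume "y \<in> W"
    then have "y \<in> V" using assms(4) by blast
    then show "s y = finsum (L p y)
        (\<lambda>k. a k y \<odot>\<^bsub>L p y\<^esub> wedge_list (stalk R y) (stalk F y) (map (\<lambda>i. f k i y) [0..<p])) {..<m}" by (rule 2)
  qed (use 1 sec_R_restrict[OF assms(1) _ assms(3,4)] sec_F_restrict[OF assms(1) _ assms(3,4)] in simp_all)
qed

lemma simple_sec_add:
  assumes V: "openin T V" and s: "simple_sec p V s" and t: "simple_sec p V t"
  shows "simple_sec p V (\<lambda>y. s y \<oplus>\<^bsub>L p y\<^esub> t y)"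
proof -
  obtain m a f where rep1: "simple_rep p V s m a f" using s unfolding simple_sec_def by blast
  note 1 = simple_repD1[OF rep1] and 2 = simple_repD2[OF rep1]
  obtain n b g where rep3: "simple_rep p V t n b g" using t unfolding simple_sec_def by blast
  note 3 = simple_repD1[OF rep3] and 4 = simple_repD2[OF rep3]
  \<comment> \<open>The terms of \<open>t\<close> are attached behind those of \<open>s\<close>, so
    their index is lowered by \<open>m\<close>.\<close>
  define c where "c = (\<lambda>k. if k < m then a k else b (k - m))"
  define h where "h = (\<lambda>k. if k < m then f k else g (k - m))"
  have 5: "is_sec R V (c k) \<and> (\<forall>i<p. is_sec F V (h k i))" if "k < m + n" for k
    using 1 3[of "k - m"] that by (auto simp: c_def h_def)
  have 6: "s y \<oplus>\<^bsub>L p y\<^esub> t y = finsum (L p y)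
        (\<lambda>k. c k y \<odot>\<^bsub>L p y\<^esub> wedge_list (stalk R y) (stalk F y) (map (\<lambda>i. h k i y) [0..<p])) {..<m + n}"
    if y: "y \<in> V" for y
  proof -
    interpret E: module "stalk R y" "L p y" by (rule L_module[OF in_top[OF V y]])
    have c1: "a k y \<odot>\<^bsub>L p y\<^esub> wedge_list (stalk R y) (stalk F y) (map (\<lambda>i. f k i y) [0..<p]) \<in> carrier (L p y)"
      if "k < m" for k using simple_term_closed[OF V y] 1[OF that] by simp
    have c2: "b k y \<odot>\<^bsub>L p y\<^esub> wedge_list (stalk R y) (stalk F y) (map (\<lambda>i. g k i y) [0..<p]) \<in> carrier (L p y)"
      if "k < n" for k using simple_term_closed[OF V y] 3[OF that] by simp
    have "finsum (L p y)
        (\<lambda>k. c k y \<odot>\<^bsub>L p y\<^esub> wedge_list (stalk R y) (stalk F y) (map (\<lambda>i. h k i y) [0..<p])) {..<m + n} =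
      finsum (L p y)
        (\<lambda>k. c k y \<odot>\<^bsub>L p y\<^esub> wedge_list (stalk R y) (stalk F y) (map (\<lambda>i. h k i y) [0..<p])) {..<m} \<oplus>\<^bsub>L p y\<^esub>
      finsum (L p y)
        (\<lambda>k. c (m + k) y \<odot>\<^bsub>L p y\<^esub> wedge_list (stalk R y) (stalk F y) (map (\<lambda>i. h (m + k) i y) [0..<p])) {..<n}"
      by (rule E.M.finsum_lessThan_add, rule simple_term_closed[OF V y]) (use 5 in simp_all)
    also have "\<dots> = s y \<oplus>\<^bsub>L p y\<^esub> t y"
      unfolding 2[OF y] 4[OF y]
      by (intro arg_cong2[where f = "add (L p y)"] E.M.finsum_cong' refl) (simp_all add: c_def h_def c1 c2)
    finally show ?thesis ..
  qed
  show ?thesis by (rule simple_secI[OF 5 6])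
qed

lemma simple_sec_smult:
  assumes V: "openin T V" and s: "simple_sec p V s" and b: "is_sec R V b"
  shows "simple_sec p V (\<lambda>y. b y \<odot>\<^bsub>L p y\<^esub> s y)"
proof -
  obtain m a f where rep1: "simple_rep p V s m a f" using s unfolding simple_sec_def by blast
  note 1 = simple_repD1[OF rep1] and 2 = simple_repD2[OF rep1]
  define c where "c = (\<lambda>k y. b y \<otimes>\<^bsub>stalk R y\<^esub> a k y)"
  have 5: "is_sec R V (c k) \<and> (\<forall>i<p. is_sec F V (f k i))" if "k < m" for k
    using 1[OF that] sec_R_mult[OF V b] by (simp add: c_def)
  have 6: "b y \<odot>\<^bsub>L p y\<^esub> s y = finsum (L p y)
        (\<lambda>k. c k y \<odot>\<^bsub>L p y\<^esub> wedge_list (stalk R y) (stalk F y) (map (\<lambda>i. f k i y) [0..<p])) {..<m}"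
    if y: "y \<in> V" for y
  proof -
    interpret E: module "stalk R y" "L p y" by (rule L_module[OF in_top[OF V y]])
    have c1: "a k y \<odot>\<^bsub>L p y\<^esub> wedge_list (stalk R y) (stalk F y) (map (\<lambda>i. f k i y) [0..<p]) \<in> carrier (L p y)"
      if "k < m" for k using simple_term_closed[OF V y] 1[OF that] by simp
    have c2: "a k y \<in> carrier (stalk R y)" if "k < m" for k
      using sec_R_closed[OF V _ y] 1[OF that] by simp
    have c3: "wedge_list (stalk R y) (stalk F y) (map (\<lambda>i. f k i y) [0..<p]) \<in> carrier (L p y)" if "k < m" for k
      using wedge_list_closed[OF stalk_module[OF in_top[OF V y]] map_lists_of[OF V y]] 1[OF that] by simp
    have bY: "b y \<in> carrier (stalk R y)" by (rule sec_R_closed[OF V b y])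
    have "b y \<odot>\<^bsub>L p y\<^esub> s y = finsum (L p y) (\<lambda>k. b y \<odot>\<^bsub>L p y\<^esub>
        (a k y \<odot>\<^bsub>L p y\<^esub> wedge_list (stalk R y) (stalk F y) (map (\<lambda>i. f k i y) [0..<p]))) {..<m}"
      unfolding 2[OF y] by (rule E.finsum_smult_ldistr) (use bY c1 in simp_all)
    also have "\<dots> = finsum (L p y)
        (\<lambda>k. c k y \<odot>\<^bsub>L p y\<^esub> wedge_list (stalk R y) (stalk F y) (map (\<lambda>i. f k i y) [0..<p])) {..<m}"
      by (rule E.M.finsum_cong'[OF refl]) (use bY c2 c3 in \<open>simp_all add: c_def E.smult_assoc1\<close>)
    finally show ?thesis .
  qed
  show ?thesis by (rule simple_secI[OF 5 6])
qed

lemma simple_sec_wedge_list: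
  assumes V: "openin T V" and f: "\<And>i. i < p \<Longrightarrow> is_sec F V (f i)"
  shows "simple_sec p V (\<lambda>y. wedge_list (stalk R y) (stalk F y) (map (\<lambda>i. f i y) [0..<p]))"
proof (rule simple_secI[where m = 1 and a = "\<lambda>_ y. \<one>\<^bsub>stalk R y\<^esub>" and f = "\<lambda>_. f"])
  fix y assume y: "y \<in> V"
  interpret E: module "stalk R y" "L p y" by (rule L_module[OF in_top[OF V y]])
  have "wedge_list (stalk R y) (stalk F y) (map (\<lambda>i. f i y) [0..<p]) \<in> carrier (L p y)"
    by (rule wedge_list_closed[OF stalk_module[OF in_top[OF V y]] map_lists_of[OF V y f]])
  then show "wedge_list (stalk R y) (stalk F y) (map (\<lambda>i. f i y) [0..<p]) = finsum (L p y)
     (\<lambda>k. \<one>\<^bsub>stalk R y\<^esub> \<odot>\<^bsub>L p y\<^esub> wedge_list (stalk R y) (stalk F y) (map (\<lambda>i. f i y) [0..<p])) {..<1::nat}"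
    by (simp add: lessThan_Suc E.M.finsum_insert)
qed (use sec_R_one[OF V] f in simp_all)

lemma esec_closed: "openin T U \<Longrightarrow> esec p U s \<Longrightarrow> x \<in> U \<Longrightarrow> s x \<in> carrier (L p x)"
  unfolding esec_iff using simple_sec_closed by blast

lemma simple_sec_esec: "openin T V \<Longrightarrow> simple_sec p V s \<Longrightarrow> esec p V s"
  unfolding esec_iff by blast

text \<open>Being a section is a local condition, so it may be checked on open sets small enough to
  carry one finite sum.\<close>

lemma esec_local:
  assumes "\<And>x. x \<in> U \<Longrightarrow> \<exists>V. openin T V \<and> x \<in> V \<and> V \<subseteq> U \<and> esec p V s"
  shows "esec p U s"
  unfolding esec_iff
proof (rule ballI)
  fix x assume "x \<in> U"
  from assms[OF this] obtain V where V: "openin T V" "x \<in> V" "V \<subseteq> U" "esec p V s" by (elim exE conjE)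
  from bspec[OF V(4)[unfolded esec_iff] V(2)] obtain W where "openin T W" "x \<in> W" "W \<subseteq> V" "simple_sec p W s"
    by (elim exE conjE)
  with V(3) show "\<exists>V. openin T V \<and> x \<in> V \<and> V \<subseteq> U \<and> simple_sec p V s"
    by (intro exI[of _ W]) simp
qed

lemma esec_cong:
  assumes "esec p U s" and "\<And>y. y \<in> U \<Longrightarrow> s y = t y"
  shows "esec p U t"
proof -
  have "simple_sec p V t" if V: "V \<subseteq> U" and s: "simple_sec p V s" for V
  proof -
    obtain m a f where rep1: "simple_rep p V s m a f" using s unfolding simple_sec_def by (elim exE)
    have ts: "t y = s y" if "y \<in> V" for y
      by (rule assms(2)[symmetric]) (rule subsetD[OF V that])
    show ?thesis
    proof (rule simple_secI)
      fix y assume y: "y \<in> V"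
      show "t y = finsum (L p y)
        (\<lambda>k. a k y \<odot>\<^bsub>L p y\<^esub> wedge_list (stalk R y) (stalk F y) (map (\<lambda>i. f k i y) [0..<p])) {..<m}"
        by (rule trans[OF ts[OF y] simple_repD2[OF rep1 y]])
    qed (rule simple_repD1[OF rep1])
  qed
  note * = this
  show ?thesis unfolding esec_iff
  proof (rule ballI)
    fix x assume "x \<in> U"
    from bspec[OF assms(1)[unfolded esec_iff] this] obtain V where
      V: "openin T V" "x \<in> V" "V \<subseteq> U" "simple_sec p V s" by (elim exE conjE)
    with *[OF V(3,4)] show "\<exists>V. openin T V \<and> x \<in> V \<and> V \<subseteq> U \<and> simple_sec p V t"
      by (intro exI[of _ V]) simp
  qed
qed

lemma esec_restrict:
  assumes "openin T U" "esec p U s" "openin T V" "V \<subseteq> U"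
  shows "esec p V s"
  unfolding esec_iff
proof
  fix x assume "x \<in> V"
  then obtain W where "openin T W" "x \<in> W" "W \<subseteq> U" "simple_sec p W s" using assms unfolding esec_iff by blast
  then show "\<exists>W. openin T W \<and> x \<in> W \<and> W \<subseteq> V \<and> simple_sec p W s"
    using simple_sec_restrict[of W p s "W \<inter> V"] assms \<open>x \<in> V\<close>
    by (intro exI[of _ "W \<inter> V"]) (auto intro: openin_Int)
qed

lemma esec_add:
  assumes U: "openin T U" and s: "esec p U s" and t: "esec p U t"
  shows "esec p U (\<lambda>y. s y \<oplus>\<^bsub>L p y\<^esub> t y)"
  unfolding esec_iff
proof
  fix x assume x: "x \<in> U"
  obtain V where V: "openin T V" "x \<in> V" "V \<subseteq> U" "simple_sec p V s" using s x unfolding esec_iff by blast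
  obtain W where W: "openin T W" "x \<in> W" "W \<subseteq> U" "simple_sec p W t" using t x unfolding esec_iff by blast
  have VW: "openin T (V \<inter> W)" using V W by (auto intro: openin_Int)
  show "\<exists>V. openin T V \<and> x \<in> V \<and> V \<subseteq> U \<and> simple_sec p V (\<lambda>y. s y \<oplus>\<^bsub>L p y\<^esub> t y)"
    using simple_sec_add[OF VW simple_sec_restrict[OF V(1,4) VW] simple_sec_restrict[OF W(1,4) VW]] V W VW
    by (intro exI[of _ "V \<inter> W"]) auto
qed

lemma esec_smult:
  assumes U: "openin T U" and s: "esec p U s" and b: "is_sec R U b"
  shows "esec p U (\<lambda>y. b y \<odot>\<^bsub>L p y\<^esub> s y)"
  unfolding esec_iff
proof
  fix x assume x: "x \<in> U"
  obtain V where V: "openin T V" "x \<in> V" "V \<subseteq> U" "simple_sec p V s" using s x unfolding esec_iff by blast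
  then show "\<exists>V. openin T V \<and> x \<in> V \<and> V \<subseteq> U \<and> simple_sec p V (\<lambda>y. b y \<odot>\<^bsub>L p y\<^esub> s y)"
    using simple_sec_smult[OF V(1,4) sec_R_restrict[OF U b V(1,3)]] by blast
qed

lemma esec_zero: "openin T U \<Longrightarrow> esec p U (\<lambda>y. \<zero>\<^bsub>L p y\<^esub>)"
  by (rule simple_sec_esec, assumption, rule simple_secI[where m = 0])
    (simp_all add: abelian_monoid.finsum_empty abelian_group.axioms(1) module.axioms(2)[OF L_module] in_top)

text \<open>Negation is multiplication by the section -1 of \<open>R\<close>.\<close>

lemma esec_uminus:
  assumes U: "openin T U" and s: "esec p U s"
  shows "esec p U (\<lambda>y. \<ominus>\<^bsub>L p y\<^esub> s y)"
proof (rule esec_cong[OF esec_smult[OF U s sec_R_uminus[OF U sec_R_one[OF U]]]])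
  fix y assume y: "y \<in> U"
  interpret E: module "stalk R y" "L p y" by (rule L_module[OF in_top[OF U y]])
  show "(\<ominus>\<^bsub>stalk R y\<^esub> \<one>\<^bsub>stalk R y\<^esub>) \<odot>\<^bsub>L p y\<^esub> s y = \<ominus>\<^bsub>L p y\<^esub> s y"
    using esec_closed[OF U s y] by (simp add: E.smult_l_minus)
qed

lemma esec_minus:
  "openin T U \<Longrightarrow> esec p U s \<Longrightarrow> esec p U t \<Longrightarrow> esec p U (\<lambda>y. s y \<ominus>\<^bsub>L p y\<^esub> t y)"
  unfolding a_minus_def by (intro esec_add esec_uminus)

lemma esec_finsum:
  assumes U: "openin T U" and "\<And>k. k < m \<Longrightarrow> esec p U (s k)"
  shows "esec p U (\<lambda>y. finsum (L p y) (\<lambda>k. s k y) {..<m::nat})"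
  using assms(2)
proof (induction m)
  case 0
  have "esec p U (\<lambda>y. \<zero>\<^bsub>L p y\<^esub>)" by (rule esec_zero[OF U])
  then show ?case
    by (rule esec_cong)
      (simp add: abelian_monoid.finsum_empty abelian_group.axioms(1) module.axioms(2)[OF L_module] in_top[OF U])
next
  case (Suc m)
  have "esec p U (\<lambda>y. s m y \<oplus>\<^bsub>L p y\<^esub> finsum (L p y) (\<lambda>k. s k y) {..<m})"
    by (rule esec_add[OF U]) (use Suc in auto)
  then show ?case
  proof (rule esec_cong)
    fix y assume y: "y \<in> U"
    interpret E: module "stalk R y" "L p y" by (rule L_module[OF in_top[OF U y]])
    have "\<And>k. k < Suc m \<Longrightarrow> s k y \<in> carrier (L p y)" using esec_closed[OF U _ y] Suc.prems by blast
    then show "s m y \<oplus>\<^bsub>L p y\<^esub> finsum (L p y) (\<lambda>k. s k y) {..<m} = finsum (L p y) (\<lambda>k. s k y) {..<Suc m}"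
      by (simp add: lessThan_Suc E.M.finsum_insert Pi_def)
  qed
qed

lemma esec_wedge_list:
  assumes V: "openin T V" and f: "\<And>i. i < p \<Longrightarrow> is_sec F V (f i)"
  shows "esec p V (\<lambda>y. wedge_list (stalk R y) (stalk F y) (map (\<lambda>i. f i y) [0..<p]))"
  by (rule simple_sec_esec[OF V simple_sec_wedge_list[OF V f]])

lemma esec_pair:
  assumes V: "openin T V" and "is_sec F V g" "is_sec F V h"
  shows "esec 2 V (\<lambda>y. wedge_list (stalk R y) (stalk F y) [g y, h y])"
  using esec_wedge_list[OF V, of 2 "\<lambda>i. if i = 0 then g else h"] assms by (simp add: upt_rec numeral_2_eq_2)

text \<open>On an open set that carries a finite sum for \<open>J\<close>, the section
  \<open>u\<close> is put in front of the factors of every term.\<close>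

lemma esec_wedge_left:
  assumes U: "openin T U" and J: "esec p U J" and u: "is_sec F U u"
  shows "esec (Suc p) U (\<lambda>y. wedge_left (stalk R y) (stalk F y) p (u y) (J y))"
proof (rule esec_local)
  fix x assume "x \<in> U"
  then obtain V where V: "openin T V" "x \<in> V" "V \<subseteq> U" "simple_sec p V J" using J unfolding esec_iff by blast
  obtain m a f where rep1: "simple_rep p V J m a f" using V(4) unfolding simple_sec_def by blast
  note 1 = simple_repD1[OF rep1] and 2 = simple_repD2[OF rep1]
  have uV: "is_sec F V u" by (rule sec_F_restrict[OF U u V(1,3)])
  define g where "g = (\<lambda>k i. case i of 0 \<Rightarrow> u | Suc j \<Rightarrow> f k j)"
  have g: "is_sec F V (g k i)" if "k < m" "i < Suc p" for k i
    using 1[OF that(1)] that(2) uV by (auto simp: g_def split: nat.splits)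
  have "esec (Suc p) V (\<lambda>y. finsum (L (Suc p) y)
        (\<lambda>k. a k y \<odot>\<^bsub>L (Suc p) y\<^esub> wedge_list (stalk R y) (stalk F y) (map (\<lambda>i. g k i y) [0..<Suc p])) {..<m})"
    by (intro esec_finsum esec_smult esec_wedge_list V(1)) (use 1 g in simp_all)
  then have "esec (Suc p) V (\<lambda>y. wedge_left (stalk R y) (stalk F y) p (u y) (J y))"
  proof (rule esec_cong)
    fix y assume y: "y \<in> V"
    have yt: "y \<in> topspace T" by (rule in_top[OF V(1) y])
    interpret E: module "stalk R y" "L (Suc p) y" by (rule L_module[OF yt])
    note M = stalk_module[OF yt]
    have uy: "u y \<in> carrier (stalk F y)" by (rule sec_F_closed[OF V(1) uV y])
    note h = wedge_left_hom[OF M uy, of p]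
    have l: "map (\<lambda>i. f k i y) [0..<p] \<in> lists_of (stalk F y) p" if "k < m" for k
      by (rule map_lists_of[OF V(1) y]) (use 1[OF that] in simp)
    have a: "a k y \<in> carrier (stalk R y)" if "k < m" for k using sec_R_closed[OF V(1) _ y] 1[OF that] by simp
    have mg: "map (\<lambda>i. g k i y) [0..<Suc p] = u y # map (\<lambda>i. f k i y) [0..<p]" for k
      by (simp add: g_def map_upt_Suc del: upt_Suc)
    have t: "a k y \<odot>\<^bsub>L p y\<^esub> wedge_list (stalk R y) (stalk F y) (map (\<lambda>i. f k i y) [0..<p]) \<in> carrier (L p y)" if "k < m" for k
      by (rule simple_term_closed[OF V(1) y]) (use 1[OF that] in simp_all)
    have "wedge_left (stalk R y) (stalk F y) p (u y) (J y) = finsum (L (Suc p) y)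
        (\<lambda>k. wedge_left (stalk R y) (stalk F y) p (u y)
          (a k y \<odot>\<^bsub>L p y\<^esub> wedge_list (stalk R y) (stalk F y) (map (\<lambda>i. f k i y) [0..<p]))) {..<m}"
      unfolding 2[OF y] by (rule mod_hom_finsum[OF L_module[OF yt] L_module[OF yt] h]) (use t in simp_all)
    also have "\<dots> = finsum (L (Suc p) y)
        (\<lambda>k. a k y \<odot>\<^bsub>L (Suc p) y\<^esub> wedge_list (stalk R y) (stalk F y) (map (\<lambda>i. g k i y) [0..<Suc p])) {..<m}"
    proof (rule E.M.finsum_cong'[OF refl])
      show "(\<lambda>k. a k y \<odot>\<^bsub>L (Suc p) y\<^esub> wedge_list (stalk R y) (stalk F y) (map (\<lambda>i. g k i y) [0..<Suc p]))
         \<in> {..<m} \<rightarrow> carrier (L (Suc p) y)"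
        by (intro Pi_I simple_term_closed[OF V(1) y]) (use 1 g in simp_all)
      fix k assume "k \<in> {..<m}"
      then show "wedge_left (stalk R y) (stalk F y) p (u y)
          (a k y \<odot>\<^bsub>L p y\<^esub> wedge_list (stalk R y) (stalk F y) (map (\<lambda>i. f k i y) [0..<p])) =
        a k y \<odot>\<^bsub>L (Suc p) y\<^esub> wedge_list (stalk R y) (stalk F y) (map (\<lambda>i. g k i y) [0..<Suc p])"
        unfolding mg using l a
        by (simp add: mod_hom_smult[OF h] wedge_list_closed[OF M] wedge_left_wedge_list[OF M uy])
    qed
    finally show "finsum (L (Suc p) y)
        (\<lambda>k. a k y \<odot>\<^bsub>L (Suc p) y\<^esub> wedge_list (stalk R y) (stalk F y) (map (\<lambda>i. g k i y) [0..<Suc p])) {..<m} =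
      wedge_left (stalk R y) (stalk F y) p (u y) (J y)" ..
  qed
  then show "\<exists>V. openin T V \<and> x \<in> V \<and> V \<subseteq> U \<and> esec (Suc p) V (\<lambda>y. wedge_left (stalk R y) (stalk F y) p (u y) (J y))"
    using V by blast
qed

text \<open>The finite sum is taken for \<open>e\<close>: each of its terms multiplies
  \<open>J\<close> by two sections from the left, and \<open>J\<close> itself is not
  expanded.\<close>

lemma esec_wedge2:
  assumes U: "openin T U" and J: "esec p U J" and e: "esec 2 U e"
  shows "esec (Suc (Suc p)) U (\<lambda>y. wedge2 (stalk R y) (stalk F y) p (e y) (J y))"
proof (rule esec_local)
  fix x assume "x \<in> U"
  then obtain V where V: "openin T V" "x \<in> V" "V \<subseteq> U" "simple_sec 2 V e" using e unfolding esec_iff by blast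
  obtain m a f where rep1: "simple_rep 2 V e m a f" using V(4) unfolding simple_sec_def by blast
  note 1 = simple_repD1[OF rep1] and 2 = simple_repD2[OF rep1]
  have JV: "esec p V J" by (rule esec_restrict[OF U J V(1,3)])
  let ?w = "\<lambda>k y. wedge_left (stalk R y) (stalk F y) (Suc p) (f k 0 y) (wedge_left (stalk R y) (stalk F y) p (f k 1 y) (J y))"
  have "esec (Suc (Suc p)) V (\<lambda>y. finsum (L (Suc (Suc p)) y) (\<lambda>k. a k y \<odot>\<^bsub>L (Suc (Suc p)) y\<^esub> ?w k y) {..<m})"
    by (intro esec_finsum esec_smult esec_wedge_left V(1) JV) (use 1 in simp_all)
  then have "esec (Suc (Suc p)) V (\<lambda>y. wedge2 (stalk R y) (stalk F y) p (e y) (J y))"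
  proof (rule esec_cong)
    fix y assume y: "y \<in> V"
    have yt: "y \<in> topspace T" by (rule in_top[OF V(1) y])
    interpret E: module "stalk R y" "L (Suc (Suc p)) y" by (rule L_module[OF yt])
    note M = stalk_module[OF yt]
    have Jy: "J y \<in> carrier (L p y)" by (rule esec_closed[OF V(1) JV y])
    note h = wedge2_hom[OF M Jy]
    have f: "f k 0 y \<in> carrier (stalk F y)" "f k 1 y \<in> carrier (stalk F y)" if "k < m" for k
      using sec_F_closed[OF V(1) _ y] 1[OF that] by simp_all
    have a: "a k y \<in> carrier (stalk R y)" if "k < m" for k using sec_R_closed[OF V(1) _ y] 1[OF that] by simp
    have t: "a k y \<odot>\<^bsub>L 2 y\<^esub> wedge_list (stalk R y) (stalk F y) (map (\<lambda>i. f k i y) [0..<2]) \<in> carrier (L 2 y)" if "k < m" for k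
      by (rule simple_term_closed[OF V(1) y]) (use 1[OF that] in simp_all)
    have "wedge2 (stalk R y) (stalk F y) p (e y) (J y) = finsum (L (Suc (Suc p)) y)
        (\<lambda>k. wedge2 (stalk R y) (stalk F y) p
          (a k y \<odot>\<^bsub>L 2 y\<^esub> wedge_list (stalk R y) (stalk F y) (map (\<lambda>i. f k i y) [0..<2])) (J y)) {..<m}"
      unfolding 2[OF y] by (rule mod_hom_finsum[OF L_module[OF yt] L_module[OF yt] h]) (use t in simp_all)
    also have "\<dots> = finsum (L (Suc (Suc p)) y) (\<lambda>k. a k y \<odot>\<^bsub>L (Suc (Suc p)) y\<^esub> ?w k y) {..<m}"
    proof (rule E.M.finsum_cong'[OF refl])
      show "(\<lambda>k. a k y \<odot>\<^bsub>L (Suc (Suc p)) y\<^esub> ?w k y) \<in> {..<m} \<rightarrow> carrier (L (Suc (Suc p)) y)"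
        by (intro Pi_I E.smult_closed wedge_left_closed[OF M] Jy) (use a f in simp_all)
      fix k assume "k \<in> {..<m}"
      then show "wedge2 (stalk R y) (stalk F y) p
          (a k y \<odot>\<^bsub>L 2 y\<^esub> wedge_list (stalk R y) (stalk F y) (map (\<lambda>i. f k i y) [0..<2])) (J y) =
        a k y \<odot>\<^bsub>L (Suc (Suc p)) y\<^esub> ?w k y"
        using a f Jy by (simp add: upt_rec numeral_2_eq_2[symmetric] mod_hom_smult[OF h] pair_closed[OF M] wedge2_pair[OF M])
    qed
    finally show "finsum (L (Suc (Suc p)) y) (\<lambda>k. a k y \<odot>\<^bsub>L (Suc (Suc p)) y\<^esub> ?w k y) {..<m} =
      wedge2 (stalk R y) (stalk F y) p (e y) (J y)" ..
  qed
  then show "\<exists>V. openin T V \<and> x \<in> V \<and> V \<subseteq> U \<and> esec (Suc (Suc p)) V (\<lambda>y. wedge2 (stalk R y) (stalk F y) p (e y) (J y))"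
    using V by blast
qed

text \<open>\<open>us\<close> is a list of sections here, evaluated at \<open>y\<close> only inside
  \<open>wdiff\<close>. The recursion then runs over sections, and every operation in it preserves
  them.\<close>

lemma esec_wdiff:
  assumes E: "sheaf_map T F (ext_sheaf T R F 2) E" and V: "openin T V"
  shows "\<forall>u\<in>set us. is_sec F V u \<Longrightarrow>
    esec (Suc (length us)) V (\<lambda>y. wdiff (stalk R y) (stalk F y) (E y) (map (\<lambda>u. u y) us))"
proof (induction us)
  case Nil
  then show ?case using esec_zero[OF V] by simp
next
  case (Cons u us)
  have "esec (length us) V (\<lambda>y. wedge_list (stalk R y) (stalk F y) (map (\<lambda>i. (us ! i) y) [0..<length us]))"
    by (rule esec_wedge_list[OF V]) (use Cons in auto)
  moreover have "map (\<lambda>i. (us ! i) y) [0..<length us] = map (\<lambda>u. u y) us" for y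
    by (rule nth_equalityI) auto
  ultimately have "esec (length us) V (\<lambda>y. wedge_list (stalk R y) (stalk F y) (map (\<lambda>u. u y) us))" by simp
  moreover have "esec 2 V (\<lambda>y. E y (u y))" using E V Cons.prems unfolding sheaf_map_def by simp
  ultimately show ?case using Cons
    by (simp, intro esec_minus esec_wedge2 esec_wedge_left V) auto
qed

text \<open>The derivations \<open>D x\<close> at different points are unrelated choices. But
  additivity, the Leibniz rule and the values on products express \<open>D y (J y)\<close> through
  \<delta>, \<open>E\<close> and the terms of a local sum for \<open>J\<close>, uniformly in
  \<open>y\<close>.\<close>

lemma esec_derivation:
  assumes E: "sheaf_map T F (ext_sheaf T R F 2) E" and \<delta>: "sheaf_map T R F \<delta>"
    and D: "\<And>x. x \<in> topspace T \<Longrightarrow> ext_derivation (stalk R x) (stalk F x) (\<delta> x) (E x) p (D x)"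
  shows "sheaf_map T (ext_sheaf T R F p) (ext_sheaf T R F (Suc p)) D"
  unfolding sheaf_map_def
proof (intro allI impI)
  fix U J assume U: "openin T U" and J: "esec p U J"
  show "esec (Suc p) U (\<lambda>x. D x (J x))"
  proof (rule esec_local)
    fix x assume "x \<in> U"
    then obtain V where V: "openin T V" "x \<in> V" "V \<subseteq> U" "simple_sec p V J" using J unfolding esec_iff by blast
    obtain m a f where rep1: "simple_rep p V J m a f" using V(4) unfolding simple_sec_def by blast
    note 1 = simple_repD1[OF rep1] and 2 = simple_repD2[OF rep1]
    let ?l = "\<lambda>k y. map (\<lambda>i. f k i y) [0..<p]"
    let ?t = "\<lambda>k y. a k y \<odot>\<^bsub>L (Suc p) y\<^esub> wdiff (stalk R y) (stalk F y) (E y) (?l k y) \<oplus>\<^bsub>L (Suc p) y\<^esub>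
       wedge_left (stalk R y) (stalk F y) p (\<delta> y (a k y)) (wedge_list (stalk R y) (stalk F y) (?l k y))"
    have wd: "esec (Suc p) V (\<lambda>y. wdiff (stalk R y) (stalk F y) (E y) (?l k y))" if "k < m" for k
      using esec_wdiff[OF E V(1), of "map (f k) [0..<p]"] 1[OF that] by (simp add: comp_def)
    have t: "esec (Suc p) V (?t k)" if "k < m" for k
      using 1[OF that] \<delta> V(1) wd[OF that] unfolding sheaf_map_def
      by (intro esec_add esec_smult esec_wedge_left esec_wedge_list V(1)) auto
    have "esec (Suc p) V (\<lambda>y. finsum (L (Suc p) y) (\<lambda>k. ?t k y) {..<m})"
      by (intro esec_finsum V(1) t)
    then have "esec (Suc p) V (\<lambda>y. D y (J y))"
    proof (rule esec_cong)
      fix y assume y: "y \<in> V"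
      have yt: "y \<in> topspace T" by (rule in_top[OF V(1) y])
      interpret Lp: module "stalk R y" "L p y" by (rule L_module[OF yt])
      interpret L': module "stalk R y" "L (Suc p) y" by (rule L_module[OF yt])
      note M = stalk_module[OF yt] and Dy = ext_derivationD[OF D[OF yt]]
      have zero: "D y \<zero>\<^bsub>L p y\<^esub> = \<zero>\<^bsub>L (Suc p) y\<^esub>"
        by (rule ext_derivation_zero[OF M D[OF yt]])
      have l: "?l k y \<in> lists_of (stalk F y) p" if "k < m" for k
        using map_lists_of[OF V(1) y, of p "f k"] 1[OF that] by simp
      have a: "a k y \<in> carrier (stalk R y)" if "k < m" for k using sec_R_closed[OF V(1) _ y] 1[OF that] by simp
      \<comment> \<open>\<open>D y\<close> is additive without being linear, so it is taken into the
        sum by induction on the number of terms, each of which produces a Leibniz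
        contribution.\<close>
      have "D y (finsum (L p y) (\<lambda>k. a k y \<odot>\<^bsub>L p y\<^esub> wedge_list (stalk R y) (stalk F y) (?l k y)) {..<n}) =
        finsum (L (Suc p) y) (\<lambda>k. ?t k y) {..<n}" if "n \<le> m" for n
        using that
      proof (induction n)
        case 0
        then show ?case by (simp add: zero)
      next
        case (Suc n)
        have c: "(\<lambda>k. a k y \<odot>\<^bsub>L p y\<^esub> wedge_list (stalk R y) (stalk F y) (?l k y)) \<in> {..<n} \<rightarrow> carrier (L p y)"
          using Suc l a by (auto intro!: wedge_list_closed[OF M])
        have n: "n < m" using Suc by simp
        note wn = wedge_list_closed[OF M l[OF n]]
        have tn: "?t k y \<in> carrier (L (Suc p) y)" if "k < m" for k by (rule esec_closed[OF V(1) t[OF that] y])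
        let ?w = "\<lambda>k. a k y \<odot>\<^bsub>L p y\<^esub> wedge_list (stalk R y) (stalk F y) (?l k y)"
        have d1: "D y (?w n) = ?t n y"
          by (simp only: Dy(3)[OF a[OF n] wn] Dy(4)[OF l[OF n]])
        have d2: "D y (?w n \<oplus>\<^bsub>L p y\<^esub> finsum (L p y) ?w {..<n}) =
          D y (?w n) \<oplus>\<^bsub>L (Suc p) y\<^esub> D y (finsum (L p y) ?w {..<n})"
          by (rule Dy(2)[OF Lp.smult_closed[OF a[OF n] wn] Lp.M.finsum_closed[OF c]])
        have e1: "finsum (L p y) ?w {..<Suc n} = ?w n \<oplus>\<^bsub>L p y\<^esub> finsum (L p y) ?w {..<n}"
          unfolding lessThan_Suc by (rule Lp.M.finsum_insert) (use c a[OF n] wn in simp_all)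
        have e2: "finsum (L (Suc p) y) (\<lambda>k. ?t k y) {..<Suc n} = ?t n y \<oplus>\<^bsub>L (Suc p) y\<^esub> finsum (L (Suc p) y) (\<lambda>k. ?t k y) {..<n}"
          unfolding lessThan_Suc
        proof (rule L'.M.finsum_insert)
          show "(\<lambda>k. ?t k y) \<in> {..<n} \<rightarrow> carrier (L (Suc p) y)"
            by (rule Pi_I, rule tn) (use n in simp)
          show "?t n y \<in> carrier (L (Suc p) y)" by (rule tn[OF n])
        qed simp_all
        have IH: "D y (finsum (L p y) ?w {..<n}) = finsum (L (Suc p) y) (\<lambda>k. ?t k y) {..<n}"
          by (rule Suc.IH) (use n in simp)
        show ?case
          by (rule trans[OF trans[OF arg_cong[OF e1, of "D y"] d2]
                trans[OF arg_cong2[OF d1 IH, of "add (L (Suc p) y)"] e2[symmetric]]])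
      qed
      note final = this[OF order_refl]
      show "finsum (L (Suc p) y) (\<lambda>k. ?t k y) {..<m} = D y (J y)"
        using final by (simp only: 2[OF y])
    qed
    then show "\<exists>V. openin T V \<and> x \<in> V \<and> V \<subseteq> U \<and> esec (Suc p) V (\<lambda>x. D x (J x))" using V by blast
  qed
qed

end

section \<open>Germs and charts\<close>

lemma germ_self: "x \<in> topspace T \<Longrightarrow> f \<in> germ T x f"
  unfolding germ_def by (auto intro!: exI[of _ "topspace T"])

lemma germ_mem_iff: "g \<in> germ T x f \<longleftrightarrow> (\<exists>V. openin T V \<and> x \<in> V \<and> (\<forall>y\<in>V. g y = f y))"
  by (simp add: germ_def)

lemma germ_eqI:
  assumes "openin T V" "x \<in> V" "\<And>y. y \<in> V \<Longrightarrow> f y = g y"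
  shows "germ T x f = germ T x g"
proof -
  have "germ T x f \<subseteq> germ T x g" if "\<And>y. y \<in> V \<Longrightarrow> f y = g y" for f g :: "'a \<Rightarrow> 'b"
  proof
    fix h assume "h \<in> germ T x f"
    then obtain W where W: "openin T W" "x \<in> W" "\<forall>y\<in>W. h y = f y" by (auto simp: germ_def)
    then show "h \<in> germ T x g" unfolding germ_mem_iff
      using assms(1,2) that by (intro exI[of _ "V \<inter> W"]) (auto intro: openin_Int)
  qed
  then show ?thesis using assms(3) by (intro subset_antisym) auto
qed

lemma germ_eqD:
  assumes "x \<in> topspace T" "germ T x f = germ T x g"
  shows "\<exists>V. openin T V \<and> x \<in> V \<and> (\<forall>y\<in>V. f y = g y)"
  using germ_self[OF assms(1), of f] unfolding assms(2) germ_mem_iff .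

lemma germ_value:
  assumes "x \<in> topspace T" "germ T x f = germ T x g"
  shows "f x = g x"
proof -
  obtain V where "x \<in> V" "\<forall>y\<in>V. f y = g y" using germ_eqD[OF assms] by (elim exE conjE)
  then show ?thesis by simp
qed

text \<open>The operations on germs are defined as unions over representatives. Any two choices
  agree on a common neighbourhood, so all the sets in the union coincide.\<close>

lemma germ_pointwise:
  assumes x: "x \<in> topspace T"
  shows "(\<Union>f\<in>germ T x f0. \<Union>g\<in>germ T x g0. germ T x (\<lambda>y. h (f y) (g y))) = germ T x (\<lambda>y. h (f0 y) (g0 y))"
proof -
  have e: "germ T x (\<lambda>y. h (f y) (g y)) = germ T x (\<lambda>y. h (f0 y) (g0 y))"
    if f: "f \<in> germ T x f0" and g: "g \<in> germ T x g0" for f g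
  proof -
    obtain V where V: "openin T V" "x \<in> V" "\<forall>y\<in>V. f y = f0 y" using f by (auto simp: germ_def)
    obtain W where W: "openin T W" "x \<in> W" "\<forall>y\<in>W. g y = g0 y" using g by (auto simp: germ_def)
    show ?thesis by (rule germ_eqI[of _ "V \<inter> W"]) (use V W in \<open>auto intro: openin_Int\<close>)
  qed
  have inner: "(\<Union>g\<in>germ T x g0. germ T x (\<lambda>y. h (f y) (g y))) = germ T x (\<lambda>y. h (f0 y) (g0 y))"
    if "f \<in> germ T x f0" for f
    by (rule UN_constant_eq[OF germ_self[OF x]]) (intro ballI e that)
  show ?thesis
    by (rule UN_constant_eq[OF germ_self[OF x]]) (intro ballI inner)
qed

section \<open>Holomorphic functions and the rings of their germs\<close>

lemma holo_on_subset: "holo_on W f \<Longrightarrow> V \<subseteq> W \<Longrightarrow> holo_on V f"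
  unfolding holo_on_def by (meson has_derivative_subset subsetD)

lemma holo_on_cong: "holo_on W f \<Longrightarrow> (\<And>z. z \<in> W \<Longrightarrow> g z = f z) \<Longrightarrow> holo_on W g"
  unfolding holo_on_def using has_derivative_transform by metis

lemma holo_on_const: "holo_on W (\<lambda>_. c)"
  unfolding holo_on_def by (auto intro!: exI[of _ "\<lambda>_. 0"])

lemma holo_on_add: 
  assumes "holo_on W f" "holo_on W g"
  shows "holo_on W (\<lambda>z. f z + g z)"
  unfolding holo_on_def
proof
  fix z assume "z \<in> W"
  then obtain D E where "(f has_derivative D) (at z within W)" "\<forall>c v. D (c *s v) = c * D v"
    "(g has_derivative E) (at z within W)" "\<forall>c v. E (c *s v) = c * E v"
    using assms unfolding holo_on_def by meson
  then show "\<exists>D. ((\<lambda>z. f z + g z) has_derivative D) (at z within W) \<and> (\<forall>c v. D (c *s v) = c * D v)"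
    by (intro exI[of _ "\<lambda>v. D v + E v"]) (auto intro!: has_derivative_add simp: algebra_simps)
qed

lemma holo_on_mult: 
  assumes "holo_on W f" "holo_on W g"
  shows "holo_on W (\<lambda>z. f z * g z)"
  unfolding holo_on_def
proof
  fix z assume "z \<in> W"
  then obtain D E where "(f has_derivative D) (at z within W)" "\<forall>c v. D (c *s v) = c * D v"
    "(g has_derivative E) (at z within W)" "\<forall>c v. E (c *s v) = c * E v"
    using assms unfolding holo_on_def by meson
  then show "\<exists>D. ((\<lambda>z. f z * g z) has_derivative D) (at z within W) \<and> (\<forall>c v. D (c *s v) = c * D v)"
    by (intro exI[of _ "\<lambda>v. f z * E v + D v * g z"] conjI has_derivative_mult) (auto simp: algebra_simps)
qed

lemma holfun_open: "holfun M V f \<Longrightarrow> openin (mtop M) V"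
  by (simp add: holfun_def)

lemma holfunI:
  assumes "openin (mtop M) V"
    and "\<And>U \<phi> S. (U, \<phi>, S) \<in> atlas M \<Longrightarrow> holo_on (\<phi> ` (U \<inter> V)) (\<lambda>z. f (inv_into U \<phi> z))"
  shows "holfun M V f"
  unfolding holfun_def by (intro conjI ballI assms(1)) (clarsimp simp: assms(2))

lemma holfunD:
  "holfun M V f \<Longrightarrow> (U, \<phi>, S) \<in> atlas M \<Longrightarrow> holo_on (\<phi> ` (U \<inter> V)) (\<lambda>z. f (inv_into U \<phi> z))"
  unfolding holfun_def by (drule conjunct2, drule bspec, assumption) simp

lemma holfun_subset:
  assumes "holfun M V f" "openin (mtop M) W" "W \<subseteq> V"
  shows "holfun M W f"
proof (rule holfunI[OF assms(2)])
  fix U S and \<phi> :: "'a \<Rightarrow> complex ^ 'b" assume "(U, \<phi>, S) \<in> atlas M"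
  from holfunD[OF assms(1) this] show "holo_on (\<phi> ` (U \<inter> W)) (\<lambda>z. f (inv_into U \<phi> z))"
    by (rule holo_on_subset) (intro image_mono Int_mono subset_refl assms(3))
qed

lemma holfun_const: "openin (mtop M) V \<Longrightarrow> holfun M V (\<lambda>_. c)"
  by (rule holfunI) (auto intro: holo_on_const)

lemma holfun_add: "holfun M V f \<Longrightarrow> holfun M V g \<Longrightarrow> holfun M V (\<lambda>y. f y + g y)"
  by (rule holfunI, erule holfun_open, rule holo_on_add) (erule (1) holfunD)+

lemma holfun_mult: "holfun M V f \<Longrightarrow> holfun M V g \<Longrightarrow> holfun M V (\<lambda>y. f y * g y)"
  by (rule holfunI, erule holfun_open, rule holo_on_mult) (erule (1) holfunD)+

lemma holfun_uminus: "holfun M V f \<Longrightarrow> holfun M V (\<lambda>y. - f y)"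
  using holfun_mult[OF holfun_const[OF holfun_open], of M V f f "-1"] by simp

lemma holfun_diff: "holfun M V f \<Longrightarrow> holfun M V g \<Longrightarrow> holfun M V (\<lambda>y. f y - g y)"
  using holfun_add[OF _ holfun_uminus] by simp

lemma holfun_Int:
  "holfun M V f \<Longrightarrow> openin (mtop M) W \<Longrightarrow> holfun M (V \<inter> W) f"
  "holfun M V f \<Longrightarrow> openin (mtop M) W \<Longrightarrow> holfun M (W \<inter> V) f"
  by (auto intro!: holfun_subset[of M V f] openin_Int dest: holfun_open)

lemma holfun_sum:
  "openin (mtop M) V \<Longrightarrow> (\<And>k. k \<in> A \<Longrightarrow> holfun M V (f k)) \<Longrightarrow> holfun M V (\<lambda>y. \<Sum>k\<in>A. f k y)"
  by (induction A rule: infinite_finite_induct) (auto intro: holfun_const holfun_add)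

lemma hol_germs_carrier: "A \<in> carrier (hol_germs M x) \<longleftrightarrow> (\<exists>f V. x \<in> V \<and> holfun M V f \<and> A = germ (mtop M) x f)"
  by (auto simp: hol_germs_def)

lemma hol_germsE:
  assumes "A \<in> carrier (hol_germs M x)"
  obtains f V where "x \<in> V" "holfun M V f" "A = germ (mtop M) x f"
  using assms unfolding hol_germs_carrier by blast

lemma germ_closed: "holfun M V f \<Longrightarrow> x \<in> V \<Longrightarrow> germ (mtop M) x f \<in> carrier (hol_germs M x)"
  unfolding hol_germs_carrier by blast

lemma hol_germs_ops:
  assumes "x \<in> topspace (mtop M)"
  shows "germ (mtop M) x f \<oplus>\<^bsub>hol_germs M x\<^esub> germ (mtop M) x g = germ (mtop M) x (\<lambda>y. f y + g y)"
    and "germ (mtop M) x f \<otimes>\<^bsub>hol_germs M x\<^esub> germ (mtop M) x g = germ (mtop M) x (\<lambda>y. f y * g y)"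
    and "\<zero>\<^bsub>hol_germs M x\<^esub> = germ (mtop M) x (\<lambda>_. 0)"
    and "\<one>\<^bsub>hol_germs M x\<^esub> = germ (mtop M) x (\<lambda>_. 1)"
  using germ_pointwise[OF assms, where h = "(+)" and ?f0.0 = f and ?g0.0 = g]
    germ_pointwise[OF assms, where h = "(*)" and ?f0.0 = f and ?g0.0 = g]
  by (simp_all add: hol_germs_def)

lemma hol_germs_cring:
  assumes x: "x \<in> topspace (mtop M)"
  shows "cring (hol_germs M x)"
proof (rule cringI)
  note op = hol_germs_ops[OF x]
  have two: "\<exists>V. x \<in> V \<and> holfun M V f \<and> holfun M V g" if "x \<in> V" "holfun M V f" "x \<in> W" "holfun M W g" for f g V W
    using that holfun_Int[OF that(2) holfun_open[OF that(4)]] holfun_Int[OF that(4) holfun_open[OF that(2)]]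
    by (intro exI[of _ "V \<inter> W"]) (simp add: Int_commute)
  have top: "openin (mtop M) (topspace (mtop M))" by simp
  have add: "A \<oplus>\<^bsub>hol_germs M x\<^esub> B \<in> carrier (hol_germs M x)"
    if A: "A \<in> carrier (hol_germs M x)" and B: "B \<in> carrier (hol_germs M x)" for A B
    using A
  proof (rule hol_germsE)
    fix f V assume f: "x \<in> V" "holfun M V f" "A = germ (mtop M) x f"
    show ?thesis using B
    proof (rule hol_germsE)
      fix g W assume g: "x \<in> W" "holfun M W g" "B = germ (mtop M) x g"
      obtain V' where "x \<in> V'" "holfun M V' f" "holfun M V' g" using two[OF f(1,2) g(1,2)] by (elim exE conjE)
      then show ?thesis unfolding f(3) g(3) op by (intro germ_closed[of M V'] holfun_add)
    qed
  qed
  have mult: "A \<otimes>\<^bsub>hol_germs M x\<^esub> B \<in> carrier (hol_germs M x)"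
    if A: "A \<in> carrier (hol_germs M x)" and B: "B \<in> carrier (hol_germs M x)" for A B
    using A
  proof (rule hol_germsE)
    fix f V assume f: "x \<in> V" "holfun M V f" "A = germ (mtop M) x f"
    show ?thesis using B
    proof (rule hol_germsE)
      fix g W assume g: "x \<in> W" "holfun M W g" "B = germ (mtop M) x g"
      obtain V' where "x \<in> V'" "holfun M V' f" "holfun M V' g" using two[OF f(1,2) g(1,2)] by (elim exE conjE)
      then show ?thesis unfolding f(3) g(3) op by (intro germ_closed[of M V'] holfun_mult)
    qed
  qed
  have one: "\<one>\<^bsub>hol_germs M x\<^esub> \<in> carrier (hol_germs M x)"
    unfolding op by (rule germ_closed[OF holfun_const[OF top] x])
  have zero: "\<zero>\<^bsub>hol_germs M x\<^esub> \<in> carrier (hol_germs M x)"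
    unfolding op by (rule germ_closed[OF holfun_const[OF top] x])
  have rep: "\<exists>f. A = germ (mtop M) x f" if "A \<in> carrier (hol_germs M x)" for A
    using that unfolding hol_germs_carrier by blast
  show "abelian_group (hol_germs M x)"
  proof (rule abelian_groupI)
    fix A B C assume A: "A \<in> carrier (hol_germs M x)" and B: "B \<in> carrier (hol_germs M x)"
      and C: "C \<in> carrier (hol_germs M x)"
    obtain f g h where f: "A = germ (mtop M) x f" "B = germ (mtop M) x g" "C = germ (mtop M) x h"
      using rep[OF A] rep[OF B] rep[OF C] by (elim exE)
    show "A \<oplus>\<^bsub>hol_germs M x\<^esub> B \<oplus>\<^bsub>hol_germs M x\<^esub> C = A \<oplus>\<^bsub>hol_germs M x\<^esub> (B \<oplus>\<^bsub>hol_germs M x\<^esub> C)"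
      unfolding f by (simp only: op add.assoc)
  next
    fix A B assume A: "A \<in> carrier (hol_germs M x)" and B: "B \<in> carrier (hol_germs M x)"
    obtain f g where f: "A = germ (mtop M) x f" "B = germ (mtop M) x g"
      using rep[OF A] rep[OF B] by (elim exE)
    show "A \<oplus>\<^bsub>hol_germs M x\<^esub> B = B \<oplus>\<^bsub>hol_germs M x\<^esub> A"
      unfolding f by (simp only: op add.commute)
  next
    fix A assume A: "A \<in> carrier (hol_germs M x)"
    then obtain f V where f: "x \<in> V" "holfun M V f" "A = germ (mtop M) x f" by (auto simp: hol_germs_carrier)
    show "\<zero>\<^bsub>hol_germs M x\<^esub> \<oplus>\<^bsub>hol_germs M x\<^esub> A = A" unfolding f by (simp only: op add_0)
    show "\<exists>B\<in>carrier (hol_germs M x). B \<oplus>\<^bsub>hol_germs M x\<^esub> A = \<zero>\<^bsub>hol_germs M x\<^esub>"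
      by (rule bexI[OF _ germ_closed[OF holfun_uminus[OF f(2)] f(1)]])
        (simp only: f op left_minus)
  qed (fact add, fact zero)
  show "comm_monoid (hol_germs M x)"
  proof (rule comm_monoidI)
    fix A B C assume A: "A \<in> carrier (hol_germs M x)" and B: "B \<in> carrier (hol_germs M x)"
      and C: "C \<in> carrier (hol_germs M x)"
    obtain f g h where f: "A = germ (mtop M) x f" "B = germ (mtop M) x g" "C = germ (mtop M) x h"
      using rep[OF A] rep[OF B] rep[OF C] by (elim exE)
    show "A \<otimes>\<^bsub>hol_germs M x\<^esub> B \<otimes>\<^bsub>hol_germs M x\<^esub> C = A \<otimes>\<^bsub>hol_germs M x\<^esub> (B \<otimes>\<^bsub>hol_germs M x\<^esub> C)"
      unfolding f by (simp only: op mult.assoc)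
  next
    fix A B assume A: "A \<in> carrier (hol_germs M x)" and B: "B \<in> carrier (hol_germs M x)"
    obtain f g where f: "A = germ (mtop M) x f" "B = germ (mtop M) x g"
      using rep[OF A] rep[OF B] by (elim exE)
    show "A \<otimes>\<^bsub>hol_germs M x\<^esub> B = B \<otimes>\<^bsub>hol_germs M x\<^esub> A"
      unfolding f by (simp only: op mult.commute)
  next
    fix A assume A: "A \<in> carrier (hol_germs M x)"
    obtain f where f: "A = germ (mtop M) x f" using rep[OF A] by (elim exE)
    show "\<one>\<^bsub>hol_germs M x\<^esub> \<otimes>\<^bsub>hol_germs M x\<^esub> A = A" unfolding f by (simp only: op mult_1)
  qed (fact mult, fact one)
  fix A B C assume A: "A \<in> carrier (hol_germs M x)" and B: "B \<in> carrier (hol_germs M x)"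
    and C: "C \<in> carrier (hol_germs M x)"
  obtain f g h where f: "A = germ (mtop M) x f" "B = germ (mtop M) x g" "C = germ (mtop M) x h"
    using rep[OF A] rep[OF B] rep[OF C] by (elim exE)
  show "(A \<oplus>\<^bsub>hol_germs M x\<^esub> B) \<otimes>\<^bsub>hol_germs M x\<^esub> C = A \<otimes>\<^bsub>hol_germs M x\<^esub> C \<oplus>\<^bsub>hol_germs M x\<^esub> B \<otimes>\<^bsub>hol_germs M x\<^esub> C"
    unfolding f by (simp only: op distrib_right)
qed

lemma hol_germs_uminus:
  assumes "holfun M V f" "x \<in> V"
  shows "\<ominus>\<^bsub>hol_germs M x\<^esub> germ (mtop M) x f = germ (mtop M) x (\<lambda>y. - f y)"
proof -
  have x: "x \<in> topspace (mtop M)" using assms holfun_open openin_subset by blast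
  interpret cring "hol_germs M x" by (rule hol_germs_cring[OF x])
  show ?thesis
    by (rule minus_equality[OF _ germ_closed[OF assms] germ_closed[OF holfun_uminus[OF assms(1)] assms(2)]])
      (simp only: hol_germs_ops[OF x] left_minus)
qed

text \<open>The componentwise criterion tests inner products with the real basis of the vector
  space, whose members are \<open>axis i u\<close>; such a product depends on the
  \<open>i\<close>-th component only.\<close>

lemma has_derivative_vec_components:
  fixes f :: "'a::real_normed_vector \<Rightarrow> complex ^ 'n::finite"
  assumes "\<And>i. ((\<lambda>z. f z $ i) has_derivative (\<lambda>v. D v $ i)) (at a within S)"
  shows "(f has_derivative D) (at a within S)"
  unfolding has_derivative_componentwise_within[of f]
proof
  fix b :: "complex ^ 'n" assume "b \<in> Basis"
  then obtain i u where "b = axis i u" by (auto simp: Basis_vec_def)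
  then show "((\<lambda>x. f x \<bullet> b) has_derivative (\<lambda>x. D x \<bullet> b)) (at a within S)"
    using has_derivative_inner_left[OF assms[of i], of u] by (simp add: inner_axis)
qed

section \<open>Charts and changes of coordinates\<close>

lemma is_chart_inv:
  assumes "is_chart T (U, \<phi>, S)" "p \<in> U"
  shows "inv_into U \<phi> (\<phi> p) = p"
proof -
  have "inj_on \<phi> U"
    using assms(1) openin_subset homeomorphic_imp_injective_map[of "subtopology T U" "top_of_set (\<phi> ` U)" \<phi>]
    by (fastforce simp: is_chart_def topspace_subtopology inf_absorb2)
  then show ?thesis using assms(2) by simp
qed

lemma is_chart_open_image:
  assumes "is_chart T (U, \<phi>, S)" "openin T V"
  shows "\<exists>B. open B \<and> \<phi> ` (U \<inter> V) = \<phi> ` U \<inter> B"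
proof -
  have "openin (subtopology T U) (U \<inter> V)" using assms by (auto simp: openin_subtopology_Int2)
  then have "openin (top_of_set (\<phi> ` U)) (\<phi> ` (U \<inter> V))"
    using assms(1) homeomorphic_imp_open_map by (fastforce simp: is_chart_def open_map_def)
  then show ?thesis by (auto simp: openin_open)
qed

text \<open>Chain rule: the expression of \<open>f\<close> in the first chart is that in the second
  one composed with the transition. This gives a derivative within the image of
  \<open>U \<inter> U' \<inter> V\<close>. As \<open>U'\<close> is open, this image agrees near the
  point with that of \<open>U \<inter> V\<close>, so the derivative is also one within the
  latter.\<close>

lemma chart_change:
  fixes \<phi> :: "'y \<Rightarrow> complex ^ 'n::finite"
  assumes c: "is_chart T (U, \<phi>, S)" and c': "is_chart T (U', \<phi>', S')"
    and tr: "holo_transition (U, \<phi>, S) (U', \<phi>', S')"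
    and f: "holo_on (\<phi>' ` (U' \<inter> V)) (\<lambda>z. f (inv_into U' \<phi>' z))" and p: "p \<in> U" "p \<in> U'" "p \<in> V"
  shows "\<exists>D. ((\<lambda>z. f (inv_into U \<phi> z)) has_derivative D) (at (\<phi> p) within \<phi> ` (U \<inter> V)) \<and>
    (\<forall>c v. D (c *s v) = c * D v)"
proof -
  let ?\<psi> = "\<lambda>z. \<phi>' (inv_into U \<phi> z)"
  let ?A = "\<phi> ` (U \<inter> U' \<inter> V)"
  note inv = is_chart_inv[OF c] is_chart_inv[OF c']
  have "\<forall>i. \<exists>D. ((\<lambda>z. ?\<psi> z $ i) has_derivative D) (at (\<phi> p) within \<phi> ` (U \<inter> U')) \<and> (\<forall>c v. D (c *s v) = c * D v)"
    using tr p unfolding holo_transition_def holo_on_def by auto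
  then obtain D where D: "\<And>i. ((\<lambda>z. ?\<psi> z $ i) has_derivative D i) (at (\<phi> p) within \<phi> ` (U \<inter> U'))"
    "\<And>i c v. D i (c *s v) = c * D i v" by metis
  define DD where "DD = (\<lambda>v. \<chi> i. D i v)"
  have "(?\<psi> has_derivative DD) (at (\<phi> p) within \<phi> ` (U \<inter> U'))"
    by (rule has_derivative_vec_components) (use D in \<open>simp add: DD_def\<close>)
  then have 1: "(?\<psi> has_derivative DD) (at (\<phi> p) within ?A)"
    by (rule has_derivative_subset) auto
  have "\<phi>' p \<in> \<phi>' ` (U' \<inter> V)" using p by blast
  then obtain E where E: "((\<lambda>z. f (inv_into U' \<phi>' z)) has_derivative E) (at (\<phi>' p) within \<phi>' ` (U' \<inter> V))"
    "\<And>c v. E (c *s v) = c * E v"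
    using f unfolding holo_on_def by blast
  have "?\<psi> ` ?A \<subseteq> \<phi>' ` (U' \<inter> V)" by (auto simp: inv)
  then have 2: "((\<lambda>z. f (inv_into U' \<phi>' z)) has_derivative E) (at (?\<psi> (\<phi> p)) within ?\<psi> ` ?A)"
    using E(1) p by (auto simp: inv intro: has_derivative_subset)
  have "((\<lambda>z. f (inv_into U' \<phi>' (?\<psi> z))) has_derivative (\<lambda>v. E (DD v))) (at (\<phi> p) within ?A)"
    by (rule has_derivative_in_compose[OF 1 2])
  then have 3: "((\<lambda>z. f (inv_into U \<phi> z)) has_derivative (\<lambda>v. E (DD v))) (at (\<phi> p) within ?A)"
    by (rule has_derivative_transform[rotated 2]) (use p in \<open>auto simp: inv\<close>)
  obtain B where B: "open B" "\<phi> ` (U \<inter> U') = \<phi> ` U \<inter> B"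
    using is_chart_open_image[OF c, of U'] c' by (auto simp: is_chart_def)
  have "?A = \<phi> ` (U \<inter> V) \<inter> B"
  proof
    show "?A \<subseteq> \<phi> ` (U \<inter> V) \<inter> B" using B(2) by blast
    show "\<phi> ` (U \<inter> V) \<inter> B \<subseteq> ?A"
    proof
      fix z assume "z \<in> \<phi> ` (U \<inter> V) \<inter> B"
      then obtain y where y: "y \<in> U" "y \<in> V" "z = \<phi> y" "z \<in> B" by blast
      then obtain y' where "y' \<in> U" "y' \<in> U'" "z = \<phi> y'" using B(2) by blast
      then have "y' = y" using inv(1) y by metis
      then show "z \<in> ?A" using y \<open>y' \<in> U'\<close> by blast
    qed
  qed
  moreover have "\<phi> p \<in> B" using B(2) p by blast
  ultimately have "at (\<phi> p) within ?A = at (\<phi> p) within \<phi> ` (U \<inter> V)"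
    using B(1) by (intro at_within_nhd[of _ B]) auto
  then have "((\<lambda>z. f (inv_into U \<phi> z)) has_derivative (\<lambda>v. E (DD v))) (at (\<phi> p) within \<phi> ` (U \<inter> V))" using 3 by simp
  moreover have "E (DD (c *s v)) = c * E (DD v)" for c v
  proof -
    have "DD (c *s v) = c *s DD v" by (simp add: DD_def vec_eq_iff D(2))
    then show ?thesis by (simp add: E(2))
  qed
  ultimately show ?thesis by blast
qed

context
  fixes Y :: "('y, 'n::finite) cmfd"
  assumes cm: "complex_manifold Y"
begin

lemma max_atlas_chart: "c \<in> max_atlas Y \<Longrightarrow> is_chart (mtop Y) c"
  by (simp add: max_atlas_def)

lemma atlas_cover: "p \<in> topspace (mtop Y) \<Longrightarrow> \<exists>U \<phi> S. (U, \<phi>, S) \<in> atlas Y \<and> p \<in> U"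
  using cm unfolding complex_manifold_def by blast

text \<open>\<open>holfun\<close> tests a function in the charts of the atlas only, while adapted
  charts are taken from the maximal atlas.\<close>

lemma holfun_max_atlas:
  assumes f: "holfun Y V f" and c: "(U, \<phi>, S) \<in> max_atlas Y"
  shows "holo_on (\<phi> ` (U \<inter> V)) (\<lambda>z. f (inv_into U \<phi> z))"
  unfolding holo_on_def
proof
  fix z assume "z \<in> \<phi> ` (U \<inter> V)"
  then obtain p where p: "p \<in> U" "p \<in> V" "z = \<phi> p" by blast
  then have "p \<in> topspace (mtop Y)" using holfun_open[OF f] openin_subset by blast
  then obtain U' \<phi>' S' where c': "(U', \<phi>', S') \<in> atlas Y" "p \<in> U'" using atlas_cover by blast
  have ic': "is_chart (mtop Y) (U', \<phi>', S')" using cm c' by (auto simp: complex_manifold_def)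
  have tr: "holo_transition (U, \<phi>, S) (U', \<phi>', S')"
    using c c' unfolding max_atlas_def compatible_def by blast
  have h: "holo_on (\<phi>' ` (U' \<inter> V)) (\<lambda>z. f (inv_into U' \<phi>' z))"
    by (rule holfunD[OF f c'(1)])
  show "\<exists>D. ((\<lambda>z. f (inv_into U \<phi> z)) has_derivative D) (at z within \<phi> ` (U \<inter> V)) \<and> (\<forall>c v. D (c *s v) = c * D v)"
    unfolding p(3) by (rule chart_change[OF max_atlas_chart[OF c] ic' tr h p(1) c'(2) p(2)])
qed

lemma max_atlas_coord_holfun:
  assumes c: "(U, \<phi>, S) \<in> max_atlas Y"
  shows "holfun Y U (\<lambda>y. \<phi> y $ i)"
proof -
  show ?thesis
  proof (rule holfunI)
    show "openin (mtop Y) U" using max_atlas_chart[OF c] by (simp add: is_chart_def)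
    fix U' \<phi>' S' assume c': "(U', \<phi>', S') \<in> atlas Y"
    have "\<forall>c'\<in>atlas Y. compatible (U, \<phi>, S) c'" using c unfolding max_atlas_def by simp
    from bspec[OF this c'] have "holo_transition (U', \<phi>', S') (U, \<phi>, S)" unfolding compatible_def by (rule conjunct2)
    then show "holo_on (\<phi>' ` (U' \<inter> U)) (\<lambda>z. \<phi> (inv_into U' \<phi>' z) $ i)"
      unfolding holo_transition_def split by (rule spec)
  qed
qed

text \<open>The coordinates of \<open>c'\<close> are holomorphic functions, and these are
  holomorphic in every chart of the maximal atlas.\<close>

lemma max_atlas_transition:
  assumes "c \<in> max_atlas Y" "c' \<in> max_atlas Y"
  shows "holo_transition c c'"
proof -
  obtain U \<phi> S where e: "c = (U, \<phi>, S)" by (cases c)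
  obtain U' \<phi>' S' where e': "c' = (U', \<phi>', S')" by (cases c')
  show ?thesis unfolding e e' holo_transition_def split
    by (intro allI, rule holfun_max_atlas[OF max_atlas_coord_holfun[OF assms(2)[unfolded e']] assms(1)[unfolded e]])
qed

end

text \<open>By adaptedness the image of \<open>U \<inter> X\<close> is the intersection of that of
  \<open>U\<close> with a smaller coordinate plane, hence relatively open in it.\<close>

lemma adapted_restrict_chart:
  assumes "adapted_chart Y X (U, \<phi>, S) K"
  shows "is_chart (mtop (submfd Y X)) (U \<inter> X, \<phi>, S - K)"
proof -
  have m: "is_chart (mtop Y) (U, \<phi>, S)" and im: "\<phi> ` (U \<inter> X) = \<phi> ` U \<inter> cplane (S - K)" and K: "K \<subseteq> S"
    using assms by (auto simp: adapted_chart_def max_atlas_def)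
  have sub: "cplane (S - K) \<subseteq> cplane S" by (auto simp: cplane_def)
  have 1: "openin (subtopology (mtop Y) X) (U \<inter> X)"
    using m by (auto simp: is_chart_def openin_subtopology)
  obtain B where B: "open B" "\<phi> ` U = cplane S \<inter> B" using m by (auto simp: is_chart_def openin_open)
  then have 2: "openin (top_of_set (cplane (S - K))) (\<phi> ` (U \<inter> X))"
    unfolding im openin_open using sub by (intro exI[of _ B]) auto
  have U: "U \<subseteq> topspace (mtop Y)" using m openin_subset by (auto simp: is_chart_def)
  have e: "topspace (subtopology (mtop Y) U) \<inter> (U \<inter> X) = U \<inter> X" "U \<inter> (U \<inter> X) = U \<inter> X" "X \<inter> (U \<inter> X) = U \<inter> X"
    "\<phi> ` U \<inter> \<phi> ` (U \<inter> X) = \<phi> ` (U \<inter> X)" using U by auto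
  have h: "homeomorphic_map (subtopology (mtop Y) U) (top_of_set (\<phi> ` U)) \<phi>" using m by (simp add: is_chart_def)
  have "homeomorphic_map (subtopology (subtopology (mtop Y) U) (U \<inter> X)) (subtopology (top_of_set (\<phi> ` U)) (\<phi> ` (U \<inter> X))) \<phi>"
    by (rule homeomorphic_map_subtopologies[OF h]) (simp only: e topspace_euclidean_subtopology)
  then have 3: "homeomorphic_map (subtopology (subtopology (mtop Y) X) (U \<inter> X)) (top_of_set (\<phi> ` (U \<inter> X))) \<phi>"
    by (simp only: subtopology_subtopology e)
  show ?thesis using 1 2 3 by (simp add: is_chart_def submfd_def)
qed

section \<open>The first formal neighbourhood\<close>

locale closed_pair =
  fixes Y :: "('y, 'n::finite) cmfd" and X :: "'y set" and r :: nat
  assumes cm: "complex_manifold Y" and sub: "closed_submanifold Y X r"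
begin

abbreviation "TX \<equiv> mtop (submfd Y X)"
abbreviation "RX \<equiv> hol_germs (submfd Y X)"
abbreviation "RY \<equiv> hol_germs Y"
abbreviation "RB \<equiv> stalk (OXbar Y X)"
abbreviation "NX \<equiv> stalk (conormal Y X)"
abbreviation "cls \<equiv> obar_class Y X"

lemma X_sub: "X \<subseteq> topspace (mtop Y)"
  using sub closedin_subset by (auto simp: closed_submanifold_def)

lemma TX_def: "TX = subtopology (mtop Y) X"
  by (simp add: submfd_def)

lemma topspace_TX: "topspace TX = X"
  using X_sub by (simp add: TX_def inf_absorb2)

lemma openin_TX: "openin TX U \<longleftrightarrow> (\<exists>V. openin (mtop Y) V \<and> U = V \<inter> X)"
  by (simp add: TX_def openin_subtopology)

lemma openin_TX_Int: "openin (mtop Y) V \<Longrightarrow> openin TX (V \<inter> X)"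
  unfolding openin_TX by blast

text \<open>A chart of \<open>submfd Y X\<close> is the restriction of an adapted chart of
  \<open>Y\<close>, and the expressions of \<open>f\<close> in the two charts agree on the points of
  \<open>X\<close>.\<close>

lemma holfun_restrict:
  assumes f: "holfun Y V f"
  shows "holfun (submfd Y X) (V \<inter> X) f"
proof (rule holfunI)
  show "openin TX (V \<inter> X)" by (rule openin_TX_Int[OF holfun_open[OF f]])
  fix U S and \<phi> :: "'y \<Rightarrow> complex ^ 'n" assume "(U, \<phi>, S) \<in> atlas (submfd Y X)"
  then obtain U' S' K where c: "adapted_chart Y X (U', \<phi>, S') K" "U = U' \<inter> X" by (auto simp: submfd_def)
  have m: "(U', \<phi>, S') \<in> max_atlas Y" using c(1) by (simp add: adapted_chart_def)
  have "holo_on (\<phi> ` (U \<inter> (V \<inter> X))) (\<lambda>z. f (inv_into U' \<phi> z))"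
    by (rule holo_on_subset[OF holfun_max_atlas[OF cm f m]]) (auto simp: c(2))
  then show "holo_on (\<phi> ` (U \<inter> (V \<inter> X))) (\<lambda>z. f (inv_into U \<phi> z))"
  proof (rule holo_on_cong)
    fix z assume "z \<in> \<phi> ` (U \<inter> (V \<inter> X))"
    then obtain p where p: "p \<in> U" "z = \<phi> p" by blast
    then have "p \<in> U'" using c(2) by blast
    then show "f (inv_into U \<phi> z) = f (inv_into U' \<phi> z)"
      using is_chart_inv[OF max_atlas_chart[OF cm m]] is_chart_inv[OF adapted_restrict_chart[OF c(1)]] p c(2) by simp
  qed
qed

section \<open>Stalks of the first formal neighbourhood at a point\<close>

context
  fixes x assumes x: "x \<in> X"
begin

lemma xY: "x \<in> topspace (mtop Y)" using x X_sub by blast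
lemma xX: "x \<in> topspace TX" using x topspace_TX by simp

interpretation RX: cring "RX x" by (rule hol_germs_cring[OF xX])
interpretation RY: cring "RY x" by (rule hol_germs_cring[OF xY])

lemma ideal_stalk_mem: "A \<in> ideal_stalk Y X x \<longleftrightarrow> 
    (\<exists>f V. x \<in> V \<and> holfun Y V f \<and> (\<forall>y\<in>V \<inter> X. f y = 0) \<and> A = germ (mtop Y) x f)"
  unfolding ideal_stalk_def by blast

lemma ideal_stalk_ideal: "ideal (ideal_stalk Y X x) (RY x)"
proof (rule idealI)
  show "ring (RY x)" by (rule RY.ring_axioms)
  have sub: "ideal_stalk Y X x \<subseteq> carrier (RY x)"
    unfolding ideal_stalk_def hol_germs_def by auto
  have add: "A \<oplus>\<^bsub>RY x\<^esub> B \<in> ideal_stalk Y X x"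
    if A: "A \<in> ideal_stalk Y X x" and B: "B \<in> ideal_stalk Y X x" for A B
  proof -
    obtain f V where f: "x \<in> V" "holfun Y V f" "\<forall>y\<in>V \<inter> X. f y = 0" "A = germ (mtop Y) x f"
      using A unfolding ideal_stalk_mem by (elim exE conjE)
    obtain g W where g: "x \<in> W" "holfun Y W g" "\<forall>y\<in>W \<inter> X. g y = 0" "B = germ (mtop Y) x g"
      using B unfolding ideal_stalk_mem by (elim exE conjE)
    show ?thesis unfolding f(4) g(4) hol_germs_ops[OF xY] ideal_stalk_mem
      by (rule exI[of _ "\<lambda>y. f y + g y"], rule exI[of _ "V \<inter> W"])
        (use f g holfun_Int[OF f(2) holfun_open[OF g(2)]] holfun_Int(2)[OF g(2) holfun_open[OF f(2)]] in
          \<open>simp add: holfun_add\<close>)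
  qed
  have mult: "B \<otimes>\<^bsub>RY x\<^esub> A \<in> ideal_stalk Y X x"
    if A: "A \<in> ideal_stalk Y X x" and B: "B \<in> carrier (RY x)" for A B
  proof -
    obtain f V where f: "x \<in> V" "holfun Y V f" "\<forall>y\<in>V \<inter> X. f y = 0" "A = germ (mtop Y) x f"
      using A unfolding ideal_stalk_mem by (elim exE conjE)
    obtain g W where g: "x \<in> W" "holfun Y W g" "B = germ (mtop Y) x g"
      using B unfolding hol_germs_carrier by (elim exE conjE)
    show ?thesis unfolding f(4) g(3) hol_germs_ops[OF xY] ideal_stalk_mem
      by (rule exI[of _ "\<lambda>y. g y * f y"], rule exI[of _ "V \<inter> W"])
        (use f g holfun_Int[OF f(2) holfun_open[OF g(2)]] holfun_Int(2)[OF g(2) holfun_open[OF f(2)]] in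
          \<open>simp add: holfun_mult\<close>)
  qed
  show m2: "\<And>A B. A \<in> ideal_stalk Y X x \<Longrightarrow> B \<in> carrier (RY x) \<Longrightarrow> B \<otimes>\<^bsub>RY x\<^esub> A \<in> ideal_stalk Y X x"
    by (rule mult)
  show "A \<otimes>\<^bsub>RY x\<^esub> B \<in> ideal_stalk Y X x" if "A \<in> ideal_stalk Y X x" "B \<in> carrier (RY x)" for A B
    using mult[OF that] RY.m_comm[of A B] that sub by (simp add: subset_iff)
  show "subgroup (ideal_stalk Y X x) (add_monoid (RY x))"
  proof (rule RY.add.subgroupI)
    show "ideal_stalk Y X x \<subseteq> carrier (RY x)" by (rule sub)
    have "\<zero>\<^bsub>RY x\<^esub> \<in> ideal_stalk Y X x"
      unfolding hol_germs_ops[OF xY] ideal_stalk_mem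
      by (rule exI[of _ "\<lambda>_. 0"], rule exI[of _ "topspace (mtop Y)"]) (simp add: xY holfun_const)
    then show "ideal_stalk Y X x \<noteq> {}" by blast
    fix A assume A: "A \<in> ideal_stalk Y X x"
    then have "(\<ominus>\<^bsub>RY x\<^esub> \<one>\<^bsub>RY x\<^esub>) \<otimes>\<^bsub>RY x\<^esub> A \<in> ideal_stalk Y X x" by (rule mult) simp
    then show "\<ominus>\<^bsub>RY x\<^esub> A \<in> ideal_stalk Y X x" using A sub by (simp add: RY.l_minus subset_iff)
    fix B assume B: "B \<in> ideal_stalk Y X x"
    show "A \<oplus>\<^bsub>RY x\<^esub> B \<in> ideal_stalk Y X x" by (rule add[OF A B])
  qed
qed

interpretation J: ideal "ideal_stalk Y X x" "RY x" by (rule ideal_stalk_ideal)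

lemma ideal_sq_ideal: "ideal (ideal_sq Y X x) (RY x)"
  unfolding ideal_sq_def by (rule RY.ideal_prod_is_ideal[OF ideal_stalk_ideal ideal_stalk_ideal])

interpretation I2: ideal "ideal_sq Y X x" "RY x" by (rule ideal_sq_ideal)

lemma ideal_sq_sub: "ideal_sq Y X x \<subseteq> ideal_stalk Y X x"
  using RY.ideal_prod_inter[OF ideal_stalk_ideal ideal_stalk_ideal] unfolding ideal_sq_def by simp

lemma ideal_sq_prod: "A \<in> ideal_stalk Y X x \<Longrightarrow> B \<in> ideal_stalk Y X x \<Longrightarrow> A \<otimes>\<^bsub>RY x\<^esub> B \<in> ideal_sq Y X x"
  unfolding ideal_sq_def by (rule ideal_prod.prod)

lemma RB_eq: "RB x = RY x Quot ideal_sq Y X x"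
  by (simp add: OXbar_def)

lemma RB_cring: "cring (RB x)"
  unfolding RB_eq by (rule I2.quotient_is_cring[OF RY.is_cring])

interpretation RB: cring "RB x" by (rule RB_cring)

lemma RB_carrier: "b \<in> carrier (RB x) \<longleftrightarrow> (\<exists>f V. x \<in> V \<and> holfun Y V f \<and> b = cls x f)"
  unfolding RB_eq FactRing_def A_RCOSETS_def' obar_class_def hol_germs_def a_r_coset_def' by auto

lemma RBE:
  assumes "b \<in> carrier (RB x)"
  obtains f V where "x \<in> V" "holfun Y V f" "b = cls x f"
  using assms unfolding RB_carrier by (elim exE conjE)

lemma cls_closed: "holfun Y V f \<Longrightarrow> x \<in> V \<Longrightarrow> cls x f \<in> carrier (RB x)"
  unfolding RB_carrier by (intro exI conjI) auto

lemma cls_add: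
  assumes "holfun Y V f" "x \<in> V" "holfun Y W g" "x \<in> W"
  shows "cls x f \<oplus>\<^bsub>RB x\<^esub> cls x g = cls x (\<lambda>y. f y + g y)"
  unfolding RB_eq obar_class_def FactRing_def
  using I2.a_rcos_sum[OF germ_closed[OF assms(1,2)] germ_closed[OF assms(3,4)]]
  by (simp add: hol_germs_ops[OF xY])

lemma cls_mult:
  assumes "holfun Y V f" "x \<in> V" "holfun Y W g" "x \<in> W"
  shows "cls x f \<otimes>\<^bsub>RB x\<^esub> cls x g = cls x (\<lambda>y. f y * g y)"
  unfolding RB_eq obar_class_def FactRing_def
  using I2.rcoset_mult_add[OF germ_closed[OF assms(1,2)] germ_closed[OF assms(3,4)]]
  by (simp add: hol_germs_ops[OF xY])

lemma cls_zero: "\<zero>\<^bsub>RB x\<^esub> = cls x (\<lambda>_. 0)"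
proof -
  have "ideal_sq Y X x +>\<^bsub>RY x\<^esub> \<zero>\<^bsub>RY x\<^esub> = ideal_sq Y X x"
    by (rule RY.a_coset_add_zero[OF I2.a_subset])
  then show ?thesis unfolding RB_eq obar_class_def FactRing_def by (simp add: hol_germs_ops[OF xY])
qed

lemma cls_uminus:
  assumes "holfun Y V f" "x \<in> V"
  shows "\<ominus>\<^bsub>RB x\<^esub> cls x f = cls x (\<lambda>y. - f y)"
  by (rule RB.minus_equality[OF _ cls_closed[OF assms] cls_closed[OF holfun_uminus[OF assms(1)] assms(2)]])
    (simp only: cls_add[OF holfun_uminus[OF assms(1)] assms(2) assms] cls_zero left_minus)

lemma cls_minus:
  assumes "holfun Y V f" "x \<in> V" "holfun Y W g" "x \<in> W"
  shows "cls x f \<ominus>\<^bsub>RB x\<^esub> cls x g = cls x (\<lambda>y. f y - g y)"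
  using cls_add[OF assms(1,2) holfun_uminus[OF assms(3)] assms(4)] cls_uminus[OF assms(3,4)]
  by (simp add: a_minus_def)

lemma cls_eq_iff:
  assumes "holfun Y V f" "x \<in> V" "holfun Y W g" "x \<in> W"
  shows "cls x f = cls x g \<longleftrightarrow> germ (mtop Y) x (\<lambda>y. f y - g y) \<in> ideal_sq Y X x"
proof -
  have "germ (mtop Y) x f \<ominus>\<^bsub>RY x\<^esub> germ (mtop Y) x g = germ (mtop Y) x (\<lambda>y. f y - g y)"
    by (simp add: a_minus_def hol_germs_uminus[OF assms(3,4)] hol_germs_ops[OF xY])
  moreover have "cls x f = cls x g \<longleftrightarrow> germ (mtop Y) x f \<ominus>\<^bsub>RY x\<^esub> germ (mtop Y) x g \<in> ideal_sq Y X x"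
  proof -
    have "germ (mtop Y) x f \<ominus>\<^bsub>RY x\<^esub> germ (mtop Y) x g \<in> ideal_sq Y X x \<longleftrightarrow>
        germ (mtop Y) x f \<in> ideal_sq Y X x +>\<^bsub>RY x\<^esub> germ (mtop Y) x g"
      using I2.a_rcos_module[OF germ_closed[OF assms(3,4)] germ_closed[OF assms(1,2)]] by (simp add: a_minus_def)
    also have "\<dots> \<longleftrightarrow> cls x f = cls x g"
      unfolding obar_class_def
    proof
      assume "germ (mtop Y) x f \<in> ideal_sq Y X x +>\<^bsub>RY x\<^esub> germ (mtop Y) x g"
      then show "ideal_sq Y X x +>\<^bsub>RY x\<^esub> germ (mtop Y) x f = ideal_sq Y X x +>\<^bsub>RY x\<^esub> germ (mtop Y) x g"
        by (rule I2.a_repr_independence'[OF _ germ_closed[OF assms(3,4)], symmetric])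
    next
      assume "ideal_sq Y X x +>\<^bsub>RY x\<^esub> germ (mtop Y) x f = ideal_sq Y X x +>\<^bsub>RY x\<^esub> germ (mtop Y) x g"
      then show "germ (mtop Y) x f \<in> ideal_sq Y X x +>\<^bsub>RY x\<^esub> germ (mtop Y) x g"
        using I2.a_rcos_self[OF germ_closed[OF assms(1,2)]] by (simp only:)
    qed
    finally show ?thesis ..
  qed
  ultimately show ?thesis by (simp only:)
qed

text \<open>\<open>res_stalk\<close> is a union over all functions that represent the class. They
  differ by germs from the square of the ideal, which vanish on \<open>X\<close>, so all of them
  have the same restriction.\<close>

lemma res_cls:
  assumes f: "holfun Y V f" "x \<in> V"
  shows "res_stalk Y X x (cls x f) = germ TX x f"
proof -
  have *: "germ TX x g = germ TX x f" if A: "A \<in> cls x f" and g: "g \<in> A" for A g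
  proof -
    obtain B where B: "B \<in> ideal_sq Y X x" "A = B \<oplus>\<^bsub>RY x\<^esub> germ (mtop Y) x f"
      using A by (auto simp: obar_class_def a_r_coset_def')
    obtain h W where h: "x \<in> W" "holfun Y W h" "\<forall>y\<in>W \<inter> X. h y = 0" "B = germ (mtop Y) x h"
      using subsetD[OF ideal_sq_sub B(1)] unfolding ideal_stalk_mem by (elim exE conjE)
    have "A = germ (mtop Y) x (\<lambda>y. h y + f y)" unfolding B(2) h(4) by (rule hol_germs_ops[OF xY])
    then obtain V' where V': "openin (mtop Y) V'" "x \<in> V'" "\<forall>y\<in>V'. g y = h y + f y"
      using g by (auto simp: germ_def)
    show ?thesis
      by (rule germ_eqI[of _ "(W \<inter> V') \<inter> X"])
        (use V' h x holfun_open[OF h(2)] in \<open>auto intro!: openin_TX_Int openin_Int\<close>)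
  qed
  have 1: "f \<in> germ (mtop Y) x f" by (rule germ_self[OF xY])
  have 2: "germ (mtop Y) x f \<in> cls x f"
    unfolding obar_class_def by (rule I2.a_rcos_self[OF germ_closed[OF f]])
  show ?thesis unfolding res_stalk_def
  proof (rule equalityI)
    show "(\<Union>A\<in>cls x f. \<Union>g\<in>A. germ TX x g) \<subseteq> germ TX x f"
      by (intro UN_least) (simp only: * subset_refl)
    show "germ TX x f \<subseteq> (\<Union>A\<in>cls x f. \<Union>g\<in>A. germ TX x g)"
      by (rule subset_trans[OF UN_upper[OF 1, of "germ TX x"] UN_upper[OF 2, of "\<lambda>A. \<Union>g\<in>A. germ TX x g"]])
  qed
qed

lemma res_closed: "b \<in> carrier (RB x) \<Longrightarrow> res_stalk Y X x b \<in> carrier (RX x)"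
  by (erule RBE) (simp add: res_cls germ_closed[OF holfun_restrict] x)

lemma res_add: "b \<in> carrier (RB x) \<Longrightarrow> c \<in> carrier (RB x) \<Longrightarrow>
   res_stalk Y X x (b \<oplus>\<^bsub>RB x\<^esub> c) = res_stalk Y X x b \<oplus>\<^bsub>RX x\<^esub> res_stalk Y X x c"
proof (erule RBE, erule RBE)
  fix f V g W assume f: "x \<in> V" "holfun Y V f" "b = cls x f" and g: "x \<in> W" "holfun Y W g" "c = cls x g"
  have h: "holfun Y (V \<inter> W) (\<lambda>y. f y + g y)"
    by (intro holfun_add holfun_Int holfun_open[OF f(2)] holfun_open[OF g(2)] f g)
  show ?thesis unfolding f(3) g(3) cls_add[OF f(2,1) g(2,1)] res_cls[OF f(2,1)] res_cls[OF g(2,1)] hol_germs_ops[OF xX]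
    by (rule res_cls[OF h]) (simp add: f g)
qed

lemma res_mult: "b \<in> carrier (RB x) \<Longrightarrow> c \<in> carrier (RB x) \<Longrightarrow>
   res_stalk Y X x (b \<otimes>\<^bsub>RB x\<^esub> c) = res_stalk Y X x b \<otimes>\<^bsub>RX x\<^esub> res_stalk Y X x c"
proof (erule RBE, erule RBE)
  fix f V g W assume f: "x \<in> V" "holfun Y V f" "b = cls x f" and g: "x \<in> W" "holfun Y W g" "c = cls x g"
  have h: "holfun Y (V \<inter> W) (\<lambda>y. f y * g y)"
    by (intro holfun_mult holfun_Int holfun_open[OF f(2)] holfun_open[OF g(2)] f g)
  show ?thesis unfolding f(3) g(3) cls_mult[OF f(2,1) g(2,1)] res_cls[OF f(2,1)] res_cls[OF g(2,1)] hol_germs_ops[OF xX]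
    by (rule res_cls[OF h]) (simp add: f g)
qed

lemma res_uminus: "b \<in> carrier (RB x) \<Longrightarrow> res_stalk Y X x (\<ominus>\<^bsub>RB x\<^esub> b) = \<ominus>\<^bsub>RX x\<^esub> res_stalk Y X x b"
proof (erule RBE)
  fix f V assume f: "x \<in> V" "holfun Y V f" "b = cls x f"
  have "x \<in> V \<inter> X" using f x by simp
  then show ?thesis unfolding f(3) cls_uminus[OF f(2,1)] res_cls[OF f(2,1)]
    res_cls[OF holfun_uminus[OF f(2)] f(1)] by (rule hol_germs_uminus[OF holfun_restrict[OF f(2)], symmetric])
qed

lemma N_carrier: "u \<in> carrier (NX x) \<longleftrightarrow> (\<exists>f V. x \<in> V \<and> holfun Y V f \<and> (\<forall>y\<in>V \<inter> X. f y = 0) \<and> u = cls x f)"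
  unfolding conormal_def Let_def obar_class_def by (simp add: Bex_def[symmetric] ideal_stalk_mem) blast

lemma N_ops: "add (NX x) = add (RB x)" "\<zero>\<^bsub>NX x\<^esub> = \<zero>\<^bsub>RB x\<^esub>"
  by (simp_all add: conormal_def Let_def)

lemma N_sub: "u \<in> carrier (NX x) \<Longrightarrow> u \<in> carrier (RB x)"
  unfolding N_carrier RB_carrier by (elim exE conjE, intro exI conjI)

text \<open>A restriction that is zero as a germ on \<open>X\<close> vanishes on the trace of an
  open set of \<open>Y\<close>, to which the domain is shrunk. With the conormal stalk described as
  a kernel, differences of two lifts of a germ are recognised as conormal.\<close>

lemma N_iff_res: "u \<in> carrier (NX x) \<longleftrightarrow> u \<in> carrier (RB x) \<and> res_stalk Y X x u = \<zero>\<^bsub>RX x\<^esub>"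
proof
  assume "u \<in> carrier (NX x)"
  then obtain f V where f: "x \<in> V" "holfun Y V f" "\<forall>y\<in>V \<inter> X. f y = 0" "u = cls x f"
    unfolding N_carrier by (elim exE conjE)
  have "germ TX x f = germ TX x (\<lambda>_. 0)"
    by (rule germ_eqI[OF openin_TX_Int[OF holfun_open[OF f(2)]]]) (use f x in auto)
  then show "u \<in> carrier (RB x) \<and> res_stalk Y X x u = \<zero>\<^bsub>RX x\<^esub>"
    unfolding f(4) res_cls[OF f(2,1)] hol_germs_ops[OF xX] by (intro conjI cls_closed[OF f(2,1)])
next
  assume u: "u \<in> carrier (RB x) \<and> res_stalk Y X x u = \<zero>\<^bsub>RX x\<^esub>"
  obtain f V where f: "x \<in> V" "holfun Y V f" "u = cls x f"
    using conjunct1[OF u] unfolding RB_carrier by (elim exE conjE)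
  have "germ TX x f = germ TX x (\<lambda>_. 0)" using u unfolding f(3) res_cls[OF f(2,1)] hol_germs_ops[OF xX] by (rule conjunct2)
  from germ_eqD[OF xX this] obtain W where W: "openin TX W" "x \<in> W" "\<forall>y\<in>W. f y = 0" by (elim exE conjE)
  then obtain W' where W': "openin (mtop Y) W'" "W = W' \<inter> X" unfolding openin_TX by (elim exE conjE)
  show "u \<in> carrier (NX x)" unfolding N_carrier f(3)
    by (rule exI[of _ f], rule exI[of _ "V \<inter> W'"]) (use f W W' holfun_Int[OF f(2) W'(1)] in auto)
qed

lemma N_square_zero:
  assumes "u \<in> carrier (NX x)" "v \<in> carrier (NX x)"
  shows "u \<otimes>\<^bsub>RB x\<^esub> v = \<zero>\<^bsub>RB x\<^esub>"
proof -
  obtain f V where f: "x \<in> V" "holfun Y V f" "\<forall>y\<in>V \<inter> X. f y = 0" "u = cls x f"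
    using assms(1) unfolding N_carrier by (elim exE conjE)
  obtain g W where g: "x \<in> W" "holfun Y W g" "\<forall>y\<in>W \<inter> X. g y = 0" "v = cls x g"
    using assms(2) unfolding N_carrier by (elim exE conjE)
  have h: "holfun Y (V \<inter> W) (\<lambda>y. f y * g y)"
    by (intro holfun_mult holfun_Int holfun_open[OF f(2)] holfun_open[OF g(2)] f g)
  have "germ (mtop Y) x f \<otimes>\<^bsub>RY x\<^esub> germ (mtop Y) x g \<in> ideal_sq Y X x"
  proof (rule ideal_sq_prod)
    show "germ (mtop Y) x f \<in> ideal_stalk Y X x" unfolding ideal_stalk_mem
      by (rule exI[of _ f], rule exI[of _ V]) (use f in simp)
    show "germ (mtop Y) x g \<in> ideal_stalk Y X x" unfolding ideal_stalk_mem
      by (rule exI[of _ g], rule exI[of _ W]) (use g in simp)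
  qed
  then have "germ (mtop Y) x (\<lambda>y. f y * g y - 0) \<in> ideal_sq Y X x" by (simp add: hol_germs_ops[OF xY])
  then show ?thesis unfolding f(4) g(4) cls_mult[OF f(2,1) g(2,1)] cls_zero
    by (subst cls_eq_iff[OF h _ holfun_const[OF openin_topspace]]) (use f g xY in auto)
qed

text \<open>The scalar action on the conormal stalk is independent of the lift, because \<open>NX x\<close> squares to zero.\<close>

lemma N_smult:
  assumes b: "b \<in> carrier (RB x)" and u: "u \<in> carrier (NX x)"
  shows "res_stalk Y X x b \<odot>\<^bsub>NX x\<^esub> u = b \<otimes>\<^bsub>RB x\<^esub> u"
proof -
  define c where "c = (SOME c. c \<in> carrier (RB x) \<and> res_stalk Y X x c = res_stalk Y X x b)"
  have c: "c \<in> carrier (RB x) \<and> res_stalk Y X x c = res_stalk Y X x b"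
    unfolding c_def by (rule someI[of _ b]) (simp add: b)
  have "c \<ominus>\<^bsub>RB x\<^esub> b \<in> carrier (NX x)"
    unfolding N_iff_res using c b res_closed[OF b] by (simp add: a_minus_def res_add res_uminus RX.r_neg)
  then have "(c \<ominus>\<^bsub>RB x\<^esub> b) \<otimes>\<^bsub>RB x\<^esub> u = \<zero>\<^bsub>RB x\<^esub>" by (rule N_square_zero[OF _ u])
  then have "c \<otimes>\<^bsub>RB x\<^esub> u \<ominus>\<^bsub>RB x\<^esub> b \<otimes>\<^bsub>RB x\<^esub> u = \<zero>\<^bsub>RB x\<^esub>"
    using c b N_sub[OF u] by (simp add: a_minus_def RB.l_distr RB.l_minus)
  then have "c \<otimes>\<^bsub>RB x\<^esub> u = b \<otimes>\<^bsub>RB x\<^esub> u"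
    using RB.eq_if_minus_zero[of "c \<otimes>\<^bsub>RB x\<^esub> u" "b \<otimes>\<^bsub>RB x\<^esub> u"] c b N_sub[OF u] by simp
  moreover have "res_stalk Y X x b \<odot>\<^bsub>NX x\<^esub> u = c \<otimes>\<^bsub>RB x\<^esub> u"
    unfolding c_def conormal_def Let_def by simp
  ultimately show ?thesis by (simp only:)
qed

end

end

section \<open>Retractions and the isomorphism of complexes\<close>

text \<open>Both sides of each identity have the same image under \<open>h\<close>, and applying
  \<open>k\<close> to it gives the claim; closure of \<open>M\<close> under the operations lets
  \<open>k\<close> undo \<open>h\<close> there.\<close>

lemma mod_hom_inverse:
  assumes h: "h \<in> mod_hom R M N" and k: "\<And>v. v \<in> carrier N \<Longrightarrow> k v \<in> carrier M"
    and kh: "\<And>u. u \<in> carrier M \<Longrightarrow> k (h u) = u" and hk: "\<And>v. v \<in> carrier N \<Longrightarrow> h (k v) = v"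
    and add: "\<And>u v. u \<in> carrier M \<Longrightarrow> v \<in> carrier M \<Longrightarrow> u \<oplus>\<^bsub>M\<^esub> v \<in> carrier M"
    and smult: "\<And>a u. a \<in> carrier R \<Longrightarrow> u \<in> carrier M \<Longrightarrow> a \<odot>\<^bsub>M\<^esub> u \<in> carrier M"
  shows "k \<in> mod_hom R N M"
proof (rule mod_homI)
  fix u v assume uv: "u \<in> carrier N" "v \<in> carrier N"
  have "h (k u \<oplus>\<^bsub>M\<^esub> k v) = u \<oplus>\<^bsub>N\<^esub> v" using uv by (simp add: mod_hom_add[OF h] k hk)
  then show "k (u \<oplus>\<^bsub>N\<^esub> v) = k u \<oplus>\<^bsub>M\<^esub> k v" using kh[OF add[OF k k]] uv by metis
next
  fix a u assume au: "a \<in> carrier R" "u \<in> carrier N"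
  have "h (a \<odot>\<^bsub>M\<^esub> k u) = a \<odot>\<^bsub>N\<^esub> u" using au by (simp add: mod_hom_smult[OF h] k hk)
  then show "k (a \<odot>\<^bsub>N\<^esub> u) = a \<odot>\<^bsub>M\<^esub> k u" using kh[OF smult[OF _ k]] au by metis
qed (fact k)

context closed_pair
begin

lemma retractionD:
  assumes "retraction_pullback Y X \<sigma>" "x \<in> X"
  shows "a \<in> carrier (RX x) \<Longrightarrow> \<sigma> x a \<in> carrier (RB x)"
    and "a \<in> carrier (RX x) \<Longrightarrow> b \<in> carrier (RX x) \<Longrightarrow> \<sigma> x (a \<oplus>\<^bsub>RX x\<^esub> b) = \<sigma> x a \<oplus>\<^bsub>RB x\<^esub> \<sigma> x b"
    and "a \<in> carrier (RX x) \<Longrightarrow> b \<in> carrier (RX x) \<Longrightarrow> \<sigma> x (a \<otimes>\<^bsub>RX x\<^esub> b) = \<sigma> x a \<otimes>\<^bsub>RB x\<^esub> \<sigma> x b"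
    and "\<sigma> x \<one>\<^bsub>RX x\<^esub> = \<one>\<^bsub>RB x\<^esub>"
    and "a \<in> carrier (RX x) \<Longrightarrow> res_stalk Y X x (\<sigma> x a) = a"
    and "\<sigma> x (germ TX x (\<lambda>_. c)) = cls x (\<lambda>_. c)"
proof -
  have "stalk (OX Y X) x = RX x" by (simp add: hol_sheaf_def)
  then have h: "\<sigma> x \<in> ring_hom (RX x) (RB x)" and c: "\<sigma> x (germ TX x (\<lambda>_. c)) = cls x (\<lambda>_. c)"
    and s: "\<forall>a\<in>carrier (RX x). res_stalk Y X x (\<sigma> x a) = a" for c
    using assms unfolding retraction_pullback_def by auto
  show "a \<in> carrier (RX x) \<Longrightarrow> \<sigma> x a \<in> carrier (RB x)" by (rule ring_hom_closed[OF h])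
  show "a \<in> carrier (RX x) \<Longrightarrow> b \<in> carrier (RX x) \<Longrightarrow> \<sigma> x (a \<oplus>\<^bsub>RX x\<^esub> b) = \<sigma> x a \<oplus>\<^bsub>RB x\<^esub> \<sigma> x b"
    by (rule ring_hom_add[OF h])
  show "a \<in> carrier (RX x) \<Longrightarrow> b \<in> carrier (RX x) \<Longrightarrow> \<sigma> x (a \<otimes>\<^bsub>RX x\<^esub> b) = \<sigma> x a \<otimes>\<^bsub>RB x\<^esub> \<sigma> x b"
    by (rule ring_hom_mult[OF h])
  show "\<sigma> x \<one>\<^bsub>RX x\<^esub> = \<one>\<^bsub>RB x\<^esub>" by (rule ring_hom_one[OF h])
  show "a \<in> carrier (RX x) \<Longrightarrow> res_stalk Y X x (\<sigma> x a) = a" by (rule bspec[OF s])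
  show "\<sigma> x (germ TX x (\<lambda>_. c)) = cls x (\<lambda>_. c)" by (rule c)
qed

text \<open>The scalar action uses an arbitrary lift, which need not respect sums and products. It
  may be replaced by the lift \<sigma> a, and since \<sigma> is a ring homomorphism, the module laws
  become ring laws in the stalk of \<open>OXbar\<close>.\<close>

lemma N_module:
  assumes \<sigma>: "retraction_pullback Y X \<sigma>" and x: "x \<in> X"
  shows "module (RX x) (NX x)"
proof -
  interpret RX: cring "RX x" by (rule hol_germs_cring[OF xX[OF x]])
  interpret RB: cring "RB x" by (rule RB_cring[OF x])
  note N = N_iff_res[OF x] and res = res_add[OF x] res_uminus[OF x] res_mult[OF x] and \<sigma>x = retractionD[OF \<sigma> x]
  have sm: "a \<odot>\<^bsub>NX x\<^esub> u = \<sigma> x a \<otimes>\<^bsub>RB x\<^esub> u" if "a \<in> carrier (RX x)" "u \<in> carrier (NX x)" for a u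
    using N_smult[OF x \<sigma>x(1)[OF that(1)] that(2)] by (simp add: \<sigma>x(5)[OF that(1)])
  have add: "u \<oplus>\<^bsub>RB x\<^esub> v \<in> carrier (NX x)" if "u \<in> carrier (NX x)" "v \<in> carrier (NX x)" for u v
    using that unfolding N by (simp add: res)
  have mult: "b \<otimes>\<^bsub>RB x\<^esub> u \<in> carrier (NX x)" if "b \<in> carrier (RB x)" "u \<in> carrier (NX x)" for b u
    using that unfolding N by (simp add: res res_closed[OF x])
  have zero: "\<zero>\<^bsub>RB x\<^esub> \<in> carrier (NX x)"
  proof -
    have "res_stalk Y X x \<zero>\<^bsub>RB x\<^esub> \<oplus>\<^bsub>RX x\<^esub> res_stalk Y X x \<zero>\<^bsub>RB x\<^esub> = res_stalk Y X x \<zero>\<^bsub>RB x\<^esub>"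
      by (subst res(1)[symmetric]) simp_all
    then show ?thesis unfolding N using res_closed[OF x RB.zero_closed] by (simp add: RX.add.r_cancel_one)
  qed
  have sub: "u \<in> carrier (RB x)" if "u \<in> carrier (NX x)" for u using that unfolding N by simp
  show ?thesis
  proof (rule moduleI)
    show "cring (RX x)" by (rule RX.is_cring)
    show "abelian_group (NX x)"
    proof (rule abelian_groupI, unfold N_ops[OF x])
      fix u assume u: "u \<in> carrier (NX x)"
      show "\<exists>v\<in>carrier (NX x). v \<oplus>\<^bsub>RB x\<^esub> u = \<zero>\<^bsub>RB x\<^esub>"
        using u unfolding N by (intro bexI[of _ "\<ominus>\<^bsub>RB x\<^esub> u"]) (simp_all add: res RB.l_neg N)
    qed (simp_all add: add zero sub RB.a_ac)
  next
    fix a u assume "a \<in> carrier (RX x)" "u \<in> carrier (NX x)"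
    then show "a \<odot>\<^bsub>NX x\<^esub> u \<in> carrier (NX x)" by (simp add: sm mult \<sigma>x)
  qed (simp_all add: sm mult add \<sigma>x sub N_ops[OF x] RB.l_distr RB.r_distr RB.m_assoc)
qed

lemma sec_N_iff:
  "is_sec (conormal Y X) U s \<longleftrightarrow> (\<forall>x\<in>U. \<exists>V f. x \<in> V \<and> V \<inter> X \<subseteq> U \<and> holfun Y V f \<and> (\<forall>y\<in>V \<inter> X. f y = 0) \<and>
     (\<forall>y\<in>V \<inter> X. s y = cls y f))"
  by (simp add: conormal_def)

lemma sec_B_iff:
  "is_sec (OXbar Y X) U s \<longleftrightarrow> (\<forall>x\<in>U. \<exists>V f. x \<in> V \<and> V \<inter> X \<subseteq> U \<and> holfun Y V f \<and> (\<forall>y\<in>V \<inter> X. s y = cls y f))"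
  by (simp add: OXbar_def)

lemma sec_O_iff:
  "is_sec (OX Y X) U s \<longleftrightarrow> (\<forall>x\<in>U. \<exists>V f. x \<in> V \<and> V \<subseteq> U \<and> holfun (submfd Y X) V f \<and> (\<forall>y\<in>V. s y = germ TX y f))"
  by (simp add: hol_sheaf_def)

lemma stalk_OX: "stalk (OX Y X) = RX"
  by (simp add: hol_sheaf_def)

lemma sec_O_germ: "holfun (submfd Y X) V f \<Longrightarrow> is_sec (OX Y X) V (\<lambda>y. germ TX y f)"
  unfolding sec_O_iff by (intro ballI exI[of _ V] exI[of _ f]) simp

lemma sec_O_closed: "is_sec (OX Y X) U s \<Longrightarrow> x \<in> U \<Longrightarrow> s x \<in> carrier (RX x)"
  unfolding sec_O_iff by (drule bspec, assumption, elim exE conjE) (simp add: germ_closed)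

lemma sec_O_mult:
  assumes s: "is_sec (OX Y X) U s" and t: "is_sec (OX Y X) U t" and U: "openin TX U"
  shows "is_sec (OX Y X) U (\<lambda>x. s x \<otimes>\<^bsub>RX x\<^esub> t x)"
  unfolding sec_O_iff
proof
  fix x assume x: "x \<in> U"
  obtain V f where V: "x \<in> V" "V \<subseteq> U" "holfun (submfd Y X) V f" "\<forall>y\<in>V. s y = germ TX y f"
    using bspec[OF s[unfolded sec_O_iff] x] by (elim exE conjE)
  obtain W g where W: "x \<in> W" "W \<subseteq> U" "holfun (submfd Y X) W g" "\<forall>y\<in>W. t y = germ TX y g"
    using bspec[OF t[unfolded sec_O_iff] x] by (elim exE conjE)
  have h: "holfun (submfd Y X) (V \<inter> W) (\<lambda>y. f y * g y)"
    by (intro holfun_mult holfun_Int holfun_open[OF V(3)] holfun_open[OF W(3)] V W)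
  have "y \<in> topspace TX" if "y \<in> V" for y using holfun_open[OF V(3)] that openin_subset by blast
  then show "\<exists>V f. x \<in> V \<and> V \<subseteq> U \<and> holfun (submfd Y X) V f \<and> (\<forall>y\<in>V. s y \<otimes>\<^bsub>RX y\<^esub> t y = germ TX y f)"
    by (intro exI[of _ "V \<inter> W"] exI[of _ "\<lambda>y. f y * g y"] conjI h)
      (use V W in \<open>auto simp only: hol_germs_ops\<close>)
qed

lemma conormal_module_sheaf:
  assumes \<sigma>: "retraction_pullback Y X \<sigma>"
  shows "module_sheaf TX (OX Y X) (conormal Y X)"
proof (rule module_sheaf.intro, unfold stalk_OX)
  show "module (RX x) (NX x)" if "x \<in> topspace TX" for x
    using N_module[OF \<sigma>] that by (simp add: topspace_TX)
next
  fix U s x assume U: "openin TX U" and s: "is_sec (OX Y X) U s" and x: "x \<in> U"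
  show "s x \<in> carrier (RX x)" by (rule sec_O_closed[OF s x])
next
  fix U s x assume U: "openin TX U" and s: "is_sec (conormal Y X) U s" and x: "x \<in> U"
  have xX: "x \<in> X" using U x openin_subset topspace_TX by blast
  obtain V f where V: "x \<in> V" "V \<inter> X \<subseteq> U" "holfun Y V f" "\<forall>y\<in>V \<inter> X. f y = 0" "\<forall>y\<in>V \<inter> X. s y = cls y f"
    using bspec[OF s[unfolded sec_N_iff] x] by (elim exE conjE)
  show "s x \<in> carrier (NX x)" unfolding N_carrier[OF xX]
    by (rule exI[of _ f], rule exI[of _ V]) (use V xX in simp)
next
  fix U V s assume U: "openin TX U" and s: "is_sec (OX Y X) U s" and V: "openin TX V" "V \<subseteq> U"
  show "is_sec (OX Y X) V s" unfolding sec_O_iff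
  proof
    fix x assume x: "x \<in> V"
    obtain W f where W: "x \<in> W" "W \<subseteq> U" "holfun (submfd Y X) W f" "\<forall>y\<in>W. s y = germ TX y f"
      using bspec[OF s[unfolded sec_O_iff] subsetD[OF V(2) x]] by (elim exE conjE)
    show "\<exists>V' f. x \<in> V' \<and> V' \<subseteq> V \<and> holfun (submfd Y X) V' f \<and> (\<forall>y\<in>V'. s y = germ TX y f)"
      by (rule exI[of _ "W \<inter> V"], rule exI[of _ f]) (use W V x holfun_Int(1)[OF W(3) V(1)] in simp)
  qed
next
  fix U V s assume U: "openin TX U" and s: "is_sec (conormal Y X) U s" and V: "openin TX V" "V \<subseteq> U"
  show "is_sec (conormal Y X) V s" unfolding sec_N_iff
  proof
    fix x assume x: "x \<in> V"
    obtain W f where W: "x \<in> W" "W \<inter> X \<subseteq> U" "holfun Y W f" "\<forall>y\<in>W \<inter> X. f y = 0" "\<forall>y\<in>W \<inter> X. s y = cls y f"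
      using bspec[OF s[unfolded sec_N_iff] subsetD[OF V(2) x]] by (elim exE conjE)
    obtain V' where V': "openin (mtop Y) V'" "V = V' \<inter> X" using V(1) unfolding openin_TX by (elim exE conjE)
    show "\<exists>V' f. x \<in> V' \<and> V' \<inter> X \<subseteq> V \<and> holfun Y V' f \<and> (\<forall>y\<in>V' \<inter> X. f y = 0) \<and> (\<forall>y\<in>V' \<inter> X. s y = cls y f)"
      by (rule exI[of _ "W \<inter> V'"], rule exI[of _ f]) (use W V' x holfun_Int(1)[OF W(3) V'(1)] in auto)
  qed
next
  fix U assume U: "openin TX U"
  have "y \<in> topspace TX" if "y \<in> U" for y using U that openin_subset by blast
  then show "is_sec (OX Y X) U (\<lambda>x. \<one>\<^bsub>RX x\<^esub>)" unfolding sec_O_iff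
    by (intro ballI exI[of _ U] exI[of _ "\<lambda>_. 1"]) (simp add: hol_germs_ops holfun_const U)
next
  fix U s t assume U: "openin TX U" and s: "is_sec (OX Y X) U s" and t: "is_sec (OX Y X) U t"
  show "is_sec (OX Y X) U (\<lambda>x. s x \<otimes>\<^bsub>RX x\<^esub> t x)" by (rule sec_O_mult[OF s t U])
next
  fix U s assume U: "openin TX U" and s: "is_sec (OX Y X) U s"
  show "is_sec (OX Y X) U (\<lambda>x. \<ominus>\<^bsub>RX x\<^esub> s x)" unfolding sec_O_iff
  proof
    fix x assume x: "x \<in> U"
    obtain W f where W: "x \<in> W" "W \<subseteq> U" "holfun (submfd Y X) W f" "\<forall>y\<in>W. s y = germ TX y f"
      using bspec[OF s[unfolded sec_O_iff] x] by (elim exE conjE)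
    show "\<exists>V' f. x \<in> V' \<and> V' \<subseteq> U \<and> holfun (submfd Y X) V' f \<and> (\<forall>y\<in>V'. \<ominus>\<^bsub>RX y\<^esub> s y = germ TX y f)"
      by (rule exI[of _ W], rule exI[of _ "\<lambda>y. - f y"]) (use W holfun_uminus[OF W(3)] hol_germs_uminus[OF W(3)] in simp)
  qed
qed

text \<open>As \<sigma> is a section of the restriction, a function \<open>F\<close> that represents
  the image of \<open>s\<close> near \<open>x\<close> also restricts to \<open>s\<close>. Sections
  over \<open>X\<close> thus acquire lifts to \<open>Y\<close> that are valid on a whole
  neighbourhood.\<close>

lemma retraction_lift:
  assumes \<sigma>: "retraction_pullback Y X \<sigma>" and U: "openin TX U" and s: "is_sec (OX Y X) U s" and x: "x \<in> U"
  shows "\<exists>V F. x \<in> V \<and> V \<inter> X \<subseteq> U \<and> holfun Y V F \<and> (\<forall>y\<in>V \<inter> X. \<sigma> y (s y) = cls y F) \<and>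
    (\<forall>y\<in>V \<inter> X. s y = germ TX y F)"
proof -
  have "is_sec (OXbar Y X) U (\<lambda>y. \<sigma> y (s y))"
    using \<sigma> U s unfolding retraction_pullback_def sheaf_map_def by simp
  from bspec[OF this[unfolded sec_B_iff] x] obtain V F where V: "x \<in> V" "V \<inter> X \<subseteq> U" "holfun Y V F"
    "\<forall>y\<in>V \<inter> X. \<sigma> y (s y) = cls y F" by (elim exE conjE)
  have "s y = germ TX y F" if y: "y \<in> V \<inter> X" for y
  proof -
    have yU: "y \<in> U" "y \<in> X" "y \<in> V" using y V(2) by auto
    have "s y = res_stalk Y X y (\<sigma> y (s y))"
      by (rule retractionD(5)[OF \<sigma> yU(2) sec_O_closed[OF s yU(1)], symmetric])
    also have "\<dots> = res_stalk Y X y (cls y F)" by (rule arg_cong[OF bspec[OF V(4) y]])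
    also have "\<dots> = germ TX y F" by (rule res_cls[OF yU(2) V(3) yU(3)])
    finally show ?thesis .
  qed
  then show ?thesis using V by (intro exI[of _ V] exI[of _ F] conjI ballI) simp_all
qed

lemma N_smult_lift:
  assumes "retraction_pullback Y X \<sigma>" "x \<in> X" "a \<in> carrier (RX x)" "u \<in> carrier (NX x)"
  shows "a \<odot>\<^bsub>NX x\<^esub> u = \<sigma> x a \<otimes>\<^bsub>RB x\<^esub> u"
  using N_smult[OF assms(2) retractionD(1)[OF assms(1-3)] assms(4)] by (simp add: retractionD(5)[OF assms(1-3)])

text \<open>The scalar is lifted by \<sigma>, and the product is represented by a product of
  functions on \<open>Y\<close>.\<close>

lemma sec_N_smult:
  assumes \<sigma>: "retraction_pullback Y X \<sigma>" and U: "openin TX U" and a: "is_sec (OX Y X) U a" and u: "is_sec (conormal Y X) U u"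
  shows "is_sec (conormal Y X) U (\<lambda>x. a x \<odot>\<^bsub>NX x\<^esub> u x)"
  unfolding sec_N_iff
proof
  fix x assume x: "x \<in> U"
  obtain V F where V: "x \<in> V" "V \<inter> X \<subseteq> U" "holfun Y V F" "\<forall>y\<in>V \<inter> X. \<sigma> y (a y) = cls y F"
    using retraction_lift[OF \<sigma> U a x] by (elim exE conjE)
  obtain W f where W: "x \<in> W" "W \<inter> X \<subseteq> U" "holfun Y W f" "\<forall>y\<in>W \<inter> X. f y = 0" "\<forall>y\<in>W \<inter> X. u y = cls y f"
    using bspec[OF u[unfolded sec_N_iff] x] by (elim exE conjE)
  have h: "holfun Y (V \<inter> W) (\<lambda>y. F y * f y)"
    by (intro holfun_mult holfun_Int holfun_open[OF V(3)] holfun_open[OF W(3)] V W)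
  have "a y \<odot>\<^bsub>NX y\<^esub> u y = cls y (\<lambda>y. F y * f y)" if y: "y \<in> V \<inter> W \<inter> X" for y
  proof -
    have yU: "y \<in> U" "y \<in> X" using y V(2) by auto
    have uy: "u y \<in> carrier (NX y)"
      by (rule module_sheaf.sec_F_closed[OF conormal_module_sheaf[OF \<sigma>] U u yU(1)])
    have "\<sigma> y (a y) = cls y F" "u y = cls y f" using V(4) W(5) y by simp_all
    then show ?thesis using N_smult_lift[OF \<sigma> yU(2) sec_O_closed[OF a yU(1)] uy] cls_mult[OF yU(2) V(3) _ W(3)] y by simp
  qed
  then show "\<exists>V f. x \<in> V \<and> V \<inter> X \<subseteq> U \<and> holfun Y V f \<and> (\<forall>y\<in>V \<inter> X. f y = 0) \<and> (\<forall>y\<in>V \<inter> X. a y \<odot>\<^bsub>NX y\<^esub> u y = cls y f)"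
    by (intro exI[of _ "V \<inter> W"] exI[of _ "\<lambda>y. F y * f y"]) (use V(1,2) W(1,4) h in auto)
qed

lemma sec_N_add:
  assumes u: "is_sec (conormal Y X) U u" and v: "is_sec (conormal Y X) U v"
  shows "is_sec (conormal Y X) U (\<lambda>x. u x \<oplus>\<^bsub>NX x\<^esub> v x)"
  unfolding sec_N_iff
proof
  fix x assume x: "x \<in> U"
  obtain V F where V: "x \<in> V" "V \<inter> X \<subseteq> U" "holfun Y V F" "\<forall>y\<in>V \<inter> X. F y = 0" "\<forall>y\<in>V \<inter> X. u y = cls y F"
    using bspec[OF u[unfolded sec_N_iff] x] by (elim exE conjE)
  obtain W f where W: "x \<in> W" "W \<inter> X \<subseteq> U" "holfun Y W f" "\<forall>y\<in>W \<inter> X. f y = 0" "\<forall>y\<in>W \<inter> X. v y = cls y f"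
    using bspec[OF v[unfolded sec_N_iff] x] by (elim exE conjE)
  have h: "holfun Y (V \<inter> W) (\<lambda>y. F y + f y)"
    by (intro holfun_add holfun_Int holfun_open[OF V(3)] holfun_open[OF W(3)] V W)
  have "u y \<oplus>\<^bsub>NX y\<^esub> v y = cls y (\<lambda>y. F y + f y)" if y: "y \<in> V \<inter> W \<inter> X" for y
    using cls_add[of y V F W f] V(3,5) W(3,5) y by (simp add: N_ops)
  then show "\<exists>V f. x \<in> V \<and> V \<inter> X \<subseteq> U \<and> holfun Y V f \<and> (\<forall>y\<in>V \<inter> X. f y = 0) \<and> (\<forall>y\<in>V \<inter> X. u y \<oplus>\<^bsub>NX y\<^esub> v y = cls y f)"
    by (intro exI[of _ "V \<inter> W"] exI[of _ "\<lambda>y. F y + f y"]) (use V(1,2,4) W(1,4) h in auto)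
qed

end

section \<open>The difference of two retractions\<close>

locale two_retractions = closed_pair Y X r for Y :: "('y, 'n::finite) cmfd" and X r +
  fixes \<sigma> \<sigma>'
  assumes \<sigma>: "retraction_pullback Y X \<sigma>" and \<sigma>': "retraction_pullback Y X \<sigma>'"
begin

definition \<delta> :: "'y \<Rightarrow> 'y fgerm \<Rightarrow> 'y fgerm set" where
  "\<delta> x a = \<sigma>' x a \<ominus>\<^bsub>RB x\<^esub> \<sigma> x a"

sublocale N: module_sheaf TX "OX Y X" "conormal Y X"
  by (rule conormal_module_sheaf[OF \<sigma>])

lemma \<delta>_closed: "x \<in> X \<Longrightarrow> a \<in> carrier (RX x) \<Longrightarrow> \<delta> x a \<in> carrier (NX x)"
proof -
  assume x: "x \<in> X" and a: "a \<in> carrier (RX x)"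
  interpret RX: cring "RX x" by (rule hol_germs_cring[OF xX[OF x]])
  interpret RB: cring "RB x" by (rule RB_cring[OF x])
  show ?thesis unfolding N_iff_res[OF x] \<delta>_def using a retractionD[OF \<sigma> x] retractionD[OF \<sigma>' x]
    by (simp add: a_minus_def res_add[OF x] res_uminus[OF x] RX.r_neg)
qed

lemma \<delta>_add:
  assumes x: "x \<in> X" and a: "a \<in> carrier (RX x)" and b: "b \<in> carrier (RX x)"
  shows "\<delta> x (a \<oplus>\<^bsub>RX x\<^esub> b) = \<delta> x a \<oplus>\<^bsub>NX x\<^esub> \<delta> x b"
proof -
  interpret RB: cring "RB x" by (rule RB_cring[OF x])
  show ?thesis unfolding \<delta>_def N_ops[OF x] using a b retractionD[OF \<sigma> x] retractionD[OF \<sigma>' x]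
    by (simp add: a_minus_def RB.minus_add RB.a_ac)
qed

text \<open>The difference of \<sigma>' a \<sigma>' b and \<sigma> a \<sigma> b is \<sigma>' a
  (\<sigma>' b - \<sigma> b) + \<sigma> b (\<sigma>' a - \<sigma> a). Here \<open>a\<close> is
  lifted by \<sigma>' and \<open>b\<close> by \<sigma>, which is allowed because all lifts act in
  the same way on conormal germs.\<close>

lemma \<delta>_mult:
  assumes x: "x \<in> X" and a: "a \<in> carrier (RX x)" and b: "b \<in> carrier (RX x)"
  shows "\<delta> x (a \<otimes>\<^bsub>RX x\<^esub> b) = a \<odot>\<^bsub>NX x\<^esub> \<delta> x b \<oplus>\<^bsub>NX x\<^esub> b \<odot>\<^bsub>NX x\<^esub> \<delta> x a"
proof -
  interpret RB: cring "RB x" by (rule RB_cring[OF x])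
  have split: "p \<otimes>\<^bsub>RB x\<^esub> q \<ominus>\<^bsub>RB x\<^esub> p' \<otimes>\<^bsub>RB x\<^esub> q' =
      p \<otimes>\<^bsub>RB x\<^esub> (q \<ominus>\<^bsub>RB x\<^esub> q') \<oplus>\<^bsub>RB x\<^esub> q' \<otimes>\<^bsub>RB x\<^esub> (p \<ominus>\<^bsub>RB x\<^esub> p')"
    if "p \<in> carrier (RB x)" "q \<in> carrier (RB x)" "p' \<in> carrier (RB x)" "q' \<in> carrier (RB x)" for p q p' q'
    using that by (simp add: a_minus_def RB.r_distr RB.r_minus RB.a_assoc RB.m_comm[of q'] RB.r_neg1)
  note r = retractionD[OF \<sigma> x] retractionD[OF \<sigma>' x]
  show ?thesis
    unfolding N_smult_lift[OF \<sigma>' x a \<delta>_closed[OF x b]] N_smult_lift[OF \<sigma> x b \<delta>_closed[OF x a]] N_ops[OF x]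
    unfolding \<delta>_def r(3)[OF a b] r(9)[OF a b] by (rule split[OF r(7)[OF a] r(7)[OF b] r(1)[OF a] r(1)[OF b]])
qed

text \<open>Near a point the two lifts of \<open>s\<close> are represented by functions
  \<open>F\<close> and \<open>G\<close> with the same restriction, so \<open>G - F\<close> vanishes
  on \<open>X\<close> and represents a conormal section.\<close>

lemma \<delta>_sheaf_map: "sheaf_map TX (OX Y X) (conormal Y X) \<delta>"
  unfolding sheaf_map_def sec_N_iff
proof (intro allI impI ballI)
  fix U s x assume U: "openin TX U" and s: "is_sec (OX Y X) U s" and x: "x \<in> U"
  obtain V F where V: "x \<in> V" "V \<inter> X \<subseteq> U" "holfun Y V F" "\<forall>y\<in>V \<inter> X. \<sigma> y (s y) = cls y F"
    "\<forall>y\<in>V \<inter> X. s y = germ TX y F"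
    using retraction_lift[OF \<sigma> U s x] by (elim exE conjE)
  obtain W G where W: "x \<in> W" "W \<inter> X \<subseteq> U" "holfun Y W G" "\<forall>y\<in>W \<inter> X. \<sigma>' y (s y) = cls y G"
    "\<forall>y\<in>W \<inter> X. s y = germ TX y G"
    using retraction_lift[OF \<sigma>' U s x] by (elim exE conjE)
  have h: "holfun Y (V \<inter> W) (\<lambda>y. G y - F y)"
    by (intro holfun_diff holfun_Int holfun_open[OF V(3)] holfun_open[OF W(3)] V W)
  have c: "\<delta> y (s y) = cls y (\<lambda>y. G y - F y)" if y: "y \<in> V \<inter> W \<inter> X" for y
    unfolding \<delta>_def using V(4) W(4) cls_minus[of y W G V F] V(3) W(3) y by simp
  have z: "G y - F y = 0" if y: "y \<in> V \<inter> W \<inter> X" for y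
    using germ_value[of y TX G F] bspec[OF V(5), of y] bspec[OF W(5), of y] y by (simp add: topspace_TX)
  show "\<exists>V f. x \<in> V \<and> V \<inter> X \<subseteq> U \<and> holfun Y V f \<and> (\<forall>y\<in>V \<inter> X. f y = 0) \<and> (\<forall>y\<in>V \<inter> X. \<delta> y (s y) = cls y f)"
    by (intro exI[of _ "V \<inter> W"] exI[of _ "\<lambda>y. G y - F y"] conjI h ballI)
      (use V(1,2) W(1) c z in blast)+
qed

end

context two_retractions
begin

abbreviation "\<Lambda> q x \<equiv> ext_power (RX x) (NX x) q"

lemma stalk_extN: "stalk (extN Y X q) x = \<Lambda> q x"
  by (simp add: ext_sheaf_def stalk_OX)

lemma ext_module: "x \<in> X \<Longrightarrow> module (RX x) (\<Lambda> q x)"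
  by (rule ext_power_module[OF N_module[OF \<sigma>]])

lemma AK_stalk_simps:
  "carrier (AK_stalk Y X \<tau> (Suc p) x) = carrier (\<Lambda> (Suc p) x) \<times> carrier (\<Lambda> p x)"
  "(I, J) \<oplus>\<^bsub>AK_stalk Y X \<tau> (Suc p) x\<^esub> (I', J') = (I \<oplus>\<^bsub>\<Lambda> (Suc p) x\<^esub> I', J \<oplus>\<^bsub>\<Lambda> p x\<^esub> J')"
  "\<zero>\<^bsub>AK_stalk Y X \<tau> (Suc p) x\<^esub> = (\<zero>\<^bsub>\<Lambda> (Suc p) x\<^esub>, \<zero>\<^bsub>\<Lambda> p x\<^esub>)"
  "b \<odot>\<^bsub>AK_stalk Y X \<tau> (Suc p) x\<^esub> (I, J) =
     (res_stalk Y X x b \<odot>\<^bsub>\<Lambda> (Suc p) x\<^esub> I \<oplus>\<^bsub>\<Lambda> (Suc p) x\<^esub>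
        wedge_left (RX x) (NX x) p (b \<ominus>\<^bsub>RB x\<^esub> \<tau> x (res_stalk Y X x b)) J,
      res_stalk Y X x b \<odot>\<^bsub>\<Lambda> p x\<^esub> J)"
  by (simp_all add: AK_stalk_def Let_def stalk_extN stalk_OX)

lemma lift_part_closed:
  assumes \<tau>: "retraction_pullback Y X \<tau>" and x: "x \<in> X" and b: "b \<in> carrier (RB x)"
  shows "b \<ominus>\<^bsub>RB x\<^esub> \<tau> x (res_stalk Y X x b) \<in> carrier (NX x)"
proof -
  interpret RX: cring "RX x" by (rule hol_germs_cring[OF xX[OF x]])
  interpret RB: cring "RB x" by (rule RB_cring[OF x])
  note res = res_closed[OF x b]
  show ?thesis unfolding N_iff_res[OF x] using b res retractionD[OF \<tau> x]
    by (simp add: a_minus_def res_add[OF x] res_uminus[OF x] RX.r_neg)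
qed

lemma AK_closed:
  assumes \<tau>: "retraction_pullback Y X \<tau>" and x: "x \<in> X"
  shows "u \<in> carrier (AK_stalk Y X \<tau> (Suc p) x) \<Longrightarrow> v \<in> carrier (AK_stalk Y X \<tau> (Suc p) x) \<Longrightarrow>
      u \<oplus>\<^bsub>AK_stalk Y X \<tau> (Suc p) x\<^esub> v \<in> carrier (AK_stalk Y X \<tau> (Suc p) x)"
    and "b \<in> carrier (RB x) \<Longrightarrow> u \<in> carrier (AK_stalk Y X \<tau> (Suc p) x) \<Longrightarrow>
      b \<odot>\<^bsub>AK_stalk Y X \<tau> (Suc p) x\<^esub> u \<in> carrier (AK_stalk Y X \<tau> (Suc p) x)"
proof -
  interpret L: module "RX x" "\<Lambda> p x" by (rule ext_module[OF x])
  interpret L': module "RX x" "\<Lambda> (Suc p) x" by (rule ext_module[OF x])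
  show "u \<in> carrier (AK_stalk Y X \<tau> (Suc p) x) \<Longrightarrow> v \<in> carrier (AK_stalk Y X \<tau> (Suc p) x) \<Longrightarrow>
      u \<oplus>\<^bsub>AK_stalk Y X \<tau> (Suc p) x\<^esub> v \<in> carrier (AK_stalk Y X \<tau> (Suc p) x)"
    by (cases u; cases v) (simp add: AK_stalk_simps)
  show "b \<in> carrier (RB x) \<Longrightarrow> u \<in> carrier (AK_stalk Y X \<tau> (Suc p) x) \<Longrightarrow>
      b \<odot>\<^bsub>AK_stalk Y X \<tau> (Suc p) x\<^esub> u \<in> carrier (AK_stalk Y X \<tau> (Suc p) x)"
    by (cases u) (simp add: AK_stalk_simps res_closed[OF x] wedge_left_closed[OF N_module[OF \<sigma> x]]
        lift_part_closed[OF \<tau> x])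
qed

text \<open>The differentials are multiples formed in these groups, and the commutation of a
  homomorphism with multiples relies on the group laws.\<close>

lemma AK_abelian_group:
  assumes x: "x \<in> X"
  shows "abelian_group (AK_stalk Y X \<tau> (Suc p) x)"
proof -
  interpret L: module "RX x" "\<Lambda> p x" by (rule ext_module[OF x])
  interpret L': module "RX x" "\<Lambda> (Suc p) x" by (rule ext_module[OF x])
  show ?thesis
  proof (rule abelian_groupI)
    fix u assume "u \<in> carrier (AK_stalk Y X \<tau> (Suc p) x)"
    then show "\<exists>v\<in>carrier (AK_stalk Y X \<tau> (Suc p) x). v \<oplus>\<^bsub>AK_stalk Y X \<tau> (Suc p) x\<^esub> u = \<zero>\<^bsub>AK_stalk Y X \<tau> (Suc p) x\<^esub>"
      by (intro bexI[of _ "(\<ominus>\<^bsub>\<Lambda> (Suc p) x\<^esub> fst u, \<ominus>\<^bsub>\<Lambda> p x\<^esub> snd u)"]; cases u)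
        (simp_all add: AK_stalk_simps L.M.l_neg L'.M.l_neg)
    show "\<zero>\<^bsub>AK_stalk Y X \<tau> (Suc p) x\<^esub> \<oplus>\<^bsub>AK_stalk Y X \<tau> (Suc p) x\<^esub> u = u"
      using \<open>u \<in> carrier _\<close> by (cases u) (simp add: AK_stalk_simps)
  next
    fix u v assume "u \<in> carrier (AK_stalk Y X \<tau> (Suc p) x)" "v \<in> carrier (AK_stalk Y X \<tau> (Suc p) x)"
    then show "u \<oplus>\<^bsub>AK_stalk Y X \<tau> (Suc p) x\<^esub> v \<in> carrier (AK_stalk Y X \<tau> (Suc p) x)"
      "u \<oplus>\<^bsub>AK_stalk Y X \<tau> (Suc p) x\<^esub> v = v \<oplus>\<^bsub>AK_stalk Y X \<tau> (Suc p) x\<^esub> u"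
      by (cases u; cases v; simp add: AK_stalk_simps L.M.a_comm L'.M.a_comm)+
    fix w assume "w \<in> carrier (AK_stalk Y X \<tau> (Suc p) x)"
    with \<open>u \<in> carrier _\<close> \<open>v \<in> carrier _\<close>
    show "u \<oplus>\<^bsub>AK_stalk Y X \<tau> (Suc p) x\<^esub> v \<oplus>\<^bsub>AK_stalk Y X \<tau> (Suc p) x\<^esub> w =
      u \<oplus>\<^bsub>AK_stalk Y X \<tau> (Suc p) x\<^esub> (v \<oplus>\<^bsub>AK_stalk Y X \<tau> (Suc p) x\<^esub> w)"
      by (cases u; cases v; cases w) (simp add: AK_stalk_simps L.M.a_assoc L'.M.a_assoc)
  qed (simp add: AK_stalk_simps)
qed

text \<open>The retraction enters only the scalar action. In index 0 the isomorphism is the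
  identity, and this identifies the multiples formed in the two stalks.\<close>

lemma add_monoid_AK: "add_monoid (AK_stalk Y X \<sigma> q x) = add_monoid (AK_stalk Y X \<sigma>' q x)"
  by (simp add: AK_stalk_def Let_def)

lemma AK_zero_eq: "AK Y X \<sigma> 0 = AK Y X \<sigma>' 0"
proof -
  have "AK_stalk Y X \<sigma> 0 = AK_stalk Y X \<sigma>' 0" by (rule ext) (simp add: AK_stalk_def Let_def)
  then show ?thesis by (simp add: AK_def)
qed

section \<open>The isomorphisms attached to a map E\<close>

context
  fixes E D
  assumes E_closed: "\<And>x u. x \<in> X \<Longrightarrow> u \<in> carrier (NX x) \<Longrightarrow> E x u \<in> carrier (\<Lambda> 2 x)"
    and E_add: "\<And>x u v. x \<in> X \<Longrightarrow> u \<in> carrier (NX x) \<Longrightarrow> v \<in> carrier (NX x) \<Longrightarrow>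
      E x (u \<oplus>\<^bsub>NX x\<^esub> v) = E x u \<oplus>\<^bsub>\<Lambda> 2 x\<^esub> E x v"
    and E_smult: "\<And>x a u. x \<in> X \<Longrightarrow> a \<in> carrier (RX x) \<Longrightarrow> u \<in> carrier (NX x) \<Longrightarrow>
      E x (a \<odot>\<^bsub>NX x\<^esub> u) = a \<odot>\<^bsub>\<Lambda> 2 x\<^esub> E x u \<oplus>\<^bsub>\<Lambda> 2 x\<^esub> wedge_list (RX x) (NX x) [\<delta> x a, u]"
    and E_sheaf_map: "sheaf_map TX (conormal Y X) (extN Y X 2) E"
  defines "D \<equiv> \<lambda>p x. SOME d. ext_derivation (RX x) (NX x) (\<delta> x) (E x) p d"
begin

lemma D_derivation: "x \<in> X \<Longrightarrow> ext_derivation (RX x) (NX x) (\<delta> x) (E x) p (D p x)"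
proof -
  assume x: "x \<in> X"
  have "\<exists>d. ext_derivation (RX x) (NX x) (\<delta> x) (E x) p d"
    by (rule ext_derivation_exists[OF N_module[OF \<sigma> x]])
      (use x in \<open>simp_all only: \<delta>_closed \<delta>_add \<delta>_mult E_closed E_add E_smult\<close>)
  then show ?thesis unfolding D_def by (rule someI_ex)
qed

lemma D_sheaf_map: "sheaf_map TX (extN Y X p) (extN Y X (Suc p)) (D p)"
  by (rule N.esec_derivation[OF E_sheaf_map \<delta>_sheaf_map]) (simp add: topspace_TX stalk_OX D_derivation)

text \<open>For \<open>q = 0\<close> the second component is a placeholder, and \<open>q - 1\<close>
  is truncated to 0, so that \<open>D 0\<close> has values in degree one instead of degree zero;
  hence the case distinction.\<close>

definition shift :: "nat \<Rightarrow> 'y \<Rightarrow> 'y ext \<times> 'y ext \<Rightarrow> 'y ext \<times> 'y ext" where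
  "shift q x = (\<lambda>(I, J). if q = 0 then (I, J) else (I \<ominus>\<^bsub>\<Lambda> q x\<^esub> D (q - 1) x J, J))"

definition unshift :: "nat \<Rightarrow> 'y \<Rightarrow> 'y ext \<times> 'y ext \<Rightarrow> 'y ext \<times> 'y ext" where
  "unshift q x = (\<lambda>(I, J). (I \<oplus>\<^bsub>\<Lambda> q x\<^esub> D (q - 1) x J, J))"

text \<open>With a the restriction of b, the two retractions decompose b as i + \<sigma> a and as i'
  + \<sigma>' a, so that i = i' + \<delta> a. The surplus \<delta> a \<and> J on the source side is
  exactly the surplus in D (a J), which is subtracted.\<close>

lemma shift_hom:
  assumes x: "x \<in> X"
  shows "shift (Suc p) x \<in> mod_hom (RB x) (AK_stalk Y X \<sigma> (Suc p) x) (AK_stalk Y X \<sigma>' (Suc p) x)"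
proof -
  interpret RB: cring "RB x" by (rule RB_cring[OF x])
  interpret N: module "RX x" "NX x" by (rule N_module[OF \<sigma> x])
  interpret L: module "RX x" "\<Lambda> p x" by (rule ext_module[OF x])
  interpret L': module "RX x" "\<Lambda> (Suc p) x" by (rule ext_module[OF x])
  note Nm = N_module[OF \<sigma> x]
  note d = ext_derivationD[OF D_derivation[OF x, of p]]
  show ?thesis
  proof (rule mod_homI)
    fix u assume u: "u \<in> carrier (AK_stalk Y X \<sigma> (Suc p) x)"
    then show "shift (Suc p) x u \<in> carrier (AK_stalk Y X \<sigma>' (Suc p) x)"
      by (cases u) (simp add: AK_stalk_simps shift_def d a_minus_def)
    obtain I J where IJ: "u = (I, J)" "I \<in> carrier (\<Lambda> (Suc p) x)" "J \<in> carrier (\<Lambda> p x)"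
      using u by (cases u) (simp add: AK_stalk_simps)
    { fix v assume v: "v \<in> carrier (AK_stalk Y X \<sigma> (Suc p) x)"
      show "shift (Suc p) x (u \<oplus>\<^bsub>AK_stalk Y X \<sigma> (Suc p) x\<^esub> v) =
        shift (Suc p) x u \<oplus>\<^bsub>AK_stalk Y X \<sigma>' (Suc p) x\<^esub> shift (Suc p) x v"
        using IJ v by (cases v)
          (simp add: AK_stalk_simps shift_def d a_minus_def L'.M.minus_add L'.M.a_ac) }
    { fix b assume b: "b \<in> carrier (RB x)"
      define a where "a = res_stalk Y X x b"
      define i where "i = b \<ominus>\<^bsub>RB x\<^esub> \<sigma> x a"
      define i' where "i' = b \<ominus>\<^bsub>RB x\<^esub> \<sigma>' x a"
      have a: "a \<in> carrier (RX x)" unfolding a_def by (rule res_closed[OF x b])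
      have i: "i' \<in> carrier (NX x)" unfolding i'_def a_def by (rule lift_part_closed[OF \<sigma>' x b])
      have "i = i' \<oplus>\<^bsub>NX x\<^esub> \<delta> x a"
        unfolding i_def i'_def \<delta>_def N_ops[OF x] using b a retractionD(1)[OF \<sigma> x a] retractionD(1)[OF \<sigma>' x a]
        by (simp add: a_minus_def RB.a_assoc RB.r_neg1)
      then have w: "wedge_left (RX x) (NX x) p i J = wedge_left (RX x) (NX x) p i' J \<oplus>\<^bsub>\<Lambda> (Suc p) x\<^esub> wedge_left (RX x) (NX x) p (\<delta> x a) J"
        using wedge_left_add[OF Nm i \<delta>_closed[OF x a] IJ(3)] by (simp only:)
      note c = wedge_left_closed[OF Nm i IJ(3)] wedge_left_closed[OF Nm \<delta>_closed[OF x a] IJ(3)]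
        L'.smult_closed[OF a IJ(2)] L'.smult_closed[OF a d(1)[OF IJ(3)]]
      \<comment> \<open>\<open>C\<close> stands for \<delta> a \<and> J, which occurs once from the
        change of retraction and once, negated, from the Leibniz rule of \<open>D\<close>.\<close>
      have "(A \<oplus>\<^bsub>\<Lambda> (Suc p) x\<^esub> (B \<oplus>\<^bsub>\<Lambda> (Suc p) x\<^esub> C)) \<oplus>\<^bsub>\<Lambda> (Suc p) x\<^esub> (\<ominus>\<^bsub>\<Lambda> (Suc p) x\<^esub> D' \<oplus>\<^bsub>\<Lambda> (Suc p) x\<^esub> \<ominus>\<^bsub>\<Lambda> (Suc p) x\<^esub> C) =
          A \<oplus>\<^bsub>\<Lambda> (Suc p) x\<^esub> \<ominus>\<^bsub>\<Lambda> (Suc p) x\<^esub> D' \<oplus>\<^bsub>\<Lambda> (Suc p) x\<^esub> B"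
        if "A \<in> carrier (\<Lambda> (Suc p) x)" "B \<in> carrier (\<Lambda> (Suc p) x)" "C \<in> carrier (\<Lambda> (Suc p) x)" "D' \<in> carrier (\<Lambda> (Suc p) x)"
        for A B C D'
        using that by (simp add: L'.M.a_ac L'.M.r_neg1 L'.M.r_neg2 L'.M.r_neg L'.M.l_neg)
      note re = this[OF c(3,1,2,4)]
      have 1: "b \<odot>\<^bsub>AK_stalk Y X \<sigma> (Suc p) x\<^esub> u =
          (a \<odot>\<^bsub>\<Lambda> (Suc p) x\<^esub> I \<oplus>\<^bsub>\<Lambda> (Suc p) x\<^esub> wedge_left (RX x) (NX x) p i J, a \<odot>\<^bsub>\<Lambda> p x\<^esub> J)"
        by (simp add: IJ(1) AK_stalk_simps a_def i_def)
      have 2: "shift (Suc p) x u = (I \<ominus>\<^bsub>\<Lambda> (Suc p) x\<^esub> D p x J, J)"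
        by (simp add: IJ(1) shift_def)
      have 3: "b \<odot>\<^bsub>AK_stalk Y X \<sigma>' (Suc p) x\<^esub> (I \<ominus>\<^bsub>\<Lambda> (Suc p) x\<^esub> D p x J, J) =
          (a \<odot>\<^bsub>\<Lambda> (Suc p) x\<^esub> (I \<ominus>\<^bsub>\<Lambda> (Suc p) x\<^esub> D p x J) \<oplus>\<^bsub>\<Lambda> (Suc p) x\<^esub> wedge_left (RX x) (NX x) p i' J, a \<odot>\<^bsub>\<Lambda> p x\<^esub> J)"
        by (simp add: AK_stalk_simps a_def i'_def)
      have 4: "(a \<odot>\<^bsub>\<Lambda> (Suc p) x\<^esub> I \<oplus>\<^bsub>\<Lambda> (Suc p) x\<^esub> wedge_left (RX x) (NX x) p i J) \<ominus>\<^bsub>\<Lambda> (Suc p) x\<^esub> D p x (a \<odot>\<^bsub>\<Lambda> p x\<^esub> J) =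
          a \<odot>\<^bsub>\<Lambda> (Suc p) x\<^esub> (I \<ominus>\<^bsub>\<Lambda> (Suc p) x\<^esub> D p x J) \<oplus>\<^bsub>\<Lambda> (Suc p) x\<^esub> wedge_left (RX x) (NX x) p i' J"
        using re a c d(1)[OF IJ(3)] IJ(2)
        by (simp add: w d(3)[OF a IJ(3)] a_minus_def L'.M.minus_add L'.smult_r_distr L'.smult_r_minus)
      show "shift (Suc p) x (b \<odot>\<^bsub>AK_stalk Y X \<sigma> (Suc p) x\<^esub> u) =
        b \<odot>\<^bsub>AK_stalk Y X \<sigma>' (Suc p) x\<^esub> shift (Suc p) x u"
        unfolding 1 2 3 by (simp add: shift_def 4) }
  qed
qed

lemma shift_inverse:
  assumes x: "x \<in> X"
  shows "u \<in> carrier (AK_stalk Y X \<sigma> (Suc p) x) \<Longrightarrow> unshift (Suc p) x (shift (Suc p) x u) = u"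
    and "v \<in> carrier (AK_stalk Y X \<sigma>' (Suc p) x) \<Longrightarrow> shift (Suc p) x (unshift (Suc p) x v) = v"
    and "v \<in> carrier (AK_stalk Y X \<sigma>' (Suc p) x) \<Longrightarrow> unshift (Suc p) x v \<in> carrier (AK_stalk Y X \<sigma> (Suc p) x)"
proof -
  interpret L': module "RX x" "\<Lambda> (Suc p) x" by (rule ext_module[OF x])
  note d = ext_derivationD[OF D_derivation[OF x, of p]]
  show "u \<in> carrier (AK_stalk Y X \<sigma> (Suc p) x) \<Longrightarrow> unshift (Suc p) x (shift (Suc p) x u) = u"
    by (cases u) (simp add: AK_stalk_simps shift_def unshift_def d a_minus_def L'.M.a_assoc L'.M.l_neg)
  show "v \<in> carrier (AK_stalk Y X \<sigma>' (Suc p) x) \<Longrightarrow> shift (Suc p) x (unshift (Suc p) x v) = v"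
    by (cases v) (simp add: AK_stalk_simps shift_def unshift_def d a_minus_def L'.M.a_assoc L'.M.r_neg)
  show "v \<in> carrier (AK_stalk Y X \<sigma>' (Suc p) x) \<Longrightarrow> unshift (Suc p) x v \<in> carrier (AK_stalk Y X \<sigma> (Suc p) x)"
    by (cases v) (simp add: AK_stalk_simps unshift_def d)
qed

text \<open>\<open>D\<close> sends zero to zero. The elements with second component zero contain the
  images of the differentials and of the coaugmentation, so this is what makes \<open>shift\<close>
  commute with both.\<close>

lemma shift_fix:
  assumes x: "x \<in> X" and "I \<in> carrier (\<Lambda> q x)"
  shows "shift q x (I, \<zero>\<^bsub>\<Lambda> (q - 1) x\<^esub>) = (I, \<zero>\<^bsub>\<Lambda> (q - 1) x\<^esub>)"
proof (cases q)
  case (Suc p)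
  interpret L': module "RX x" "\<Lambda> (Suc p) x" by (rule ext_module[OF x])
  show ?thesis using assms(2) ext_derivation_zero[OF N_module[OF \<sigma> x] D_derivation[OF x, of p]]
    by (simp add: Suc shift_def a_minus_def)
qed (simp add: shift_def)

lemma is_sec_AK_Suc:
  "is_sec (AK Y X \<tau> (Suc p)) U s \<longleftrightarrow> is_sec (extN Y X (Suc p)) U (\<lambda>x. fst (s x)) \<and> is_sec (extN Y X p) U (\<lambda>x. snd (s x))"
  by (simp add: AK_def)

lemma stalk_AK: "stalk (AK Y X \<tau> q) x = AK_stalk Y X \<tau> q x"
  by (simp add: AK_def)

text \<open>Sections of \<open>AK\<close> are defined componentwise without reference to the
  retraction, so the point is that \<open>D\<close> preserves sections.\<close>

lemma shift_sheaf_maps: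
  "sheaf_map TX (AK Y X \<sigma> (Suc p)) (AK Y X \<sigma>' (Suc p)) (shift (Suc p))"
  "sheaf_map TX (AK Y X \<sigma>' (Suc p)) (AK Y X \<sigma> (Suc p)) (unshift (Suc p))"
proof -
  have Ds: "is_sec (extN Y X (Suc p)) U (\<lambda>x. D p x (snd (s x)))"
    if "openin TX U" "is_sec (extN Y X p) U (\<lambda>x. snd (s x))" for U and s :: "'y \<Rightarrow> 'y ext \<times> 'y ext"
    using D_sheaf_map that unfolding sheaf_map_def by simp
  show "sheaf_map TX (AK Y X \<sigma> (Suc p)) (AK Y X \<sigma>' (Suc p)) (shift (Suc p))"
    unfolding sheaf_map_def is_sec_AK_Suc
    using N.esec_minus[OF _ _ Ds, unfolded stalk_OX] by (simp add: shift_def split_beta)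
  show "sheaf_map TX (AK Y X \<sigma>' (Suc p)) (AK Y X \<sigma> (Suc p)) (unshift (Suc p))"
    unfolding sheaf_map_def is_sec_AK_Suc
    using N.esec_add[OF _ _ Ds, unfolded stalk_OX] by (simp add: unshift_def split_beta)
qed

text \<open>In index 0 the two sheaves are equal and the map is the identity. In the other indices
  \<open>unshift\<close> is the inverse, and its linearity is inherited from that of
  \<open>shift\<close>.\<close>

lemma shift_sheaf_iso: "sheaf_iso TX (OXbar Y X) (AK Y X \<sigma> q) (AK Y X \<sigma>' q) (shift q)"
proof (cases q)
  case 0
  have "shift 0 x u = u" for x u by (simp add: shift_def split_beta)
  then show ?thesis unfolding 0 AK_zero_eq sheaf_iso_def sheaf_hom_def sheaf_map_def mod_hom_def
    by (intro conjI exI[of _ "\<lambda>x u. u"]) simp_all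
next
  case (Suc p)
  have "unshift (Suc p) x \<in> mod_hom (RB x) (AK_stalk Y X \<sigma>' (Suc p) x) (AK_stalk Y X \<sigma> (Suc p) x)" if x: "x \<in> X" for x
    by (rule mod_hom_inverse[OF shift_hom[OF x]]) (simp_all add: shift_inverse[OF x] AK_closed[OF \<sigma> x])
  then show ?thesis unfolding Suc sheaf_iso_def sheaf_hom_def stalk_AK topspace_TX
    by (intro conjI exI[of _ "unshift (Suc p)"] shift_sheaf_maps ballI shift_hom shift_inverse)
qed

text \<open>\<open>shift\<close> is additive, so it commutes with integer multiples, and it fixes
  (J, 0). The differentials of both complexes send (I, J) to a multiple of (J, 0); those of the dual
  complex have negative coefficients, hence integers.\<close>

lemma shift_add_pow:
  fixes n :: int
  assumes x: "x \<in> X" and J: "J \<in> carrier (\<Lambda> q x)"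
  shows "shift q x (add_pow (AK_stalk Y X \<sigma> q x) n (J, \<zero>\<^bsub>\<Lambda> (q - 1) x\<^esub>)) =
    add_pow (AK_stalk Y X \<sigma>' q x) n (J, \<zero>\<^bsub>\<Lambda> (q - 1) x\<^esub>)"
proof (cases q)
  case 0
  then show ?thesis by (simp add: shift_def split_beta add_pow_def add_monoid_AK)
next
  case (Suc p)
  interpret A: abelian_group "AK_stalk Y X \<sigma> (Suc p) x" by (rule AK_abelian_group[OF x])
  interpret A': abelian_group "AK_stalk Y X \<sigma>' (Suc p) x" by (rule AK_abelian_group[OF x])
  interpret L: module "RX x" "\<Lambda> p x" by (rule ext_module[OF x])
  have "shift (Suc p) x \<in> hom (add_monoid (AK_stalk Y X \<sigma> (Suc p) x)) (add_monoid (AK_stalk Y X \<sigma>' (Suc p) x))"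
    using shift_hom[OF x, of p] by (simp add: mod_hom_def hom_def)
  moreover have "(J, \<zero>\<^bsub>\<Lambda> p x\<^esub>) \<in> carrier (AK_stalk Y X \<sigma> (Suc p) x)"
    using J by (simp add: Suc AK_stalk_simps)
  ultimately have "shift (Suc p) x (add_pow (AK_stalk Y X \<sigma> (Suc p) x) n (J, \<zero>\<^bsub>\<Lambda> p x\<^esub>)) =
      add_pow (AK_stalk Y X \<sigma>' (Suc p) x) n (shift (Suc p) x (J, \<zero>\<^bsub>\<Lambda> p x\<^esub>))"
    unfolding add_pow_def by (intro hom_int_pow A.a_group A'.a_group) simp_all
  then show ?thesis using shift_fix[OF x J] by (simp add: Suc)
qed

lemma AK_isomorphic: "AK_isomorphic Y X r \<sigma> \<sigma>'"
  unfolding AK_isomorphic_def complex_iso_def topspace_TX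
\<comment> \<open>Degree -p of the AK complex carries the module with index \<open>p + 1\<close>,
  whence the offset.\<close>
proof (intro exI[of _ "\<lambda>p. shift (p + 1)"] conjI allI impI ballI)
  fix p show "sheaf_iso TX (OXbar Y X) (obj (AKcomplex Y X \<sigma>) p) (obj (AKcomplex Y X \<sigma>') p) (shift (p + 1))"
    unfolding AKcomplex_def by (simp add: shift_sheaf_iso[of "Suc p", simplified])
next
  fix p x u assume p: "p \<in> {1..r}" and x: "x \<in> X" and u: "u \<in> carrier (stalk (obj (AKcomplex Y X \<sigma>) p) x)"
  obtain I J where IJ: "u = (I, J)" "J \<in> carrier (\<Lambda> p x)"
    using u by (cases u) (simp add: AKcomplex_def stalk_AK AK_stalk_simps)
  \<comment> \<open>The zero produced by \<open>AK_d\<close> with index \<open>p + 1\<close> lives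
    in index \<open>p + 1 - 2\<close>, which has to be recognised as \<open>p - 1\<close>.\<close>
  have e: "p - 1 + 1 = p" "p + 1 - 2 = p - 1" using p by auto
  have int: "add_pow G (int p) y = add_pow G p y" for G :: "('y fgerm set, 'y ext \<times> 'y ext) module" and y
    by (simp add: add_pow_def int_pow_int)
  show "shift (p - 1 + 1) x (bd (AKcomplex Y X \<sigma>) p x u) = bd (AKcomplex Y X \<sigma>') p x (shift (p + 1) x u)"
    using shift_add_pow[OF x IJ(2), of "int p", unfolded int]
    unfolding e(1) IJ(1) by (simp add: AKcomplex_def AK_d_def stalk_AK stalk_extN shift_def[of "Suc p"] e(2)[simplified])
next
  fix x u assume "x \<in> X" "u \<in> carrier (stalk (AK Y X \<sigma> 1) x)"
  then show "AK_augmentation Y X x (shift (0 + 1) x u) = AK_augmentation Y X x u"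
    by (cases u) (simp add: AK_augmentation_def AK_d_def shift_def)
qed

lemma dualAK_isomorphic: "dualAK_isomorphic Y X r \<sigma> \<sigma>'"
  unfolding dualAK_isomorphic_def complex_iso_def topspace_TX
proof (intro exI[of _ shift] conjI allI impI ballI)
  fix q show "sheaf_iso TX (OXbar Y X) (obj (dualAKcomplex Y X r \<sigma>) q) (obj (dualAKcomplex Y X r \<sigma>') q) (shift q)"
    unfolding dualAKcomplex_def by (simp add: shift_sheaf_iso)
next
  fix q x u assume q: "q \<in> {1..r}" and x: "x \<in> X" and u: "u \<in> carrier (stalk (obj (dualAKcomplex Y X r \<sigma>) q) x)"
  obtain p where p: "q = Suc p" using q by (cases q) auto
  obtain I J where IJ: "u = (I, J)" "J \<in> carrier (\<Lambda> p x)"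
    using u by (cases u) (simp add: dualAKcomplex_def stalk_AK AK_stalk_simps p)
  show "shift (q - 1) x (bd (dualAKcomplex Y X r \<sigma>) q x u) = bd (dualAKcomplex Y X r \<sigma>') q x (shift q x u)"
    using shift_add_pow[OF x IJ(2), of "- (int r - int q + 1)"]
    by (simp add: IJ(1) p dualAKcomplex_def AK_d_def stalk_AK stalk_extN shift_def[of "Suc p"] numeral_2_eq_2)
next
  fix x I assume "x \<in> X" "I \<in> carrier (stalk (extN Y X r) x)"
  then show "shift r x (dualAK_coaugmentation Y X r x I) = dualAK_coaugmentation Y X r x I"
    using shift_fix[of x I r]
    by (simp add: dualAK_coaugmentation_def stalk_extN shift_fix)
qed

end

end

section \<open>Holomorphic functions of several variables\<close>

text \<open>Formed like the components of \<open>cdiff\<close>, as a one-variable derivative along a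
  coordinate line.\<close>

definition pd :: "'n \<Rightarrow> (complex ^ 'n::finite \<Rightarrow> complex) \<Rightarrow> complex ^ 'n \<Rightarrow> complex" where
  "pd i f z = deriv (\<lambda>t. f (z + t *s axis i 1)) 0"

lemma norm_smult_axis: "norm (t *s axis i 1 :: complex ^ 'n::finite) = norm t"
proof -
  have "t *s axis i 1 = (axis i t :: complex ^ 'n)" by (simp add: vec_eq_iff axis_def)
  then show ?thesis by (simp add: norm_eq_sqrt_inner inner_axis_axis)
qed

lemma smult_axis_linear: "bounded_linear (\<lambda>t. t *s axis i 1 :: complex ^ 'n::finite)"
  by (rule bounded_linear_intro[where K = 1])
    (simp_all add: norm_smult_axis vec_eq_iff distrib_right)

lemma continuous_on_smult_axis [continuous_intros]:
  "continuous_on S c \<Longrightarrow> continuous_on S (\<lambda>x. c x *s axis i 1 :: complex ^ 'n::finite)"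
  by (rule bounded_linear.continuous_on[OF smult_axis_linear])

text \<open>The derivative is complex linear, hence determined by its values on the coordinate
  vectors, and restriction to coordinate lines identifies these values with one-variable
  derivatives.\<close>

lemma holo_has_derivative:
  fixes f :: "complex ^ 'n::finite \<Rightarrow> complex"
  assumes W: "open W" and f: "holo_on W f" and z: "z \<in> W"
  shows "(f has_derivative (\<lambda>v. \<Sum>i\<in>UNIV. v $ i * pd i f z)) (at z)"
proof -
  obtain D where D: "(f has_derivative D) (at z)" and D': "\<forall>c v. D (c *s v) = c * D v"
    using bspec[OF f[unfolded holo_on_def] z] unfolding at_within_open[OF z W] by (elim exE conjE)
  note D = D D'[rule_format]
  have pd: "pd i f z = D (axis i 1)" for i
  proof -
    have "((\<lambda>t. z + t *s axis i 1) has_derivative (\<lambda>t. t *s axis i 1)) (at (0::complex))"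
      using has_derivative_add[OF has_derivative_const bounded_linear_imp_has_derivative[OF smult_axis_linear]] by simp
    then have "((\<lambda>t. f (z + t *s axis i 1)) has_derivative (\<lambda>t. D (t *s axis i 1))) (at 0)"
      by (rule has_derivative_compose) (simp add: D(1))
    then have "((\<lambda>t. f (z + t *s axis i 1)) has_field_derivative D (axis i 1)) (at 0)"
      by (simp add: has_field_derivative_def D(2) mult.commute[of _ "D _"])
    then show ?thesis unfolding pd_def by (rule DERIV_imp_deriv)
  qed
  interpret linear D by (rule has_derivative_linear[OF D(1)])
  have "D v = (\<Sum>i\<in>UNIV. v $ i * pd i f z)" for v
  proof -
    have "D v = D (\<Sum>i\<in>UNIV. v $ i *s axis i 1)" by (simp add: basis_expansion)
    then show ?thesis by (simp add: sum D(2) pd)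
  qed
  then have "D = (\<lambda>v. \<Sum>i\<in>UNIV. v $ i * pd i f z)" by (rule ext)
  then show ?thesis using D(1) by simp
qed

lemma holo_onI:
  assumes "\<And>z. z \<in> W \<Longrightarrow> (f has_derivative (\<lambda>v. \<Sum>i\<in>UNIV. v $ i * d z i)) (at z)"
  shows "holo_on W f"
  unfolding holo_on_def
proof
  fix z assume "z \<in> W"
  from has_derivative_at_withinI[OF assms[OF this]]
  show "\<exists>D. (f has_derivative D) (at z within W) \<and> (\<forall>c v. D (c *s v) = c * D v)"
    by (intro exI conjI) (auto simp: sum_distrib_left mult.assoc)
qed

lemma pd_eqI:
  assumes "(f has_derivative (\<lambda>v. \<Sum>i\<in>UNIV. v $ i * d i)) (at z)"
  shows "pd j f z = d j"
proof -
  have "((\<lambda>t. z + t *s axis j 1) has_derivative (\<lambda>t. t *s axis j 1)) (at (0::complex))"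
    using has_derivative_add[OF has_derivative_const bounded_linear_imp_has_derivative[OF smult_axis_linear]] by simp
  then have "((\<lambda>t. f (z + t *s axis j 1)) has_derivative (\<lambda>t. \<Sum>i\<in>UNIV. (t *s axis j 1) $ i * d i)) (at 0)"
    by (rule has_derivative_compose) (simp add: assms)
  moreover have "(\<Sum>i\<in>UNIV. (t *s axis j 1) $ i * d i) = d j * t" for t
    by (simp add: axis_def if_distrib[of "\<lambda>x. _ * x * _"] if_distrib[of "\<lambda>x. x * _"] cong: if_cong)
  ultimately have "((\<lambda>t. f (z + t *s axis j 1)) has_field_derivative d j) (at 0)"
    by (simp add: has_field_derivative_def)
  then show ?thesis unfolding pd_def by (rule DERIV_imp_deriv)
qed

lemma holo_continuous: "open W \<Longrightarrow> holo_on W f \<Longrightarrow> continuous_on W f"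
  by (intro continuous_at_imp_continuous_on ballI has_derivative_continuous[OF holo_has_derivative])

lemma holo_line:
  assumes W: "open W" and f: "holo_on W f" and z: "z + t *s axis i 1 \<in> W"
  shows "((\<lambda>t. f (z + t *s axis i 1)) has_field_derivative pd i f (z + t *s axis i 1)) (at t)"
proof -
  let ?d = "\<lambda>i'. pd i' f (z + t *s axis i 1)"
  have "((\<lambda>t. z + t *s axis i 1) has_derivative (\<lambda>t. t *s axis i 1)) (at t)"
    using has_derivative_add[OF has_derivative_const bounded_linear_imp_has_derivative[OF smult_axis_linear]] by simp
  then have "((\<lambda>t. f (z + t *s axis i 1)) has_derivative (\<lambda>s. \<Sum>j\<in>UNIV. (s *s axis i 1) $ j * ?d j)) (at t)"
    by (rule has_derivative_compose) (rule holo_has_derivative[OF W f z])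
  moreover have "(\<Sum>j\<in>UNIV. (s *s axis i 1) $ j * ?d j) = ?d i * s" for s
    by (simp add: axis_def if_distrib[of "\<lambda>x. _ * x * _"] if_distrib[of "\<lambda>x. x * _"] cong: if_cong)
  ultimately show ?thesis by (simp add: has_field_derivative_def)
qed

text \<open>Differentiation under the integral sign. The partial derivatives are packed into one
  bounded linear map so that the Leibniz rule for parameter integrals applies, and evaluation at
  \<open>v\<close> unpacks the result.\<close>

lemma has_derivative_param_integral:
  fixes F :: "complex ^ 'n::finite \<Rightarrow> real \<Rightarrow> complex"
  assumes U: "open U" "convex U" and z0: "z0 \<in> U"
    and der: "\<And>z t. z \<in> U \<Longrightarrow> t \<in> {0..1} \<Longrightarrow> ((\<lambda>z. F z t) has_derivative (\<lambda>v. \<Sum>i\<in>UNIV. v $ i * G i z t)) (at z)"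
    and contF: "\<And>z. z \<in> U \<Longrightarrow> continuous_on {0..1} (F z)"
    and contG: "\<And>i. continuous_on (U \<times> {0..1}) (\<lambda>(z, t). G i z t)"
  shows "((\<lambda>z. integral {0..1} (F z)) has_derivative (\<lambda>v. \<Sum>i\<in>UNIV. v $ i * integral {0..1} (G i z0))) (at z0)"
proof -
  define fx where "fx = (\<lambda>z t. Blinfun (\<lambda>v::complex ^ 'n. \<Sum>i\<in>UNIV. v $ i * G i z t))"
  have bl: "bounded_linear (\<lambda>v::complex ^ 'n. \<Sum>i\<in>UNIV. v $ i * G i z t)" for z t
    by (intro bounded_linear_sum bounded_linear_mult_const bounded_linear_vec_nth)
  have fx: "blinfun_apply (fx z t) v = (\<Sum>i\<in>UNIV. v $ i * G i z t)" for z t v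
    unfolding fx_def by (simp add: bounded_linear_Blinfun_apply[OF bl])
  have fx': "blinfun_apply (fx z t) = (\<lambda>v. \<Sum>i\<in>UNIV. v $ i * G i z t)" for z t
    by (rule ext) (rule fx)
  have cfx: "continuous_on (U \<times> cbox 0 1) (\<lambda>(z, t). fx z t)"
  proof -
    have "continuous_on (U \<times> {0..1}) (\<lambda>x. fx (fst x) (snd x))"
      unfolding continuous_on_eq_continuous_within
    proof
      fix x assume x: "x \<in> U \<times> {0..1::real}"
      have "continuous (at x within U \<times> {0..1}) (\<lambda>x. G i (fst x) (snd x))" for i
        using contG[of i] x by (auto simp: continuous_on_eq_continuous_within split_beta)
      then show "continuous (at x within U \<times> {0..1}) (\<lambda>x. fx (fst x) (snd x))"
        by (intro continuous_blinfun_componentwiseI1) (simp add: fx continuous_intros)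
    qed
    then show ?thesis by (simp add: split_beta)
  qed
  have der_int: "((\<lambda>z. integral (cbox 0 1) (F z)) has_derivative blinfun_apply (integral (cbox 0 1) (fx z0))) (at z0 within U)"
  proof (rule leibniz_rule[OF _ _ cfx z0 U(2)])
    fix z and t :: real assume "z \<in> U" "t \<in> cbox 0 1"
    then show "((\<lambda>z. F z t) has_derivative blinfun_apply (fx z t)) (at z within U)"
      unfolding fx' by (simp add: der has_derivative_at_withinI)
  next
    fix z assume "z \<in> U"
    then show "F z integrable_on cbox 0 1" using contF by (simp add: integrable_continuous_interval)
  qed
  have app: "blinfun_apply (integral (cbox 0 1) (fx z0)) v = (\<Sum>i\<in>UNIV. v $ i * integral {0..1} (G i z0))" for v
  proof -
    have cG: "continuous_on {0..1} (G i z0)" for i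
    proof -
      have "continuous_on {0..1} (\<lambda>t. (\<lambda>(z, t). G i z t) (z0, t))"
        by (rule continuous_on_compose2[OF contG]) (use z0 in \<open>auto intro!: continuous_intros\<close>)
      then show ?thesis by simp
    qed
    have "continuous_on {0..1} (\<lambda>t. (\<lambda>(z, t). fx z t) (z0, t))"
      by (rule continuous_on_compose2[OF cfx]) (use z0 in \<open>auto intro!: continuous_intros\<close>)
    then have "fx z0 integrable_on cbox 0 1" by (simp add: integrable_continuous_interval)
    then have "blinfun_apply (integral (cbox 0 1) (fx z0)) v = integral {0..1} (\<lambda>t. \<Sum>i\<in>UNIV. v $ i * G i z0 t)"
      by (simp add: blinfun_apply_integral fx)
    also have "\<dots> = (\<Sum>i\<in>UNIV. v $ i * integral {0..1} (G i z0))"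
      by (subst integral_sum) (auto intro!: integrable_continuous_interval continuous_intros cG)
    finally show ?thesis .
  qed
  have app': "blinfun_apply (integral (cbox 0 1) (fx z0)) = (\<lambda>v. \<Sum>i\<in>UNIV. v $ i * integral {0..1} (G i z0))"
    by (rule ext) (rule app)
  show ?thesis using der_int[unfolded at_within_open[OF z0 U(1)] app'] by (simp only: cbox_interval)
qed

section \<open>Cauchy integrals and the regularity of partial derivatives\<close>

text \<open>Cauchy's formula for the first derivative on a circle in the \<open>i\<close>-th
  coordinate line. The parametrisation contributes 2 \<pi> \<i> \<zeta>, which cancels the constant
  in front and one of the two factors \<zeta> in the denominator. On the right \<open>z\<close>
  occurs only inside \<open>f\<close>, so regularity of \<open>f\<close> passes to its partial
  derivatives.\<close>

lemma Cauchy_pd: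
  fixes f :: "complex ^ 'n::finite \<Rightarrow> complex"
  assumes W: "open W" and f: "holo_on W f" and \<rho>: "\<rho> > 0"
    and sub: "\<And>t. norm t \<le> \<rho> \<Longrightarrow> z + t *s axis i 1 \<in> W"
  defines "\<zeta> \<equiv> \<lambda>\<theta>::real. of_real \<rho> * exp (2 * of_real pi * \<i> * of_real \<theta>)"
  shows "pd i f z = integral {0..1} (\<lambda>\<theta>. f (z + \<zeta> \<theta> *s axis i 1) / \<zeta> \<theta>)"
proof -
  let ?g = "\<lambda>t. f (z + t *s axis i 1)"
  have d: "(?g has_field_derivative pd i f (z + t *s axis i 1)) (at t)" if "norm t \<le> \<rho>" for t
    by (rule holo_line[OF W f sub[OF that]])
  have c: "continuous_on (cball 0 \<rho>) ?g"
    by (rule continuous_at_imp_continuous_on) (auto intro: DERIV_isCont[OF d])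
  have h: "?g holomorphic_on ball 0 \<rho>"
    by (rule holomorphic_onI) (use d field_differentiable_at_within in \<open>force simp: field_differentiable_def\<close>)
  have "pd i f z = deriv ?g 0" by (simp add: pd_def)
  also have "\<dots> = 1 / (2 * of_real pi * \<i>) * contour_integral (circlepath 0 \<rho>) (\<lambda>u. ?g u / (u - 0)^2)"
    by (rule DERIV_imp_deriv[OF Cauchy_derivative_integral_circlepath(2)[OF c h]]) (simp add: \<rho>)
  also have "contour_integral (circlepath 0 \<rho>) (\<lambda>u. ?g u / (u - 0)^2) =
     integral {0..1} (\<lambda>\<theta>. (2 * of_real pi * \<i>) * (?g (\<zeta> \<theta>) / \<zeta> \<theta>))"
    unfolding contour_integral_integral
  proof (rule arg_cong[where f = "integral {0..1}"], rule ext)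
    fix \<theta> :: real
    have "vector_derivative (circlepath 0 \<rho>) (at \<theta>) = 2 * of_real pi * \<i> * \<zeta> \<theta>"
      by (simp only: vector_derivative_circlepath) (simp add: \<zeta>_def)
    moreover have "circlepath 0 \<rho> \<theta> = \<zeta> \<theta>" by (simp add: circlepath \<zeta>_def)
    moreover have "\<zeta> \<theta> \<noteq> 0" using \<rho> by (simp add: \<zeta>_def)
    ultimately show "?g (circlepath 0 \<rho> \<theta>) / (circlepath 0 \<rho> \<theta> - 0)^2 * vector_derivative (circlepath 0 \<rho>) (at \<theta>) =
        (2 * of_real pi * \<i>) * (?g (\<zeta> \<theta>) / \<zeta> \<theta>)"
      by (simp add: power2_eq_square)
  qed
  also have "\<dots> = (2 * of_real pi * \<i>) * integral {0..1} (\<lambda>\<theta>. ?g (\<zeta> \<theta>) / \<zeta> \<theta>)"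
    by (rule integral_mult_right)
  finally show ?thesis by simp
qed

text \<open>Half the radius of a ball in \<open>W\<close> is spent on the centre of the circle and
  half on the circle itself.\<close>

lemma circle_nhd:
  fixes z0 :: "complex ^ 'n::finite"
  assumes W: "open W" and z0: "z0 \<in> W"
  obtains \<rho> where "\<rho> > 0" "\<And>z t i. z \<in> ball z0 \<rho> \<Longrightarrow> norm t \<le> \<rho> \<Longrightarrow> z + t *s axis i 1 \<in> W"
proof -
  obtain e where e: "e > 0" "ball z0 e \<subseteq> W" using W z0 open_contains_ball by blast
  have "z + t *s axis i 1 \<in> W" if "z \<in> ball z0 (e/2)" "norm t \<le> e/2" for z t i
  proof -
    have "dist z0 (z + t *s axis i 1) \<le> dist z0 z + norm (t *s axis i 1 :: complex ^ 'n)"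
      using dist_triangle[of z0 "z + t *s axis i 1" z] by (simp add: dist_norm)
    also have "\<dots> < e" using that by (simp add: norm_smult_axis)
    finally show ?thesis using e(2) by auto
  qed
  then show thesis using that[of "e/2"] e(1) by simp
qed

text \<open>\<open>holo_on\<close> asks for a derivative at every point and says nothing about its
  continuity. This comes from the Cauchy integral, with one radius serving all points near
  \<open>z0\<close>.\<close>

lemma pd_continuous:
  fixes f :: "complex ^ 'n::finite \<Rightarrow> complex"
  assumes W: "open W" and f: "holo_on W f"
  shows "continuous_on W (pd i f)"
proof (rule continuous_at_imp_continuous_on, rule ballI)
  fix z0 assume z0: "z0 \<in> W"
  obtain \<rho> where \<rho>: "\<rho> > 0" "\<And>z t i. z \<in> ball z0 \<rho> \<Longrightarrow> norm t \<le> \<rho> \<Longrightarrow> z + t *s axis i 1 \<in> W"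
    using circle_nhd[OF W z0] by blast
  define \<zeta> where "\<zeta> = (\<lambda>\<theta>::real. complex_of_real \<rho> * exp (2 * of_real pi * \<i> * of_real \<theta>))"
  have \<zeta>: "norm (\<zeta> \<theta>) = \<rho>" "\<zeta> \<theta> \<noteq> 0" for \<theta> using \<rho>(1) by (auto simp: \<zeta>_def norm_mult norm_exp_eq_Re)
  have cont_\<zeta>: "continuous_on S (\<lambda>x. \<zeta> (h x))" if "continuous_on S h" for S :: "'b::topological_space set" and h
    unfolding \<zeta>_def using that by (intro continuous_intros)
  have "continuous_on (ball z0 \<rho> \<times> cbox 0 1) (\<lambda>(z, \<theta>). f (z + \<zeta> \<theta> *s axis i 1) / \<zeta> \<theta>)"
    unfolding split_beta
    by (intro continuous_intros cont_\<zeta> continuous_on_compose2[OF holo_continuous[OF W f]])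
      (use \<rho>(2) \<zeta> in auto)
  then have "continuous_on (ball z0 \<rho>) (\<lambda>z. integral (cbox 0 1) (\<lambda>\<theta>. f (z + \<zeta> \<theta> *s axis i 1) / \<zeta> \<theta>))"
    by (rule integral_continuous_on_param)
  then have "continuous_on (ball z0 \<rho>) (pd i f)"
    by (rule continuous_on_eq) (simp add: Cauchy_pd[OF W f \<rho>(1) \<rho>(2)] \<zeta>_def)
  then show "isCont (pd i f) z0"
    by (rule continuous_on_interior) (simp add: \<rho>(1))
qed

text \<open>The Cauchy integral is differentiated under the integral sign. The integral formula for
  the derivatives is kept in the conclusion because, read backwards, it is Cauchy's formula for
  \<open>pd j f\<close>.\<close>

lemma pd_pd:
  fixes f :: "complex ^ 'n::finite \<Rightarrow> complex"
  assumes W: "open W" and f: "holo_on W f" and z0: "z0 \<in> W"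
  shows "\<exists>d. (pd i f has_derivative (\<lambda>v. \<Sum>j\<in>UNIV. v $ j * d j)) (at z0) \<and>
    (\<exists>\<rho>>0. (\<forall>t. norm t \<le> \<rho> \<longrightarrow> z0 + t *s axis i 1 \<in> W) \<and>
       (\<forall>j. d j = integral {0..1} (\<lambda>\<theta>::real. pd j f (z0 + (of_real \<rho> * exp (2 * of_real pi * \<i> * of_real \<theta>)) *s axis i 1) /
         (of_real \<rho> * exp (2 * of_real pi * \<i> * of_real \<theta>)))))"
proof -
  obtain \<rho> where \<rho>: "\<rho> > 0" "\<And>z t i. z \<in> ball z0 \<rho> \<Longrightarrow> norm t \<le> \<rho> \<Longrightarrow> z + t *s axis i 1 \<in> W"
    using circle_nhd[OF W z0] by blast
  define \<zeta> where "\<zeta> = (\<lambda>\<theta>::real. complex_of_real \<rho> * exp (2 * of_real pi * \<i> * of_real \<theta>))"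
  have \<zeta>: "norm (\<zeta> \<theta>) = \<rho>" "\<zeta> \<theta> \<noteq> 0" for \<theta> using \<rho>(1) by (auto simp: \<zeta>_def norm_mult norm_exp_eq_Re)
  have cont_\<zeta>: "continuous_on S (\<lambda>x. \<zeta> (h x))" if "continuous_on S h" for S :: "'b::topological_space set" and h
    unfolding \<zeta>_def using that by (intro continuous_intros)
  let ?F = "\<lambda>z \<theta>. f (z + \<zeta> \<theta> *s axis i 1) / \<zeta> \<theta>"
  let ?G = "\<lambda>j z \<theta>. pd j f (z + \<zeta> \<theta> *s axis i 1) / \<zeta> \<theta>"
  have "((\<lambda>z. integral {0..1} (?F z)) has_derivative (\<lambda>v. \<Sum>j\<in>UNIV. v $ j * integral {0..1} (?G j z0))) (at z0)"
  proof (rule has_derivative_param_integral)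
    show "open (ball z0 \<rho>)" "convex (ball z0 \<rho>)" "z0 \<in> ball z0 \<rho>" using \<rho>(1) by auto
  next
    fix z and \<theta> :: real assume z: "z \<in> ball z0 \<rho>"
    have "z + \<zeta> \<theta> *s axis i 1 \<in> W" using \<rho>(2) z \<zeta> by simp
    have "((\<lambda>z. z + \<zeta> \<theta> *s axis i 1) has_derivative (\<lambda>v. v)) (at z)"
      by (auto intro!: derivative_eq_intros)
    from has_derivative_compose[OF this holo_has_derivative[OF W f \<open>z + \<zeta> \<theta> *s axis i 1 \<in> W\<close>]]
    have "((\<lambda>z. inverse (\<zeta> \<theta>) * f (z + \<zeta> \<theta> *s axis i 1)) has_derivative
        (\<lambda>v. inverse (\<zeta> \<theta>) * (\<Sum>j\<in>UNIV. v $ j * pd j f (z + \<zeta> \<theta> *s axis i 1)))) (at z)"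
      by (rule has_derivative_mult_right)
    then
    show "((\<lambda>z. ?F z \<theta>) has_derivative (\<lambda>v. \<Sum>j\<in>UNIV. v $ j * ?G j z \<theta>)) (at z)"
      by (simp add: divide_inverse sum_distrib_left mult_ac)
  next
    fix z assume z: "z \<in> ball z0 \<rho>"
    show "continuous_on {0..1} (?F z)"
      by (intro continuous_intros cont_\<zeta> continuous_on_compose2[OF holo_continuous[OF W f]])
        (use \<rho>(2) z \<zeta> in auto)
  next
    fix j
    show "continuous_on (ball z0 \<rho> \<times> {0..1}) (\<lambda>(z, \<theta>). ?G j z \<theta>)"
      unfolding split_beta
      by (intro continuous_intros cont_\<zeta> continuous_on_compose2[OF pd_continuous[OF W f]])
        (use \<rho>(2) \<zeta> in auto)
  qed
  then have "(pd i f has_derivative (\<lambda>v. \<Sum>j\<in>UNIV. v $ j * integral {0..1} (?G j z0))) (at z0)"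
    by (rule has_derivative_transform_within_open[of _ _ _ _ "ball z0 \<rho>"])
      (use \<rho>(1) in \<open>auto simp: Cauchy_pd[OF W f \<rho>(1) \<rho>(2)] \<zeta>_def\<close>)
  moreover have "z0 + t *s axis i 1 \<in> W" if "norm t \<le> \<rho>" for t using \<rho> that by simp
  ultimately show ?thesis using \<rho>(1) unfolding \<zeta>_def
    by (intro exI[of _ "\<lambda>j. integral {0..1} (\<lambda>\<theta>::real. pd j f (z0 + (of_real \<rho> * exp (2 * of_real pi * \<i> * of_real \<theta>)) *s axis i 1) /
         (of_real \<rho> * exp (2 * of_real pi * \<i> * of_real \<theta>)))"] exI[of _ \<rho>] conjI) auto
qed

lemma pd_holo:
  assumes W: "open W" and f: "holo_on W f"
  shows "holo_on W (pd i f)"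
proof -
  have "\<exists>d. (pd i f has_derivative (\<lambda>v. \<Sum>j\<in>UNIV. v $ j * d j)) (at z)" if "z \<in> W" for z
    using pd_pd[OF W f that, of i] by (elim exE conjE) (rule exI)
  note ex = this
  show ?thesis by (rule holo_onI, rule someI_ex, rule ex)
qed

text \<open>Differentiating the Cauchy integral of \<open>f\<close> over circles in direction
  \<open>i\<close> by the \<open>j\<close>-th variable gives the Cauchy integral of
  \<open>pd j f\<close> over the same circles, which is \<open>pd i (pd j f)\<close>.\<close>

lemma pd_commute:
  assumes W: "open W" and f: "holo_on W f" and z: "z \<in> W"
  shows "pd j (pd i f) z = pd i (pd j f) z"
proof -
  obtain d \<rho> where d: "(pd i f has_derivative (\<lambda>v. \<Sum>j\<in>UNIV. v $ j * d j)) (at z)" and \<rho>: "\<rho> > 0"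
    and sub: "\<forall>t. norm t \<le> \<rho> \<longrightarrow> z + t *s axis i 1 \<in> W" and
    dj: "\<forall>j. d j = integral {0..1} (\<lambda>\<theta>::real. pd j f (z + (of_real \<rho> * exp (2 * of_real pi * \<i> * of_real \<theta>)) *s axis i 1) /
         (of_real \<rho> * exp (2 * of_real pi * \<i> * of_real \<theta>)))"
    using pd_pd[OF W f z, of i] by (elim exE conjE)
  have "pd j (pd i f) z = d j" by (rule pd_eqI[OF d])
  also have "\<dots> = pd i (pd j f) z" unfolding dj[rule_format]
    by (rule Cauchy_pd[OF W pd_holo[OF W f] \<rho>, symmetric]) (use sub in simp)
  finally show ?thesis .
qed

section \<open>Hadamard's lemma\<close>

text \<open>Used with two choices of \<open>K\<close> and a centre on \<open>X\<close>: the normal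
  coordinates, where the projection goes to \<open>X\<close>, and all coordinates of
  \<open>X\<close>, where it sends the points of \<open>X\<close> to the centre.\<close>

definition proj_on :: "'n set \<Rightarrow> complex ^ 'n \<Rightarrow> complex ^ 'n \<Rightarrow> complex ^ 'n::finite" where
  "proj_on K p z = (\<chi> i. if i \<in> K then p $ i else z $ i)"

text \<open>By the fundamental theorem of calculus along the segment from the projected point to
  \<open>z\<close>; \<open>g i\<close> is the mean of the \<open>i\<close>-th partial derivative
  over this segment. Where the projection is the identity, the segment is constant and the mean is
  the derivative itself. A ball around \<open>p\<close> contains all these segments.\<close>

lemma hadamard:
  fixes f :: "complex ^ 'n::finite \<Rightarrow> complex"
  assumes \<epsilon>: "\<epsilon> > 0" and f: "holo_on (ball p \<epsilon>) f"
  shows "\<exists>g. (\<forall>i. holo_on (ball p \<epsilon>) (g i)) \<and>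
    (\<forall>z\<in>ball p \<epsilon>. f z - f (proj_on K p z) = (\<Sum>i\<in>K. (z $ i - p $ i) * g i z)) \<and>
    (\<forall>i. \<forall>z\<in>ball p \<epsilon>. proj_on K p z = z \<longrightarrow> g i z = pd i f z)"
proof -
  define seg where "seg = (\<lambda>z t. \<chi> j. if j \<in> K then p $ j + of_real t * (z $ j - p $ j) else (z::complex ^ 'n) $ j)"
  define g where "g = (\<lambda>i z. integral {0..1::real} (\<lambda>t. pd i f (seg z t)))"
  have B: "open (ball p \<epsilon>)" "convex (ball p \<epsilon>)" by auto
  have seg0: "seg z 0 = proj_on K p z" and seg1: "seg z 1 = z" for z by (auto simp: seg_def proj_on_def vec_eq_iff)
  \<comment> \<open>Along the segment the coordinates in \<open>K\<close> are contracted towards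
    those of \<open>p\<close> and the others are kept, so no component of the difference from
    \<open>p\<close> grows.\<close>
  have segB: "seg z t \<in> ball p \<epsilon>" if z: "z \<in> ball p \<epsilon>" and t: "t \<in> {0..1}" for z t
  proof -
    have "norm (seg z t - p) \<le> norm (z - p)"
    proof (rule norm_le_componentwise_cart)
      fix j
      have "norm (of_real t * (z $ j - p $ j)) \<le> norm (z $ j - p $ j)"
        using t by (simp add: norm_mult mult_left_le_one_le)
      then show "norm ((seg z t - p) $ j) \<le> norm ((z - p) $ j)" by (simp add: seg_def)
    qed
    then show ?thesis using z by (simp add: dist_norm norm_minus_commute)
  qed
  have cont_seg: "continuous_on S (\<lambda>x. seg (a x) (b x))" if "continuous_on S a" "continuous_on S b"
    for S :: "'b::topological_space set" and a b
    unfolding seg_def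
  proof (rule continuous_on_vec_lambda)
    fix j show "continuous_on S (\<lambda>x. if j \<in> K then p $ j + of_real (b x) * (a x $ j - p $ j) else a x $ j)"
      using that by (cases "j \<in> K") (auto intro!: continuous_intros)
  qed
  have comp: "((\<lambda>z. h (seg z t)) has_derivative (\<lambda>v. \<Sum>j\<in>UNIV. v $ j * ((if j \<in> K then of_real t else 1) * pd j h (seg z t)))) (at z)"
    if h: "holo_on (ball p \<epsilon>) h" and z: "z \<in> ball p \<epsilon>" and t: "t \<in> {0..1}" for h z t
  proof -
    have "((\<lambda>z. seg z t) has_derivative (\<lambda>v. \<chi> j. (if j \<in> K then of_real t else 1) * v $ j)) (at z within UNIV)"
    proof (rule has_derivative_vec_components)
      fix j
      have "((\<lambda>z::complex ^ 'n. z $ j) has_derivative (\<lambda>v. v $ j)) (at z)"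
        by (rule bounded_linear_imp_has_derivative[OF bounded_linear_vec_nth])
      then show "((\<lambda>z. seg z t $ j) has_derivative (\<lambda>v. (\<chi> j. (if j \<in> K then of_real t else 1) * v $ j) $ j)) (at z within UNIV)"
        by (cases "j \<in> K") (auto simp: seg_def intro!: derivative_eq_intros)
    qed
    from has_derivative_compose[OF this holo_has_derivative[OF B(1) h segB[OF z t]]]
    show ?thesis by (simp add: mult_ac)
  qed
  have "holo_on (ball p \<epsilon>) (g i)" for i
    unfolding g_def
  proof (rule holo_onI, rule has_derivative_param_integral[OF B])
    fix z t assume "z \<in> ball p \<epsilon>" "t \<in> {0..1::real}"
    then show "((\<lambda>z. pd i f (seg z t)) has_derivative
      (\<lambda>v. \<Sum>j\<in>UNIV. v $ j * ((if j \<in> K then of_real t else 1) * pd j (pd i f) (seg z t)))) (at z)"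
      by (rule comp[OF pd_holo[OF B(1) f]])
  next
    fix z assume "z \<in> ball p \<epsilon>"
    then show "continuous_on {0..1} (\<lambda>t. pd i f (seg z t))"
      by (intro continuous_on_compose2[OF pd_continuous[OF B(1) f]] cont_seg continuous_intros) (use segB in auto)
  next
    fix j
    have "continuous_on (ball p \<epsilon> \<times> {0..1}) (\<lambda>x. (if j \<in> K then of_real (snd x) else 1) * pd j (pd i f) (seg (fst x) (snd x)))"
    proof (rule continuous_on_mult)
      show "continuous_on (ball p \<epsilon> \<times> {0..1}) (\<lambda>x. if j \<in> K then complex_of_real (snd x) else 1)"
        by (cases "j \<in> K") (auto intro!: continuous_intros)
      show "continuous_on (ball p \<epsilon> \<times> {0..1}) (\<lambda>x. pd j (pd i f) (seg (fst x) (snd x)))"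
        by (intro continuous_on_compose2[OF pd_continuous[OF B(1) pd_holo[OF B(1) f]]] cont_seg continuous_intros)
          (use segB in auto)
    qed
    then show "continuous_on (ball p \<epsilon> \<times> {0..1}) (\<lambda>(z, t). (if j \<in> K then of_real t else 1) * pd j (pd i f) (seg z t))"
      by (simp add: split_beta)
  qed auto
  moreover have "f z - f (proj_on K p z) = (\<Sum>i\<in>K. (z $ i - p $ i) * g i z)" if z: "z \<in> ball p \<epsilon>" for z
  proof -
    let ?d = "\<lambda>t. \<Sum>i\<in>K. (z $ i - p $ i) * pd i f (seg z t)"
    have "((\<lambda>t. f (seg z t)) has_vector_derivative ?d t) (at t within {0..1})" if t: "t \<in> {0..1}" for t
    proof -
      have "((\<lambda>t. seg z t) has_derivative (\<lambda>s. \<chi> j. if j \<in> K then of_real s * (z $ j - p $ j) else 0)) (at t within {0..1})"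
      proof (rule has_derivative_vec_components)
        fix j
        show "((\<lambda>t. seg z t $ j) has_derivative (\<lambda>s. (\<chi> j. if j \<in> K then of_real s * (z $ j - p $ j) else 0) $ j)) (at t within {0..1})"
          by (cases "j \<in> K") (auto simp: seg_def intro!: derivative_eq_intros)
      qed
      from has_derivative_compose[OF this holo_has_derivative[OF B(1) f segB[OF z t]]]
      have "((\<lambda>t. f (seg z t)) has_derivative (\<lambda>s. \<Sum>j\<in>UNIV. (if j \<in> K then of_real s * (z $ j - p $ j) else 0) * pd j f (seg z t))) (at t within {0..1})"
        by simp
      moreover have "(\<Sum>j\<in>UNIV. (if j \<in> K then of_real s * (z $ j - p $ j) else 0) * pd j f (seg z t)) = s *\<^sub>R ?d t" for s
      proof -
        have "(\<Sum>j\<in>UNIV. (if j \<in> K then of_real s * (z $ j - p $ j) else 0) * pd j f (seg z t)) =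
          (\<Sum>j\<in>K. of_real s * (z $ j - p $ j) * pd j f (seg z t))"
          by (rule sum.mono_neutral_cong_right) auto
        then show ?thesis by (simp add: scaleR_conv_of_real sum_distrib_left mult.assoc)
      qed
      ultimately show ?thesis by (simp add: has_vector_derivative_def)
    qed
    then have "(?d has_integral (f (seg z 1) - f (seg z 0))) {0..1}"
      by (intro fundamental_theorem_of_calculus) auto
    then have "f z - f (proj_on K p z) = integral {0..1} ?d" by (simp add: seg0 seg1 integral_unique)
    also have "\<dots> = (\<Sum>i\<in>K. (z $ i - p $ i) * g i z)"
      unfolding g_def
    proof (subst integral_sum)
      fix i
      have c: "continuous_on {0..1} (\<lambda>t. pd i f (seg z t))"
        by (intro continuous_on_compose2[OF pd_continuous[OF B(1) f]] cont_seg continuous_intros) (use segB z in auto)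
      then show "(\<lambda>t. (z $ i - p $ i) * pd i f (seg z t)) integrable_on {0..1}"
        by (intro integrable_continuous_interval continuous_intros)
    qed simp_all
    finally show ?thesis .
  qed
  moreover have "g i z = pd i f z" if "proj_on K p z = z" for i z
  proof -
    have "seg z t = z" for t
    proof -
      have "z $ j = p $ j" if "j \<in> K" for j
        using arg_cong[OF \<open>proj_on K p z = z\<close>, of "\<lambda>z. z $ j"] that by (simp add: proj_on_def)
      then show ?thesis by (simp add: seg_def vec_eq_iff)
    qed
    then show ?thesis by (simp add: g_def)
  qed
  ultimately show ?thesis by (intro exI[of _ g] conjI allI ballI impI)
qed

section \<open>Partial derivatives in a chart\<close>

lemma pd_cong:
  assumes "open B" "z \<in> B" "\<And>w. w \<in> B \<Longrightarrow> f w = g w"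
  shows "pd i f z = pd i g z"
proof -
  have "continuous_on UNIV (\<lambda>t::complex. z + t *s axis i 1)" by (intro continuous_intros)
  then have "open ((\<lambda>t. z + t *s axis i 1) -` B)" using assms(1) by (simp add: open_vimage)
  then have "\<forall>\<^sub>F t in nhds 0. t \<in> (\<lambda>t. z + t *s axis i 1) -` B"
    by (rule eventually_nhds_in_open) (simp add: assms(2))
  then have "\<forall>\<^sub>F t in nhds 0. f (z + t *s axis i 1) = g (z + t *s axis i 1)"
    by (rule eventually_mono) (simp add: assms(3))
  then show ?thesis unfolding pd_def by (rule deriv_cong_ev) simp
qed

text \<open>Common interface of two kinds of charts: those of the maximal atlas of \<open>Y\<close>,
  and restrictions to \<open>X\<close> of adapted charts. One calculus of partial derivatives thus
  serves both manifolds.\<close>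

locale mchart =
  fixes M :: "('y, 'n::finite) cmfd" and U :: "'y set" and \<phi> :: "'y \<Rightarrow> complex ^ 'n" and S :: "'n set"
  assumes chart: "is_chart (mtop M) (U, \<phi>, S)"
    and trans: "\<And>c'. c' \<in> atlas M \<Longrightarrow> is_chart (mtop M) c' \<and> holo_transition c' (U, \<phi>, S)"
    and hol: "\<And>V f. holfun M V f \<Longrightarrow> holo_on (\<phi> ` (U \<inter> V)) (\<lambda>z. f (inv_into U \<phi> z))"
begin

text \<open>Functions on the chart are extended to be constant in the coordinates outside \<open>S\<close>, so that their
  partial derivatives are those of functions on open subsets of \<open>complex ^ 'n\<close>.\<close>

definition emb :: "complex ^ 'n \<Rightarrow> complex ^ 'n" where
  "emb z = (\<chi> i. if i \<in> S then z $ i else 0)"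

definition ef :: "('y \<Rightarrow> complex) \<Rightarrow> complex ^ 'n \<Rightarrow> complex" where
  "ef f z = f (inv_into U \<phi> (emb z))"

definition dom :: "'y set \<Rightarrow> (complex ^ 'n) set" where
  "dom W = {z. emb z \<in> \<phi> ` W}"

definition dd :: "'n \<Rightarrow> ('y \<Rightarrow> complex) \<Rightarrow> 'y \<Rightarrow> complex" where
  "dd i f y = pd i (ef f) (\<phi> y)"

lemmas inv = is_chart_inv[OF chart]

lemma U_open: "openin (mtop M) U" using chart by (simp add: is_chart_def)

lemma \<phi>_cplane: "y \<in> U \<Longrightarrow> \<phi> y \<in> cplane S"
proof -
  have "\<phi> ` U \<subseteq> cplane S" using chart openin_subset unfolding is_chart_def by fastforce
  then show "y \<in> U \<Longrightarrow> \<phi> y \<in> cplane S" by blast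
qed

lemma emb_cplane: "z \<in> cplane S \<Longrightarrow> emb z = z" "emb z \<in> cplane S"
  by (auto simp: emb_def cplane_def vec_eq_iff)

lemma emb_\<phi>: "y \<in> U \<Longrightarrow> emb (\<phi> y) = \<phi> y"
  by (simp add: emb_cplane \<phi>_cplane)

lemma ef_\<phi>: "y \<in> U \<Longrightarrow> ef f (\<phi> y) = f y"
  by (simp add: ef_def emb_\<phi> inv)

lemma \<phi>_dom: "y \<in> W \<Longrightarrow> W \<subseteq> U \<Longrightarrow> \<phi> y \<in> dom W"
  using emb_\<phi>[of y] by (auto simp: dom_def)

lemma emb_linear: "bounded_linear emb"
  unfolding emb_def
  by (intro linear_conv_bounded_linear[THEN iffD1] linearI) (auto simp: vec_eq_iff)

lemma emb_smult: "emb (c *s v) = c *s emb v"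
  by (simp add: emb_def vec_eq_iff)

text \<open>\<open>dom W\<close> is the preimage under \<open>emb\<close> of an open set, because
  the image of the chart is relatively open in its coordinate plane.\<close>

lemma dom_open:
  assumes W: "openin (mtop M) W" "W \<subseteq> U"
  shows "open (dom W)"
proof -
  obtain B where B: "open B" "\<phi> ` (U \<inter> W) = \<phi> ` U \<inter> B" using is_chart_open_image[OF chart W(1)] by (elim exE conjE)
  obtain B' where B': "open B'" "\<phi> ` U = cplane S \<inter> B'" using chart by (auto simp: is_chart_def openin_open)
  have "\<phi> ` W = cplane S \<inter> (B' \<inter> B)" using B(2) B'(2) W(2) by (simp add: Int_absorb1 Int_assoc)
  then have "dom W = emb -` (B' \<inter> B)" by (auto simp: dom_def emb_cplane)
  moreover have "continuous_on UNIV emb"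
    using linear_continuous_on[OF emb_linear] by simp
  ultimately show ?thesis using B(1) B'(1) by (simp add: open_vimage open_Int)
qed

lemma ef_holo:
  assumes f: "holfun M W f" "W \<subseteq> U"
  shows "holo_on (dom W) (ef f)"
  unfolding holo_on_def
proof
  fix z assume z: "z \<in> dom W"
  then have "emb z \<in> \<phi> ` (U \<inter> W)" using f(2) by (auto simp: dom_def)
  from bspec[OF hol[OF f(1), unfolded holo_on_def] this] obtain D where
    D: "((\<lambda>z. f (inv_into U \<phi> z)) has_derivative D) (at (emb z) within \<phi> ` (U \<inter> W))"
    and D': "\<forall>c v. D (c *s v) = c * D v" by (elim exE conjE)
  have "emb ` dom W \<subseteq> \<phi> ` (U \<inter> W)" using f(2) by (auto simp: dom_def)
  from has_derivative_in_compose[OF bounded_linear_imp_has_derivative[OF emb_linear] has_derivative_subset[OF D this]]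
  have "(ef f has_derivative (\<lambda>v. D (emb v))) (at z within dom W)" by (simp add: ef_def[abs_def])
  then show "\<exists>D. (ef f has_derivative D) (at z within dom W) \<and> (\<forall>c v. D (c *s v) = c * D v)"
    using D' by (intro exI[of _ "\<lambda>v. D (emb v)"]) (simp add: emb_smult)
qed

lemma holfun_of_chart:
  assumes W: "openin (mtop M) W" "W \<subseteq> U" and G: "holo_on (\<phi> ` W) G"
  shows "holfun M W (\<lambda>y. G (\<phi> y))"
proof (rule holfunI[OF W(1)])
  fix U' S' and \<phi>' :: "'y \<Rightarrow> complex ^ 'n" assume c': "(U', \<phi>', S') \<in> atlas M"
  have h: "holo_on (\<phi> ` (U \<inter> W)) (\<lambda>z. G (\<phi> (inv_into U \<phi> z)))"
    using G by (rule holo_on_cong[OF holo_on_subset]) (auto simp: inv)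
  show "holo_on (\<phi>' ` (U' \<inter> W)) (\<lambda>z. G (\<phi> (inv_into U' \<phi>' z)))"
    unfolding holo_on_def
  proof
    fix z assume "z \<in> \<phi>' ` (U' \<inter> W)"
    then obtain p where p: "p \<in> U'" "p \<in> W" "z = \<phi>' p" by blast
    show "\<exists>D. ((\<lambda>z. G (\<phi> (inv_into U' \<phi>' z))) has_derivative D) (at z within \<phi>' ` (U' \<inter> W)) \<and> (\<forall>c v. D (c *s v) = c * D v)"
      unfolding p(3)
      by (rule chart_change[OF conjunct1[OF trans[OF c']] chart conjunct2[OF trans[OF c']] h p(1) _ p(2)]) (use p W in blast)
  qed
qed

lemma coord_holfun: "holfun M U (\<lambda>y. \<phi> y $ i)"
proof (rule holfun_of_chart[OF U_open subset_refl])
  have "holo_on UNIV (\<lambda>z::complex ^ 'n. z $ i)"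
    unfolding holo_on_def
    by (auto intro!: exI[of _ "\<lambda>v. v $ i"] bounded_linear_imp_has_derivative bounded_linear_vec_nth)
  then show "holo_on (\<phi> ` U) (\<lambda>z. z $ i)" by (rule holo_on_subset) simp
qed

lemma dd_holfun:
  assumes f: "holfun M W f" "W \<subseteq> U"
  shows "holfun M W (dd i f)"
proof -
  have "\<phi> ` W \<subseteq> dom W" using \<phi>_dom f(2) by blast
  then have "holo_on (\<phi> ` W) (pd i (ef f))"
    by (rule holo_on_subset[OF pd_holo[OF dom_open[OF holfun_open[OF f(1)] f(2)] ef_holo[OF f]]])
  from holfun_of_chart[OF holfun_open[OF f(1)] f(2) this] show ?thesis by (simp add: dd_def[abs_def])
qed

lemma dd_has_derivative:
  assumes f: "holfun M V f" and y: "y \<in> V" "y \<in> U"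
  shows "(ef f has_derivative (\<lambda>v. \<Sum>i\<in>UNIV. v $ i * dd i f y)) (at (\<phi> y))"
proof -
  have V: "holfun M (V \<inter> U) f" by (rule holfun_Int(1)[OF f U_open])
  show ?thesis unfolding dd_def
    by (rule holo_has_derivative[OF dom_open[OF holfun_open[OF V]] ef_holo[OF V]]) (use y in \<open>auto intro: \<phi>_dom\<close>)
qed

lemma dd_cong:
  assumes V: "openin (mtop M) V" "y \<in> V" "y \<in> U" and eq: "\<And>z. z \<in> V \<Longrightarrow> f z = g z"
  shows "dd i f y = dd i g y"
  unfolding dd_def
proof (rule pd_cong)
  show "open (dom (V \<inter> U))" using V(1) U_open by (intro dom_open openin_Int) auto
  show "\<phi> y \<in> dom (V \<inter> U)" using V by (intro \<phi>_dom) auto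
  fix w assume "w \<in> dom (V \<inter> U)"
  then obtain p where "p \<in> V" "p \<in> U" "emb w = \<phi> p" by (auto simp: dom_def)
  then show "ef f w = ef g w" using eq by (simp add: ef_def inv)
qed

lemma dd_add:
  assumes "holfun M V f" "y \<in> V" "holfun M W g" "y \<in> W" "y \<in> U"
  shows "dd i (\<lambda>z. f z + g z) y = dd i f y + dd i g y"
proof -
  have "((\<lambda>z. ef f z + ef g z) has_derivative (\<lambda>v. \<Sum>i\<in>UNIV. v $ i * (dd i f y + dd i g y))) (at (\<phi> y))"
    using has_derivative_add[OF dd_has_derivative[OF assms(1,2,5)] dd_has_derivative[OF assms(3,4,5)]]
    by (simp add: distrib_left sum.distrib)
  from pd_eqI[OF this] show ?thesis unfolding dd_def by (simp add: ef_def[abs_def])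
qed

lemma dd_mult:
  assumes "holfun M V f" "y \<in> V" "holfun M W g" "y \<in> W" "y \<in> U"
  shows "dd i (\<lambda>z. f z * g z) y = f y * dd i g y + g y * dd i f y"
proof -
  have "((\<lambda>z. ef f z * ef g z) has_derivative (\<lambda>v. \<Sum>i\<in>UNIV. v $ i * (f y * dd i g y + g y * dd i f y))) (at (\<phi> y))"
    using has_derivative_mult[OF dd_has_derivative[OF assms(1,2,5)] dd_has_derivative[OF assms(3,4,5)]]
    by (simp add: ef_\<phi>[OF assms(5)] sum_distrib_left sum_distrib_right sum.distrib[symmetric] algebra_simps)
  from pd_eqI[OF this] show ?thesis unfolding dd_def by (simp add: ef_def[abs_def])
qed

lemma dd_const: "dd i (\<lambda>_. c) y = 0"
  by (simp add: dd_def pd_def ef_def)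

lemma dd_uminus:
  assumes "holfun M V f" "y \<in> V" "y \<in> U"
  shows "dd i (\<lambda>z. - f z) y = - dd i f y"
proof -
  have "y \<in> topspace (mtop M)" using assms(3) U_open openin_subset by blast
  then show ?thesis
    using dd_mult[OF holfun_const[OF openin_topspace, of M "-1"] _ assms] by (simp add: dd_const)
qed

text \<open>\<open>ef f\<close> depends on its argument only through \<open>emb\<close>, and so do
  its partial derivatives; evaluating them on the chart and extending again changes nothing.
  Iterated derivatives in the chart thereby become iterated partial derivatives, to which
  \<open>pd_commute\<close> applies.\<close>

lemma ef_dd:
  assumes f: "holfun M W f" "W \<subseteq> U" and z: "z \<in> dom W"
  shows "ef (dd i f) z = pd i (ef f) z"
proof -
  have e: "emb (emb z + t *s axis i 1) = emb (z + t *s axis i 1)" for t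
    by (simp add: emb_def vec_eq_iff)
  obtain p where p: "p \<in> W" "emb z = \<phi> p" using z by (auto simp: dom_def)
  have "ef (dd i f) z = pd i (ef f) (emb z)" using p f(2) inv[of p] by (auto simp: ef_def dd_def)
  also have "\<dots> = pd i (ef f) z" by (simp add: pd_def ef_def e)
  finally show ?thesis .
qed

lemma dd_commute:
  assumes f: "holfun M W f" "W \<subseteq> U" and y: "y \<in> W"
  shows "dd j (dd i f) y = dd i (dd j f) y"
proof -
  have o: "open (dom W)" by (rule dom_open[OF holfun_open[OF f(1)] f(2)])
  have y': "\<phi> y \<in> dom W" by (rule \<phi>_dom[OF y f(2)])
  have "dd j (dd i f) y = pd j (pd i (ef f)) (\<phi> y)" for i j
    unfolding dd_def[of j] by (rule pd_cong[OF o y']) (rule ef_dd[OF f])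
  then show ?thesis using pd_commute[OF o ef_holo[OF f] y', of j i] by simp
qed

text \<open>For \<open>i\<close> in \<open>S\<close> the coordinate line through a point of the
  chart stays in the coordinate plane, where \<open>emb\<close> is the identity.\<close>

lemma cdiff_dd:
  assumes "(U, \<phi>, S) \<in> atlas M" "y \<in> U" "i \<in> S"
  shows "cdiff M f y (U, \<phi>, S) $ i = dd i f y"
proof -
  have "emb (\<phi> y + t *s axis i 1) = \<phi> y + t *s axis i 1" for t
    using \<phi>_cplane[OF assms(2)] assms(3) by (intro emb_cplane(1)) (auto simp: cplane_def axis_def)
  then show ?thesis using assms by (simp add: cdiff_def dd_def pd_def ef_def)
qed

lemma ball_nhd:
  assumes W: "openin (mtop M) W" "W \<subseteq> U"
  shows "openin (mtop M) {y\<in>W. \<phi> y \<in> ball p \<epsilon>}"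
proof -
  have "homeomorphic_map (subtopology (mtop M) U) (top_of_set (\<phi> ` U)) \<phi>" using chart by (simp add: is_chart_def)
  then have "continuous_map (subtopology (mtop M) U) euclidean \<phi>"
    using homeomorphic_imp_continuous_map continuous_map_in_subtopology by blast
  then have "openin (subtopology (mtop M) U) {y\<in>topspace (subtopology (mtop M) U). \<phi> y \<in> ball p \<epsilon>}"
    by (rule openin_continuous_map_preimage) simp
  then have "openin (mtop M) {y\<in>topspace (subtopology (mtop M) U). \<phi> y \<in> ball p \<epsilon>}"
    by (rule openin_trans_full) (rule U_open)
  from openin_Int[OF W(1) this] have "openin (mtop M) (W \<inter> {y\<in>topspace (subtopology (mtop M) U). \<phi> y \<in> ball p \<epsilon>})" .
  moreover have "W \<inter> {y\<in>topspace (subtopology (mtop M) U). \<phi> y \<in> ball p \<epsilon>} = {y\<in>W. \<phi> y \<in> ball p \<epsilon>}"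
    using W U_open openin_subset by (auto simp: subset_iff)
  ultimately show ?thesis by simp
qed

text \<open>\<open>hadamard\<close> is applied to the extension of \<open>f\<close> on a ball inside
  its domain. Since \<open>K\<close> is contained in \<open>S\<close>, the projected point has zero
  coordinates outside \<open>S\<close>; it therefore lies in the image of \<open>W\<close> and not
  only in the domain of the extension.\<close>

lemma hadamard_chart:
  assumes f: "holfun M W f" "W \<subseteq> U" and x: "x \<in> W" and K: "K \<subseteq> S"
  shows "\<exists>W' g. openin (mtop M) W' \<and> x \<in> W' \<and> W' \<subseteq> W \<and> (\<forall>i. holfun M W' (g i)) \<and>
    (\<forall>y\<in>W'. proj_on K (\<phi> x) (\<phi> y) \<in> \<phi> ` W \<and>
      f y - f (inv_into U \<phi> (proj_on K (\<phi> x) (\<phi> y))) = (\<Sum>i\<in>K. (\<phi> y $ i - \<phi> x $ i) * g i y) \<and>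
      (\<forall>i. proj_on K (\<phi> x) (\<phi> y) = \<phi> y \<longrightarrow> g i y = dd i f y))"
proof -
  have o: "open (dom W)" by (rule dom_open[OF holfun_open[OF f(1)] f(2)])
  obtain \<epsilon> where \<epsilon>: "\<epsilon> > 0" "ball (\<phi> x) \<epsilon> \<subseteq> dom W"
    using open_contains_ball_eq[OF o] \<phi>_dom[OF x f(2)] by blast
  obtain G where G: "\<forall>i. holo_on (ball (\<phi> x) \<epsilon>) (G i)"
    "\<forall>z\<in>ball (\<phi> x) \<epsilon>. ef f z - ef f (proj_on K (\<phi> x) z) = (\<Sum>i\<in>K. (z $ i - \<phi> x $ i) * G i z)"
    "\<forall>i. \<forall>z\<in>ball (\<phi> x) \<epsilon>. proj_on K (\<phi> x) z = z \<longrightarrow> G i z = pd i (ef f) z"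
    using hadamard[OF \<epsilon>(1) holo_on_subset[OF ef_holo[OF f] \<epsilon>(2)], of K] by (elim exE conjE)
  let ?W = "{y\<in>W. \<phi> y \<in> ball (\<phi> x) \<epsilon>}"
  have W: "openin (mtop M) ?W" by (rule ball_nhd[OF holfun_open[OF f(1)] f(2)])
  have h: "holfun M ?W (\<lambda>y. G i (\<phi> y))" for i
    by (rule holfun_of_chart[OF W]) (use f(2) in blast, rule holo_on_subset[OF G(1)[rule_format]], blast)
  have "proj_on K (\<phi> x) (\<phi> y) \<in> \<phi> ` W \<and>
      f y - f (inv_into U \<phi> (proj_on K (\<phi> x) (\<phi> y))) = (\<Sum>i\<in>K. (\<phi> y $ i - \<phi> x $ i) * G i (\<phi> y)) \<and>
      (\<forall>i. proj_on K (\<phi> x) (\<phi> y) = \<phi> y \<longrightarrow> G i (\<phi> y) = dd i f y)" if y: "y \<in> ?W" for y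
  proof -
    let ?z = "proj_on K (\<phi> x) (\<phi> y)"
    have yU: "y \<in> U" using y f(2) by blast
    have zc: "emb ?z = ?z" using K \<phi>_cplane[OF yU] by (intro emb_cplane(1)) (auto simp: cplane_def proj_on_def)
    have "norm (?z - \<phi> x) \<le> norm (\<phi> y - \<phi> x)"
      by (rule norm_le_componentwise_cart) (simp add: proj_on_def)
    then have "?z \<in> ball (\<phi> x) \<epsilon>" using y by (simp add: dist_norm norm_minus_commute)
    then have "?z \<in> dom W" by (rule subsetD[OF \<epsilon>(2)])
    then have "emb ?z \<in> \<phi> ` W" by (simp add: dom_def)
    then have zW: "?z \<in> \<phi> ` W" by (simp only: zc)
    have e: "ef f ?z = f (inv_into U \<phi> ?z)" by (simp add: ef_def zc)
    have yb: "\<phi> y \<in> ball (\<phi> x) \<epsilon>" using y by blast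
    have "f y - f (inv_into U \<phi> ?z) = (\<Sum>i\<in>K. (\<phi> y $ i - \<phi> x $ i) * G i (\<phi> y))"
      using bspec[OF G(2) yb] unfolding ef_\<phi>[OF yU] e .
    moreover have "\<forall>i. ?z = \<phi> y \<longrightarrow> G i (\<phi> y) = dd i f y"
      using G(3) yb unfolding dd_def by blast
    ultimately show ?thesis using zW by blast
  qed
  moreover have "x \<in> ?W" using x \<epsilon>(1) by simp
  moreover have "?W \<subseteq> W" by blast
  ultimately show ?thesis using W h
    apply -
    apply (rule exI[of _ ?W])
    apply (rule exI[of _ "\<lambda>i y. G i (\<phi> y)"])
    apply (rule conjI, assumption)+
    apply (rule conjI)
     apply (rule allI, assumption)
    apply (rule ballI)
    by assumption
qed

end

lemma mchart_max_atlas: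
  assumes "complex_manifold Y" "(U, \<phi>, S) \<in> max_atlas Y"
  shows "mchart Y U \<phi> S"
proof
  show "is_chart (mtop Y) (U, \<phi>, S)" by (rule max_atlas_chart[OF assms])
  fix c' assume c': "c' \<in> atlas Y"
  have "\<forall>c\<in>atlas Y. is_chart (mtop Y) c" using assms(1) by (simp add: complex_manifold_def)
  moreover have "\<forall>c'\<in>atlas Y. compatible (U, \<phi>, S) c'" using assms(2) by (simp add: max_atlas_def)
  ultimately show "is_chart (mtop Y) c' \<and> holo_transition c' (U, \<phi>, S)"
    using c' unfolding compatible_def by simp
next
  fix V f assume "holfun Y V f"
  then show "holo_on (\<phi> ` (U \<inter> V)) (\<lambda>z. f (inv_into U \<phi> z))" by (rule holfun_max_atlas[OF assms(1) _ assms(2)])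
qed

text \<open>On the points of \<open>X\<close> the inverse of a restricted chart agrees with that of
  the full one, so holomorphic transitions restrict to holomorphic transitions.\<close>

lemma mchart_submfd:
  assumes cm: "complex_manifold Y" and c: "adapted_chart Y X (U, \<phi>, S) K"
  shows "mchart (submfd Y X) (U \<inter> X) \<phi> (S - K)"
proof
  have m: "(U, \<phi>, S) \<in> max_atlas Y" using c by (simp add: adapted_chart_def)
  show ch: "is_chart (mtop (submfd Y X)) (U \<inter> X, \<phi>, S - K)" by (rule adapted_restrict_chart[OF c])
  have mem: "(U \<inter> X, \<phi>, S - K) \<in> atlas (submfd Y X)" using c by (auto simp: submfd_def)
  fix c' assume "c' \<in> atlas (submfd Y X)"
  then obtain U' \<phi>' S' K' where c': "c' = (U' \<inter> X, \<phi>', S' - K')" "adapted_chart Y X (U', \<phi>', S') K'"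
    by (auto simp: submfd_def)
  have m': "(U', \<phi>', S') \<in> max_atlas Y" using c' by (simp add: adapted_chart_def)
  have t: "\<forall>i. holo_on (\<phi>' ` (U' \<inter> U)) (\<lambda>z. \<phi> (inv_into U' \<phi>' z) $ i)"
    using max_atlas_transition[OF cm m' m] unfolding holo_transition_def split .
  have "holo_on (\<phi>' ` (U' \<inter> X \<inter> (U \<inter> X))) (\<lambda>z. \<phi> (inv_into (U' \<inter> X) \<phi>' z) $ i)" for i
  proof (rule holo_on_cong)
    show "holo_on (\<phi>' ` (U' \<inter> X \<inter> (U \<inter> X))) (\<lambda>z. \<phi> (inv_into U' \<phi>' z) $ i)"
      by (rule holo_on_subset[OF t[rule_format]]) blast
    fix z assume "z \<in> \<phi>' ` (U' \<inter> X \<inter> (U \<inter> X))"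
    then obtain p where "p \<in> U'" "p \<in> X" "z = \<phi>' p" by blast
    then show "\<phi> (inv_into (U' \<inter> X) \<phi>' z) $ i = \<phi> (inv_into U' \<phi>' z) $ i"
      using is_chart_inv[OF max_atlas_chart[OF cm m']] is_chart_inv[OF adapted_restrict_chart[OF c'(2)]] by simp
  qed
  then show "is_chart (mtop (submfd Y X)) c' \<and> holo_transition c' (U \<inter> X, \<phi>, S - K)"
    unfolding c'(1) holo_transition_def split using adapted_restrict_chart[OF c'(2)] by simp
next
  fix V f assume "holfun (submfd Y X) V f"
  then show "holo_on (\<phi> ` ((U \<inter> X) \<inter> V)) (\<lambda>z. f (inv_into (U \<inter> X) \<phi> z))"
    by (rule holfunD) (use c in \<open>auto simp: submfd_def\<close>)
qed

section \<open>Derivations into the conormal sheaf in an adapted chart\<close>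

context closed_pair
begin

lemma sec_N_cong:
  assumes s: "is_sec (conormal Y X) U s" and eq: "\<And>x. x \<in> U \<Longrightarrow> s x = t x"
  shows "is_sec (conormal Y X) U t"
  unfolding sec_N_iff
proof
  fix x assume "x \<in> U"
  from bspec[OF s[unfolded sec_N_iff] this] obtain V f where
    V: "x \<in> V" "V \<inter> X \<subseteq> U" "holfun Y V f" "\<forall>y\<in>V \<inter> X. f y = 0" "\<forall>y\<in>V \<inter> X. s y = cls y f"
    by (elim exE conjE)
  have "\<forall>y\<in>V \<inter> X. t y = cls y f"
  proof
    fix y assume y: "y \<in> V \<inter> X"
    show "t y = cls y f" using eq[OF subsetD[OF V(2) y]] bspec[OF V(5) y] by (simp only:)
  qed
  with V(1-4) show "\<exists>V f. x \<in> V \<and> V \<inter> X \<subseteq> U \<and> holfun Y V f \<and> (\<forall>y\<in>V \<inter> X. f y = 0) \<and> (\<forall>y\<in>V \<inter> X. t y = cls y f)"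
    by (intro exI conjI)
qed

lemma sec_N_finsum:
  assumes \<sigma>: "retraction_pullback Y X \<sigma>" and U: "openin TX U" and A: "finite A"
    and s: "\<And>i. i \<in> A \<Longrightarrow> is_sec (conormal Y X) U (s i)"
  shows "is_sec (conormal Y X) U (\<lambda>x. finsum (NX x) (\<lambda>i. s i x) A)"
proof -
  interpret N: module_sheaf TX "OX Y X" "conormal Y X" by (rule conormal_module_sheaf[OF \<sigma>])
  have UX: "U \<subseteq> X" using openin_subset[OF U] topspace_TX by simp
  note eq = sec_N_cong
  show ?thesis using A s
  proof (induction A rule: finite_induct)
    case empty
    have "is_sec (conormal Y X) U (\<lambda>x. cls x (\<lambda>_. 0))"
      unfolding sec_N_iff
    proof
      fix x assume x: "x \<in> U"
      obtain V where V: "openin (mtop Y) V" "U = V \<inter> X" using U unfolding openin_TX by (elim exE conjE)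
      show "\<exists>V f. x \<in> V \<and> V \<inter> X \<subseteq> U \<and> holfun Y V f \<and> (\<forall>y\<in>V \<inter> X. f y = 0) \<and> (\<forall>y\<in>V \<inter> X. cls y (\<lambda>_. 0) = cls y f)"
        by (rule exI[of _ V], rule exI[of _ "\<lambda>_. 0"]) (use V x holfun_const[OF V(1)] in blast)
    qed
    then show ?case
    proof (rule eq)
      fix x assume "x \<in> U"
      then have x: "x \<in> X" using UX by blast
      interpret N: module "RX x" "NX x" by (rule N_module[OF \<sigma> x])
      show "cls x (\<lambda>_. 0) = finsum (NX x) (\<lambda>i. s i x) {}"
        by (simp add: N_ops[OF x] cls_zero[OF x])
    qed
  next
    case (insert a A)
    have h: "is_sec (conormal Y X) U (\<lambda>x. s a x \<oplus>\<^bsub>NX x\<^esub> finsum (NX x) (\<lambda>i. s i x) A)"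
      using insert by (intro sec_N_add) simp_all
    show ?case
    proof (rule eq[OF h])
      fix x assume xU: "x \<in> U"
      then have x: "x \<in> X" using UX by blast
      interpret N: module "RX x" "NX x" by (rule N_module[OF \<sigma> x])
      have "s i x \<in> carrier (NX x)" if "i \<in> insert a A" for i
        by (rule N.sec_F_closed[OF U insert.prems[OF that] xU])
      then show "s a x \<oplus>\<^bsub>NX x\<^esub> finsum (NX x) (\<lambda>i. s i x) A = finsum (NX x) (\<lambda>i. s i x) (insert a A)"
        using insert.hyps by (subst N.finsum_insert) (auto simp only: Pi_iff insertI1 insertI2)
    qed
  qed
qed

end

section \<open>Normal derivatives of lifts in an adapted chart\<close>

locale adapted = closed_pair Y X r for Y :: "('y, 'n::finite) cmfd" and X r +
  fixes U :: "'y set" and \<phi> :: "'y \<Rightarrow> complex ^ 'n" and S K :: "'n set"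
  assumes ac: "adapted_chart Y X (U, \<phi>, S) K"
begin

lemma chartY: "(U, \<phi>, S) \<in> max_atlas Y" "K \<subseteq> S" "\<phi> ` (U \<inter> X) = \<phi> ` U \<inter> cplane (S - K)"
  using ac by (auto simp: adapted_chart_def)

sublocale CY: mchart Y U \<phi> S by (rule mchart_max_atlas[OF cm chartY(1)])
sublocale CX: mchart "submfd Y X" "U \<inter> X" \<phi> "S - K" by (rule mchart_submfd[OF cm ac])

lemma chartX: "(U \<inter> X, \<phi>, S - K) \<in> atlas (submfd Y X)"
  using ac by (auto simp: submfd_def)

lemma \<phi>_K: "y \<in> U \<Longrightarrow> y \<in> X \<Longrightarrow> k \<notin> S - K \<Longrightarrow> \<phi> y $ k = 0"
  using CX.\<phi>_cplane[of y] by (simp add: cplane_def)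

text \<open>By the product rule, the derivative of a product vanishes where both factors do. The
  induction over the product ideal carries along a representative with vanishing derivative at
  \<open>x\<close>; for the germ of \<open>F\<close> it agrees with \<open>F\<close> near
  \<open>x\<close>.\<close>

lemma dd_ideal_sq:
  assumes x: "x \<in> X" and F: "holfun Y V F" "x \<in> V" "x \<in> U" and sq: "germ (mtop Y) x F \<in> ideal_sq Y X x"
  shows "CY.dd k F x = 0"
proof -
  have "\<exists>F V. x \<in> V \<and> holfun Y V F \<and> A = germ (mtop Y) x F \<and> CY.dd k F x = 0"
    if "A \<in> ideal_prod (RY x) (ideal_stalk Y X x) (ideal_stalk Y X x)" for A
    using that
  proof induction
    case (prod i j)
    obtain f V where f: "x \<in> V" "holfun Y V f" "\<forall>y\<in>V \<inter> X. f y = 0" "i = germ (mtop Y) x f"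
      using prod(1) unfolding ideal_stalk_mem[OF x] by (elim exE conjE)
    obtain g W where g: "x \<in> W" "holfun Y W g" "\<forall>y\<in>W \<inter> X. g y = 0" "j = germ (mtop Y) x g"
      using prod(2) unfolding ideal_stalk_mem[OF x] by (elim exE conjE)
    have h: "holfun Y (V \<inter> W) (\<lambda>y. f y * g y)"
      by (rule holfun_mult[OF holfun_Int(1)[OF f(2) holfun_open[OF g(2)]] holfun_Int(2)[OF g(2) holfun_open[OF f(2)]]])
    have "f x = 0" "g x = 0" using f(1,3) g(1,3) x by blast+
    then have "CY.dd k (\<lambda>y. f y * g y) x = 0"
      using CY.dd_mult[OF f(2,1) g(2,1) F(3)] by simp
    moreover have "i \<otimes>\<^bsub>RY x\<^esub> j = germ (mtop Y) x (\<lambda>y. f y * g y)"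
      unfolding f(4) g(4) hol_germs_ops[OF xY[OF x]] ..
    ultimately show ?case using h f(1) g(1) by (intro exI[of _ "\<lambda>y. f y * g y"] exI[of _ "V \<inter> W"] conjI) simp_all
  next
    case (sum A B)
    obtain f V where f: "x \<in> V" "holfun Y V f" "A = germ (mtop Y) x f" "CY.dd k f x = 0"
      using sum.IH(1) by (elim exE conjE)
    obtain g W where g: "x \<in> W" "holfun Y W g" "B = germ (mtop Y) x g" "CY.dd k g x = 0"
      using sum.IH(2) by (elim exE conjE)
    have h: "holfun Y (V \<inter> W) (\<lambda>y. f y + g y)"
      by (rule holfun_add[OF holfun_Int(1)[OF f(2) holfun_open[OF g(2)]] holfun_Int(2)[OF g(2) holfun_open[OF f(2)]]])
    have "CY.dd k (\<lambda>y. f y + g y) x = 0"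
      using CY.dd_add[OF f(2,1) g(2,1) F(3)] f(4) g(4) by simp
    moreover have "A \<oplus>\<^bsub>RY x\<^esub> B = germ (mtop Y) x (\<lambda>y. f y + g y)"
      unfolding f(3) g(3) hol_germs_ops[OF xY[OF x]] ..
    ultimately show ?case using h f(1) g(1) by (intro exI[of _ "\<lambda>y. f y + g y"] exI[of _ "V \<inter> W"] conjI) simp_all
  qed
  from this[OF sq[unfolded ideal_sq_def]] obtain G W where
    G: "x \<in> W" "holfun Y W G" "germ (mtop Y) x F = germ (mtop Y) x G" "CY.dd k G x = 0" by (elim exE conjE)
  obtain V' where V': "openin (mtop Y) V'" "x \<in> V'" "\<forall>y\<in>V'. F y = G y"
    using germ_eqD[OF xY[OF x] G(3)] by (elim exE conjE)
  have "CY.dd k F x = CY.dd k G x" by (rule CY.dd_cong[OF V'(1,2) F(3)]) (use V'(3) in blast)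
  then show ?thesis using G(4) by simp
qed

text \<open>By Hadamard's lemma, a function vanishing on \<open>X\<close> to second order is locally a combination
  \<open>\<Sum>\<^sub>k z\<^sub>k g\<^sub>k\<close> with \<open>g\<^sub>k\<close> in the ideal of \<open>X\<close>.\<close>

lemma ideal_sqI:
  assumes x: "x \<in> X" and F: "holfun Y V F" "x \<in> V" "V \<subseteq> U"
    and z: "\<And>y. y \<in> V \<Longrightarrow> y \<in> X \<Longrightarrow> F y = 0" and dz: "\<And>y k. y \<in> V \<Longrightarrow> y \<in> X \<Longrightarrow> k \<in> K \<Longrightarrow> CY.dd k F y = 0"
  shows "germ (mtop Y) x F \<in> ideal_sq Y X x"
proof -
  interpret I2: ideal "ideal_sq Y X x" "RY x" by (rule ideal_sq_ideal[OF x])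
  obtain W g where W: "openin (mtop Y) W" "x \<in> W" "W \<subseteq> V" "\<forall>i. holfun Y W (g i)"
    "\<forall>y\<in>W. proj_on K (\<phi> x) (\<phi> y) \<in> \<phi> ` V \<and>
      F y - F (inv_into U \<phi> (proj_on K (\<phi> x) (\<phi> y))) = (\<Sum>i\<in>K. (\<phi> y $ i - \<phi> x $ i) * g i y) \<and>
      (\<forall>i. proj_on K (\<phi> x) (\<phi> y) = \<phi> y \<longrightarrow> g i y = CY.dd i F y)"
    using CY.hadamard_chart[OF F(1,3,2) chartY(2)] by (elim exE conjE)
  have xU: "x \<in> U" using F by blast
  \<comment> \<open>The projection sets the normal coordinates to zero, as they are zero at
    \<open>x\<close>. The projected point thus lies on \<open>X\<close>, where \<open>F\<close>
    vanishes, and the second term in Hadamard's formula disappears.\<close>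
  have F_eq: "F y = (\<Sum>i\<in>K. \<phi> y $ i * g i y)" if y: "y \<in> W" for y
  proof -
    let ?z = "proj_on K (\<phi> x) (\<phi> y)"
    note Wy = bspec[OF W(5) y]
    obtain p where p: "p \<in> V" "?z = \<phi> p" using conjunct1[OF Wy] by (elim imageE)
    have yU: "y \<in> U" and pU: "p \<in> U" using y W(3) F(3) p by blast+
    have "?z \<in> cplane (S - K)"
      using \<phi>_K[OF xU x] CY.\<phi>_cplane[OF yU] by (auto simp: cplane_def proj_on_def)
    then have "\<phi> p \<in> \<phi> ` (U \<inter> X)" unfolding chartY(3) p(2)[symmetric] using p(2) pU by (simp add: Int_iff)
    then obtain q where q: "q \<in> U" "q \<in> X" "\<phi> p = \<phi> q" by blast
    have "p = q" using CY.inv[OF pU] CY.inv[OF q(1)] unfolding q(3) by (rule trans[OF sym])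
    then have "F (inv_into U \<phi> ?z) = 0"
      unfolding p(2) CY.inv[OF pU] using z[OF p(1)] q(2) by simp
    moreover have "(\<Sum>i\<in>K. (\<phi> y $ i - \<phi> x $ i) * g i y) = (\<Sum>i\<in>K. \<phi> y $ i * g i y)"
      by (rule sum.cong) (simp_all add: \<phi>_K[OF xU x])
    ultimately show ?thesis using conjunct1[OF conjunct2[OF Wy]] by (simp only: diff_zero)
  qed
  \<comment> \<open>On \<open>X\<close> the projection is the identity, so \<open>g k\<close> is the
    normal derivative of \<open>F\<close> there, which is zero by assumption.\<close>
  have g_I: "germ (mtop Y) x (g k) \<in> ideal_stalk Y X x" if k: "k \<in> K" for k
  proof -
    have "g k y = 0" if y: "y \<in> W \<inter> X" for y
    proof -
      have yU: "y \<in> U" using y W(3) F(3) by blast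
      have "proj_on K (\<phi> x) (\<phi> y) = \<phi> y"
        using \<phi>_K[OF xU x] \<phi>_K[OF yU] y by (auto simp: proj_on_def vec_eq_iff)
      then have "g k y = CY.dd k F y" using W(5) y by blast
      then show ?thesis using dz[of y k] y k W(3) by auto
    qed
    then show ?thesis unfolding ideal_stalk_mem[OF x] using W(2,4) by blast
  qed
  have z_I: "germ (mtop Y) x (\<lambda>y. \<phi> y $ k) \<in> ideal_stalk Y X x" if k: "k \<in> K" for k
    unfolding ideal_stalk_mem[OF x]
    by (intro exI[of _ "\<lambda>y. \<phi> y $ k"] exI[of _ U] conjI) (use CY.coord_holfun \<phi>_K k xU in auto)
  have "germ (mtop Y) x (\<lambda>y. \<Sum>i\<in>A. \<phi> y $ i * g i y) \<in> ideal_sq Y X x" if "A \<subseteq> K" for A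
    using finite[of A] that
  proof (induction A rule: finite_induct)
    case empty
    then show ?case using additive_subgroup.zero_closed[OF I2.additive_subgroup_axioms]
      by (simp add: hol_germs_ops[OF xY[OF x]])
  next
    case (insert a A)
    have "germ (mtop Y) x (\<lambda>y. \<phi> y $ a) \<otimes>\<^bsub>RY x\<^esub> germ (mtop Y) x (g a) \<in> ideal_sq Y X x"
      using insert.prems by (intro ideal_sq_prod[OF x] g_I z_I) simp_all
    from additive_subgroup.a_closed[OF I2.additive_subgroup_axioms this insert.IH] insert.prems insert.hyps show ?case
      by (simp add: hol_germs_ops[OF xY[OF x]])
  qed
  moreover have "germ (mtop Y) x F = germ (mtop Y) x (\<lambda>y. \<Sum>i\<in>K. \<phi> y $ i * g i y)"
    by (rule germ_eqI[OF W(1,2) F_eq])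
  ultimately show ?thesis by simp
qed

text \<open>The derivative of a lift to \<open>Y\<close> in the direction of a normal coordinate; it vanishes on the square of the ideal.\<close>

definition nrm :: "'n \<Rightarrow> 'y \<Rightarrow> 'y fgerm set \<Rightarrow> complex" where
  "nrm k x b = (SOME c. \<exists>F V. x \<in> V \<and> holfun Y V F \<and> b = cls x F \<and> c = CY.dd k F x)"

context
  fixes x assumes x: "x \<in> X" "x \<in> U"
begin

text \<open>Two functions with the same class differ by an element of the square of the ideal, whose
  derivative at \<open>x\<close> is zero by \<open>dd_ideal_sq\<close>; so the choice in
  \<open>nrm\<close> has only one candidate.\<close>

lemma nrm_cls:
  assumes F: "holfun Y V F" "x \<in> V"
  shows "nrm k x (cls x F) = CY.dd k F x"
  unfolding nrm_def
proof (rule some_equality)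
  show "\<exists>F' V. x \<in> V \<and> holfun Y V F' \<and> cls x F = cls x F' \<and> CY.dd k F x = CY.dd k F' x"
    using F by blast
  fix c assume "\<exists>F' V. x \<in> V \<and> holfun Y V F' \<and> cls x F = cls x F' \<and> c = CY.dd k F' x"
  then obtain G W where G: "x \<in> W" "holfun Y W G" "cls x F = cls x G" "c = CY.dd k G x" by (elim exE conjE)
  have h: "holfun Y (V \<inter> W) (\<lambda>y. F y - G y)"
    by (rule holfun_diff[OF holfun_Int(1)[OF F(1) holfun_open[OF G(2)]] holfun_Int(2)[OF G(2) holfun_open[OF F(1)]]])
  have "germ (mtop Y) x (\<lambda>y. F y - G y) \<in> ideal_sq Y X x"
    using G(3) unfolding cls_eq_iff[OF x(1) F G(2,1)] .
  from dd_ideal_sq[OF x(1) h _ x(2) this] have "CY.dd k (\<lambda>y. F y - G y) x = 0" using F(2) G(1) by simp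
  then show "c = CY.dd k F x"
    using CY.dd_add[OF F holfun_uminus[OF G(2)] G(1) x(2)] CY.dd_uminus[OF G(2,1) x(2)] G(4) by simp
qed

lemma nrm_add:
  assumes "b \<in> carrier (RB x)" "c \<in> carrier (RB x)"
  shows "nrm k x (b \<oplus>\<^bsub>RB x\<^esub> c) = nrm k x b + nrm k x c"
proof -
  obtain F V where F: "x \<in> V" "holfun Y V F" "b = cls x F" using assms(1) unfolding RB_carrier[OF x(1)] by (elim exE conjE)
  obtain G W where G: "x \<in> W" "holfun Y W G" "c = cls x G" using assms(2) unfolding RB_carrier[OF x(1)] by (elim exE conjE)
  have h: "holfun Y (V \<inter> W) (\<lambda>y. F y + G y)"
    by (rule holfun_add[OF holfun_Int(1)[OF F(2) holfun_open[OF G(2)]] holfun_Int(2)[OF G(2) holfun_open[OF F(2)]]])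
  show ?thesis unfolding F(3) G(3) cls_add[OF x(1) F(2,1) G(2,1)] nrm_cls[OF F(2,1)] nrm_cls[OF G(2,1)]
    using nrm_cls[OF h] CY.dd_add[OF F(2,1) G(2,1) x(2)] F(1) G(1) by simp
qed

lemma nrm_mult:
  assumes F: "holfun Y V F" "x \<in> V" and G: "holfun Y W G" "x \<in> W"
  shows "nrm k x (cls x F \<otimes>\<^bsub>RB x\<^esub> cls x G) = F x * nrm k x (cls x G) + G x * nrm k x (cls x F)"
proof -
  have h: "holfun Y (V \<inter> W) (\<lambda>y. F y * G y)"
    by (rule holfun_mult[OF holfun_Int(1)[OF F(1) holfun_open[OF G(1)]] holfun_Int(2)[OF G(1) holfun_open[OF F(1)]]])
  show ?thesis unfolding cls_mult[OF x(1) F G] nrm_cls[OF F] nrm_cls[OF G]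
    using nrm_cls[OF h] CY.dd_mult[OF F G x(2)] F(2) G(2) by simp
qed

lemma nrm_const: "nrm k x (cls x (\<lambda>_. c)) = 0"
  using nrm_cls[OF holfun_const[OF CY.U_open] x(2)] by (simp add: CY.dd_const)

lemma nrm_minus:
  assumes "b \<in> carrier (RB x)" "c \<in> carrier (RB x)"
  shows "nrm k x (b \<ominus>\<^bsub>RB x\<^esub> c) = nrm k x b - nrm k x c"
proof -
  interpret RB: cring "RB x" by (rule RB_cring[OF x(1)])
  have "nrm k x ((b \<ominus>\<^bsub>RB x\<^esub> c) \<oplus>\<^bsub>RB x\<^esub> c) = nrm k x (b \<ominus>\<^bsub>RB x\<^esub> c) + nrm k x c"
    using assms by (intro nrm_add) simp_all
  moreover have "(b \<ominus>\<^bsub>RB x\<^esub> c) \<oplus>\<^bsub>RB x\<^esub> c = b"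
    using assms by (simp add: a_minus_def RB.a_assoc RB.l_neg)
  ultimately show ?thesis by (simp only: algebra_simps)
qed

lemma retraction_rep:
  assumes \<tau>: "retraction_pullback Y X \<tau>" and f: "holfun (submfd Y X) V f" "x \<in> V"
  shows "\<exists>F W. x \<in> W \<and> holfun Y W F \<and> \<tau> x (germ TX x f) = cls x F \<and> F x = f x"
proof -
  have a: "germ TX x f \<in> carrier (RX x)" by (rule germ_closed[OF f])
  obtain F W where F: "x \<in> W" "holfun Y W F" "\<tau> x (germ TX x f) = cls x F"
    using retractionD(1)[OF \<tau> x(1) a] unfolding RB_carrier[OF x(1)] by (elim exE conjE)
  have "germ TX x F = germ TX x f"
    using retractionD(5)[OF \<tau> x(1) a] unfolding F(3) res_cls[OF x(1) F(2,1)] .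
  then have "F x = f x" by (rule germ_value[OF xX[OF x(1)]])
  with F show ?thesis by blast
qed

text \<open>With \<open>nrm_retraction_add\<close> and \<open>nrm_retraction_const\<close> this
  makes the normal derivative of the lift of \<open>f\<close> a complex-valued derivation at the
  point \<open>x\<close>. The lift has the same value at \<open>x\<close> as \<open>f\<close>, which
  gives the right coefficients.\<close>

lemma nrm_retraction_mult:
  assumes \<tau>: "retraction_pullback Y X \<tau>" and f: "holfun (submfd Y X) V f" "x \<in> V" and g: "holfun (submfd Y X) W g" "x \<in> W"
  shows "nrm k x (\<tau> x (germ TX x (\<lambda>y. f y * g y))) =
    f x * nrm k x (\<tau> x (germ TX x g)) + g x * nrm k x (\<tau> x (germ TX x f))"
proof -
  obtain F V' where F: "x \<in> V'" "holfun Y V' F" "\<tau> x (germ TX x f) = cls x F" "F x = f x"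
    using retraction_rep[OF \<tau> f] by (elim exE conjE)
  obtain G W' where G: "x \<in> W'" "holfun Y W' G" "\<tau> x (germ TX x g) = cls x G" "G x = g x"
    using retraction_rep[OF \<tau> g] by (elim exE conjE)
  have "\<tau> x (germ TX x (\<lambda>y. f y * g y)) = cls x F \<otimes>\<^bsub>RB x\<^esub> cls x G"
    unfolding F(3)[symmetric] G(3)[symmetric] hol_germs_ops(2)[OF xX[OF x(1)], symmetric]
    by (rule retractionD(3)[OF \<tau> x(1) germ_closed[OF f] germ_closed[OF g]])
  then show ?thesis using nrm_mult[OF F(2,1) G(2,1)] F(3,4) G(3,4) by (simp only:)
qed

lemma nrm_retraction_add:
  assumes \<tau>: "retraction_pullback Y X \<tau>" and f: "holfun (submfd Y X) V f" "x \<in> V" and g: "holfun (submfd Y X) W g" "x \<in> W"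
  shows "nrm k x (\<tau> x (germ TX x (\<lambda>y. f y + g y))) = nrm k x (\<tau> x (germ TX x f)) + nrm k x (\<tau> x (germ TX x g))"
proof -
  note c = germ_closed[OF f] germ_closed[OF g]
  have "\<tau> x (germ TX x (\<lambda>y. f y + g y)) = \<tau> x (germ TX x f) \<oplus>\<^bsub>RB x\<^esub> \<tau> x (germ TX x g)"
    unfolding hol_germs_ops(1)[OF xX[OF x(1)], symmetric] by (rule retractionD(2)[OF \<tau> x(1) c])
  then show ?thesis using nrm_add[OF retractionD(1)[OF \<tau> x(1) c(1)] retractionD(1)[OF \<tau> x(1) c(2)]] by (simp only:)
qed

lemma nrm_retraction_const:
  assumes \<tau>: "retraction_pullback Y X \<tau>"
  shows "nrm k x (\<tau> x (germ TX x (\<lambda>_. c))) = 0"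
  unfolding retractionD(6)[OF \<tau> x(1)] by (rule nrm_const)

text \<open>A point derivation of the ring of germs is determined by its values on the coordinates.\<close>

lemma nrm_retraction:
  assumes \<tau>: "retraction_pullback Y X \<tau>" and f: "holfun (submfd Y X) W f" "W \<subseteq> U \<inter> X" "x \<in> W"
  shows "nrm k x (\<tau> x (germ TX x f)) =
    (\<Sum>i\<in>S - K. CX.dd i f x * nrm k x (\<tau> x (germ TX x (\<lambda>y. \<phi> y $ i))))"
proof -
  let ?T = "\<lambda>f. nrm k x (\<tau> x (germ TX x f))"
  obtain W' g where W: "openin TX W'" "x \<in> W'" "W' \<subseteq> W" "\<forall>i. holfun (submfd Y X) W' (g i)"
    "\<forall>y\<in>W'. proj_on (S - K) (\<phi> x) (\<phi> y) \<in> \<phi> ` W \<and>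
      f y - f (inv_into (U \<inter> X) \<phi> (proj_on (S - K) (\<phi> x) (\<phi> y))) = (\<Sum>i\<in>S - K. (\<phi> y $ i - \<phi> x $ i) * g i y) \<and>
      (\<forall>i. proj_on (S - K) (\<phi> x) (\<phi> y) = \<phi> y \<longrightarrow> g i y = CX.dd i f y)"
    using CX.hadamard_chart[OF f subset_refl] by (elim exE conjE)
  have xUX: "x \<in> U \<inter> X" using x by simp
  \<comment> \<open>All coordinates of \<open>X\<close> are replaced by those of \<open>x\<close>,
    so the projection is constant and Hadamard's lemma becomes an expansion of \<open>f\<close>
    around its value at \<open>x\<close>.\<close>
  have p: "proj_on (S - K) (\<phi> x) (\<phi> y) = \<phi> x" if "y \<in> W'" for y
  proof -
    have "y \<in> U" "y \<in> X" using that W(3) f(2) by blast+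
    then show ?thesis by (simp add: proj_on_def vec_eq_iff \<phi>_K x)
  qed
  have gx: "g i x = CX.dd i f x" for i using bspec[OF W(5,2)] p[OF W(2)] by blast
  let ?h = "\<lambda>i y. (\<phi> y $ i - \<phi> x $ i) * g i y"
  have feq: "f y = f x + (\<Sum>i\<in>S - K. ?h i y)" if y: "y \<in> W'" for y
    using conjunct1[OF conjunct2[OF bspec[OF W(5) y]]] unfolding p[OF y] CX.inv[OF xUX] by (simp only: algebra_simps)
  have c: "holfun (submfd Y X) W' (\<lambda>y. \<phi> y $ i)" for i
    by (rule holfun_subset[OF CX.coord_holfun W(1)]) (use W(3) f(2) in blast)
  have ci: "holfun (submfd Y X) W' (\<lambda>y. \<phi> y $ i - \<phi> x $ i)" for i
    by (rule holfun_diff[OF c holfun_const[OF W(1)]])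
  have hh: "holfun (submfd Y X) W' (?h i)" for i by (rule holfun_mult[OF ci W(4)[rule_format]])
  have tc: "?T (\<lambda>y. \<phi> y $ i - \<phi> x $ i) = ?T (\<lambda>y. \<phi> y $ i)" for i
    using nrm_retraction_add[OF \<tau> c W(2) holfun_const[OF W(1), of "- \<phi> x $ i"] W(2)]
    by (simp add: nrm_retraction_const[OF \<tau>])
  \<comment> \<open>The first factor of \<open>?h i\<close> vanishes at \<open>x\<close>, so the
    product rule leaves the value of \<open>g i\<close> at \<open>x\<close>, which is the partial
    derivative there.\<close>
  have th: "?T (?h i) = CX.dd i f x * ?T (\<lambda>y. \<phi> y $ i)" for i
    using nrm_retraction_mult[OF \<tau> ci W(2) W(4)[rule_format] W(2), of k i i] by (simp add: tc gx)
  have ts: "?T (\<lambda>y. \<Sum>i\<in>A. ?h i y) = (\<Sum>i\<in>A. ?T (?h i))" for A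
    using finite[of A]
  proof (induction A rule: finite_induct)
    case empty
    show ?case by (simp add: nrm_retraction_const[OF \<tau>])
  next
    case (insert a A)
    have "?T (\<lambda>y. ?h a y + (\<Sum>i\<in>A. ?h i y)) = ?T (?h a) + ?T (\<lambda>y. \<Sum>i\<in>A. ?h i y)"
      by (rule nrm_retraction_add[OF \<tau> hh W(2) holfun_sum[OF W(1) hh] W(2)])
    then show ?case using insert by simp
  qed
  have "germ TX x f = germ TX x (\<lambda>y. f x + (\<Sum>i\<in>S - K. ?h i y))" by (rule germ_eqI[OF W(1,2) feq])
  then have "?T f = ?T (\<lambda>y. f x + (\<Sum>i\<in>S - K. ?h i y))" by (rule arg_cong)
  also have "\<dots> = ?T (\<lambda>_. f x) + ?T (\<lambda>y. \<Sum>i\<in>S - K. ?h i y)"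
    by (rule nrm_retraction_add[OF \<tau> holfun_const[OF W(1)] W(2) holfun_sum[OF W(1) hh] W(2)])
  also have "\<dots> = (\<Sum>i\<in>S - K. ?T (?h i))"
    by (simp only: nrm_retraction_const[OF \<tau>] ts add_0)
  finally show ?thesis by (simp only: th)
qed

text \<open>In the product rule the term with the value at \<open>x\<close> of a representative of
  \<open>u\<close> drops out, as it vanishes on \<open>X\<close>.\<close>

lemma nrm_smult:
  assumes \<tau>: "retraction_pullback Y X \<tau>" and f: "holfun (submfd Y X) V f" "x \<in> V" and u: "u \<in> carrier (NX x)"
  shows "nrm k x (germ TX x f \<odot>\<^bsub>NX x\<^esub> u) = f x * nrm k x u"
proof -
  obtain F V' where F: "x \<in> V'" "holfun Y V' F" "\<tau> x (germ TX x f) = cls x F" "F x = f x"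
    using retraction_rep[OF \<tau> f] by (elim exE conjE)
  obtain G W where G: "x \<in> W" "holfun Y W G" "\<forall>y\<in>W \<inter> X. G y = 0" "u = cls x G"
    using u unfolding N_carrier[OF x(1)] by (elim exE conjE)
  have "G x = 0" using G x by blast
  then show ?thesis
    using N_smult_lift[OF \<tau> x(1) germ_closed[OF f] u] nrm_mult[OF F(2,1) G(2,1), of k] F(3,4) G(4) by simp
qed

lemma nrm_finsum:
  assumes \<tau>: "retraction_pullback Y X \<tau>" and u: "\<And>i. i \<in> A \<Longrightarrow> u i \<in> carrier (NX x)" and A: "finite A"
  shows "nrm k x (finsum (NX x) u A) = (\<Sum>i\<in>A. nrm k x (u i))"
proof -
  interpret N: module "RX x" "NX x" by (rule N_module[OF \<tau> x(1)])
  show ?thesis using A u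
  proof (induction A rule: finite_induct)
    case empty
    show ?case using nrm_const[of k 0] by (simp add: N_ops[OF x(1)] cls_zero[OF x(1)])
  next
    case (insert a A)
    have c: "u a \<in> carrier (NX x)" "finsum (NX x) u A \<in> carrier (NX x)"
      using insert.prems by (auto simp only: Pi_iff insertI1 insertI2 intro!: N.finsum_closed)
    have "finsum (NX x) u (insert a A) = u a \<oplus>\<^bsub>NX x\<^esub> finsum (NX x) u A"
      using insert.hyps insert.prems by (intro N.finsum_insert) (auto simp only: Pi_iff insertI1 insertI2)
    then show ?case
      using nrm_add[OF N_sub[OF x(1) c(1)] N_sub[OF x(1) c(2)]] insert by (simp add: N_ops[OF x(1)])
  qed
qed

end

text \<open>Normal derivatives at \<open>x\<close> alone do not determine a conormal germ at
  \<open>x\<close>. Their equality at all points of \<open>V\<close> on \<open>X\<close> makes the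
  difference of two representatives vanish to second order along \<open>X\<close> near
  \<open>x\<close>, and \<open>ideal_sqI\<close> applies.\<close>

lemma conormal_sec_eqI:
  assumes V: "V \<subseteq> U" and s: "is_sec (conormal Y X) V s" and t: "is_sec (conormal Y X) V t" and x: "x \<in> V" "x \<in> X"
    and eq: "\<And>y k. y \<in> V \<Longrightarrow> y \<in> X \<Longrightarrow> k \<in> K \<Longrightarrow> nrm k y (s y) = nrm k y (t y)"
  shows "s x = t x"
proof -
  obtain W1 F where F: "x \<in> W1" "W1 \<inter> X \<subseteq> V" "holfun Y W1 F" "\<forall>y\<in>W1 \<inter> X. F y = 0" "\<forall>y\<in>W1 \<inter> X. s y = cls y F"
    using bspec[OF s[unfolded sec_N_iff] x(1)] by (elim exE conjE)
  obtain W2 G where G: "x \<in> W2" "W2 \<inter> X \<subseteq> V" "holfun Y W2 G" "\<forall>y\<in>W2 \<inter> X. G y = 0" "\<forall>y\<in>W2 \<inter> X. t y = cls y G"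
    using bspec[OF t[unfolded sec_N_iff] x(1)] by (elim exE conjE)
  let ?W = "W1 \<inter> W2 \<inter> U"
  have o: "openin (mtop Y) ?W" by (intro openin_Int holfun_open[OF F(3)] holfun_open[OF G(3)] CY.U_open)
  have h: "holfun Y ?W (\<lambda>y. F y - G y)"
    by (rule holfun_diff; rule holfun_subset[OF _ o]) (rule F(3), blast, rule G(3), blast)
  have "germ (mtop Y) x (\<lambda>y. F y - G y) \<in> ideal_sq Y X x"
  proof (rule ideal_sqI[OF x(2) h])
    show "x \<in> ?W" using x(1) V F(1) G(1) by blast
    fix y assume y: "y \<in> ?W" "y \<in> X"
    show "F y - G y = 0" using y F(4) G(4) by simp
    fix k assume k: "k \<in> K"
    have yU: "y \<in> U" "y \<in> W1" "y \<in> W2" using y by blast+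
    have "nrm k y (cls y F) = nrm k y (cls y G)"
      using eq[of y k] k y F(2,5) G(5) by (metis IntI subsetD yU(2,3))
    then have "CY.dd k F y = CY.dd k G y"
      unfolding nrm_cls[OF y(2) yU(1) F(3) yU(2)] nrm_cls[OF y(2) yU(1) G(3) yU(3)] .
    then show "CY.dd k (\<lambda>y. F y - G y) y = 0"
      using CY.dd_add[OF F(3) yU(2) holfun_uminus[OF G(3)] yU(3,1)] CY.dd_uminus[OF G(3) yU(3,1)] by simp
  qed blast
  then have "cls x F = cls x G" unfolding cls_eq_iff[OF x(2) F(3,1) G(3,1)] .
  moreover have "s x = cls x F" using F(1,5) x(2) by (intro bspec[OF F(5)] IntI)
  moreover have "t x = cls x G" using G(1) x(2) by (intro bspec[OF G(5)] IntI)
  ultimately show ?thesis by (simp only:)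
qed

end

locale adapted_retractions = adapted Y X r U \<phi> S K + two_retractions Y X r \<sigma> \<sigma>'
  for Y :: "('y, 'n::finite) cmfd" and X r U \<phi> S K \<sigma> \<sigma>'
begin

abbreviation zg :: "'n \<Rightarrow> 'y \<Rightarrow> 'y fgerm" where "zg i x \<equiv> germ TX x (\<lambda>y. \<phi> y $ i)"

text \<open>Both sides are sections over \<open>W\<close>, so they may be compared through their
  normal derivatives at all points of \<open>W\<close>. There \<open>nrm_retraction\<close>, applied
  to \<sigma> and to \<sigma>', gives the same sum for both.\<close>

lemma \<delta>_expand:
  assumes f: "holfun (submfd Y X) W f" "W \<subseteq> U \<inter> X" "x \<in> W"
  shows "\<delta> x (germ TX x f) = finsum (NX x) (\<lambda>i. germ TX x (CX.dd i f) \<odot>\<^bsub>NX x\<^esub> \<delta> x (zg i x)) (S - K)"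
proof -
  have o: "openin TX W" by (rule holfun_open[OF f(1)])
  have c: "holfun (submfd Y X) W (\<lambda>y. \<phi> y $ i)" for i by (rule holfun_subset[OF CX.coord_holfun o f(2)])
  have \<delta>s: "is_sec (conormal Y X) W (\<lambda>y. \<delta> y (germ TX y g))" if "holfun (submfd Y X) W g" for g
    using \<delta>_sheaf_map o sec_O_germ[OF that] unfolding sheaf_map_def by blast
  show ?thesis
  proof (rule conormal_sec_eqI[where V = W])
    show "is_sec (conormal Y X) W (\<lambda>x. \<delta> x (germ TX x f))" by (rule \<delta>s[OF f(1)])
    show "is_sec (conormal Y X) W (\<lambda>x. finsum (NX x) (\<lambda>i. germ TX x (CX.dd i f) \<odot>\<^bsub>NX x\<^esub> \<delta> x (zg i x)) (S - K))"
      by (rule sec_N_finsum[OF \<sigma> o finite]) (intro sec_N_smult[OF \<sigma> o] sec_O_germ[OF CX.dd_holfun[OF f(1,2)]] \<delta>s[OF c])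
    fix y k assume y: "y \<in> W" "y \<in> X"
    then have yU: "y \<in> U" using f(2) by blast
    have n\<delta>: "nrm k y (\<delta> y (germ TX y g)) = nrm k y (\<sigma>' y (germ TX y g)) - nrm k y (\<sigma> y (germ TX y g))"
      if "holfun (submfd Y X) W g" for g
      unfolding \<delta>_def
      by (rule nrm_minus[OF y(2) yU retractionD(1)[OF \<sigma>' y(2) germ_closed[OF that y(1)]] retractionD(1)[OF \<sigma> y(2) germ_closed[OF that y(1)]]])
    note cl = \<delta>_closed[OF y(2) germ_closed[OF c y(1)]] and d = CX.dd_holfun[OF f(1,2)]
    interpret N: module "RX y" "NX y" by (rule N_module[OF \<sigma> y(2)])
    have "nrm k y (finsum (NX y) (\<lambda>i. germ TX y (CX.dd i f) \<odot>\<^bsub>NX y\<^esub> \<delta> y (zg i y)) (S - K)) =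
      (\<Sum>i\<in>S - K. CX.dd i f y * nrm k y (\<delta> y (zg i y)))"
      by (simp only: nrm_finsum[OF y(2) yU \<sigma>] N.smult_closed[OF germ_closed[OF d y(1)] cl]
          finite nrm_smult[OF y(2) yU \<sigma> d y(1) cl])
    also have "\<dots> = nrm k y (\<delta> y (germ TX y f))"
      unfolding n\<delta>[OF f(1)] n\<delta>[OF c] nrm_retraction[OF y(2) yU \<sigma> f(1,2) y(1)] nrm_retraction[OF y(2) yU \<sigma>' f(1,2) y(1)]
      by (simp add: right_diff_distrib sum_subtractf)
    finally show "nrm k y (\<delta> y (germ TX y f)) =
      nrm k y (finsum (NX y) (\<lambda>i. germ TX y (CX.dd i f) \<odot>\<^bsub>NX y\<^esub> \<delta> y (zg i y)) (S - K))" ..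
  qed (use f in blast)+
qed

end

section \<open>Tensor products and alternating bilinear sums\<close>

context
  fixes R :: "'r ring" and M :: "('r, 'm) module" and N :: "('r, 'k) module"
  assumes N: "module R N"
    and M_add: "\<And>u u'. u \<in> carrier M \<Longrightarrow> u' \<in> carrier M \<Longrightarrow> u \<oplus>\<^bsub>M\<^esub> u' \<in> carrier M"
    and M_smult: "\<And>a u. a \<in> carrier R \<Longrightarrow> u \<in> carrier M \<Longrightarrow> a \<odot>\<^bsub>M\<^esub> u \<in> carrier M"
begin

interpretation N: module R N by (rule N)

abbreviation "TF \<equiv> free_module R (carrier M \<times> carrier N)"

lemma TF_module: "module R TF" by (rule free_module_module[OF N.R.is_cring])

lemma tensor_rel_submodule: "submodule (tensor_rel R M N) R TF"
proof -
  interpret F: module R TF by (rule TF_module)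
  have g: "u \<in> carrier M \<Longrightarrow> v \<in> carrier N \<Longrightarrow> gen R (u, v) \<in> carrier TF" for u v
    by (rule gen_closed[OF N.R.is_cring]) simp
  show ?thesis unfolding tensor_rel_def Let_def
    by (rule submod_span_submodule[OF TF_module])
      (auto intro!: F.M.minus_closed F.M.a_closed F.smult_closed g M_add M_smult)
qed

lemma tensor_module: "module R (tensor R M N)"
  unfolding tensor_def by (rule quot_module_module[OF TF_module tensor_rel_submodule])

lemma pure_tensor_closed:
  assumes "u \<in> carrier M" "v \<in> carrier N"
  shows "pure_tensor R M N u v \<in> carrier (tensor R M N)"
  unfolding tensor_def pure_tensor_def quot_carrier[OF TF_module tensor_rel_submodule]
  by (rule imageI) (rule gen_closed[OF N.R.is_cring], simp add: assms)

text \<open>The bilinear map extends linearly to the free module on pairs and kills the four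
  families of relations. \<open>M\<close> enters through its closure under the operations, which is
  the form in which stalks of 1-forms are available.\<close>

lemma tensor_lift:
  assumes P: "module R P"
    and cl: "\<And>u v. u \<in> carrier M \<Longrightarrow> v \<in> carrier N \<Longrightarrow> \<theta> u v \<in> carrier P"
    and a1: "\<And>u u' v. u \<in> carrier M \<Longrightarrow> u' \<in> carrier M \<Longrightarrow> v \<in> carrier N \<Longrightarrow>
      \<theta> (u \<oplus>\<^bsub>M\<^esub> u') v = \<theta> u v \<oplus>\<^bsub>P\<^esub> \<theta> u' v"
    and a2: "\<And>u v v'. u \<in> carrier M \<Longrightarrow> v \<in> carrier N \<Longrightarrow> v' \<in> carrier N \<Longrightarrow>
      \<theta> u (v \<oplus>\<^bsub>N\<^esub> v') = \<theta> u v \<oplus>\<^bsub>P\<^esub> \<theta> u v'"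
    and s1: "\<And>a u v. a \<in> carrier R \<Longrightarrow> u \<in> carrier M \<Longrightarrow> v \<in> carrier N \<Longrightarrow> \<theta> (a \<odot>\<^bsub>M\<^esub> u) v = a \<odot>\<^bsub>P\<^esub> \<theta> u v"
    and s2: "\<And>a u v. a \<in> carrier R \<Longrightarrow> u \<in> carrier M \<Longrightarrow> v \<in> carrier N \<Longrightarrow> \<theta> u (a \<odot>\<^bsub>N\<^esub> v) = a \<odot>\<^bsub>P\<^esub> \<theta> u v"
  shows "\<exists>g. g \<in> mod_hom R (tensor R M N) P \<and>
    (\<forall>u\<in>carrier M. \<forall>v\<in>carrier N. g (pure_tensor R M N u v) = \<theta> u v)"
proof -
  interpret F: module R TF by (rule TF_module)
  interpret P: module R P by (rule P)
  have c: "(\<lambda>(u, v). \<theta> u v) \<in> carrier M \<times> carrier N \<rightarrow> carrier P" using cl by auto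
  define L where "L = lin_ext R P (\<lambda>(u, v). \<theta> u v)"
  have L: "L \<in> mod_hom R TF P" unfolding L_def by (rule lin_ext_hom[OF P c])
  have Lg: "L (gen R (u, v)) = \<theta> u v" if "u \<in> carrier M" "v \<in> carrier N" for u v
    unfolding L_def by (subst lin_ext_gen[OF P c]) (simp_all add: that)
  have g: "u \<in> carrier M \<Longrightarrow> v \<in> carrier N \<Longrightarrow> gen R (u, v) \<in> carrier TF" for u v
    by (rule gen_closed[OF N.R.is_cring]) simp
  have pz: "x \<ominus>\<^bsub>P\<^esub> x = \<zero>\<^bsub>P\<^esub>" if "x \<in> carrier P" for x
    using that by (simp add: a_minus_def P.M.r_neg)
  note LL = mod_hom_minus[OF TF_module P L] mod_hom_add[OF L] mod_hom_smult[OF L]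
  have "tensor_rel R M N \<subseteq> {c \<in> carrier TF. L c = \<zero>\<^bsub>P\<^esub>}"
    unfolding tensor_rel_def Let_def
  proof (rule submod_span_least[OF kernel_submodule[OF TF_module P L]], safe, goal_cases)
    case (1 x u u' v)
    then show ?case by (intro F.M.minus_closed F.M.a_closed g M_add)
  next
    case (2 x u u' v)
    then show ?case by (simp add: LL g Lg pz cl M_add a1)
  next
    case (3 x u v v')
    then show ?case by (intro F.M.minus_closed F.M.a_closed g N.M.a_closed)
  next
    case (4 x u v v')
    then show ?case by (simp add: LL g Lg pz cl a2)
  next
    case (5 x a u v)
    then show ?case by (intro F.M.minus_closed F.smult_closed g M_smult)
  next
    case (6 x a u v)
    then show ?case by (simp add: LL g Lg pz cl M_smult s1)
  next
    case (7 x a u v)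
    then show ?case by (intro F.M.minus_closed F.smult_closed g N.smult_closed)
  next
    case (8 x a u v)
    then show ?case by (simp add: LL g Lg pz cl s2)
  qed
  then have 0: "\<And>c. c \<in> tensor_rel R M N \<Longrightarrow> L c = \<zero>\<^bsub>P\<^esub>" by blast
  show ?thesis
  proof (rule quot_lift[OF TF_module tensor_rel_submodule P L 0])
    fix G assume G: "G \<in> mod_hom R (quot_module TF (tensor_rel R M N)) P"
      "\<And>c. c \<in> carrier TF \<Longrightarrow> G (tensor_rel R M N +>\<^bsub>TF\<^esub> c) = L c"
    have "G (pure_tensor R M N u v) = \<theta> u v" if "u \<in> carrier M" "v \<in> carrier N" for u v
      unfolding pure_tensor_def G(2)[OF g[OF that]] by (rule Lg[OF that])
    then show ?thesis using G(1) unfolding tensor_def by blast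
  qed
qed

end

section \<open>Products of two elements of a module\<close>

context
  fixes R :: "'r ring" and M :: "('r, 'm) module"
  assumes M: "module R M"
begin

interpretation M: module R M by (rule M)

lemma pair_add_left: "u \<in> carrier M \<Longrightarrow> u' \<in> carrier M \<Longrightarrow> v \<in> carrier M \<Longrightarrow>
    wedge_list R M [u \<oplus>\<^bsub>M\<^esub> u', v] = wedge_list R M [u, v] \<oplus>\<^bsub>ext_power R M 2\<^esub> wedge_list R M [u', v]"
  using alternatingD(2)[OF wedge_list_alternating[OF M], of "[]" u "[v]" 2 u'] by (simp add: lists_of_2)

lemma pair_add_right: "u \<in> carrier M \<Longrightarrow> v \<in> carrier M \<Longrightarrow> v' \<in> carrier M \<Longrightarrow>
    wedge_list R M [u, v \<oplus>\<^bsub>M\<^esub> v'] = wedge_list R M [u, v] \<oplus>\<^bsub>ext_power R M 2\<^esub> wedge_list R M [u, v']"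
  using alternatingD(2)[OF wedge_list_alternating[OF M], of "[u]" v "[]" 2 v'] by (simp add: lists_of_2)

lemma pair_smult_left: "a \<in> carrier R \<Longrightarrow> u \<in> carrier M \<Longrightarrow> v \<in> carrier M \<Longrightarrow>
    wedge_list R M [a \<odot>\<^bsub>M\<^esub> u, v] = a \<odot>\<^bsub>ext_power R M 2\<^esub> wedge_list R M [u, v]"
  using alternatingD(3)[OF wedge_list_alternating[OF M], of "[]" u "[v]" 2 a] by (simp add: lists_of_2)

lemma pair_smult_right: "a \<in> carrier R \<Longrightarrow> u \<in> carrier M \<Longrightarrow> v \<in> carrier M \<Longrightarrow>
    wedge_list R M [u, a \<odot>\<^bsub>M\<^esub> v] = a \<odot>\<^bsub>ext_power R M 2\<^esub> wedge_list R M [u, v]"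
  using alternatingD(3)[OF wedge_list_alternating[OF M], of "[u]" v "[]" 2 a] by (simp add: lists_of_2)

lemma pair_self: "u \<in> carrier M \<Longrightarrow> wedge_list R M [u, u] = \<zero>\<^bsub>ext_power R M 2\<^esub>"
  using alternatingD(4)[OF wedge_list_alternating[OF M], of "[u, u]" 2] by (simp add: lists_of_2)

lemma pair_anticomm:
  assumes u: "u \<in> carrier M" and v: "v \<in> carrier M"
  shows "wedge_list R M [u, v] \<oplus>\<^bsub>ext_power R M 2\<^esub> wedge_list R M [v, u] = \<zero>\<^bsub>ext_power R M 2\<^esub>"
proof -
  interpret L: module R "ext_power R M 2" by (rule ext_power_module[OF M])
  note c = pair_closed[OF M]
  have "\<zero>\<^bsub>ext_power R M 2\<^esub> = wedge_list R M [u \<oplus>\<^bsub>M\<^esub> v, u \<oplus>\<^bsub>M\<^esub> v]"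
    by (rule pair_self[symmetric]) (simp add: u v)
  also have "\<dots> = wedge_list R M [u, v] \<oplus>\<^bsub>ext_power R M 2\<^esub> wedge_list R M [v, u]"
    unfolding pair_add_left[OF u v M.M.a_closed[OF u v]] pair_add_right[OF u u v] pair_add_right[OF v u v]
      pair_self[OF u] pair_self[OF v] by (simp add: c u v)
  finally show ?thesis ..
qed

lemma pair_right_hom: "u \<in> carrier M \<Longrightarrow> (\<lambda>v. wedge_list R M [u, v]) \<in> mod_hom R M (ext_power R M 2)"
  by (rule mod_homI) (simp_all add: pair_closed[OF M] pair_add_right pair_smult_right)

text \<open>Induction on the index set: the old indices contribute zero, the diagonal term of the
  new index is a square, and its row and its column cancel by symmetry of \<open>c\<close> and
  anticommutativity. This is the algebra behind the vanishing of the exterior derivative on exact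
  forms.\<close>

lemma pair_symmetric_sum:
  assumes A: "finite A" and v: "\<And>i. i \<in> A \<Longrightarrow> v i \<in> carrier M"
    and c: "\<And>i j. i \<in> A \<Longrightarrow> j \<in> A \<Longrightarrow> c i j \<in> carrier R" "\<And>i j. i \<in> A \<Longrightarrow> j \<in> A \<Longrightarrow> c i j = c j i"
  shows "finsum (ext_power R M 2) (\<lambda>i. wedge_list R M [finsum M (\<lambda>j. c i j \<odot>\<^bsub>M\<^esub> v j) A, v i]) A = \<zero>\<^bsub>ext_power R M 2\<^esub>"
  using A v c
proof (induction A rule: finite_induct)
  case empty
  interpret L: module R "ext_power R M 2" by (rule ext_power_module[OF M])
  show ?case by simp
next
  case (insert a A)
  let ?L = "ext_power R M 2"
  interpret L: module R ?L by (rule ext_power_module[OF M])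
  note pc = pair_closed[OF M]
  have va: "v a \<in> carrier M" and vA: "i \<in> A \<Longrightarrow> v i \<in> carrier M" for i using insert.prems(1) by simp_all
  have cA: "i \<in> insert a A \<Longrightarrow> j \<in> A \<Longrightarrow> c i j \<in> carrier R" for i j using insert.prems(2) by simp
  have ca: "i \<in> insert a A \<Longrightarrow> c i a \<in> carrier R" for i using insert.prems(2) by simp
  \<comment> \<open>\<open>Z i\<close> is row \<open>i\<close> over the old indices; the term with
    the new index \<open>a\<close> is split off from every row.\<close>
  define Z where "Z i = finsum M (\<lambda>j. c i j \<odot>\<^bsub>M\<^esub> v j) A" for i
  have Z: "Z i \<in> carrier M" if "i \<in> insert a A" for i
    unfolding Z_def by (rule M.finsum_closed) (use that cA vA in \<open>auto simp only: Pi_iff M.smult_closed\<close>)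
  have e: "finsum M (\<lambda>j. c i j \<odot>\<^bsub>M\<^esub> v j) (insert a A) = c i a \<odot>\<^bsub>M\<^esub> v a \<oplus>\<^bsub>M\<^esub> Z i" if i: "i \<in> insert a A" for i
    unfolding Z_def
  proof (rule M.finsum_insert[OF insert.hyps])
    show "(\<lambda>j. c i j \<odot>\<^bsub>M\<^esub> v j) \<in> A \<rightarrow> carrier M" using cA[OF i] vA by (simp add: Pi_iff)
    show "c i a \<odot>\<^bsub>M\<^esub> v a \<in> carrier M" by (rule M.smult_closed[OF ca[OF i] va])
  qed
  have vi: "i \<in> insert a A \<Longrightarrow> v i \<in> carrier M" for i by (rule insert.prems(1))
  have p1: "wedge_list R M [v a, c i a \<odot>\<^bsub>M\<^esub> v i] \<in> carrier ?L" if "i \<in> insert a A" for i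
    by (rule pc[OF va M.smult_closed[OF ca[OF that] vi[OF that]]])
  have p2: "wedge_list R M [Z i, v i] \<in> carrier ?L" if "i \<in> insert a A" for i
    by (rule pc[OF Z[OF that] vi[OF that]])
  have p12: "wedge_list R M [v a, c i a \<odot>\<^bsub>M\<^esub> v i] \<oplus>\<^bsub>?L\<^esub> wedge_list R M [Z i, v i] \<in> carrier ?L"
    if "i \<in> insert a A" for i by (rule L.M.a_closed[OF p1[OF that] p2[OF that]])
  have ew: "wedge_list R M [finsum M (\<lambda>j. c i j \<odot>\<^bsub>M\<^esub> v j) (insert a A), v i] =
      wedge_list R M [v a, c i a \<odot>\<^bsub>M\<^esub> v i] \<oplus>\<^bsub>?L\<^esub> wedge_list R M [Z i, v i]" if i: "i \<in> insert a A" for i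
  proof -
    have "v i \<in> carrier M" using i va vA by blast
    then show ?thesis
      by (simp add: e[OF i] pair_add_left pair_smult_left pair_smult_right va ca[OF i] Z[OF i])
  qed
  have 1: "wedge_list R M [v a, c a a \<odot>\<^bsub>M\<^esub> v a] = \<zero>\<^bsub>?L\<^esub>"
    by (simp add: pair_smult_right pair_self va ca)
  \<comment> \<open>The part over the old indices vanishes by induction. Symmetry of
    \<open>c\<close> turns the column of \<open>a\<close> into its row, and the resulting product is
    cancelled in the last step by the row term of \<open>a\<close>.\<close>
  have 2: "finsum ?L (\<lambda>i. wedge_list R M [v a, c i a \<odot>\<^bsub>M\<^esub> v i] \<oplus>\<^bsub>?L\<^esub> wedge_list R M [Z i, v i]) A =
      wedge_list R M [v a, Z a]"
  proof -
    have "finsum ?L (\<lambda>i. wedge_list R M [Z i, v i]) A = \<zero>\<^bsub>?L\<^esub>"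
      unfolding Z_def by (rule insert.IH) (use insert.prems in simp_all)
    moreover have "finsum ?L (\<lambda>i. wedge_list R M [v a, c i a \<odot>\<^bsub>M\<^esub> v i]) A = wedge_list R M [v a, Z a]"
    proof -
      have "wedge_list R M [v a, Z a] = finsum ?L (\<lambda>i. wedge_list R M [v a, c a i \<odot>\<^bsub>M\<^esub> v i]) A"
        unfolding Z_def
        by (rule mod_hom_finsum[OF M ext_power_module[OF M] pair_right_hom[OF va]])
          (use insert.hyps cA vA in \<open>simp_all add: Pi_iff\<close>)
      also have "\<dots> = finsum ?L (\<lambda>i. wedge_list R M [v a, c i a \<odot>\<^bsub>M\<^esub> v i]) A"
        by (rule L.M.finsum_cong') (use insert.prems(3) ca vA va in \<open>simp_all add: Pi_iff pc\<close>)
      finally show ?thesis ..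
    qed
    moreover have "finsum ?L (\<lambda>i. wedge_list R M [v a, c i a \<odot>\<^bsub>M\<^esub> v i] \<oplus>\<^bsub>?L\<^esub> wedge_list R M [Z i, v i]) A =
      finsum ?L (\<lambda>i. wedge_list R M [v a, c i a \<odot>\<^bsub>M\<^esub> v i]) A \<oplus>\<^bsub>?L\<^esub> finsum ?L (\<lambda>i. wedge_list R M [Z i, v i]) A"
      by (rule L.M.finsum_addf) (use ca vA va Z in \<open>simp_all add: Pi_iff pc\<close>)
    ultimately show ?thesis by (simp add: pc va Z)
  qed
  have "finsum ?L (\<lambda>i. wedge_list R M [finsum M (\<lambda>j. c i j \<odot>\<^bsub>M\<^esub> v j) (insert a A), v i]) (insert a A) =
    finsum ?L (\<lambda>i. wedge_list R M [v a, c i a \<odot>\<^bsub>M\<^esub> v i] \<oplus>\<^bsub>?L\<^esub> wedge_list R M [Z i, v i]) (insert a A)"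
    by (rule L.M.finsum_cong'[OF refl Pi_I]) (rule p12, assumption, rule ew, assumption)
  also have "\<dots> = (wedge_list R M [v a, c a a \<odot>\<^bsub>M\<^esub> v a] \<oplus>\<^bsub>?L\<^esub> wedge_list R M [Z a, v a]) \<oplus>\<^bsub>?L\<^esub>
    finsum ?L (\<lambda>i. wedge_list R M [v a, c i a \<odot>\<^bsub>M\<^esub> v i] \<oplus>\<^bsub>?L\<^esub> wedge_list R M [Z i, v i]) A"
  proof (rule L.M.finsum_insert[OF insert.hyps])
    show "(\<lambda>i. wedge_list R M [v a, c i a \<odot>\<^bsub>M\<^esub> v i] \<oplus>\<^bsub>?L\<^esub> wedge_list R M [Z i, v i]) \<in> A \<rightarrow> carrier ?L"
      by (rule Pi_I) (rule p12[OF insertI2])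
  qed (rule p12[OF insertI1])
  also have "\<dots> = \<zero>\<^bsub>?L\<^esub>" unfolding 1 2 using pair_anticomm[OF Z[OF insertI1] va] by (simp add: pc Z va)
  finally show ?case .
qed

end

section \<open>Differential forms and the operators induced by a derivation\<close>

context closed_pair
begin

abbreviation "WX \<equiv> form_germs (submfd Y X)"

abbreviation dX :: "('y \<Rightarrow> complex) \<Rightarrow> 'y \<Rightarrow> ('y, 'n) covector" where
  "dX \<equiv> cdiff (submfd Y X)"

abbreviation fsum :: "nat \<Rightarrow> (nat \<Rightarrow> 'y \<Rightarrow> complex) \<Rightarrow> (nat \<Rightarrow> 'y \<Rightarrow> complex) \<Rightarrow> 'y \<Rightarrow> ('y, 'n) covector" where
  "fsum m a f \<equiv> \<lambda>y c. \<Sum>k<m. a k y *s dX (f k) y c"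

lemma WX_carrier: "A \<in> carrier (WX x) \<longleftrightarrow> (\<exists>V m a f. x \<in> V \<and> openin TX V \<and>
    (\<forall>k<m. holfun (submfd Y X) V (a k) \<and> holfun (submfd Y X) V (f k)) \<and> A = germ TX x (fsum m a f))"
proof
  assume "A \<in> carrier (WX x)"
  then obtain w V where w: "A = germ TX x w" "x \<in> V" "loc_form (submfd Y X) V w"
    by (auto simp: form_germs_def)
  then obtain m a f where r: "openin TX V" "\<forall>k<m. holfun (submfd Y X) V (a k) \<and> holfun (submfd Y X) V (f k)"
    "\<forall>y\<in>V. w y = fsum m a f y" unfolding loc_form_def by (elim exE conjE)
  have "A = germ TX x (fsum m a f)" unfolding w(1) by (rule germ_eqI[OF r(1) w(2)]) (rule bspec[OF r(3)])
  with r w(2) show "\<exists>V m a f. x \<in> V \<and> openin TX V \<and>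
    (\<forall>k<m. holfun (submfd Y X) V (a k) \<and> holfun (submfd Y X) V (f k)) \<and> A = germ TX x (fsum m a f)"
    by (intro exI conjI)
next
  assume "\<exists>V m a f. x \<in> V \<and> openin TX V \<and>
    (\<forall>k<m. holfun (submfd Y X) V (a k) \<and> holfun (submfd Y X) V (f k)) \<and> A = germ TX x (fsum m a f)"
  then obtain V m a f where r: "x \<in> V" "openin TX V"
    "\<forall>k<m. holfun (submfd Y X) V (a k) \<and> holfun (submfd Y X) V (f k)" "A = germ TX x (fsum m a f)"
    by (elim exE conjE)
  have "loc_form (submfd Y X) V (fsum m a f)" unfolding loc_form_def using r(2,3) by blast
  then show "A \<in> carrier (WX x)" unfolding r(4) form_germs_def using r(1) by auto
qed

lemma fsum_closed:
  assumes "x \<in> V" "openin TX V" "\<And>k. k < m \<Longrightarrow> holfun (submfd Y X) V (a k)" "\<And>k. k < m \<Longrightarrow> holfun (submfd Y X) V (f k)"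
  shows "germ TX x (fsum m a f) \<in> carrier (WX x)"
  unfolding WX_carrier using assms by blast

lemma atlas_mchart:
  assumes "(U, \<phi>, S) \<in> atlas (submfd Y X)"
  shows "mchart (submfd Y X) U \<phi> S"
proof -
  obtain U' S' K where "U = U' \<inter> X" "S = S' - K" "adapted_chart Y X (U', \<phi>, S') K"
    using assms by (auto simp: submfd_def)
  then show ?thesis using mchart_submfd[OF cm] by simp
qed

text \<open>Checked chart by chart. For a chart that is outside the atlas or does not contain
  \<open>x\<close>, both covectors have the default value 0.\<close>

lemma dX_cong:
  assumes "openin TX V" "x \<in> V" "\<And>y. y \<in> V \<Longrightarrow> f y = g y"
  shows "dX f x = dX g x"
proof
  fix c show "dX f x c = dX g x c"
  proof (cases c)
    case (fields U \<phi> S)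
    show ?thesis
    proof (cases "(U, \<phi>, S) \<in> atlas (submfd Y X) \<and> x \<in> U")
      case True
      interpret mchart "submfd Y X" U \<phi> S by (rule atlas_mchart) (use True in blast)
      have "dX f x (U, \<phi>, S) $ i = dX g x (U, \<phi>, S) $ i" for i
      proof (cases "i \<in> S")
        case i: True
        have "dd i f x = dd i g x" by (rule dd_cong[OF assms(1,2)]) (use True assms(3) in auto)
        then show ?thesis using True i by (simp add: cdiff_dd)
      qed (simp add: cdiff_def)
      then show ?thesis unfolding fields by (simp add: vec_eq_iff)
    next
      case False
      then show ?thesis by (simp only: fields cdiff_def prod.case if_False)
    qed
  qed
qed

context
  fixes x assumes x: "x \<in> X"
begin

lemma WX_ops:
  "germ TX x v \<oplus>\<^bsub>WX x\<^esub> germ TX x w = germ TX x (\<lambda>y c. v y c + w y c)"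
  "germ TX x f \<odot>\<^bsub>WX x\<^esub> germ TX x w = germ TX x (\<lambda>y c. f y *s w y c)"
  unfolding form_germs_def
  using germ_pointwise[OF xX[OF x], where h = "\<lambda>a b c. a c + b c" and ?f0.0 = v and ?g0.0 = w]
    germ_pointwise[OF xX[OF x], where h = "\<lambda>a b c. a *s b c" and ?f0.0 = f and ?g0.0 = w]
  by simp_all

lemma dgerm_germ: "dgerm (submfd Y X) x (germ TX x f) = germ TX x (dX f)"
  unfolding dgerm_def
proof (rule UN_constant_eq[OF germ_self[OF xX[OF x]]], rule ballI)
  fix g assume "g \<in> germ TX x f"
  then obtain V where V: "openin TX V" "x \<in> V" "\<forall>y\<in>V. g y = f y" unfolding germ_mem_iff by (elim exE conjE)
  show "germ TX x (dX g) = germ TX x (dX f)"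
    by (rule germ_eqI[OF V(1,2)]) (rule dX_cong[OF V(1)], assumption, rule bspec[OF V(3)])
qed

lemma fsum_Suc: "germ TX x (fsum (Suc m) a f) =
    germ TX x (fsum m a f) \<oplus>\<^bsub>WX x\<^esub> germ TX x (a m) \<odot>\<^bsub>WX x\<^esub> dgerm (submfd Y X) x (germ TX x (f m))"
  unfolding dgerm_germ WX_ops by (simp only: sum.lessThan_Suc)

lemma WX_add_closed:
  assumes "A \<in> carrier (WX x)" "B \<in> carrier (WX x)"
  shows "A \<oplus>\<^bsub>WX x\<^esub> B \<in> carrier (WX x)"
proof -
  obtain V m a f where A: "x \<in> V" "openin TX V"
    "\<forall>k<m. holfun (submfd Y X) V (a k) \<and> holfun (submfd Y X) V (f k)" "A = germ TX x (fsum m a f)"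
    using assms(1) unfolding WX_carrier by (elim exE conjE)
  obtain W n b g where B: "x \<in> W" "openin TX W"
    "\<forall>k<n. holfun (submfd Y X) W (b k) \<and> holfun (submfd Y X) W (g k)" "B = germ TX x (fsum n b g)"
    using assms(2) unfolding WX_carrier by (elim exE conjE)
  let ?a = "\<lambda>k. if k < m then a k else b (k - m)" and ?f = "\<lambda>k. if k < m then f k else g (k - m)"
  have split: "fsum m a f y c + fsum n b g y c = fsum (m + n) ?a ?f y c" for n y c
    by (induction n) (simp_all add: add.assoc[symmetric])
  have "A \<oplus>\<^bsub>WX x\<^esub> B = germ TX x (fsum (m + n) ?a ?f)"
    unfolding A(4) B(4) WX_ops split ..
  also have "\<dots> \<in> carrier (WX x)"
  proof (rule fsum_closed)
    show "x \<in> V \<inter> W" "openin TX (V \<inter> W)" using A(1,2) B(1,2) by auto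
    fix k assume k: "k < m + n"
    show "holfun (submfd Y X) (V \<inter> W) (?a k)" "holfun (submfd Y X) (V \<inter> W) (?f k)"
      using A(3) B(3) k holfun_Int(1)[OF _ B(2)] holfun_Int(2)[OF _ A(2)] by (cases "k < m"; simp)+
  qed
  finally show ?thesis .
qed

lemma WX_smult_closed:
  assumes "b \<in> carrier (RX x)" "A \<in> carrier (WX x)"
  shows "b \<odot>\<^bsub>WX x\<^esub> A \<in> carrier (WX x)"
proof -
  obtain V m a f where A: "x \<in> V" "openin TX V"
    "\<forall>k<m. holfun (submfd Y X) V (a k) \<and> holfun (submfd Y X) V (f k)" "A = germ TX x (fsum m a f)"
    using assms(2) unfolding WX_carrier by (elim exE conjE)
  obtain g W where g: "x \<in> W" "holfun (submfd Y X) W g" "b = germ TX x g"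
    using assms(1) unfolding hol_germs_carrier by (elim exE conjE)
  have "b \<odot>\<^bsub>WX x\<^esub> A = germ TX x (fsum m (\<lambda>k y. g y * a k y) f)"
    unfolding A(4) g(3) WX_ops by (simp add: vec.scale_sum_right)
  also have "\<dots> \<in> carrier (WX x)"
  proof (rule fsum_closed)
    show "x \<in> V \<inter> W" "openin TX (V \<inter> W)" using A g holfun_open[OF g(2)] by auto
    fix k assume "k < m"
    then have k: "holfun (submfd Y X) V (a k)" "holfun (submfd Y X) V (f k)" using A(3) by blast+
    show "holfun (submfd Y X) (V \<inter> W) (\<lambda>y. g y * a k y)"
      by (rule holfun_mult[OF holfun_Int(2)[OF g(2) A(2)] holfun_Int(1)[OF k(1) holfun_open[OF g(2)]]])
    show "holfun (submfd Y X) (V \<inter> W) (f k)" by (rule holfun_Int(1)[OF k(2) holfun_open[OF g(2)]])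
  qed
  finally show ?thesis .
qed

lemma dgerm_closed:
  assumes "a \<in> carrier (RX x)"
  shows "dgerm (submfd Y X) x a \<in> carrier (WX x)"
proof -
  obtain g W where g: "x \<in> W" "holfun (submfd Y X) W g" "a = germ TX x g"
    using assms unfolding hol_germs_carrier by (elim exE conjE)
  have "germ TX x (fsum 1 (\<lambda>_ _. 1) (\<lambda>_. g)) \<in> carrier (WX x)"
    by (rule fsum_closed[OF g(1) holfun_open[OF g(2)]]) (rule holfun_const[OF holfun_open[OF g(2)]], rule g(2))
  then show ?thesis unfolding g(3) dgerm_germ by simp
qed

text \<open>An additive map on forms is determined by its values on terms a df. The formula serves
  the exterior derivative, which is not linear, as well as linear maps.\<close>

lemma fsum_additive:
  assumes P: "abelian_group P" and V: "x \<in> V" "openin TX V"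
    and T: "\<And>A. A \<in> carrier (WX x) \<Longrightarrow> T A \<in> carrier P"
    and add: "\<And>A B. A \<in> carrier (WX x) \<Longrightarrow> B \<in> carrier (WX x) \<Longrightarrow> T (A \<oplus>\<^bsub>WX x\<^esub> B) = T A \<oplus>\<^bsub>P\<^esub> T B"
  shows "\<forall>k<m. holfun (submfd Y X) V (a k) \<and> holfun (submfd Y X) V (f k) \<Longrightarrow>
    T (germ TX x (fsum m a f)) =
      finsum P (\<lambda>k. T (germ TX x (a k) \<odot>\<^bsub>WX x\<^esub> dgerm (submfd Y X) x (germ TX x (f k)))) {..<m}"
proof (induction m)
  interpret P: abelian_group P by (rule P)
  case 0
  let ?z = "germ TX x (fsum 0 a f)"
  have z: "?z \<in> carrier (WX x)" by (rule fsum_closed[OF V]) simp_all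
  \<comment> \<open>The empty sum of forms equals its own double, hence so does its image, which is
    therefore zero in the group \<open>P\<close>.\<close>
  have zz: "?z \<oplus>\<^bsub>WX x\<^esub> ?z = ?z" unfolding WX_ops by simp
  have "T ?z \<oplus>\<^bsub>P\<^esub> T ?z = T ?z" using add[OF z z] unfolding zz by (rule sym)
  then have "T ?z = \<zero>\<^bsub>P\<^esub>" using T[OF z] by (simp add: P.add.l_cancel_one)
  then show ?case by simp
next
  interpret P: abelian_group P by (rule P)
  case (Suc m)
  note op = WX_smult_closed[OF germ_closed dgerm_closed[OF germ_closed]]
  have c: "germ TX x (a k) \<odot>\<^bsub>WX x\<^esub> dgerm (submfd Y X) x (germ TX x (f k)) \<in> carrier (WX x)" if "k < Suc m" for k
    by (rule op) (use Suc.prems that V(1) in blast)+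
  have s: "germ TX x (fsum m a f) \<in> carrier (WX x)" by (rule fsum_closed[OF V]) (use Suc.prems in auto)
  have "finsum P (\<lambda>k. T (germ TX x (a k) \<odot>\<^bsub>WX x\<^esub> dgerm (submfd Y X) x (germ TX x (f k)))) (insert m {..<m}) =
    T (germ TX x (a m) \<odot>\<^bsub>WX x\<^esub> dgerm (submfd Y X) x (germ TX x (f m))) \<oplus>\<^bsub>P\<^esub> T (germ TX x (fsum m a f))"
    using Suc T c by (subst P.finsum_insert) (simp_all add: Pi_iff)
  also have "\<dots> = T (germ TX x (fsum (Suc m) a f))"
    unfolding fsum_Suc add[OF s c[OF lessI]] by (rule P.a_comm) (intro T c s lessI)+
  finally show ?case unfolding lessThan_Suc by (rule sym)
qed

text \<open>Sums of terms a db exhaust the stalk. This identifies a given linear map on forms with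
  the constructed one, both being prescribed on differentials.\<close>

lemma form_additive_eqI:
  assumes P: "abelian_group P" and A: "A \<in> carrier (WX x)"
    and T: "\<And>B. B \<in> carrier (WX x) \<Longrightarrow> T B \<in> carrier P" "\<And>B C. B \<in> carrier (WX x) \<Longrightarrow> C \<in> carrier (WX x) \<Longrightarrow>
      T (B \<oplus>\<^bsub>WX x\<^esub> C) = T B \<oplus>\<^bsub>P\<^esub> T C"
    and T': "\<And>B. B \<in> carrier (WX x) \<Longrightarrow> T' B \<in> carrier P" "\<And>B C. B \<in> carrier (WX x) \<Longrightarrow> C \<in> carrier (WX x) \<Longrightarrow>
      T' (B \<oplus>\<^bsub>WX x\<^esub> C) = T' B \<oplus>\<^bsub>P\<^esub> T' C"
    and eq: "\<And>a b. a \<in> carrier (RX x) \<Longrightarrow> b \<in> carrier (RX x) \<Longrightarrow>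
      T (a \<odot>\<^bsub>WX x\<^esub> dgerm (submfd Y X) x b) = T' (a \<odot>\<^bsub>WX x\<^esub> dgerm (submfd Y X) x b)"
  shows "T A = T' A"
proof -
  interpret P: abelian_group P by (rule P)
  obtain V m a f where r: "x \<in> V" "openin TX V"
    "\<forall>k<m. holfun (submfd Y X) V (a k) \<and> holfun (submfd Y X) V (f k)" "A = germ TX x (fsum m a f)"
    using A unfolding WX_carrier by (elim exE conjE)
  have g: "germ TX x (a k) \<in> carrier (RX x)" "germ TX x (f k) \<in> carrier (RX x)" if "k < m" for k
    by (rule germ_closed[OF _ r(1)]; use r(3) that in blast)+
  have "finsum P (\<lambda>k. T (germ TX x (a k) \<odot>\<^bsub>WX x\<^esub> dgerm (submfd Y X) x (germ TX x (f k)))) {..<m} =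
      finsum P (\<lambda>k. T' (germ TX x (a k) \<odot>\<^bsub>WX x\<^esub> dgerm (submfd Y X) x (germ TX x (f k)))) {..<m}"
  proof (rule P.finsum_cong'[OF refl])
    show "(\<lambda>k. T' (germ TX x (a k) \<odot>\<^bsub>WX x\<^esub> dgerm (submfd Y X) x (germ TX x (f k)))) \<in> {..<m} \<rightarrow> carrier P"
      by (rule Pi_I) (intro T'(1) WX_smult_closed dgerm_closed g; simp)
    fix k assume "k \<in> {..<m}"
    then show "T (germ TX x (a k) \<odot>\<^bsub>WX x\<^esub> dgerm (submfd Y X) x (germ TX x (f k))) =
        T' (germ TX x (a k) \<odot>\<^bsub>WX x\<^esub> dgerm (submfd Y X) x (germ TX x (f k)))"
      by (intro eq g) simp_all
  qed
  moreover have "T A = finsum P (\<lambda>k. T (germ TX x (a k) \<odot>\<^bsub>WX x\<^esub> dgerm (submfd Y X) x (germ TX x (f k)))) {..<m}"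
    unfolding r(4) by (rule fsum_additive[OF P r(1,2) _ _ r(3)]) (fact T)+
  moreover have "T' A = finsum P (\<lambda>k. T' (germ TX x (a k) \<odot>\<^bsub>WX x\<^esub> dgerm (submfd Y X) x (germ TX x (f k)))) {..<m}"
    unfolding r(4) by (rule fsum_additive[OF P r(1,2) _ _ r(3)]) (fact T')+
  ultimately show ?thesis by (simp only:)
qed

end

end

section \<open>Components of 1-forms in an adapted chart\<close>

context adapted
begin

definition comp :: "'n \<Rightarrow> 'y \<Rightarrow> ('y, 'n) wgerm \<Rightarrow> 'y fgerm" where
  "comp i x A = (\<Union>w\<in>A. germ TX x (\<lambda>y. w y (U \<inter> X, \<phi>, S - K) $ i))"

context
  fixes x assumes x: "x \<in> X" "x \<in> U"
begin

lemma comp_germ: "comp i x (germ TX x w) = germ TX x (\<lambda>y. w y (U \<inter> X, \<phi>, S - K) $ i)"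
  unfolding comp_def
proof (rule UN_constant_eq[OF germ_self[OF xX[OF x(1)]]], rule ballI)
  fix v assume "v \<in> germ TX x w"
  then obtain V where V: "openin TX V" "x \<in> V" "\<forall>y\<in>V. v y = w y" unfolding germ_mem_iff by (elim exE conjE)
  show "germ TX x (\<lambda>y. v y (U \<inter> X, \<phi>, S - K) $ i) = germ TX x (\<lambda>y. w y (U \<inter> X, \<phi>, S - K) $ i)"
    by (rule germ_eqI[OF V(1,2)]) (simp add: V(3))
qed

lemma comp_add:
  assumes "A \<in> carrier (WX x)" "B \<in> carrier (WX x)"
  shows "comp i x (A \<oplus>\<^bsub>WX x\<^esub> B) = comp i x A \<oplus>\<^bsub>RX x\<^esub> comp i x B"
proof -
  obtain v where v: "A = germ TX x v" using assms(1) unfolding WX_carrier by (elim exE conjE)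
  obtain w where w: "B = germ TX x w" using assms(2) unfolding WX_carrier by (elim exE conjE)
  show ?thesis unfolding v w WX_ops[OF x(1)] comp_germ hol_germs_ops[OF xX[OF x(1)]] by simp
qed

lemma comp_smult:
  assumes "b \<in> carrier (RX x)" "A \<in> carrier (WX x)"
  shows "comp i x (b \<odot>\<^bsub>WX x\<^esub> A) = b \<otimes>\<^bsub>RX x\<^esub> comp i x A"
proof -
  obtain f where f: "b = germ TX x f" using assms(1) unfolding hol_germs_carrier by (elim exE conjE)
  obtain w where w: "A = germ TX x w" using assms(2) unfolding WX_carrier by (elim exE conjE)
  show ?thesis unfolding f w WX_ops[OF x(1)] comp_germ hol_germs_ops[OF xX[OF x(1)]] by simp
qed

lemma comp_dgerm:
  assumes i: "i \<in> S - K"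
  shows "comp i x (dgerm (submfd Y X) x (germ TX x f)) = germ TX x (CX.dd i f)"
  unfolding dgerm_germ[OF x(1)] comp_germ
proof (rule germ_eqI[OF CX.U_open])
  show "x \<in> U \<inter> X" using x by simp
  fix y assume "y \<in> U \<inter> X"
  then show "dX f y (U \<inter> X, \<phi>, S - K) $ i = CX.dd i f y" by (rule CX.cdiff_dd[OF chartX _ i])
qed

text \<open>Near \<open>x\<close> the component of a sum of terms a df is the sum of the products of
  a with a partial derivative of f, which is holomorphic.\<close>

lemma comp_closed:
  assumes A: "A \<in> carrier (WX x)" and i: "i \<in> S - K"
  shows "comp i x A \<in> carrier (RX x)"
proof -
  obtain V m a f where r: "x \<in> V" "openin TX V"
    "\<forall>k<m. holfun (submfd Y X) V (a k) \<and> holfun (submfd Y X) V (f k)" "A = germ TX x (fsum m a f)"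
    using A unfolding WX_carrier by (elim exE conjE)
  have h: "holfun (submfd Y X) (V \<inter> (U \<inter> X)) (a k)" "holfun (submfd Y X) (V \<inter> (U \<inter> X)) (f k)" if "k < m" for k
    using r(3) that by (blast intro: holfun_Int(1) CX.U_open)+
  have o: "openin TX (V \<inter> (U \<inter> X))" by (rule openin_Int[OF r(2) CX.U_open])
  have "holfun (submfd Y X) (V \<inter> (U \<inter> X)) (\<lambda>y. \<Sum>k<m. a k y * CX.dd i (f k) y)"
    by (intro holfun_sum[OF o] holfun_mult h CX.dd_holfun) auto
  then have "germ TX x (\<lambda>y. \<Sum>k<m. a k y * CX.dd i (f k) y) \<in> carrier (RX x)"
    by (rule germ_closed) (use r(1) x in blast)
  moreover have "comp i x A = germ TX x (\<lambda>y. \<Sum>k<m. a k y * CX.dd i (f k) y)"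
    unfolding r(4) comp_germ
  proof (rule germ_eqI[OF CX.U_open])
    show "x \<in> U \<inter> X" using x by simp
    fix y assume "y \<in> U \<inter> X"
    then show "fsum m a f y (U \<inter> X, \<phi>, S - K) $ i = (\<Sum>k<m. a k y * CX.dd i (f k) y)"
      by (simp add: CX.cdiff_dd[OF chartX _ i])
  qed
  ultimately show ?thesis by simp
qed

end

end

section \<open>Coordinate formulas for the operators on 1-forms\<close>

context adapted_retractions
begin

context
  fixes x assumes x: "x \<in> X" "x \<in> U"
begin

interpretation RX: cring "RX x" by (rule hol_germs_cring[OF xX[OF x(1)]])
interpretation NX: module "RX x" "NX x" by (rule N_module[OF \<sigma> x(1)])
interpretation L: module "RX x" "\<Lambda> 2 x" by (rule ext_module[OF x(1)])

lemma zg_closed: "zg i x \<in> carrier (RX x)"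
  by (rule germ_closed[OF CX.coord_holfun]) (use x in simp)

lemma \<delta>_zg: "\<delta> x (zg i x) \<in> carrier (NX x)" by (rule \<delta>_closed[OF x(1) zg_closed])

definition hc :: "('y, 'n) wgerm \<Rightarrow> 'y fgerm set" where
  "hc A = finsum (NX x) (\<lambda>i. comp i x A \<odot>\<^bsub>NX x\<^esub> \<delta> x (zg i x)) (S - K)"

text \<open>The coordinate expression of dA, the sum of dA_i \<and> dz_i, with every d replaced by
  \<delta>: the exterior derivative followed by the second exterior power of the linear map, without
  passing through 2-forms.\<close>

definition tc :: "('y, 'n) wgerm \<Rightarrow> 'y ext" where
  "tc A = finsum (\<Lambda> 2 x) (\<lambda>i. wedge_list (RX x) (NX x) [\<delta> x (comp i x A), \<delta> x (zg i x)]) (S - K)"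

lemma hc_terms: "A \<in> carrier (WX x) \<Longrightarrow> (\<lambda>i. comp i x A \<odot>\<^bsub>NX x\<^esub> \<delta> x (zg i x)) \<in> S - K \<rightarrow> carrier (NX x)"
  by (rule Pi_I) (rule NX.smult_closed[OF comp_closed[OF x] \<delta>_zg])

lemma hc_hom: "hc \<in> mod_hom (RX x) (WX x) (NX x)"
proof (rule mod_homI)
  fix A assume A: "A \<in> carrier (WX x)"
  note cA = comp_closed[OF x A]
  show "hc A \<in> carrier (NX x)" unfolding hc_def by (rule NX.M.finsum_closed[OF hc_terms[OF A]])
  { fix B assume B: "B \<in> carrier (WX x)"
    note cB = comp_closed[OF x B]
    have "hc (A \<oplus>\<^bsub>WX x\<^esub> B) = finsum (NX x) (\<lambda>i. comp i x A \<odot>\<^bsub>NX x\<^esub> \<delta> x (zg i x) \<oplus>\<^bsub>NX x\<^esub> comp i x B \<odot>\<^bsub>NX x\<^esub> \<delta> x (zg i x)) (S - K)"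
      unfolding hc_def comp_add[OF x A B]
    proof (rule NX.M.finsum_cong'[OF refl Pi_I])
      fix i assume i: "i \<in> S - K"
      show "comp i x A \<odot>\<^bsub>NX x\<^esub> \<delta> x (zg i x) \<oplus>\<^bsub>NX x\<^esub> comp i x B \<odot>\<^bsub>NX x\<^esub> \<delta> x (zg i x) \<in> carrier (NX x)"
        by (rule NX.M.a_closed[OF NX.smult_closed[OF cA[OF i] \<delta>_zg] NX.smult_closed[OF cB[OF i] \<delta>_zg]])
      show "(comp i x A \<oplus>\<^bsub>RX x\<^esub> comp i x B) \<odot>\<^bsub>NX x\<^esub> \<delta> x (zg i x) =
          comp i x A \<odot>\<^bsub>NX x\<^esub> \<delta> x (zg i x) \<oplus>\<^bsub>NX x\<^esub> comp i x B \<odot>\<^bsub>NX x\<^esub> \<delta> x (zg i x)"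
        by (rule NX.smult_l_distr[OF cA[OF i] cB[OF i] \<delta>_zg])
    qed
    also have "\<dots> = hc A \<oplus>\<^bsub>NX x\<^esub> hc B"
      unfolding hc_def by (rule NX.M.finsum_addf[OF hc_terms[OF A] hc_terms[OF B]])
    finally show "hc (A \<oplus>\<^bsub>WX x\<^esub> B) = hc A \<oplus>\<^bsub>NX x\<^esub> hc B" . }
  { fix b assume b: "b \<in> carrier (RX x)"
    have "b \<odot>\<^bsub>NX x\<^esub> hc A = finsum (NX x) (\<lambda>i. b \<odot>\<^bsub>NX x\<^esub> (comp i x A \<odot>\<^bsub>NX x\<^esub> \<delta> x (zg i x))) (S - K)"
      unfolding hc_def by (rule NX.finsum_smult_ldistr[OF finite b hc_terms[OF A]])
    also have "\<dots> = hc (b \<odot>\<^bsub>WX x\<^esub> A)"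
      unfolding hc_def comp_smult[OF x b A]
    proof (rule NX.M.finsum_cong'[OF refl Pi_I])
      fix i assume i: "i \<in> S - K"
      show "(b \<otimes>\<^bsub>RX x\<^esub> comp i x A) \<odot>\<^bsub>NX x\<^esub> \<delta> x (zg i x) \<in> carrier (NX x)"
        by (rule NX.smult_closed[OF RX.m_closed[OF b cA[OF i]] \<delta>_zg])
      show "b \<odot>\<^bsub>NX x\<^esub> (comp i x A \<odot>\<^bsub>NX x\<^esub> \<delta> x (zg i x)) = (b \<otimes>\<^bsub>RX x\<^esub> comp i x A) \<odot>\<^bsub>NX x\<^esub> \<delta> x (zg i x)"
        by (rule NX.smult_assoc1[OF b cA[OF i] \<delta>_zg, symmetric])
    qed
    finally show "hc (b \<odot>\<^bsub>WX x\<^esub> A) = b \<odot>\<^bsub>NX x\<^esub> hc A" by (rule sym) }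
qed

lemma chart_rep:
  assumes "a \<in> carrier (RX x)"
  shows "\<exists>f W. holfun (submfd Y X) W f \<and> W \<subseteq> U \<inter> X \<and> x \<in> W \<and> a = germ TX x f"
proof -
  obtain f V where f: "x \<in> V" "holfun (submfd Y X) V f" "a = germ TX x f"
    using assms unfolding hol_germs_carrier by (elim exE conjE)
  show ?thesis
    by (rule exI[of _ f], rule exI[of _ "V \<inter> (U \<inter> X)"]) (use f x holfun_Int(1)[OF f(2) CX.U_open] in blast)
qed

text \<open>The components of a differential are the partial derivatives, so this is the formula
  \<open>\<delta>_expand\<close>.\<close>

lemma hc_dgerm:
  assumes "a \<in> carrier (RX x)"
  shows "hc (dgerm (submfd Y X) x a) = \<delta> x a"
proof -
  obtain f W where f: "holfun (submfd Y X) W f" "W \<subseteq> U \<inter> X" "x \<in> W" "a = germ TX x f"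
    using chart_rep[OF assms] by (elim exE conjE)
  show ?thesis unfolding f(4) \<delta>_expand[OF f(1-3)] hc_def
  proof (rule NX.M.finsum_cong'[OF refl Pi_I])
    fix i assume i: "i \<in> S - K"
    show "germ TX x (CX.dd i f) \<odot>\<^bsub>NX x\<^esub> \<delta> x (zg i x) \<in> carrier (NX x)"
      by (rule NX.smult_closed[OF germ_closed[OF CX.dd_holfun[OF f(1,2)] f(3)] \<delta>_zg])
    show "comp i x (dgerm (submfd Y X) x (germ TX x f)) \<odot>\<^bsub>NX x\<^esub> \<delta> x (zg i x) =
        germ TX x (CX.dd i f) \<odot>\<^bsub>NX x\<^esub> \<delta> x (zg i x)"
      unfolding comp_dgerm[OF x i] ..
  qed
qed

abbreviation "W2 u v \<equiv> wedge_list (RX x) (NX x) [u, v]"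

lemmas pair = pair_closed[OF N_module[OF \<sigma> x(1)]] and pair_hom = pair_right_hom[OF N_module[OF \<sigma> x(1)]]

lemma tc_terms: "A \<in> carrier (WX x) \<Longrightarrow> (\<lambda>i. W2 (\<delta> x (comp i x A)) (\<delta> x (zg i x))) \<in> S - K \<rightarrow> carrier (\<Lambda> 2 x)"
  by (rule Pi_I) (rule pair[OF \<delta>_closed[OF x(1) comp_closed[OF x]] \<delta>_zg])

lemma tc_closed: "A \<in> carrier (WX x) \<Longrightarrow> tc A \<in> carrier (\<Lambda> 2 x)"
  unfolding tc_def by (rule L.M.finsum_closed[OF tc_terms])

lemma tc_add:
  assumes A: "A \<in> carrier (WX x)" and B: "B \<in> carrier (WX x)"
  shows "tc (A \<oplus>\<^bsub>WX x\<^esub> B) = tc A \<oplus>\<^bsub>\<Lambda> 2 x\<^esub> tc B"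
proof -
  have "tc (A \<oplus>\<^bsub>WX x\<^esub> B) = finsum (\<Lambda> 2 x) (\<lambda>i. W2 (\<delta> x (comp i x A)) (\<delta> x (zg i x)) \<oplus>\<^bsub>\<Lambda> 2 x\<^esub> W2 (\<delta> x (comp i x B)) (\<delta> x (zg i x))) (S - K)"
    unfolding tc_def comp_add[OF x A B]
  proof (rule L.M.finsum_cong'[OF refl Pi_I])
    fix i assume i: "i \<in> S - K"
    note c = \<delta>_closed[OF x(1) comp_closed[OF x A i]] \<delta>_closed[OF x(1) comp_closed[OF x B i]]
    show "W2 (\<delta> x (comp i x A)) (\<delta> x (zg i x)) \<oplus>\<^bsub>\<Lambda> 2 x\<^esub> W2 (\<delta> x (comp i x B)) (\<delta> x (zg i x)) \<in> carrier (\<Lambda> 2 x)"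
      by (rule L.M.a_closed[OF pair[OF c(1) \<delta>_zg] pair[OF c(2) \<delta>_zg]])
    show "W2 (\<delta> x (comp i x A \<oplus>\<^bsub>RX x\<^esub> comp i x B)) (\<delta> x (zg i x)) =
        W2 (\<delta> x (comp i x A)) (\<delta> x (zg i x)) \<oplus>\<^bsub>\<Lambda> 2 x\<^esub> W2 (\<delta> x (comp i x B)) (\<delta> x (zg i x))"
      unfolding \<delta>_add[OF x(1) comp_closed[OF x A i] comp_closed[OF x B i]]
      by (rule pair_add_left[OF N_module[OF \<sigma> x(1)] c \<delta>_zg])
  qed
  also have "\<dots> = tc A \<oplus>\<^bsub>\<Lambda> 2 x\<^esub> tc B"
    unfolding tc_def by (rule L.M.finsum_addf[OF tc_terms[OF A] tc_terms[OF B]])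
  finally show ?thesis .
qed

text \<open>The Leibniz rule for \<delta> (b A_i) gives two sums; in the second the coefficient A_i
  moves to the other factor, where the sum over i is \<open>hc A\<close>.\<close>

lemma tc_smult:
  assumes b: "b \<in> carrier (RX x)" and A: "A \<in> carrier (WX x)"
  shows "tc (b \<odot>\<^bsub>WX x\<^esub> A) = b \<odot>\<^bsub>\<Lambda> 2 x\<^esub> tc A \<oplus>\<^bsub>\<Lambda> 2 x\<^esub> W2 (\<delta> x b) (hc A)"
proof -
  note \<delta>b = \<delta>_closed[OF x(1) b]
  let ?s = "\<lambda>i. b \<odot>\<^bsub>\<Lambda> 2 x\<^esub> W2 (\<delta> x (comp i x A)) (\<delta> x (zg i x))"
  let ?t = "\<lambda>i. W2 (\<delta> x b) (comp i x A \<odot>\<^bsub>NX x\<^esub> \<delta> x (zg i x))"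
  have s: "?s i \<in> carrier (\<Lambda> 2 x)" and t: "?t i \<in> carrier (\<Lambda> 2 x)" if i: "i \<in> S - K" for i
  proof -
    note c = comp_closed[OF x A i]
    show "?s i \<in> carrier (\<Lambda> 2 x)" by (rule L.smult_closed[OF b pair[OF \<delta>_closed[OF x(1) c] \<delta>_zg]])
    show "?t i \<in> carrier (\<Lambda> 2 x)" by (rule pair[OF \<delta>b NX.smult_closed[OF c \<delta>_zg]])
  qed
  have "tc (b \<odot>\<^bsub>WX x\<^esub> A) = finsum (\<Lambda> 2 x) (\<lambda>i. ?s i \<oplus>\<^bsub>\<Lambda> 2 x\<^esub> ?t i) (S - K)"
    unfolding tc_def comp_smult[OF x b A]
  proof (rule L.M.finsum_cong'[OF refl Pi_I])
    fix i assume i: "i \<in> S - K"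
    note c = comp_closed[OF x A i]
    note \<delta>c = \<delta>_closed[OF x(1) c]
    note M = N_module[OF \<sigma> x(1)]
    show "?s i \<oplus>\<^bsub>\<Lambda> 2 x\<^esub> ?t i \<in> carrier (\<Lambda> 2 x)" by (rule L.M.a_closed[OF s[OF i] t[OF i]])
    show "W2 (\<delta> x (b \<otimes>\<^bsub>RX x\<^esub> comp i x A)) (\<delta> x (zg i x)) = ?s i \<oplus>\<^bsub>\<Lambda> 2 x\<^esub> ?t i"
      unfolding \<delta>_mult[OF x(1) b c] pair_add_left[OF M NX.smult_closed[OF b \<delta>c] NX.smult_closed[OF c \<delta>b] \<delta>_zg]
        pair_smult_left[OF M b \<delta>c \<delta>_zg] pair_smult_left[OF M c \<delta>b \<delta>_zg] pair_smult_right[OF M c \<delta>b \<delta>_zg] ..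
  qed
  also have "\<dots> = finsum (\<Lambda> 2 x) ?s (S - K) \<oplus>\<^bsub>\<Lambda> 2 x\<^esub> finsum (\<Lambda> 2 x) ?t (S - K)"
    by (rule L.M.finsum_addf; rule Pi_I; erule s t)
  also have "finsum (\<Lambda> 2 x) ?s (S - K) = b \<odot>\<^bsub>\<Lambda> 2 x\<^esub> tc A"
    unfolding tc_def by (rule L.finsum_smult_ldistr[OF finite b tc_terms[OF A], symmetric])
  also have "finsum (\<Lambda> 2 x) ?t (S - K) = W2 (\<delta> x b) (hc A)"
    unfolding hc_def
    by (rule mod_hom_finsum[OF N_module[OF \<sigma> x(1)] ext_module[OF x(1)] pair_hom[OF \<delta>b] finite hc_terms[OF A], symmetric])
  finally show ?thesis .
qed

text \<open>This is the symmetry of the second partial derivatives.\<close>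

lemma tc_dgerm:
  assumes "a \<in> carrier (RX x)"
  shows "tc (dgerm (submfd Y X) x a) = \<zero>\<^bsub>\<Lambda> 2 x\<^esub>"
proof -
  obtain f W where f: "holfun (submfd Y X) W f" "W \<subseteq> U \<inter> X" "x \<in> W" "a = germ TX x f"
    using chart_rep[OF assms] by (elim exE conjE)
  note d = CX.dd_holfun[OF f(1,2)]
  note dd = CX.dd_holfun[OF d f(2)]
  let ?c = "\<lambda>i j. germ TX x (CX.dd j (CX.dd i f))"
  have c: "?c i j \<in> carrier (RX x)" for i j by (rule germ_closed[OF dd f(3)])
  \<comment> \<open>The first derivatives of \<open>f\<close> are again expanded by
    \<open>\<delta>_expand\<close>, so the coefficients are the second derivatives of
    \<open>f\<close>.\<close>
  have "tc (dgerm (submfd Y X) x a) = finsum (\<Lambda> 2 x)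
      (\<lambda>i. W2 (finsum (NX x) (\<lambda>j. ?c i j \<odot>\<^bsub>NX x\<^esub> \<delta> x (zg j x)) (S - K)) (\<delta> x (zg i x))) (S - K)"
    unfolding tc_def f(4)
  proof (rule L.M.finsum_cong'[OF refl Pi_I])
    fix i assume i: "i \<in> S - K"
    show "W2 (finsum (NX x) (\<lambda>j. ?c i j \<odot>\<^bsub>NX x\<^esub> \<delta> x (zg j x)) (S - K)) (\<delta> x (zg i x)) \<in> carrier (\<Lambda> 2 x)"
      by (rule pair[OF NX.M.finsum_closed[OF Pi_I] \<delta>_zg]) (rule NX.smult_closed[OF c \<delta>_zg])
    show "W2 (\<delta> x (comp i x (dgerm (submfd Y X) x (germ TX x f)))) (\<delta> x (zg i x)) =
        W2 (finsum (NX x) (\<lambda>j. ?c i j \<odot>\<^bsub>NX x\<^esub> \<delta> x (zg j x)) (S - K)) (\<delta> x (zg i x))"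
      unfolding comp_dgerm[OF x i] \<delta>_expand[OF d f(2,3)] ..
  qed
  also have "\<dots> = \<zero>\<^bsub>\<Lambda> 2 x\<^esub>"
  proof (rule pair_symmetric_sum[OF N_module[OF \<sigma> x(1)] finite])
    fix i j
    show "?c i j = ?c j i"
      by (rule germ_eqI[OF holfun_open[OF f(1)] f(3)]) (rule CX.dd_commute[OF f(1,2)])
  qed (rule \<delta>_zg c)+
  finally show ?thesis .
qed

end

end

section \<open>The two cases of the theorem\<close>

lemma sheaf_mapD: "sheaf_map T F G h \<Longrightarrow> openin T U \<Longrightarrow> is_sec F U s \<Longrightarrow> is_sec G U (\<lambda>x. h x (s x))"
  by (simp add: sheaf_map_def)

context closed_pair
begin

lemma stalk_OmegaX: "stalk (OmegaX Y X) = WX"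
  by (simp add: form_sheaf_def)

lemma sec_OmegaX_rep:
  assumes "is_sec (OmegaX Y X) U s" "x \<in> U"
  shows "\<exists>V m a f. x \<in> V \<and> V \<subseteq> U \<and> openin TX V \<and>
    (\<forall>k<m. holfun (submfd Y X) V (a k) \<and> holfun (submfd Y X) V (f k)) \<and> (\<forall>y\<in>V. s y = germ TX y (fsum m a f))"
proof -
  obtain V w where V: "x \<in> V" "V \<subseteq> U" "loc_form (submfd Y X) V w" "\<forall>y\<in>V. s y = germ TX y w"
    using assms unfolding form_sheaf_def by auto
  obtain m a f where r: "openin TX V" "\<forall>k<m. holfun (submfd Y X) V (a k) \<and> holfun (submfd Y X) V (f k)"
    "\<forall>y\<in>V. w y = fsum m a f y" using V(3) unfolding loc_form_def by (elim exE conjE)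
  have "germ TX y w = germ TX y (fsum m a f)" if "y \<in> V" for y
    by (rule germ_eqI[OF r(1) that]) (rule bspec[OF r(3)])
  then have "\<forall>y\<in>V. s y = germ TX y (fsum m a f)" by (intro ballI trans[OF bspec[OF V(4)]])
  with V(1,2) r(1,2) show ?thesis by (intro exI conjI)
qed

lemma sec_OmegaX_closed:
  assumes "is_sec (OmegaX Y X) U s" "x \<in> U"
  shows "s x \<in> carrier (WX x)"
proof -
  obtain V m a f where r: "x \<in> V" "V \<subseteq> U" "openin TX V"
    "\<forall>k<m. holfun (submfd Y X) V (a k) \<and> holfun (submfd Y X) V (f k)" "\<forall>y\<in>V. s y = germ TX y (fsum m a f)"
    using sec_OmegaX_rep[OF assms] by (elim exE conjE)
  have e: "s x = germ TX x (fsum m a f)" by (rule bspec[OF r(5,1)])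
  show ?thesis unfolding e by (rule fsum_closed[OF r(1,3)]) (use r(4) in blast)+
qed

lemma sec_N_local:
  assumes "\<And>x. x \<in> U \<Longrightarrow> \<exists>V. x \<in> V \<and> V \<subseteq> U \<and> is_sec (conormal Y X) V s"
  shows "is_sec (conormal Y X) U s"
  unfolding sec_N_iff
proof
  fix x assume "x \<in> U"
  from assms[OF this] obtain V where V: "x \<in> V" "V \<subseteq> U" "is_sec (conormal Y X) V s" by (elim exE conjE)
  from bspec[OF V(3)[unfolded sec_N_iff] V(1)] obtain W f where
    W: "x \<in> W" "W \<inter> X \<subseteq> V" "holfun Y W f" "\<forall>y\<in>W \<inter> X. f y = 0" "\<forall>y\<in>W \<inter> X. s y = cls y f"
    by (elim exE conjE)
  show "\<exists>V f. x \<in> V \<and> V \<inter> X \<subseteq> U \<and> holfun Y V f \<and> (\<forall>y\<in>V \<inter> X. f y = 0) \<and> (\<forall>y\<in>V \<inter> X. s y = cls y f)"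
    by (intro exI conjI) (rule W(1), rule subset_trans[OF W(2) V(2)], (rule W(3-5))+)
qed

end

section \<open>Operators on 1-forms independent of the chart\<close>

context two_retractions
begin

text \<open>\<open>h\<close> is the linear map on 1-forms that corresponds to \<open>\<delta>\<close>, and \<open>\<theta>\<close> is the exterior derivative
  followed by the second exterior power of \<open>h\<close>.\<close>

definition induced :: "'y \<Rightarrow> (('y, 'n) wgerm \<Rightarrow> 'y fgerm set) \<Rightarrow> (('y, 'n) wgerm \<Rightarrow> 'y ext) \<Rightarrow> bool" where
  "induced x h \<theta> \<longleftrightarrow> h \<in> mod_hom (RX x) (WX x) (NX x) \<and>
    (\<forall>a\<in>carrier (RX x). h (dgerm (submfd Y X) x a) = \<delta> x a) \<and>
    (\<forall>A\<in>carrier (WX x). \<theta> A \<in> carrier (\<Lambda> 2 x)) \<and>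
    (\<forall>A\<in>carrier (WX x). \<forall>B\<in>carrier (WX x). \<theta> (A \<oplus>\<^bsub>WX x\<^esub> B) = \<theta> A \<oplus>\<^bsub>\<Lambda> 2 x\<^esub> \<theta> B) \<and>
    (\<forall>a\<in>carrier (RX x). \<forall>A\<in>carrier (WX x). \<theta> (a \<odot>\<^bsub>WX x\<^esub> A) =
      a \<odot>\<^bsub>\<Lambda> 2 x\<^esub> \<theta> A \<oplus>\<^bsub>\<Lambda> 2 x\<^esub> wedge_list (RX x) (NX x) [\<delta> x a, h A]) \<and>
    (\<forall>a\<in>carrier (RX x). \<theta> (dgerm (submfd Y X) x a) = \<zero>\<^bsub>\<Lambda> 2 x\<^esub>)"

text \<open>The operators are those of any adapted chart around \<open>x\<close>. The conditions in
  \<open>induced\<close> do not mention the chart and prescribe the values on all terms a df, so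
  different charts give the same operators on the stalk.\<close>

lemma induced_exists:
  assumes x: "x \<in> X"
  shows "\<exists>p. induced x (fst p) (snd p)"
proof -
  obtain U \<phi> S K where c: "adapted_chart Y X (U, \<phi>, S) K" "x \<in> U"
    using sub x unfolding closed_submanifold_def by blast
  interpret A: adapted_retractions Y X r U \<phi> S K \<sigma> \<sigma>' by unfold_locales (rule c(1))
  note xx = x c(2)
  have "induced x (A.hc x) (A.tc x)"
    unfolding induced_def
    by (intro conjI ballI A.hc_hom[OF xx] A.hc_dgerm[OF xx] A.tc_closed[OF xx] A.tc_add[OF xx] A.tc_smult[OF xx]
        A.tc_dgerm[OF xx])
  then show ?thesis by (intro exI[of _ "(A.hc x, A.tc x)"]) simp
qed

definition dh :: "'y \<Rightarrow> ('y, 'n) wgerm \<Rightarrow> 'y fgerm set" where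
  "dh x = fst (SOME p. induced x (fst p) (snd p))"

definition d\<theta> :: "'y \<Rightarrow> ('y, 'n) wgerm \<Rightarrow> 'y ext" where
  "d\<theta> x = snd (SOME p. induced x (fst p) (snd p))"

lemma induced_d: "x \<in> X \<Longrightarrow> induced x (dh x) (d\<theta> x)"
  unfolding dh_def d\<theta>_def by (rule someI_ex[OF induced_exists])

context
  fixes x assumes x: "x \<in> X"
begin

lemma dh_hom: "dh x \<in> mod_hom (RX x) (WX x) (NX x)"
  and dh_dgerm: "a \<in> carrier (RX x) \<Longrightarrow> dh x (dgerm (submfd Y X) x a) = \<delta> x a"
  and d\<theta>_closed: "A \<in> carrier (WX x) \<Longrightarrow> d\<theta> x A \<in> carrier (\<Lambda> 2 x)"
  and d\<theta>_add: "A \<in> carrier (WX x) \<Longrightarrow> B \<in> carrier (WX x) \<Longrightarrow> d\<theta> x (A \<oplus>\<^bsub>WX x\<^esub> B) = d\<theta> x A \<oplus>\<^bsub>\<Lambda> 2 x\<^esub> d\<theta> x B"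
  and d\<theta>_smult: "a \<in> carrier (RX x) \<Longrightarrow> A \<in> carrier (WX x) \<Longrightarrow> d\<theta> x (a \<odot>\<^bsub>WX x\<^esub> A) =
      a \<odot>\<^bsub>\<Lambda> 2 x\<^esub> d\<theta> x A \<oplus>\<^bsub>\<Lambda> 2 x\<^esub> wedge_list (RX x) (NX x) [\<delta> x a, dh x A]"
  and d\<theta>_dgerm: "a \<in> carrier (RX x) \<Longrightarrow> d\<theta> x (dgerm (submfd Y X) x a) = \<zero>\<^bsub>\<Lambda> 2 x\<^esub>"
  using induced_d[OF x] unfolding induced_def by simp_all

text \<open>The right-hand side refers to \<delta> alone, neither to a chart nor to a choice at
  \<open>x\<close>; this is the source of \<open>dh_sheaf_map\<close>.\<close>

lemma dh_fsum:
  assumes V: "x \<in> V" "openin TX V" "\<forall>k<m. holfun (submfd Y X) V (a k) \<and> holfun (submfd Y X) V (f k)"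
  shows "dh x (germ TX x (fsum m a f)) = finsum (NX x) (\<lambda>k. germ TX x (a k) \<odot>\<^bsub>NX x\<^esub> \<delta> x (germ TX x (f k))) {..<m}"
proof -
  interpret N: module "RX x" "NX x" by (rule N_module[OF \<sigma> x])
  have g: "germ TX x (a k) \<in> carrier (RX x)" "germ TX x (f k) \<in> carrier (RX x)" if "k \<in> {..<m}" for k
    by (rule germ_closed[OF _ V(1)]; use V(3) that in blast)+
  have "dh x (germ TX x (fsum m a f)) =
      finsum (NX x) (\<lambda>k. dh x (germ TX x (a k) \<odot>\<^bsub>WX x\<^esub> dgerm (submfd Y X) x (germ TX x (f k)))) {..<m}"
    by (rule fsum_additive[OF x N.abelian_group_axioms V(1,2) _ _ V(3)]) (rule mod_hom_closed[OF dh_hom], assumption, rule mod_hom_add[OF dh_hom])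
  also have "\<dots> = finsum (NX x) (\<lambda>k. germ TX x (a k) \<odot>\<^bsub>NX x\<^esub> \<delta> x (germ TX x (f k))) {..<m}"
  proof (rule N.M.finsum_cong'[OF refl Pi_I])
    fix k assume k: "k \<in> {..<m}"
    show "germ TX x (a k) \<odot>\<^bsub>NX x\<^esub> \<delta> x (germ TX x (f k)) \<in> carrier (NX x)"
      by (rule N.smult_closed[OF g(1)[OF k] \<delta>_closed[OF x g(2)[OF k]]])
    show "dh x (germ TX x (a k) \<odot>\<^bsub>WX x\<^esub> dgerm (submfd Y X) x (germ TX x (f k))) = germ TX x (a k) \<odot>\<^bsub>NX x\<^esub> \<delta> x (germ TX x (f k))"
      unfolding mod_hom_smult[OF dh_hom g(1)[OF k] dgerm_closed[OF x g(2)[OF k]]] dh_dgerm[OF g(2)[OF k]] ..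
  qed
  finally show ?thesis .
qed

text \<open>Each term a df contributes a times \<theta> (df), which is zero, and \<delta> a \<and> h
  (df). The result again refers to \<delta> alone.\<close>

lemma d\<theta>_fsum:
  assumes V: "x \<in> V" "openin TX V" "\<forall>k<m. holfun (submfd Y X) V (a k) \<and> holfun (submfd Y X) V (f k)"
  shows "d\<theta> x (germ TX x (fsum m a f)) =
    finsum (\<Lambda> 2 x) (\<lambda>k. wedge_list (RX x) (NX x) [\<delta> x (germ TX x (a k)), \<delta> x (germ TX x (f k))]) {..<m}"
proof -
  interpret L: module "RX x" "\<Lambda> 2 x" by (rule ext_module[OF x])
  have g: "germ TX x (a k) \<in> carrier (RX x)" "germ TX x (f k) \<in> carrier (RX x)" if "k \<in> {..<m}" for k
    by (rule germ_closed[OF _ V(1)]; use V(3) that in blast)+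
  have "d\<theta> x (germ TX x (fsum m a f)) =
      finsum (\<Lambda> 2 x) (\<lambda>k. d\<theta> x (germ TX x (a k) \<odot>\<^bsub>WX x\<^esub> dgerm (submfd Y X) x (germ TX x (f k)))) {..<m}"
    by (rule fsum_additive[OF x L.abelian_group_axioms V(1,2) _ _ V(3)]) (rule d\<theta>_closed, assumption, rule d\<theta>_add)
  also have "\<dots> = finsum (\<Lambda> 2 x) (\<lambda>k. wedge_list (RX x) (NX x) [\<delta> x (germ TX x (a k)), \<delta> x (germ TX x (f k))]) {..<m}"
  proof (rule L.M.finsum_cong'[OF refl Pi_I])
    fix k assume k: "k \<in> {..<m}"
    have c: "wedge_list (RX x) (NX x) [\<delta> x (germ TX x (a k)), \<delta> x (germ TX x (f k))] \<in> carrier (\<Lambda> 2 x)"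
      by (rule pair_closed[OF N_module[OF \<sigma> x] \<delta>_closed[OF x g(1)[OF k]] \<delta>_closed[OF x g(2)[OF k]]])
    then show "wedge_list (RX x) (NX x) [\<delta> x (germ TX x (a k)), \<delta> x (germ TX x (f k))] \<in> carrier (\<Lambda> 2 x)" .
    have "d\<theta> x (germ TX x (a k) \<odot>\<^bsub>WX x\<^esub> dgerm (submfd Y X) x (germ TX x (f k))) =
      germ TX x (a k) \<odot>\<^bsub>\<Lambda> 2 x\<^esub> \<zero>\<^bsub>\<Lambda> 2 x\<^esub> \<oplus>\<^bsub>\<Lambda> 2 x\<^esub> wedge_list (RX x) (NX x) [\<delta> x (germ TX x (a k)), \<delta> x (germ TX x (f k))]"
      unfolding d\<theta>_smult[OF g(1)[OF k] dgerm_closed[OF x g(2)[OF k]]] d\<theta>_dgerm[OF g(2)[OF k]] dh_dgerm[OF g(2)[OF k]] ..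
    then show "d\<theta> x (germ TX x (a k) \<odot>\<^bsub>WX x\<^esub> dgerm (submfd Y X) x (germ TX x (f k))) =
        wedge_list (RX x) (NX x) [\<delta> x (germ TX x (a k)), \<delta> x (germ TX x (f k))]"
      unfolding L.smult_r_null[OF g(1)[OF k]] L.M.l_zero[OF c] .
  qed
  finally show ?thesis .
qed

end

lemma \<delta>_germ_sec: "holfun (submfd Y X) V f \<Longrightarrow> is_sec (conormal Y X) V (\<lambda>y. \<delta> y (germ TX y f))"
  by (rule sheaf_mapD[OF \<delta>_sheaf_map holfun_open sec_O_germ])

lemma dh_sheaf_map: "sheaf_map TX (OmegaX Y X) (conormal Y X) dh"
  unfolding sheaf_map_def
proof (intro allI impI)
  fix U s assume U: "openin TX U" and s: "is_sec (OmegaX Y X) U s"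
  show "is_sec (conormal Y X) U (\<lambda>x. dh x (s x))"
  proof (rule sec_N_local)
    fix x assume "x \<in> U"
    from sec_OmegaX_rep[OF s this] obtain V m a f where r: "x \<in> V" "V \<subseteq> U" "openin TX V"
      "\<forall>k<m. holfun (submfd Y X) V (a k) \<and> holfun (submfd Y X) V (f k)" "\<forall>y\<in>V. s y = germ TX y (fsum m a f)"
      by (elim exE conjE)
    have VX: "V \<subseteq> X" using openin_subset[OF r(3)] topspace_TX by simp
    have "is_sec (conormal Y X) V (\<lambda>y. finsum (NX y) (\<lambda>k. germ TX y (a k) \<odot>\<^bsub>NX y\<^esub> \<delta> y (germ TX y (f k))) {..<m})"
      by (rule sec_N_finsum[OF \<sigma> r(3)], simp, rule sec_N_smult[OF \<sigma> r(3)])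
        (rule sec_O_germ, use r(4) in blast, rule \<delta>_germ_sec, use r(4) in blast)
    then have "is_sec (conormal Y X) V (\<lambda>y. dh y (s y))"
    proof (rule sec_N_cong)
      fix y assume y: "y \<in> V"
      have e: "s y = germ TX y (fsum m a f)" by (rule bspec[OF r(5) y])
      show "finsum (NX y) (\<lambda>k. germ TX y (a k) \<odot>\<^bsub>NX y\<^esub> \<delta> y (germ TX y (f k))) {..<m} = dh y (s y)"
        unfolding e by (rule dh_fsum[OF subsetD[OF VX y] y r(3,4), symmetric])
    qed
    then show "\<exists>V. x \<in> V \<and> V \<subseteq> U \<and> is_sec (conormal Y X) V (\<lambda>x. dh x (s x))" using r(1,2) by (intro exI[of _ V] conjI)
  qed
qed

lemma d\<theta>_sheaf_map: "sheaf_map TX (OmegaX Y X) (extN Y X 2) d\<theta>"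
  unfolding sheaf_map_def
proof (intro allI impI)
  fix U s assume U: "openin TX U" and s: "is_sec (OmegaX Y X) U s"
  show "is_sec (extN Y X 2) U (\<lambda>x. d\<theta> x (s x))"
  proof (rule N.esec_local)
    fix x assume "x \<in> U"
    from sec_OmegaX_rep[OF s this] obtain V m a f where r: "x \<in> V" "V \<subseteq> U" "openin TX V"
      "\<forall>k<m. holfun (submfd Y X) V (a k) \<and> holfun (submfd Y X) V (f k)" "\<forall>y\<in>V. s y = germ TX y (fsum m a f)"
      by (elim exE conjE)
    have VX: "V \<subseteq> X" using openin_subset[OF r(3)] topspace_TX by simp
    have "is_sec (extN Y X 2) V (\<lambda>y. finsum (\<Lambda> 2 y)
        (\<lambda>k. wedge_list (RX y) (NX y) [\<delta> y (germ TX y (a k)), \<delta> y (germ TX y (f k))]) {..<m})"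
      by (rule N.esec_finsum[OF r(3), unfolded stalk_OX], rule N.esec_pair[OF r(3), unfolded stalk_OX])
        (rule \<delta>_germ_sec, use r(4) in blast)+
    then have "is_sec (extN Y X 2) V (\<lambda>y. d\<theta> y (s y))"
    proof (rule N.esec_cong)
      fix y assume y: "y \<in> V"
      have e: "s y = germ TX y (fsum m a f)" by (rule bspec[OF r(5) y])
      show "finsum (\<Lambda> 2 y) (\<lambda>k. wedge_list (RX y) (NX y) [\<delta> y (germ TX y (a k)), \<delta> y (germ TX y (f k))]) {..<m} = d\<theta> y (s y)"
        unfolding e by (rule d\<theta>_fsum[OF subsetD[OF VX y] y r(3,4), symmetric])
    qed
    then show "\<exists>V. openin TX V \<and> x \<in> V \<and> V \<subseteq> U \<and> is_sec (extN Y X 2) V (\<lambda>x. d\<theta> x (s x))" using r(1-3) by (intro exI[of _ V] conjI)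
  qed
qed

text \<open>Writing u = h w, the rule for E (a u) is the rule for \<theta> (a w). That rule contains
  the constructed map \<open>dh\<close> in place of the given \<open>h\<close>; the two agree
  because both are linear with value \<delta> a on da.\<close>

lemma AK_isomorphic_of_iso:
  assumes h: "retraction_diff Y X \<sigma> \<sigma>' h" and iso: "sheaf_iso TX (OX Y X) (OmegaX Y X) (conormal Y X) h"
  shows "AK_isomorphic Y X r \<sigma> \<sigma>' \<and> dualAK_isomorphic Y X r \<sigma> \<sigma>'"
proof -
  obtain k where k: "sheaf_hom TX (OX Y X) (conormal Y X) (OmegaX Y X) k"
    and hk: "\<forall>x\<in>topspace TX. (\<forall>u\<in>carrier (stalk (OmegaX Y X) x). k x (h x u) = u) \<and>
      (\<forall>v\<in>carrier (NX x). h x (k x v) = v)"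
    using iso unfolding sheaf_iso_def by (elim exE conjE)
  have hh: "h x \<in> mod_hom (RX x) (WX x) (NX x)" if "x \<in> X" for x
    using h that unfolding retraction_diff_def sheaf_hom_def stalk_OmegaX stalk_OX topspace_TX by blast
  have kh: "k x \<in> mod_hom (RX x) (NX x) (WX x)" if "x \<in> X" for x
    using k that unfolding sheaf_hom_def stalk_OmegaX stalk_OX topspace_TX by blast
  have dh: "dh x A = h x A" if x: "x \<in> X" and A: "A \<in> carrier (WX x)" for x A
  proof -
    interpret N: module "RX x" "NX x" by (rule N_module[OF \<sigma> x])
    have e: "h x (dgerm (submfd Y X) x a) = \<delta> x a" if "a \<in> carrier (RX x)" for a
      using h x that unfolding retraction_diff_def stalk_OX \<delta>_def by blast
    show ?thesis
    proof (rule form_additive_eqI[OF x N.abelian_group_axioms A])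
      fix a b assume ab: "a \<in> carrier (RX x)" "b \<in> carrier (RX x)"
      note c = dgerm_closed[OF x ab(2)]
      show "dh x (a \<odot>\<^bsub>WX x\<^esub> dgerm (submfd Y X) x b) = h x (a \<odot>\<^bsub>WX x\<^esub> dgerm (submfd Y X) x b)"
        unfolding mod_hom_smult[OF dh_hom[OF x] ab(1) c] mod_hom_smult[OF hh[OF x] ab(1) c] e[OF ab(2)] dh_dgerm[OF x ab(2)] ..
    qed (rule mod_hom_closed[OF dh_hom[OF x]] mod_hom_add[OF dh_hom[OF x]] mod_hom_closed[OF hh[OF x]] mod_hom_add[OF hh[OF x]]; assumption)+
  qed
  define E where "E = (\<lambda>x u. d\<theta> x (k x u))"
  have 1: "E x u \<in> carrier (\<Lambda> 2 x)" if "x \<in> X" "u \<in> carrier (NX x)" for x u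
    unfolding E_def by (rule d\<theta>_closed[OF that(1) mod_hom_closed[OF kh[OF that(1)] that(2)]])
  have 2: "E x (u \<oplus>\<^bsub>NX x\<^esub> v) = E x u \<oplus>\<^bsub>\<Lambda> 2 x\<^esub> E x v" if x: "x \<in> X" and u: "u \<in> carrier (NX x)" and v: "v \<in> carrier (NX x)" for x u v
    unfolding E_def mod_hom_add[OF kh[OF x] u v] by (rule d\<theta>_add[OF x mod_hom_closed[OF kh[OF x] u] mod_hom_closed[OF kh[OF x] v]])
  have 3: "E x (a \<odot>\<^bsub>NX x\<^esub> u) = a \<odot>\<^bsub>\<Lambda> 2 x\<^esub> E x u \<oplus>\<^bsub>\<Lambda> 2 x\<^esub> wedge_list (RX x) (NX x) [\<delta> x a, u]"
    if x: "x \<in> X" and a: "a \<in> carrier (RX x)" and u: "u \<in> carrier (NX x)" for x a u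
  proof -
    have ku: "k x u \<in> carrier (WX x)" by (rule mod_hom_closed[OF kh[OF x] u])
    have "dh x (k x u) = u" using hk x u unfolding dh[OF x ku] topspace_TX by blast
    then show ?thesis unfolding E_def mod_hom_smult[OF kh[OF x] a u] d\<theta>_smult[OF x a ku] by (simp only:)
  qed
  have 4: "sheaf_map TX (conormal Y X) (extN Y X 2) E"
  proof -
    have k': "sheaf_map TX (conormal Y X) (OmegaX Y X) k" using k by (simp add: sheaf_hom_def)
    show ?thesis unfolding E_def sheaf_map_def
      by (intro allI impI) (rule sheaf_mapD[OF d\<theta>_sheaf_map _ sheaf_mapD[OF k']])
  qed
  show ?thesis by (rule conjI; rule AK_isomorphic dualAK_isomorphic; (rule 1 2 3 4; assumption?))
qed

text \<open>The tensor product is mapped to the second exterior power by the linear map on 1-forms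
  in the first factor, followed by the product. This turns the term da \<otimes> u of the Leibniz
  rule into \<delta> a \<and> u.\<close>

lemma AK_isomorphic_of_connection:
  assumes D: "conormal_connection Y X D"
  shows "AK_isomorphic Y X r \<sigma> \<sigma>' \<and> dualAK_isomorphic Y X r \<sigma> \<sigma>'"
proof -
  let ?T = "\<lambda>x. tensor (RX x) (WX x) (NX x)" and ?p = "\<lambda>x. pure_tensor (RX x) (WX x) (NX x)"
  let ?TS = "tensor_sheaf TX (OX Y X) (OmegaX Y X) (conormal Y X)"
  have stalk_T: "stalk ?TS = ?T" by (simp add: tensor_sheaf_def stalk_OX stalk_OmegaX)
  have Ds: "sheaf_map TX (conormal Y X) ?TS D"
    and D': "\<forall>x\<in>X. D x \<in> carrier (NX x) \<rightarrow> carrier (?T x) \<and>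
      (\<forall>u\<in>carrier (NX x). \<forall>v\<in>carrier (NX x). D x (u \<oplus>\<^bsub>NX x\<^esub> v) = D x u \<oplus>\<^bsub>?T x\<^esub> D x v) \<and>
      (\<forall>a\<in>carrier (RX x). \<forall>u\<in>carrier (NX x). D x (a \<odot>\<^bsub>NX x\<^esub> u) =
        ?p x (dgerm (submfd Y X) x a) u \<oplus>\<^bsub>?T x\<^esub> (a \<odot>\<^bsub>?T x\<^esub> D x u))"
    using D unfolding conormal_connection_def Let_def stalk_T stalk_OX stalk_OmegaX by blast+
  have Dc: "D x u \<in> carrier (?T x)" if "x \<in> X" "u \<in> carrier (NX x)" for x u
    using D' that by blast
  have "\<exists>g. g \<in> mod_hom (RX x) (?T x) (\<Lambda> 2 x) \<and>
      (\<forall>w\<in>carrier (WX x). \<forall>v\<in>carrier (NX x). g (?p x w v) = wedge_list (RX x) (NX x) [dh x w, v])" if x: "x \<in> X" for x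
  proof -
    note M = N_module[OF \<sigma> x] and c = mod_hom_closed[OF dh_hom[OF x]]
    show ?thesis
      by (rule tensor_lift[OF M WX_add_closed[OF x] WX_smult_closed[OF x] ext_module[OF x]])
        (simp_all only: pair_closed[OF M] c mod_hom_add[OF dh_hom[OF x]] mod_hom_smult[OF dh_hom[OF x]]
          pair_add_left[OF M] pair_add_right[OF M] pair_smult_left[OF M] pair_smult_right[OF M])
  qed
  \<comment> \<open>Again a separate choice at every point; what links the choices is that the
    values on pure tensors, of which sections are local sums, are prescribed.\<close>
  then obtain \<Phi> where \<Phi>: "\<And>x. x \<in> X \<Longrightarrow> \<Phi> x \<in> mod_hom (RX x) (?T x) (\<Lambda> 2 x)"
    and \<Phi>p: "\<And>x w v. x \<in> X \<Longrightarrow> w \<in> carrier (WX x) \<Longrightarrow> v \<in> carrier (NX x) \<Longrightarrow>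
      \<Phi> x (?p x w v) = wedge_list (RX x) (NX x) [dh x w, v]"
    by metis
  have T: "module (RX x) (?T x)" if x: "x \<in> X" for x
    by (rule tensor_module[OF N_module[OF \<sigma> x] WX_add_closed[OF x] WX_smult_closed[OF x]])
  have pc: "?p x w v \<in> carrier (?T x)" if x: "x \<in> X" and "w \<in> carrier (WX x)" "v \<in> carrier (NX x)" for x w v
    by (rule pure_tensor_closed[OF N_module[OF \<sigma> x] WX_add_closed[OF x] WX_smult_closed[OF x] that(2,3)])
  define E where "E = (\<lambda>x u. \<Phi> x (D x u))"
  have 1: "E x u \<in> carrier (\<Lambda> 2 x)" if "x \<in> X" "u \<in> carrier (NX x)" for x u
    unfolding E_def by (rule mod_hom_closed[OF \<Phi>[OF that(1)] Dc[OF that]])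
  have 2: "E x (u \<oplus>\<^bsub>NX x\<^esub> v) = E x u \<oplus>\<^bsub>\<Lambda> 2 x\<^esub> E x v" if x: "x \<in> X" and u: "u \<in> carrier (NX x)" and v: "v \<in> carrier (NX x)" for x u v
  proof -
    have e: "D x (u \<oplus>\<^bsub>NX x\<^esub> v) = D x u \<oplus>\<^bsub>?T x\<^esub> D x v" using D' x u v by blast
    show ?thesis unfolding E_def e by (rule mod_hom_add[OF \<Phi>[OF x] Dc[OF x u] Dc[OF x v]])
  qed
  have 3: "E x (a \<odot>\<^bsub>NX x\<^esub> u) = a \<odot>\<^bsub>\<Lambda> 2 x\<^esub> E x u \<oplus>\<^bsub>\<Lambda> 2 x\<^esub> wedge_list (RX x) (NX x) [\<delta> x a, u]"
    if x: "x \<in> X" and a: "a \<in> carrier (RX x)" and u: "u \<in> carrier (NX x)" for x a u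
  proof -
    interpret L: module "RX x" "\<Lambda> 2 x" by (rule ext_module[OF x])
    interpret T: module "RX x" "?T x" by (rule T[OF x])
    have e: "D x (a \<odot>\<^bsub>NX x\<^esub> u) = ?p x (dgerm (submfd Y X) x a) u \<oplus>\<^bsub>?T x\<^esub> (a \<odot>\<^bsub>?T x\<^esub> D x u)"
      using D' x a u by blast
    note d = dgerm_closed[OF x a]
    have "E x (a \<odot>\<^bsub>NX x\<^esub> u) = wedge_list (RX x) (NX x) [\<delta> x a, u] \<oplus>\<^bsub>\<Lambda> 2 x\<^esub> a \<odot>\<^bsub>\<Lambda> 2 x\<^esub> E x u"
      unfolding E_def e mod_hom_add[OF \<Phi>[OF x] pc[OF x d u] T.smult_closed[OF a Dc[OF x u]]]
        mod_hom_smult[OF \<Phi>[OF x] a Dc[OF x u]] \<Phi>p[OF x d u] dh_dgerm[OF x a] ..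
    also have "\<dots> = a \<odot>\<^bsub>\<Lambda> 2 x\<^esub> E x u \<oplus>\<^bsub>\<Lambda> 2 x\<^esub> wedge_list (RX x) (NX x) [\<delta> x a, u]"
      by (rule L.M.a_comm[OF pair_closed[OF N_module[OF \<sigma> x] \<delta>_closed[OF x a] u] L.smult_closed[OF a 1[OF x u]]])
    finally show ?thesis .
  qed
  have 4: "sheaf_map TX (conormal Y X) (extN Y X 2) E"
    unfolding sheaf_map_def
  proof (intro allI impI)
    fix U s assume U: "openin TX U" and s: "is_sec (conormal Y X) U s"
    have Dsec: "is_sec ?TS U (\<lambda>x. D x (s x))" by (rule sheaf_mapD[OF Ds U s])
    show "is_sec (extN Y X 2) U (\<lambda>x. E x (s x))"
    proof (rule N.esec_local)
      fix x assume xU: "x \<in> U"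
      have "\<forall>x\<in>U. \<exists>V. openin TX V \<and> x \<in> V \<and> V \<subseteq> U \<and>
          (\<exists>(m::nat) f g. (\<forall>k<m. is_sec (OmegaX Y X) V (f k) \<and> is_sec (conormal Y X) V (g k)) \<and>
            (\<forall>y\<in>V. D y (s y) = finsum (?T y) (\<lambda>k. ?p y (f k y) (g k y)) {..<m}))"
        using Dsec by (simp only: tensor_sheaf_def sheaf.select_convs stalk_OX stalk_OmegaX)
      from bspec[OF this xU] obtain V m f g where V: "openin TX V" "x \<in> V" "V \<subseteq> U"
        and fg: "\<forall>k<m. is_sec (OmegaX Y X) V (f k) \<and> is_sec (conormal Y X) V (g k)"
        and e: "\<forall>y\<in>V. D y (s y) = finsum (?T y) (\<lambda>k. ?p y (f k y) (g k y)) {..<m::nat}"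
        by (elim exE conjE)
      have VX: "V \<subseteq> X" using openin_subset[OF V(1)] topspace_TX by simp
      have dhf: "is_sec (conormal Y X) V (\<lambda>y. dh y (f k y))" if "k < m" for k
        by (rule sheaf_mapD[OF dh_sheaf_map V(1)]) (use fg that in blast)
      have "is_sec (extN Y X 2) V (\<lambda>y. finsum (\<Lambda> 2 y) (\<lambda>k. wedge_list (RX y) (NX y) [dh y (f k y), g k y]) {..<m})"
        by (rule N.esec_finsum[OF V(1), unfolded stalk_OX], rule N.esec_pair[OF V(1), unfolded stalk_OX])
          (rule dhf, assumption, use fg in blast)
      then have "is_sec (extN Y X 2) V (\<lambda>y. E y (s y))"
      proof (rule N.esec_cong)
        fix y assume yV: "y \<in> V"
        then have y: "y \<in> X" using VX by blast
        interpret L: module "RX y" "\<Lambda> 2 y" by (rule ext_module[OF y])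
        have fk: "f k y \<in> carrier (WX y)" and gk: "g k y \<in> carrier (NX y)" if "k \<in> {..<m}" for k
          using fg that sec_OmegaX_closed[OF _ yV] N.sec_F_closed[OF V(1) _ yV] by blast+
        have "E y (s y) = finsum (\<Lambda> 2 y) (\<lambda>k. \<Phi> y (?p y (f k y) (g k y))) {..<m}"
          unfolding E_def bspec[OF e yV]
          by (rule mod_hom_finsum[OF T[OF y] ext_module[OF y] \<Phi>[OF y] _ Pi_I]) (simp, rule pc[OF y fk gk])
        also have "\<dots> = finsum (\<Lambda> 2 y) (\<lambda>k. wedge_list (RX y) (NX y) [dh y (f k y), g k y]) {..<m}"
        proof (rule L.M.finsum_cong'[OF refl Pi_I])
          fix k assume k: "k \<in> {..<m}"
          show "wedge_list (RX y) (NX y) [dh y (f k y), g k y] \<in> carrier (\<Lambda> 2 y)"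
            by (rule pair_closed[OF N_module[OF \<sigma> y] mod_hom_closed[OF dh_hom[OF y] fk[OF k]] gk[OF k]])
          show "\<Phi> y (?p y (f k y) (g k y)) = wedge_list (RX y) (NX y) [dh y (f k y), g k y]"
            by (rule \<Phi>p[OF y fk[OF k] gk[OF k]])
        qed
        finally show "finsum (\<Lambda> 2 y) (\<lambda>k. wedge_list (RX y) (NX y) [dh y (f k y), g k y]) {..<m} = E y (s y)" by (rule sym)
      qed
      then show "\<exists>V. openin TX V \<and> x \<in> V \<and> V \<subseteq> U \<and> is_sec (extN Y X 2) V (\<lambda>x. E x (s x))" using V by (intro exI[of _ V] conjI)
    qed
  qed
  show ?thesis by (rule conjI; rule AK_isomorphic dualAK_isomorphic; (rule 1 2 3 4; assumption?))
qed

end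

theorem theorem4p6:
  fixes Y :: "('y, 'n::finite) cmfd" and X :: "'y set" and r :: nat
  assumes "complex_manifold Y" and "closed_submanifold Y X r"
  shows "((\<exists>D. conormal_connection Y X D) \<longrightarrow>
           (\<forall>\<sigma> \<sigma>'. retraction_pullback Y X \<sigma> \<longrightarrow> retraction_pullback Y X \<sigma>' \<longrightarrow>
              AK_isomorphic Y X r \<sigma> \<sigma>' \<and> dualAK_isomorphic Y X r \<sigma> \<sigma>')) \<and>
         (\<forall>\<sigma> \<sigma>'. retraction_pullback Y X \<sigma> \<longrightarrow> retraction_pullback Y X \<sigma>' \<longrightarrow>
           (\<exists>h. retraction_diff Y X \<sigma> \<sigma>' h \<and>
                sheaf_iso (mtop (submfd Y X)) (OX Y X) (OmegaX Y X) (conormal Y X) h) \<longrightarrow>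
              AK_isomorphic Y X r \<sigma> \<sigma>' \<and> dualAK_isomorphic Y X r \<sigma> \<sigma>')"
proof -
  interpret closed_pair Y X r by unfold_locales (fact assms)+
  have t: "two_retractions Y X r \<sigma> \<sigma>'" if "retraction_pullback Y X \<sigma>" "retraction_pullback Y X \<sigma>'" for \<sigma> \<sigma>'
    by unfold_locales (fact that)+
  show ?thesis
  proof (intro conjI[of "_ \<longrightarrow> _"] impI allI)
    fix \<sigma> \<sigma>' assume "\<exists>D. conormal_connection Y X D" "retraction_pullback Y X \<sigma>" "retraction_pullback Y X \<sigma>'"
    then show "AK_isomorphic Y X r \<sigma> \<sigma>' \<and> dualAK_isomorphic Y X r \<sigma> \<sigma>'"
      using two_retractions.AK_isomorphic_of_connection[OF t] by blast
  next
    fix \<sigma> \<sigma>' assume "retraction_pullback Y X \<sigma>" "retraction_pullback Y X \<sigma>'"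
      "\<exists>h. retraction_diff Y X \<sigma> \<sigma>' h \<and> sheaf_iso TX (OX Y X) (OmegaX Y X) (conormal Y X) h"
    then show "AK_isomorphic Y X r \<sigma> \<sigma>' \<and> dualAK_isomorphic Y X r \<sigma> \<sigma>'"
      using two_retractions.AK_isomorphic_of_iso[OF t] by blast
  qed
qed

end
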